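(* Let $d\ge 1$ be an integer, $\beta>-1$ and $0<a<1/2$. (i) If $\beta>\frac{d-3}2$, then $\lim_{\lambda\to\infty}S_{\lambda}(u_{\beta,a})(0)=u_{\beta,a}(0)$. (ii) If $-1<\beta\le\frac{d-3}2$, then $$\liminf_{\lambda\to\infty}\frac{S_{\lambda}(u_{\beta,a})(0)-u_{\beta,a}(0)}{\lambda^{\frac{d-3}2-\beta}}=-P_{\beta,a}^{[d]},\qquad \limsup_{\lambda\to\infty}\frac{S_{\lambda}(u_{\beta,a})(0)-u_{\beta,a}(0)}{\lambda^{\frac{d-3}2-\beta}}=P_{\beta,a}^{[d]}.$$
   Context: $\mathbb{T}^d$ is identified with $(-1/2,1/2]^d\subset\mathbb{R}^d$; $|\cdot|$ is the Euclidean norm and $mx$ denotes the inner product. For $\beta>-1$, $a>0$: $U_{\beta,a}(x)=(a^2-|x|^2)^{\beta}$ if $|x|<a$ and $U_{\beta,a}(x)=0$ if $|x|\ge a$ ($x\in\mathbb{R}^d$), and $u_{\beta,a}(x)=\sum_{m\in\mathbb{Z}^d}U_{\beta,a}(x+m)$, $x\in\mathbb{T}^d$. For integrable $f$ on $\mathbb{T}^d$: $\hat f(m)=\int_{\mathbb{T}^d}f(x)e^{-2\pi imx}\,dx$ and $S_\lambda(f)(x)=\sum_{m\in\mathbb{Z}^d,\,|m|<\lambda}\hat f(m)e^{2\pi imx}$. Here $\lambda$ is a real parameter. $P_{\beta,a}^{[d]}=\dfrac{\Gamma(\beta+1)}{\Gamma(d/2)}\,a^{(d-3)/2+\beta}\,\pi^{(d-4)/2-\beta}$.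 *)

theory Defs
  imports "HOL-Analysis.Analysis"
begin

definition int_lattice :: "(real ^ 'n::finite) set" where
  "int_lattice = {m. \<forall>i. m $ i \<in> \<int>}"

text \<open>The fundamental domain identified with the torus; functions on the torus are
  represented by functions on the whole space, of which only the values on this set matter
  for Fourier coefficients.\<close>

definition torus :: "(real ^ 'n::finite) set" where
  "torus = {x. \<forall>i. - 1/2 < x $ i \<and> x $ i \<le> 1/2}"

definition U_fun :: "real \<Rightarrow> real \<Rightarrow> real ^ 'n::finite \<Rightarrow> real" where
  "U_fun \<beta> a x = (if norm x < a then (a\<^sup>2 - (norm x)\<^sup>2) powr \<beta> else 0)"

definition u_fun :: "real \<Rightarrow> real \<Rightarrow> real ^ 'n::finite \<Rightarrow> real" where
  "u_fun \<beta> a x = (\<Sum>\<^sub>\<infinity>m\<in>int_lattice. U_fun \<beta> a (x + m))"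

definition fourier_coeff :: "(real ^ 'n::finite \<Rightarrow> complex) \<Rightarrow> real ^ 'n \<Rightarrow> complex" where
  "fourier_coeff f m =
     (LINT x:torus|lebesgue. f x * exp (- 2 * of_real pi * \<i> * of_real (m \<bullet> x)))"

definition spherical_sum :: "real \<Rightarrow> (real ^ 'n::finite \<Rightarrow> complex) \<Rightarrow> real ^ 'n \<Rightarrow> complex" where
  "spherical_sum \<Lambda> f x =
     (\<Sum>m | m \<in> int_lattice \<and> norm m < \<Lambda>.
        fourier_coeff f m * exp (2 * of_real pi * \<i> * of_real (m \<bullet> x)))"

definition P_const :: "nat \<Rightarrow> real \<Rightarrow> real \<Rightarrow> real" where
  "P_const d \<beta> a =
     Gamma (\<beta> + 1) / Gamma (real d / 2)
       * a powr ((real d - 3) / 2 + \<beta>) * pi powr ((real d - 4) / 2 - \<beta>)"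

text \<open>The sum in \<^const>\<open>spherical_sum\<close> is a genuine finite sum.\<close>

lemma finite_int_lattice_ball:
  "finite {m :: real ^ 'n::finite. m \<in> int_lattice \<and> norm m < \<Lambda>}"
proof -
  let ?K = "{k::int. real_of_int \<bar>k\<bar> \<le> \<bar>\<Lambda>\<bar>}"
  have "?K \<subseteq> {- \<lceil>\<bar>\<Lambda>\<bar>\<rceil> .. \<lceil>\<bar>\<Lambda>\<bar>\<rceil>}"
    by (auto; linarith)
  then have K: "finite ?K"
    using finite_subset by blast
  have "{v :: real ^ 'n. \<forall>i. v $ i \<in> real_of_int ` ?K}
      \<subseteq> vec_lambda ` (UNIV \<rightarrow>\<^sub>E real_of_int ` ?K)"
  proof
    fix v :: "real ^ 'n" assume v: "v \<in> {v. \<forall>i. v $ i \<in> real_of_int ` ?K}"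
    have "v = vec_lambda (vec_nth v)" by simp
    moreover have "vec_nth v \<in> UNIV \<rightarrow>\<^sub>E real_of_int ` ?K" using v by auto
    ultimately show "v \<in> vec_lambda ` (UNIV \<rightarrow>\<^sub>E real_of_int ` ?K)" by blast
  qed
  then have "finite {v :: real ^ 'n. \<forall>i. v $ i \<in> real_of_int ` ?K}"
    by (rule finite_subset) (intro finite_imageI finite_PiE K finite)
  moreover have "{m :: real ^ 'n. m \<in> int_lattice \<and> norm m < \<Lambda>}
      \<subseteq> {v. \<forall>i. v $ i \<in> real_of_int ` ?K}"
  proof clarify
    fix m :: "real ^ 'n" and i
    assume m: "m \<in> int_lattice" "norm m < \<Lambda>"
    from m(1) obtain k where k: "m $ i = real_of_int k"
      by (auto simp: int_lattice_def Ints_def)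
    have "\<bar>m $ i\<bar> \<le> norm m"
      by (rule component_le_norm_cart)
    with m(2) k have "k \<in> ?K" by auto
    with k show "m $ i \<in> real_of_int ` ?K" by blast
  qed
  ultimately show ?thesis
    using finite_subset by blast
qed

text \<open>So is the series defining \<^const>\<open>u_fun\<close>.\<close>

lemma finite_u_support:
  "finite {m :: real ^ 'n::finite. m \<in> int_lattice \<and> U_fun \<beta> a (x + m) \<noteq> 0}"
proof (rule finite_subset[OF _ finite_int_lattice_ball[of "a + norm x"]], safe)
  fix m :: "real ^ 'n" assume "U_fun \<beta> a (x + m) \<noteq> 0"
  then have "norm (x + m) < a" by (auto simp: U_fun_def split: if_splits)
  moreover have "norm m \<le> norm (x + m) + norm x"
    using norm_triangle_ineq4[of "x + m" x] by simp
  ultimately show "norm m < a + norm x" by linarith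
qed

lemma u_fun_eq_finite_sum:
  "u_fun \<beta> a x = (\<Sum>m | m \<in> int_lattice \<and> U_fun \<beta> a (x + m) \<noteq> 0. U_fun \<beta> a (x + m))"
proof -
  have "u_fun \<beta> a x = (\<Sum>\<^sub>\<infinity>m | m \<in> int_lattice \<and> U_fun \<beta> a (x + m) \<noteq> 0. U_fun \<beta> a (x + m))"
    unfolding u_fun_def by (rule infsum_cong_neutral) auto
  then show ?thesis
    by (simp add: infsum_finite[OF finite_u_support])
qed

text \<open>Partial sums of a real-valued function are real, so passing to real parts, as is needed
  to form a limes inferior or superior, loses nothing.\<close>

lemma cnj_fourier_coeff_real:
  "cnj (fourier_coeff (\<lambda>x. of_real (f x)) m) = fourier_coeff (\<lambda>x. of_real (f x)) (- m)"
  unfolding fourier_coeff_def set_lebesgue_integral_def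
  by (subst Bochner_Integration.integral_cnj [symmetric]) (simp add: exp_cnj)

lemma spherical_sum_real:
  "spherical_sum \<Lambda> (\<lambda>x. of_real (f x)) x \<in> \<real>"
proof -
  let ?M = "{m. m \<in> int_lattice \<and> norm m < \<Lambda>}"
  let ?t = "\<lambda>m. fourier_coeff (\<lambda>x. of_real (f x)) m * exp (2 * of_real pi * \<i> * of_real (m \<bullet> x))"
  have "cnj (\<Sum>m\<in>?M. ?t m) = (\<Sum>m\<in>?M. ?t (- m))"
    by (simp add: cnj_fourier_coeff_real exp_cnj)
  also have "\<dots> = (\<Sum>m\<in>?M. ?t m)"
    by (rule sum.reindex_bij_witness[of _ uminus uminus]) (auto simp: int_lattice_def)
  finally show ?thesis
    unfolding spherical_sum_def by (simp add: Reals_cnj_iff)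
qed

end

theory Submission
  imports Defs "HOL-Complex_Analysis.Complex_Analysis" "HOL-Real_Asymp.Real_Asymp"
begin

text \<open>The partial sum at the origin is \<open>A \<Lambda> = (\<Sum>|m| < \<Lambda>. \<phi> |m|)\<close> with \<open>\<phi>\<close> the radial Fourier
  transform of \<open>U\<close>, a Bessel-type function decaying like \<open>r\<close> to the power \<open>- \<beta> - (d + 1) / 2\<close> and oscillating with frequency
  \<open>a\<close>. Repeated partial summation compares \<open>A \<Lambda>\<close> with the integral of \<open>\<phi>\<close> over the ball of radius
  \<open>\<Lambda>\<close>. The error consists of boundary terms, which involve the Riesz-averaged lattice point discrepancies
  of order at most \<open>J = 2 d\<close>, and of one integral against the discrepancy of order \<open>J\<close>. By Poisson summation
  the latter discrepancy is an absolutely convergent series of oscillations with frequencies \<open>|k| \<ge> 1\<close>; since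
  \<open>a < 1/2\<close> there is no resonance with \<open>\<phi>\<close>, so the integral converges as \<open>\<Lambda> \<rightarrow> \<infinity>\<close>. The lower
  discrepancies are recovered from the one of order \<open>J\<close> by finite differences and the monotonicity of the lattice point
  count; this makes the boundary terms negligible.

  The integral over the ball is \<open>\<Lambda> powr \<alpha> * Re (b * cis (2 * pi * a * \<Lambda>))\<close> up to a constant and lower
  order terms, where \<open>\<alpha> = (d - 3) / 2 - \<beta>\<close> and \<open>|b|\<close> is the constant \<open>P\<close>. For \<open>\<alpha> \<le> 0\<close> the constant
  matters; it is the limit of the Riesz means of high order, whose kernels form an approximate identity, and therefore
  equals \<open>u 0\<close>.\<close>

section \<open>Bessel-type integrals and their asymptotics\<close>

text \<open>Each Riesz averaging adds one to the decay; order 2 d makes the dual series comparable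
  to a product of one-dimensional series. The natural variable is s = r^2, because (1/(2 r)) d/dr
  maps the Bessel-type transforms to one another. Each step costs the transform one power of r and
  gives one to the discrepancy, so all boundary terms have the same critical size: with O(r^(d-1))
  for the point count they are O(\<Lambda>^\<alpha>), the order of the main term itself. Hence the
  o-estimates, which are needed only for \<alpha> \<ge> 0, where d \<ge> 2. The constant left over
  from partial summation gathers contributions of small radii and limits of integrals; averaging
  kills the oscillation and keeps that constant. For \<beta> < 0 the function is unbounded near |x|
  = a, so its value at 0 is recovered from continuity at 0 and uniform smallness of the averaging
  kernels elsewhere.\<close>

definition pospow :: "real \<Rightarrow> real \<Rightarrow> real" where
  "pospow p x = (if x > 0 then x powr p else 0)"

lemma pospow_nonneg [simp]: "0 \<le> pospow p x"
  by (simp add: pospow_def)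

lemma borel_measurable_pospow [measurable]: "pospow p \<in> borel_measurable borel"
  unfolding pospow_def by measurable

lemma nn_integral_even:
  fixes f :: "real \<Rightarrow> ennreal"
  assumes [measurable]: "f \<in> borel_measurable borel" and even: "\<And>x. f (- x) = f x"
  shows "(\<integral>\<^sup>+x. f x \<partial>lborel) = 2 * (\<integral>\<^sup>+x. f x * indicator {0..} x \<partial>lborel)"
proof -
  have "(\<integral>\<^sup>+x. f x \<partial>lborel) = (\<integral>\<^sup>+x. f x * indicator {0..} x + f x * indicator {..<0} x \<partial>lborel)"
    by (intro nn_integral_cong) (auto simp: indicator_def)
  also have "\<dots> = (\<integral>\<^sup>+x. f x * indicator {0..} x \<partial>lborel) + (\<integral>\<^sup>+x. f x * indicator {..<0} x \<partial>lborel)"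
    by (rule nn_integral_add) auto
  also have "(\<integral>\<^sup>+x. f x * indicator {..<0} x \<partial>lborel) = (\<integral>\<^sup>+x. f x * indicator {0<..} x \<partial>lborel)"
    by (subst nn_integral_real_affine[of _ "-1" 0]) (auto simp: even indicator_def intro!: nn_integral_cong)
  also have "\<dots> = (\<integral>\<^sup>+x. f x * indicator {0..} x \<partial>lborel)"
    by (intro nn_integral_cong_AE eventually_mono[OF AE_lborel_singleton[of 0]]) (auto simp: indicator_def)
  finally show ?thesis by (simp add: mult_2)
qed

text \<open>Under t = x^2 the Beta integral B(1/2, p + 1) becomes twice the integral over [0, 1],
  which by evenness is the whole integral; Gamma(1/2) = sqrt pi gives the closed form.\<close>

lemma nn_integral_pospow_unit:
  assumes "p > -1"
  shows "(\<integral>\<^sup>+t. ennreal (pospow p (1 - t\<^sup>2)) \<partial>lborel) = ennreal (sqrt pi * Gamma (p + 1) / Gamma (p + 3/2))"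
proof -
  have "((\<lambda>t. t powr (-1 / 2) * (1 - t) powr p) has_integral Beta (1 / 2) (p + 1)) {0..1}"
    using has_integral_Beta_real[of "1/2" "p + 1"] assms by simp
  from nn_integral_has_integral_lebesgue'[OF _ this] have
     "ennreal (Beta (1 / 2) (p + 1)) =
        nn_integral lborel (\<lambda>t. ennreal (t powr (-1 / 2) * (1 - t) powr p * indicator {0^2..1^2} t))"
    by (simp add: ennreal_mult' ennreal_indicator)
  also have "\<dots> = (\<integral>\<^sup>+ x. ennreal (x\<^sup>2 powr (-1 / 2) * (1 - x\<^sup>2) powr p * (2 * x) *
                          indicator {0..1} x) \<partial>lborel)"
  proof (rule nn_integral_substitution)
    show "set_borel_measurable borel {0\<^sup>2..1\<^sup>2} (\<lambda>t::real. t powr (-1 / 2) * (1 - t) powr p)"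
      unfolding set_borel_measurable_def by measurable
    show "((\<lambda>x::real. x\<^sup>2) has_real_derivative 2 * x) (at x)" for x
      by (rule DERIV_cong[OF DERIV_pow]) simp
  qed (auto intro!: continuous_on_mult_const)
  \<comment> \<open>At x = 0 the left integrand is 0 and the right one is 2, so the equality holds
    only almost everywhere.\<close>
  also have "\<dots> = (\<integral>\<^sup>+ x. 2 * (ennreal (pospow p (1 - x\<^sup>2)) * indicator {0..} x) \<partial>lborel)"
  proof (intro nn_integral_cong_AE)
    have ae: "AE x in lborel. x \<noteq> (0::real)" "AE x in lborel. x \<noteq> (1::real)"
      by (rule AE_lborel_singleton)+
    show "AE x in lborel. ennreal (x\<^sup>2 powr (-1 / 2) * (1 - x\<^sup>2) powr p * (2 * x) * indicator {0..1} x)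
        = 2 * (ennreal (pospow p (1 - x\<^sup>2)) * indicator {0..} x)"
      using ae
    proof eventually_elim
      case (elim x)
      show ?case
      proof (cases "0 < x \<and> x < 1")
        case True
        have e: "x\<^sup>2 powr (-1/2) = 1 / x"
        proof -
          have "x\<^sup>2 powr (-1/2) = (x powr 2) powr (-1/2)" using True by (subst powr_numeral) auto
          also have "\<dots> = x powr (-1)" by (simp only: powr_powr) simp
          also have "\<dots> = 1 / x" using True by (intro powr_neg_one) auto
          finally show ?thesis .
        qed
        have "x\<^sup>2 < 1" using True by (simp add: abs_square_less_1)
        moreover have "ennreal (2 * y) = 2 * ennreal y" if "y \<ge> 0" for y :: real
          using that by (simp add: ennreal_mult')
        ultimately show ?thesis using True unfolding e by (simp add: pospow_def indicator_def mult.commute[of _ 2])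
      next
        case False
        with elim consider "x < 0" | "x > 1" by linarith
        then show ?thesis
        proof cases
          case 2
          then have "\<not> x\<^sup>2 < 1" by (simp add: abs_square_less_1)
          then show ?thesis using 2 by (simp add: pospow_def)
        qed simp
      qed
    qed
  qed
  also have "\<dots> = 2 * (\<integral>\<^sup>+ x. ennreal (pospow p (1 - x\<^sup>2)) * indicator {0..} x \<partial>lborel)"
    by (rule nn_integral_cmult) auto
  also have "\<dots> = (\<integral>\<^sup>+ x. ennreal (pospow p (1 - x\<^sup>2)) \<partial>lborel)"
    by (rule nn_integral_even[symmetric]) auto
  finally have "(\<integral>\<^sup>+ x. ennreal (pospow p (1 - x\<^sup>2)) \<partial>lborel) = ennreal (Beta (1 / 2) (p + 1))" ..
  moreover have "1 / 2 + (p + 1) = p + 3 / 2" by simp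
  ultimately show ?thesis unfolding Beta_def by (simp only: Gamma_one_half_real)
qed

lemma has_bochner_integral_pospow_unit:
  assumes "p > -1"
  shows "has_bochner_integral lborel (\<lambda>t. pospow p (1 - t\<^sup>2)) (sqrt pi * Gamma (p + 1) / Gamma (p + 3/2))"
  using nn_integral_pospow_unit[OF assms] assms
  by (intro has_bochner_integral_nn_integral) (auto intro!: divide_nonneg_nonneg mult_nonneg_nonneg)

lemma integrable_pospow_unit: "p > -1 \<Longrightarrow> integrable lborel (\<lambda>t. pospow p (1 - t\<^sup>2))"
  using has_bochner_integral_pospow_unit has_bochner_integral_iff by blast

lemma integrable_mult_bounded:
  fixes f g :: "'a \<Rightarrow> 'b::{real_normed_field, banach, second_countable_topology}"
  assumes f: "integrable M f" and g: "g \<in> borel_measurable M" and b: "\<And>x. norm (g x) \<le> B"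
  shows "integrable M (\<lambda>x. f x * g x)"
proof (rule Bochner_Integration.integrable_bound)
  show "integrable M (\<lambda>x. B * norm (f x))" using f by simp
  show "(\<lambda>x. f x * g x) \<in> borel_measurable M"
    using f g by (intro borel_measurable_times) auto
  show "AE x in M. norm (f x * g x) \<le> norm (B * norm (f x))"
  proof (rule AE_I2)
    fix x
    have "norm (f x * g x) \<le> norm (f x) * B" unfolding norm_mult by (intro mult_left_mono b) auto
    also have "\<dots> \<le> norm (B * norm (f x))" by (simp add: mult.commute)
    finally show "norm (f x * g x) \<le> norm (B * norm (f x))" .
  qed
qed

lemma abs_cos_diff_le: "\<bar>cos x - cos y\<bar> \<le> \<bar>x - y\<bar>" for x y :: real
proof -
  have "\<bar>cos x - cos y\<bar> = 2 * \<bar>sin ((x + y)/2)\<bar> * \<bar>sin ((y - x)/2)\<bar>"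
    by (simp add: cos_diff_cos abs_mult)
  also have "\<dots> \<le> 2 * 1 * \<bar>(y - x)/2\<bar>"
    by (intro mult_mono mult_nonneg_nonneg abs_sin_le_one abs_sin_x_le_abs_x) auto
  finally show ?thesis by (simp add: abs_minus_commute)
qed

text \<open>Dominated convergence for difference quotients: cos is 1-Lipschitz and |t| \<le> 1 on
  the support of \<open>W\<close>, so every quotient is bounded by |\<open>W\<close>|.\<close>

lemma DERIV_cos_transform:
  fixes W :: "real \<Rightarrow> real"
  assumes W: "integrable lborel W" and supp: "\<And>t. \<bar>t\<bar> > 1 \<Longrightarrow> W t = 0"
  shows "((\<lambda>z. LINT t|lborel. W t * cos (z * t)) has_real_derivative
           (LINT t|lborel. W t * (- (t * sin (z * t))))) (at z)"
proof -
  note [measurable] = borel_measurable_integrable[OF W]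
  have intc: "integrable lborel (\<lambda>t. W t * cos (y * t))" for y
    by (rule integrable_mult_bounded[OF W, where B = 1]) auto
  show ?thesis unfolding DERIV_def tendsto_at_iff_sequentially o_def
  proof (intro allI impI)
    fix X :: "nat \<Rightarrow> real" assume X: "\<forall>i. X i \<in> UNIV - {0}" "X \<longlonglongrightarrow> 0"
    have eq: "((LINT t|lborel. W t * cos ((z + X i) * t)) - (LINT t|lborel. W t * cos (z * t))) / X i
        = (LINT t|lborel. W t * ((cos ((z + X i) * t) - cos (z * t)) / X i))" for i
    proof -
      have "((LINT t|lborel. W t * cos ((z + X i) * t)) - (LINT t|lborel. W t * cos (z * t))) / X i
        = (LINT t|lborel. (W t * cos ((z + X i) * t) - W t * cos (z * t)) / X i)"
        unfolding Bochner_Integration.integral_diff[OF intc[of "z + X i"] intc[of z], symmetric]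
        by (rule integral_divide_zero[where f = "\<lambda>t. W t * cos ((z + X i) * t) - W t * cos (z * t)" and c = "X i", symmetric])
      then show ?thesis by (simp only: right_diff_distrib times_divide_eq_right)
    qed
    have lim: "(\<lambda>i. LINT t|lborel. W t * ((cos ((z + X i) * t) - cos (z * t)) / X i))
       \<longlonglongrightarrow> (LINT t|lborel. W t * (- (t * sin (z * t))))"
    proof (rule integral_dominated_convergence[where w = "\<lambda>t. norm (W t)"])
      show "AE t in lborel. (\<lambda>i. W t * ((cos ((z + X i) * t) - cos (z * t)) / X i)) \<longlonglongrightarrow> W t * (- (t * sin (z * t)))"
      proof (rule AE_I2)
        fix t :: real
        have "((\<lambda>y. cos (y * t)) has_real_derivative (- (t * sin (z * t)))) (at z)"
          by (auto intro!: derivative_eq_intros)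
        then have "(\<lambda>i. (cos ((z + X i) * t) - cos (z * t)) / X i) \<longlonglongrightarrow> - (t * sin (z * t))"
          using X unfolding DERIV_def tendsto_at_iff_sequentially o_def by blast
        then show "(\<lambda>i. W t * ((cos ((z + X i) * t) - cos (z * t)) / X i)) \<longlonglongrightarrow> W t * (- (t * sin (z * t)))"
          by (rule tendsto_mult_left)
      qed
      show "AE t in lborel. norm (W t * ((cos ((z + X i) * t) - cos (z * t)) / X i)) \<le> norm (W t)" for i
      proof (rule AE_I2)
        fix t :: real
        have Xi: "X i \<noteq> 0" using X by auto
        show "norm (W t * ((cos ((z + X i) * t) - cos (z * t)) / X i)) \<le> norm (W t)"
        proof (cases "\<bar>t\<bar> > 1")
          case False
          have "\<bar>cos ((z + X i) * t) - cos (z * t)\<bar> \<le> \<bar>(z + X i) * t - z * t\<bar>" by (rule abs_cos_diff_le)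
          also have "\<dots> = \<bar>X i\<bar> * \<bar>t\<bar>" by (simp add: algebra_simps abs_mult)
          also have "\<dots> \<le> \<bar>X i\<bar> * 1" using False by (intro mult_left_mono) auto
          finally have "\<bar>(cos ((z + X i) * t) - cos (z * t)) / X i\<bar> \<le> 1" using Xi by (simp add: field_simps)
          then have "\<bar>W t\<bar> * \<bar>(cos ((z + X i) * t) - cos (z * t)) / X i\<bar> \<le> \<bar>W t\<bar> * 1"
            by (intro mult_left_mono) auto
          then show ?thesis unfolding real_norm_def abs_mult by simp
        qed (simp add: supp)
      qed
    qed (use W in auto)
    show "(\<lambda>i. ((LINT t|lborel. W t * cos ((z + X i) * t)) - (LINT t|lborel. W t * cos (z * t))) / X i)
       \<longlonglongrightarrow> (LINT t|lborel. W t * (- (t * sin (z * t))))"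
      unfolding eq by (rule lim)
  qed
qed

text \<open>For \<open>z > 0\<close> this is \<open>sqrt pi * (2 / z) powr (p + 1/2)\<close> times the Bessel function of order \<open>p + 1/2\<close>.\<close>

definition bess :: "real \<Rightarrow> real \<Rightarrow> real" where
  "bess p z = (LINT t|lborel. pospow p (1 - t\<^sup>2) * cos (z * t)) / Gamma (p + 1)"

lemma integrable_pospow_cos:
  "p > -1 \<Longrightarrow> integrable lborel (\<lambda>t. pospow p (1 - t\<^sup>2) * cos (z * t))"
  by (rule integrable_mult_bounded[OF integrable_pospow_unit, where B = 1]) auto

lemma bess_0:
  assumes "p > -1" shows "bess p 0 = sqrt pi / Gamma (p + 3/2)"
proof -
  have "Gamma (p + 1) > 0" using assms by (intro Gamma_real_pos) auto
  then show ?thesis using has_bochner_integral_pospow_unit[OF assms]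
    by (simp add: bess_def has_bochner_integral_iff)
qed

lemma abs_bess_le: "p > -1 \<Longrightarrow> \<bar>bess p z\<bar> \<le> bess p 0"
proof -
  assume p: "p > -1"
  have "\<bar>(LINT t|lborel. pospow p (1 - t\<^sup>2) * cos (z * t))\<bar> \<le> (LINT t|lborel. pospow p (1 - t\<^sup>2))"
  proof (rule integral_abs_bound_integral[OF integrable_pospow_cos[OF p] integrable_pospow_unit[OF p]])
    show "\<bar>pospow p (1 - t\<^sup>2) * cos (z * t)\<bar> \<le> pospow p (1 - t\<^sup>2)" for t
      using mult_left_le[of "\<bar>cos (z * t)\<bar>" "pospow p (1 - t\<^sup>2)"] by (simp add: abs_mult)
  qed
  moreover have "Gamma (p + 1) > 0" using p by (intro Gamma_real_pos) auto
  ultimately show ?thesis by (simp add: bess_def abs_divide divide_right_mono)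
qed

text \<open>The difference of the two integrands is the derivative of -(1 - t^2)^(p+1) sin(z t),
  which vanishes at both end points because p + 1 > 0. For p < 0 the derivative blows up there, so
  the fundamental theorem is used in its form with interior differentiability.\<close>

lemma pospow_sin_by_parts:
  assumes p: "p > -1"
  shows "2 * (p + 1) * (LINT t|lborel. pospow p (1 - t\<^sup>2) * (t * sin (z * t)))
       = z * (LINT t|lborel. pospow (p + 1) (1 - t\<^sup>2) * cos (z * t))"
proof -
  define h where "h = (\<lambda>t. - ((1 - t\<^sup>2) powr (p + 1) * sin (z * t)))"
  define h' where "h' = (\<lambda>t. 2 * (p + 1) * (pospow p (1 - t\<^sup>2) * (t * sin (z * t))) - z * (pospow (p + 1) (1 - t\<^sup>2) * cos (z * t)))"
  have i1: "integrable lborel (\<lambda>t. pospow p (1 - t\<^sup>2) * (t * sin (z * t)))"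
  proof (rule Bochner_Integration.integrable_bound[OF integrable_pospow_unit[OF p]])
    show "AE t in lborel. norm (pospow p (1 - t\<^sup>2) * (t * sin (z * t))) \<le> norm (pospow p (1 - t\<^sup>2))"
    proof (rule AE_I2)
      fix t :: real
      have "\<bar>t\<bar> * \<bar>sin (z * t)\<bar> \<le> 1 * 1" if "\<bar>t\<bar> < 1" using that by (intro mult_mono) auto
      then have "pospow p (1 - t\<^sup>2) * (\<bar>t\<bar> * \<bar>sin (z * t)\<bar>) \<le> pospow p (1 - t\<^sup>2) * 1"
        by (cases "\<bar>t\<bar> < 1") (auto simp: pospow_def abs_square_less_1 intro: mult_left_le)
      then show "norm (pospow p (1 - t\<^sup>2) * (t * sin (z * t))) \<le> norm (pospow p (1 - t\<^sup>2))"
        by (simp add: abs_mult)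
    qed
  qed auto
  have i2: "integrable lborel (\<lambda>t. pospow (p + 1) (1 - t\<^sup>2) * cos (z * t))"
    using p by (intro integrable_pospow_cos) auto
  have "(h' has_integral (h 1 - h (-1))) {-1..1}"
  proof (rule fundamental_theorem_of_calculus_interior)
    show "continuous_on {-1..1} h"
      using p unfolding h_def by (intro continuous_intros continuous_on_powr') (auto simp: abs_square_le_1)
    fix t :: real assume t: "t \<in> {-1<..<1}"
    then have *: "1 - t\<^sup>2 > 0" by (simp add: abs_square_less_1 abs_less_iff)
    have "((\<lambda>t. (1 - t\<^sup>2) powr (p + 1)) has_real_derivative (p + 1) * (1 - t\<^sup>2) powr p * (- 2 * t)) (at t)"
    proof -
      have "((\<lambda>t. 1 - t\<^sup>2) has_real_derivative (- 2 * t)) (at t)"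
        by (auto intro!: derivative_eq_intros)
      from DERIV_chain2[OF has_real_derivative_powr[OF *] this, of "p + 1"] show ?thesis by simp
    qed
    moreover have "((\<lambda>t. sin (z * t)) has_real_derivative z * cos (z * t)) (at t)"
      by (auto intro!: derivative_eq_intros)
    ultimately have "(h has_real_derivative - ((p + 1) * (1 - t\<^sup>2) powr p * (- 2 * t) * sin (z * t)
        + z * cos (z * t) * (1 - t\<^sup>2) powr (p + 1))) (at t)"
      unfolding h_def by (intro DERIV_minus DERIV_mult)
    also have "- ((p + 1) * (1 - t\<^sup>2) powr p * (- 2 * t) * sin (z * t)
        + z * cos (z * t) * (1 - t\<^sup>2) powr (p + 1)) = h' t"
      using * unfolding h'_def pospow_def by simp
    finally show "(h has_vector_derivative h' t) (at t)"
      unfolding has_real_derivative_iff_has_vector_derivative .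
  qed auto
  then have "(h' has_integral 0) {-1..1}" using p by (simp add: h_def)
  then have "((\<lambda>t. if t \<in> {-1..1} then h' t else 0) has_integral 0) UNIV"
    by (simp only: has_integral_restrict_UNIV)
  moreover have "(\<lambda>t. if t \<in> {-1..1} then h' t else 0) = h'"
  proof
    fix t :: real
    show "(if t \<in> {-1..1} then h' t else 0) = h' t"
      using abs_square_less_1[of t] unfolding h'_def by (auto simp: pospow_def)
  qed
  ultimately have "(h' has_integral 0) UNIV" by simp
  moreover have "(h' has_integral (LINT t|lborel. h' t)) UNIV"
    unfolding h'_def by (intro has_integral_integral_lborel Bochner_Integration.integrable_diff integrable_mult_right i1 i2)
  ultimately have "(LINT t|lborel. h' t) = 0" using has_integral_unique by blast
  then show ?thesis using i1 i2 by (simp add: h'_def)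
qed

text \<open>The classical rule that z^(-\<nu>) J_\<nu>(z) has derivative -z^(-\<nu>) J_(\<nu>+1)(z).
  Dividing by Gamma(p + 1) in \<open>bess\<close> is what removes the factor p + 1 left by the
  integration by parts.\<close>

lemma DERIV_bess:
  assumes p: "p > -1"
  shows "(bess p has_real_derivative (- (z / 2) * bess (p + 1) z)) (at z)"
proof -
  have "((\<lambda>z. LINT t|lborel. pospow p (1 - t\<^sup>2) * cos (z * t)) has_real_derivative
           (LINT t|lborel. pospow p (1 - t\<^sup>2) * (- (t * sin (z * t))))) (at z)"
    by (rule DERIV_cos_transform) (use p in \<open>auto simp: integrable_pospow_unit\<close>, simp add: pospow_def abs_square_less_1)
  also have "(LINT t|lborel. pospow p (1 - t\<^sup>2) * (- (t * sin (z * t))))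
      = - (z / (2 * (p + 1)) * (LINT t|lborel. pospow (p + 1) (1 - t\<^sup>2) * cos (z * t)))"
    using pospow_sin_by_parts[OF p, of z] p by (simp add: field_simps)
  finally have "(bess p has_real_derivative
      (- (z / (2 * (p + 1)) * (LINT t|lborel. pospow (p + 1) (1 - t\<^sup>2) * cos (z * t)))) / Gamma (p + 1)) (at z)"
    unfolding bess_def by (rule DERIV_cdivide)
  moreover have "Gamma (p + 1 + 1) = (p + 1) * Gamma (p + 1)"
    using p by (intro Gamma_plus1) (auto simp: nonpos_Ints_def)
  ultimately show ?thesis by (simp add: bess_def field_simps)
qed

lemma continuous_on_bess [continuous_intros]:
  assumes "p > -1" "continuous_on S f" shows "continuous_on S (\<lambda>x. bess p (f x))"
proof -
  have "continuous_on UNIV (bess p)"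
    by (rule DERIV_continuous_on[where D = "\<lambda>z. - (z / 2) * bess (p + 1) z"])
       (use DERIV_bess[OF assms(1)] in auto)
  from continuous_on_compose2[OF this assms(2)] show ?thesis by auto
qed

section \<open>Laplace representation and asymptotic expansion\<close>

lemma exp_growth_bound:
  fixes m s :: real assumes "m \<ge> 1" "s \<ge> 0"
  shows "(1 + s) powr m \<le> m powr m * exp s"
proof -
  have "1 + s \<le> m * (1 + s / m)" using assms by (simp add: field_simps)
  also have "\<dots> \<le> m * exp (s / m)" using assms by (intro mult_left_mono exp_ge_add_one_self) auto
  finally have "(1 + s) powr m \<le> (m * exp (s / m)) powr m" using assms by (intro powr_mono2) auto
  also have "\<dots> = m powr m * exp s" using assms by (simp add: powr_mult exp_powr_real)
  finally show ?thesis .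
qed

lemma has_bochner_integral_laplace_powr:
  assumes p: "p > 0" and z: "z > (0::real)"
  shows "has_bochner_integral lborel (\<lambda>s. indicator {0<..} s * (s powr (p - 1) * exp (- z * s))) (Gamma p * z powr - p)"
proof (rule has_bochner_integral_nn_integral)
  have "ennreal (Gamma p) = (\<integral>\<^sup>+s. ennreal (indicator {0..} s * s powr (p - 1) / exp s) \<partial>lborel)"
    by (rule Gamma_conv_nn_integral_real[OF p])
  also have "\<dots> = ennreal z * (\<integral>\<^sup>+s. ennreal (indicator {0..} (z * s) * (z * s) powr (p - 1) / exp (z * s)) \<partial>lborel)"
    using z by (subst nn_integral_real_affine[where c = z and t = 0]) auto
  also have "(\<integral>\<^sup>+s. ennreal (indicator {0..} (z * s) * (z * s) powr (p - 1) / exp (z * s)) \<partial>lborel)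
      = (\<integral>\<^sup>+s. ennreal (z powr (p - 1)) * ennreal (indicator {0<..} s * (s powr (p - 1) * exp (- z * s))) \<partial>lborel)"
  proof (intro nn_integral_cong_AE eventually_mono[OF AE_lborel_singleton[of 0]])
    fix s :: real assume "s \<noteq> 0"
    then show "ennreal (indicator {0..} (z * s) * (z * s) powr (p - 1) / exp (z * s))
        = ennreal (z powr (p - 1)) * ennreal (indicator {0<..} s * (s powr (p - 1) * exp (- z * s)))"
      using z by (cases "s > 0")
        (auto simp: powr_mult exp_minus divide_inverse zero_le_mult_iff ennreal_mult'[symmetric] mult.assoc)
  qed
  also have "\<dots> = ennreal (z powr (p - 1)) * (\<integral>\<^sup>+s. ennreal (indicator {0<..} s * (s powr (p - 1) * exp (- z * s))) \<partial>lborel)"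
    by (rule nn_integral_cmult) auto
  finally have "ennreal (Gamma p) = ennreal (z powr p) * (\<integral>\<^sup>+s. ennreal (indicator {0<..} s * (s powr (p - 1) * exp (- z * s))) \<partial>lborel)"
    using z by (simp add: mult.assoc[symmetric] ennreal_mult'[symmetric] powr_mult_base)
  then have "ennreal (z powr - p) * ennreal (Gamma p) = ennreal (z powr - p) * ennreal (z powr p) *
      (\<integral>\<^sup>+s. ennreal (indicator {0<..} s * (s powr (p - 1) * exp (- z * s))) \<partial>lborel)"
    by (simp add: mult.assoc)
  moreover have "ennreal (z powr - p) * ennreal (z powr p) = 1"
    using z by (simp add: ennreal_mult'[symmetric] powr_add[symmetric])
  ultimately show "(\<integral>\<^sup>+s. ennreal (indicator {0<..} s * (s powr (p - 1) * exp (- z * s))) \<partial>lborel) = ennreal (Gamma p * z powr - p)"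
    using p z Gamma_real_pos[OF p] by (simp add: ennreal_mult'[symmetric] mult.commute)
  show "0 \<le> Gamma p * z powr - p" using Gamma_real_pos[OF p] by simp
qed auto

text \<open>Cauchy's theorem for the rectangle over [-c, c] of height R, obtained from a primitive.
  In the strip |Re t| < 1 the number 1 - t^2 has positive real part, so the principal power is
  holomorphic there; hence c < 1. Reflection in the imaginary axis conjugates the integrand, so the
  two vertical sides together give twice an imaginary part.\<close>

lemma contour_shift:
  fixes p z c R :: real
  assumes c: "0 < c" "c < 1" and R: "R > 0"
  defines "f \<equiv> \<lambda>t. (1 - t\<^sup>2) powr complex_of_real p * exp (\<i> * z * t)"
  shows "(LINT t:{-c..c}|lborel. (1 - t\<^sup>2) powr p * cos (z * t))
       = 2 * (LINT s:{0..R}|lborel. Im (f (Complex c s))) + (LINT x:{-c..c}|lborel. Re (f (Complex x R)))"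
    and "continuous_on {0..R} (\<lambda>s. f (Complex c s))"
proof -
  define S where "S = {t::complex. \<bar>Re t\<bar> < 1}"
  have S_eq: "S = {t. Re t < 1} \<inter> {t. Re t > -1}" by (auto simp: S_def)
  have oS: "open S" unfolding S_eq by (intro open_Int open_halfspace_Re_lt open_halfspace_Re_gt)
  have cS: "convex S" unfolding S_eq by (intro convex_Int convex_halfspace_Re_lt convex_halfspace_Re_gt)
  have pos: "Re (1 - t\<^sup>2) > 0" if "t \<in> S" for t
  proof -
    have "(Re t)\<^sup>2 < 1" using that by (simp add: S_def abs_square_less_1)
    moreover have "Re (1 - t\<^sup>2) = 1 - (Re t)\<^sup>2 + (Im t)\<^sup>2" by (simp add: power2_eq_square)
    ultimately show ?thesis using zero_le_power2[of "Im t"] by linarith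
  qed
  have nonR: "1 - t\<^sup>2 \<notin> \<real>\<^sub>\<le>\<^sub>0" if "t \<in> S" for t
    using pos[OF that] by (auto simp: complex_nonpos_Reals_iff)
  have hol: "f holomorphic_on S"
    unfolding f_def by (intro holomorphic_intros) (use nonR in auto)
  obtain F where F: "\<And>x. x \<in> S \<Longrightarrow> (F has_field_derivative f x) (at x)"
    using holomorphic_convex_primitive'[OF cS oS hol] at_within_open[OF _ oS] by metis
  have contf: "continuous_on S f" using hol by (rule holomorphic_on_imp_continuous_on)
  have horiz: "((\<lambda>x. f (Complex x y)) has_integral (F (Complex c y) - F (Complex (-c) y))) {-c..c}" for y
  proof (rule fundamental_theorem_of_calculus)
    fix x assume x: "x \<in> {-c..c}"
    then have "Complex x y \<in> S" using c by (auto simp: S_def)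
    then have "(F has_field_derivative f (Complex x y)) (at (Complex x y))" by (rule F)
    moreover have "((\<lambda>x. Complex x y) has_vector_derivative 1) (at x within {-c..c})"
      unfolding Complex_eq by (auto intro!: derivative_eq_intros simp: has_vector_derivative_def scaleR_conv_of_real fun_eq_iff)
    ultimately show "((\<lambda>x. F (Complex x y)) has_vector_derivative f (Complex x y)) (at x within {-c..c})"
      using field_vector_diff_chain_within[of "\<lambda>x. Complex x y" 1 x "{-c..c}" F "f (Complex x y)"]
      by (simp add: o_def has_field_derivative_at_within)
  qed (use c in auto)
  have vert: "((\<lambda>s. \<i> * f (Complex b s)) has_integral (F (Complex b R) - F (Complex b 0))) {0..R}" if b: "\<bar>b\<bar> < 1" for b
  proof (rule fundamental_theorem_of_calculus)
    fix x assume x: "x \<in> {0..R}"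
    have "Complex b x \<in> S" using b by (auto simp: S_def)
    then have "(F has_field_derivative f (Complex b x)) (at (Complex b x))" by (rule F)
    moreover have "((\<lambda>x. Complex b x) has_vector_derivative \<i>) (at x within {0..R})"
      unfolding Complex_eq by (auto intro!: derivative_eq_intros simp: has_vector_derivative_def scaleR_conv_of_real fun_eq_iff)
    ultimately show "((\<lambda>s. F (Complex b s)) has_vector_derivative \<i> * f (Complex b x)) (at x within {0..R})"
      using field_vector_diff_chain_within[of "\<lambda>x. Complex b x" \<i> x "{0..R}" F "f (Complex b x)"]
      by (simp add: o_def has_field_derivative_at_within)
  qed (use R in auto)
  have conth: "continuous_on {-c..c} (\<lambda>x. f (Complex x y))" for y
    by (rule continuous_on_compose2[OF contf]) (use c in \<open>auto simp: S_def Complex_eq intro!: continuous_intros\<close>)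
  have contv: "continuous_on {0..R} (\<lambda>s. f (Complex b s))" if "\<bar>b\<bar> < 1" for b
    by (rule continuous_on_compose2[OF contf]) (use that in \<open>auto simp: S_def Complex_eq intro!: continuous_intros\<close>)
  have c': "\<bar>c\<bar> < 1" "\<bar>-c\<bar> < 1" using c by auto
  show "continuous_on {0..R} (\<lambda>s. f (Complex c s))" by (rule contv) fact
  have Leb: "(LINT x:{a..b}|lborel. h x) = integral {a..b} h" if "continuous_on {a..b} h" for a b and h :: "real \<Rightarrow> real"
    by (rule set_borel_integral_eq_integral(2)) (rule borel_integrable_atLeastAtMost'[OF that])
  have sym: "f (Complex (-c) s) = cnj (f (Complex c s))" for s
  proof -
    have "1 - (Complex (-c) s)\<^sup>2 = cnj (1 - (Complex c s)\<^sup>2)" by (simp add: complex_eq_iff power2_eq_square)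
    moreover have "exp (\<i> * z * Complex (-c) s) = cnj (exp (\<i> * z * Complex c s))"
      unfolding exp_cnj by (rule arg_cong[where f = exp]) (simp add: complex_eq_iff)
    moreover have "cnj (1 - (Complex c s)\<^sup>2) powr complex_of_real p = cnj ((1 - (Complex c s)\<^sup>2) powr complex_of_real p)"
      using pos[of "Complex c s"] c by (subst cnj_powr) (auto simp: S_def)
    ultimately show ?thesis by (simp add: f_def)
  qed
  have re_real: "Re (f (Complex x 0)) = (1 - x\<^sup>2) powr p * cos (z * x)" if "x \<in> {-c..c}" for x
  proof -
    have "1 - x\<^sup>2 > 0" using that c by (simp add: abs_square_less_1 abs_less_iff)
    moreover have "1 - (Complex x 0)\<^sup>2 = complex_of_real (1 - x\<^sup>2)" by (simp add: complex_eq_iff power2_eq_square)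
    moreover have "\<i> * z * Complex x 0 = \<i> * complex_of_real (z * x)" by (simp add: complex_eq_iff)
    ultimately show ?thesis
      unfolding f_def by (simp add: powr_of_real Re_exp flip: cis_conv_exp del: of_real_diff of_real_mult of_real_power)
  qed
  have "((\<lambda>x. Re (f (Complex x 0))) has_integral Re (F (Complex c 0) - F (Complex (-c) 0))) {-c..c}"
    using has_integral_Re[OF horiz[of 0]] .
  then have I1: "((\<lambda>x. (1 - x\<^sup>2) powr p * cos (z * x)) has_integral Re (F (Complex c 0) - F (Complex (-c) 0))) {-c..c}"
    by (rule has_integral_eq[rotated]) (rule re_real)
  have I2: "((\<lambda>x. Re (f (Complex x R))) has_integral Re (F (Complex c R) - F (Complex (-c) R))) {-c..c}"
    using has_integral_Re[OF horiz[of R]] .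
  have I3: "((\<lambda>s. - Im (f (Complex c s))) has_integral Re (F (Complex c R) - F (Complex c 0))) {0..R}"
    using has_integral_Re[OF vert[OF c'(1)]] by simp
  have I4: "((\<lambda>s. Im (f (Complex c s))) has_integral Re (F (Complex (-c) R) - F (Complex (-c) 0))) {0..R}"
    using has_integral_Re[OF vert[OF c'(2)]] by (simp add: sym)
  have I3': "integral {0..R} (\<lambda>s. Im (f (Complex c s))) = - Re (F (Complex c R) - F (Complex c 0))"
    using has_integral_neg[OF I3] by (simp add: integral_unique)
  have cc: "continuous_on {-c..c} (\<lambda>x. (1 - x\<^sup>2) powr p * cos (z * x))"
    by (rule continuous_on_eq[OF continuous_on_Re[OF conth[of 0]]]) (rule re_real)
  show "(LINT t:{-c..c}|lborel. (1 - t\<^sup>2) powr p * cos (z * t))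
       = 2 * (LINT s:{0..R}|lborel. Im (f (Complex c s))) + (LINT x:{-c..c}|lborel. Re (f (Complex x R)))"
    unfolding Leb[OF cc] Leb[OF continuous_on_Im[OF contv[OF c'(1)]]] Leb[OF continuous_on_Re[OF conth[of R]]]
    using integral_unique[OF I1] integral_unique[OF I2] I3' integral_unique[OF I4] by simp
qed

lemma integrable_laplace_powr:
  "q > -1 \<Longrightarrow> z > 0 \<Longrightarrow> integrable lborel (\<lambda>s::real. indicator {0<..} s * (s powr q * exp (- z * s)))"
  using has_bochner_integral_laplace_powr[of "q + 1" z] by (simp add: has_bochner_integral_iff)

text \<open>One majorant, independent of x, serves both limits: the vertical sides as c tends to 1
  and the top side as R tends to infinity. In |1 - t^2| = |1 - t| |1 + t| both factors are at least
  s and one is at least 1, which controls negative p; the upper bound 8 max(1, s)^2 controls p \<ge>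
  0.\<close>

lemma norm_contour_integrand_le:
  fixes p z x s :: real
  assumes x: "\<bar>x\<bar> \<le> 1" and s: "s > 0"
  shows "norm ((1 - (Complex x s)\<^sup>2) powr complex_of_real p * exp (\<i> * z * Complex x s))
     \<le> (s powr p + 8 powr \<bar>p\<bar> * (1 + s powr (2 * \<bar>p\<bar>))) * exp (- z * s)"
proof -
  let ?t = "Complex x s" and ?M = "max 1 s"
  have n: "norm (1 - ?t\<^sup>2) = norm (1 - ?t) * norm (1 + ?t)"
    by (simp add: norm_mult[symmetric] power2_eq_square algebra_simps)
  have ge: "s \<le> norm (1 - ?t)" "s \<le> norm (1 + ?t)" "1 - x \<le> norm (1 - ?t)" "1 + x \<le> norm (1 + ?t)"
    using abs_Im_le_cmod[of "1 - ?t"] abs_Im_le_cmod[of "1 + ?t"] abs_Re_le_cmod[of "1 - ?t"] abs_Re_le_cmod[of "1 + ?t"]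
    by auto
  have lower: "s \<le> norm (1 - ?t\<^sup>2)"
  proof (cases "x \<ge> 0")
    case True
    then have "s * 1 \<le> norm (1 - ?t) * norm (1 + ?t)" using ge s by (intro mult_mono) auto
    then show ?thesis by (simp add: n)
  next
    case False
    then have "1 * s \<le> norm (1 - ?t) * norm (1 + ?t)" using ge s by (intro mult_mono) auto
    then show ?thesis by (simp add: n)
  qed
  have "norm ?t \<le> \<bar>x\<bar> + \<bar>s\<bar>" using cmod_le[of ?t] by simp
  then have "norm ?t \<le> 2 * ?M" using x s by linarith
  then have "(norm ?t)\<^sup>2 \<le> (2 * ?M)\<^sup>2" by (intro power_mono) auto
  moreover have "norm (1 - ?t\<^sup>2) \<le> 1 + (norm ?t)\<^sup>2" using norm_triangle_ineq4[of 1 "?t\<^sup>2"] by (simp add: norm_power)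
  moreover have "1 \<le> ?M\<^sup>2" by simp
  moreover have "(2 * ?M)\<^sup>2 = 4 * ?M\<^sup>2" unfolding power_mult_distrib by simp
  ultimately have upper: "norm (1 - ?t\<^sup>2) \<le> 8 * ?M\<^sup>2" by linarith
  have key: "norm (1 - ?t\<^sup>2) powr p \<le> s powr p + 8 powr \<bar>p\<bar> * (1 + s powr (2 * \<bar>p\<bar>))"
  proof (cases "p \<ge> 0")
    case True
    have "norm (1 - ?t\<^sup>2) powr p \<le> (8 * ?M\<^sup>2) powr p" using upper True by (intro powr_mono2) auto
    also have "\<dots> = 8 powr p * ?M powr (2 * p)"
      by (simp add: powr_mult powr_powr[symmetric] powr_numeral)
    also have "?M powr (2 * p) \<le> 1 + s powr (2 * p)" by (auto simp: max_def)
    finally have "norm (1 - ?t\<^sup>2) powr p \<le> 8 powr p * (1 + s powr (2 * p))" by simp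
    then show ?thesis using True powr_ge_zero[of s p] unfolding abs_of_nonneg[OF True] by linarith
  next
    case False
    have "norm (1 - ?t\<^sup>2) powr p \<le> s powr p" using lower s False by (intro powr_mono2') auto
    moreover have "0 \<le> 8 powr \<bar>p\<bar> * (1 + s powr (2 * \<bar>p\<bar>))" by (intro mult_nonneg_nonneg add_nonneg_nonneg) auto
    ultimately show ?thesis by linarith
  qed
  have "norm ((1 - ?t\<^sup>2) powr complex_of_real p * exp (\<i> * z * ?t)) = norm (1 - ?t\<^sup>2) powr p * exp (- z * s)"
    by (simp add: norm_mult norm_powr_real_powr')
  also have "\<dots> \<le> (s powr p + 8 powr \<bar>p\<bar> * (1 + s powr (2 * \<bar>p\<bar>))) * exp (- z * s)"
    by (intro mult_right_mono key) auto
  finally show ?thesis .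
qed

text \<open>The segment from \<open>- 1\<close> to \<open>1\<close> is deformed into the two vertical half-lines above its end points: let
  \<open>c \<rightarrow> 1\<close> and \<open>R \<rightarrow> \<infinity>\<close> in \<open>contour_shift\<close>.\<close>

lemma pospow_cos_laplace:
  fixes p z :: real
  assumes p: "p > -1" and z: "z > 0"
  defines "h \<equiv> \<lambda>s::real. (complex_of_real (s\<^sup>2) - 2 * \<i> * s) powr complex_of_real p * exp (\<i> * z) * exp (- z * s)"
  shows "integrable lborel (\<lambda>s. indicator {0<..} s * Im (h s))"
    and "(LINT t|lborel. pospow p (1 - t\<^sup>2) * cos (z * t)) = 2 * (LINT s|lborel. indicator {0<..} s * Im (h s))"
proof -
  define f where "f = (\<lambda>t. (1 - t\<^sup>2) powr complex_of_real p * exp (\<i> * z * t))"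
  define W where "W = (\<lambda>s. (s powr p + 8 powr \<bar>p\<bar> * (1 + s powr (2 * \<bar>p\<bar>))) * exp (- z * s))"
  define c where "c = (\<lambda>k. 1 - 1 / (real k + 2))"
  define R where "R = (\<lambda>k. real k + 1)"
  have c01: "0 < c k" "c k < 1" for k by (auto simp: c_def field_simps)
  have R0: "R k > 0" for k by (simp add: R_def)
  have clim: "c \<longlonglongrightarrow> 1" unfolding c_def by real_asymp
  have fW: "norm (f (Complex x s)) \<le> W s" if "\<bar>x\<bar> \<le> 1" "s > 0" for x s
    unfolding f_def W_def by (rule norm_contour_integrand_le[OF that])
  \<comment> \<open>The term s^p is integrable at 0 because p > -1; at infinity exp(-z s) with z > 0
    takes over.\<close>
  have Wint: "integrable lborel (\<lambda>s. indicator {0<..} s * W s)"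
  proof -
    have "integrable lborel (\<lambda>s. indicator {0<..} s * (s powr p * exp (- z * s))
        + 8 powr \<bar>p\<bar> * (indicator {0<..} s * (s powr 0 * exp (- z * s)) + indicator {0<..} s * (s powr (2 * \<bar>p\<bar>) * exp (- z * s))))"
      using p z by (intro Bochner_Integration.integrable_add integrable_mult_right integrable_laplace_powr) auto
    then show ?thesis
      by (rule Bochner_Integration.integrable_cong[THEN iffD1, rotated -1]) (auto simp: W_def indicator_def algebra_simps)
  qed
  have f1: "f (Complex 1 s) = h s" for s
  proof -
    have "1 - (Complex 1 s)\<^sup>2 = complex_of_real (s\<^sup>2) - 2 * \<i> * s" by (simp add: complex_eq_iff power2_eq_square)
    moreover have "exp (\<i> * z * Complex 1 s) = exp (\<i> * z) * exp (- z * s)"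
      unfolding exp_add[symmetric] exp_of_real[symmetric] by (rule arg_cong[where f = exp]) (simp add: complex_eq_iff)
    ultimately show ?thesis by (simp add: f_def h_def mult.assoc)
  qed
  have L: "(\<lambda>k. LINT t:{-c k..c k}|lborel. (1 - t\<^sup>2) powr p * cos (z * t)) \<longlonglongrightarrow> (LINT t|lborel. pospow p (1 - t\<^sup>2) * cos (z * t))"
    unfolding set_lebesgue_integral_def
  proof (rule integral_dominated_convergence[where w = "\<lambda>t. pospow p (1 - t\<^sup>2)"])
    show "AE t in lborel. (\<lambda>k. indicat_real {-c k..c k} t *\<^sub>R ((1 - t\<^sup>2) powr p * cos (z * t))) \<longlonglongrightarrow> pospow p (1 - t\<^sup>2) * cos (z * t)"
    proof (rule AE_I2)
      fix t :: real
      show "(\<lambda>k. indicat_real {-c k..c k} t *\<^sub>R ((1 - t\<^sup>2) powr p * cos (z * t))) \<longlonglongrightarrow> pospow p (1 - t\<^sup>2) * cos (z * t)"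
      proof (cases "\<bar>t\<bar> < 1")
        case True
        then have "\<forall>\<^sub>F k in sequentially. \<bar>t\<bar> < c k" using order_tendstoD(1)[OF clim True] by simp
        then have "\<forall>\<^sub>F k in sequentially. pospow p (1 - t\<^sup>2) * cos (z * t) = indicat_real {-c k..c k} t *\<^sub>R ((1 - t\<^sup>2) powr p * cos (z * t))"
          by eventually_elim (use True in \<open>simp add: pospow_def abs_square_less_1 abs_less_iff\<close>)
        then show ?thesis by (rule Lim_transform_eventually[OF tendsto_const])
      next
        case False
        then have "t \<notin> {-c k..c k}" for k using c01[of k] by auto
        moreover have "\<not> t\<^sup>2 < 1" using False by (simp add: abs_square_less_1)
        ultimately show ?thesis by (simp add: pospow_def)
      qed
    qed
    show "AE t in lborel. norm (indicat_real {-c k..c k} t *\<^sub>R ((1 - t\<^sup>2) powr p * cos (z * t))) \<le> pospow p (1 - t\<^sup>2)" for k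
    proof (rule AE_I2)
      fix t :: real
      show "norm (indicat_real {-c k..c k} t *\<^sub>R ((1 - t\<^sup>2) powr p * cos (z * t))) \<le> pospow p (1 - t\<^sup>2)"
      proof (cases "t \<in> {-c k..c k}")
        case True
        then have "t\<^sup>2 < 1" using c01[of k] by (simp add: abs_square_less_1 abs_less_iff)
        then show ?thesis using True by (simp add: pospow_def abs_mult mult_left_le)
      qed simp
    qed
    show "integrable lborel (\<lambda>t. pospow p (1 - t\<^sup>2))" by (rule integrable_pospow_unit[OF p])
  qed auto
  have meas_h: "(\<lambda>s. indicator {0<..} s * Im (h s)) \<in> borel_measurable lborel"
    and T1: "(\<lambda>k. LINT s:{0..R k}|lborel. Im (f (Complex (c k) s))) \<longlonglongrightarrow> (LINT s|lborel. indicator {0<..} s * Im (h s))"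
    and int_h: "integrable lborel (\<lambda>s. indicator {0<..} s * Im (h s))"
  proof -
    have ch: "continuous_on {0<..} (\<lambda>s. Im (h s))"
      unfolding h_def by (intro continuous_intros) (auto simp: complex_eq_iff)
    have m: "(\<lambda>s. indicator {0<..} s *\<^sub>R Im (h s)) \<in> borel_measurable borel"
      by (rule borel_measurable_continuous_on_indicator[OF _ ch]) auto
    then show m': "(\<lambda>s. indicator {0<..} s * Im (h s)) \<in> borel_measurable lborel" by simp
    have mk: "(\<lambda>s. indicat_real {0..R k} s *\<^sub>R Im (f (Complex (c k) s))) \<in> borel_measurable lborel" for k
    proof -
      have "continuous_on {0..R k} (\<lambda>s. f (Complex (c k) s))"
        unfolding f_def by (rule contour_shift(2)[OF c01 R0])
      then have "(\<lambda>s. indicat_real {0..R k} s *\<^sub>R Im (f (Complex (c k) s))) \<in> borel_measurable borel"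
        by (intro borel_measurable_continuous_on_indicator continuous_on_Im) auto
      then show ?thesis by (simp only: measurable_lborel2)
    qed
    have lim: "AE s in lborel. (\<lambda>k. indicat_real {0..R k} s *\<^sub>R Im (f (Complex (c k) s))) \<longlonglongrightarrow> indicator {0<..} s * Im (h s)"
    proof (rule eventually_mono[OF AE_lborel_singleton[of 0]])
      fix s :: real assume s0: "s \<noteq> 0"
      show "(\<lambda>k. indicat_real {0..R k} s *\<^sub>R Im (f (Complex (c k) s))) \<longlonglongrightarrow> indicator {0<..} s * Im (h s)"
      proof (cases "s > 0")
        case True
        have "(\<lambda>k. Complex (c k) s) \<longlonglongrightarrow> Complex 1 s" by (intro tendsto_Complex clim tendsto_const)
        moreover have "1 - (Complex 1 s)\<^sup>2 \<notin> \<real>\<^sub>\<le>\<^sub>0" using True by (simp add: complex_nonpos_Reals_iff power2_eq_square)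
        ultimately have "(\<lambda>k. f (Complex (c k) s)) \<longlonglongrightarrow> f (Complex 1 s)"
          unfolding f_def by (intro tendsto_intros) (use clim in auto)
        then have "(\<lambda>k. Im (f (Complex (c k) s))) \<longlonglongrightarrow> Im (h s)" unfolding f1 by (rule tendsto_Im)
        moreover have "\<forall>\<^sub>F k in sequentially. s \<le> R k"
          unfolding R_def by real_asymp
        then have "\<forall>\<^sub>F k in sequentially. Im (f (Complex (c k) s)) = indicat_real {0..R k} s *\<^sub>R Im (f (Complex (c k) s))"
          by eventually_elim (use True in auto)
        ultimately have "(\<lambda>k. indicat_real {0..R k} s *\<^sub>R Im (f (Complex (c k) s))) \<longlonglongrightarrow> Im (h s)"
          by (rule Lim_transform_eventually)
        then show ?thesis using True by simp
      qed (use s0 in simp)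
    qed
    have bd: "AE s in lborel. norm (indicat_real {0..R k} s *\<^sub>R Im (f (Complex (c k) s))) \<le> indicator {0<..} s * W s" for k
    proof (rule eventually_mono[OF AE_lborel_singleton[of 0]])
      fix s :: real assume "s \<noteq> 0"
      moreover have "\<bar>Im (f (Complex (c k) s))\<bar> \<le> W s" if "s > 0"
        using fW[of "c k" s] c01[of k] that abs_Im_le_cmod[of "f (Complex (c k) s)"] by linarith
      moreover have "0 \<le> W s" unfolding W_def by (intro mult_nonneg_nonneg add_nonneg_nonneg) auto
      ultimately show "norm (indicat_real {0..R k} s *\<^sub>R Im (f (Complex (c k) s))) \<le> indicator {0<..} s * W s"
        by (auto simp: indicator_def)
    qed
    show "(\<lambda>k. LINT s:{0..R k}|lborel. Im (f (Complex (c k) s))) \<longlonglongrightarrow> (LINT s|lborel. indicator {0<..} s * Im (h s))"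
      unfolding set_lebesgue_integral_def by (rule integral_dominated_convergence[OF m' mk Wint lim bd])
    show "integrable lborel (\<lambda>s. indicator {0<..} s * Im (h s))"
      by (rule integrable_dominated_convergence[OF m' mk Wint lim bd])
  qed
  show "integrable lborel (\<lambda>s. indicator {0<..} s * Im (h s))" by fact
  \<comment> \<open>The top side has length below 2 and lies at height R, where the majorant tends
    to 0 exponentially.\<close>
  have T2: "(\<lambda>k. LINT x:{-c k..c k}|lborel. Re (f (Complex x (R k)))) \<longlonglongrightarrow> 0"
  proof (rule Lim_null_comparison)
    show "(\<lambda>k. 2 * W (R k)) \<longlonglongrightarrow> 0"
    proof -
      have "(\<lambda>k. 2 * W (real k + 1)) \<longlonglongrightarrow> 0"
        unfolding W_def using z by real_asymp
      then show ?thesis unfolding R_def .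
    qed
    show "\<forall>\<^sub>F k in sequentially. norm (LINT x:{-c k..c k}|lborel. Re (f (Complex x (R k)))) \<le> 2 * W (R k)"
    proof (rule always_eventually, rule allI)
      fix k
      have W0: "0 \<le> W (R k)" unfolding W_def by (intro mult_nonneg_nonneg add_nonneg_nonneg) auto
      have "norm (LINT x:{-c k..c k}|lborel. Re (f (Complex x (R k))))
          \<le> (LINT x|lborel. norm (indicat_real {-c k..c k} x *\<^sub>R Re (f (Complex x (R k)))))"
        unfolding set_lebesgue_integral_def by (rule Bochner_Integration.integral_norm_bound)
      also have "\<dots> \<le> (LINT x|lborel. indicator {-1..1::real} x * W (R k))"
      proof (rule integral_mono')
        show "integrable lborel (\<lambda>x. indicator {-1..1::real} x * W (R k))" by simp
        show "norm (indicat_real {-c k..c k} x *\<^sub>R Re (f (Complex x (R k)))) \<le> indicator {-1..1} x * W (R k)" for x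
        proof (cases "x \<in> {-c k..c k}")
          case True
          then have "\<bar>x\<bar> \<le> 1" using c01[of k] by auto
          then show ?thesis using True fW[of x "R k"] R0[of k] abs_Re_le_cmod[of "f (Complex x (R k))"] by (simp add: abs_le_iff)
        qed (use W0 in simp)
        show "0 \<le> indicator {-1..1} x * W (R k)" for x :: real using W0 by simp
      qed
      also have "\<dots> = 2 * W (R k)" by simp
      finally show "norm (LINT x:{-c k..c k}|lborel. Re (f (Complex x (R k)))) \<le> 2 * W (R k)" .
    qed
  qed
  have "(\<lambda>k. LINT t:{-c k..c k}|lborel. (1 - t\<^sup>2) powr p * cos (z * t)) \<longlonglongrightarrow> 2 * (LINT s|lborel. indicator {0<..} s * Im (h s)) + 0"
  proof -
    have "(LINT t:{-c k..c k}|lborel. (1 - t\<^sup>2) powr p * cos (z * t)) = 2 * (LINT s:{0..R k}|lborel. Im (f (Complex (c k) s)))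
       + (LINT x:{-c k..c k}|lborel. Re (f (Complex x (R k))))" for k
      unfolding f_def by (rule contour_shift(1)[OF c01 R0])
    then show ?thesis by (simp only:) (intro tendsto_add tendsto_mult_left T1 T2)
  qed
  from LIMSEQ_unique[OF L this] show "(LINT t|lborel. pospow p (1 - t\<^sup>2) * cos (z * t)) = 2 * (LINT s|lborel. indicator {0<..} s * Im (h s))"
    by simp
qed

text \<open>Taylor expansion of w^p at w = 1 in the direction i s / 2. The segment lies on Re w = 1,
  away from the branch cut, and 1 \<le> |w| \<le> 1 + s on it bounds the second derivative.\<close>

lemma powr_one_plus_Taylor:
  fixes p :: real
  obtains C where "C \<ge> 0" "\<And>s::real. s \<ge> 0 \<Longrightarrow>
    norm ((1 + \<i> * s / 2) powr complex_of_real p - (1 + \<i> * p * s / 2)) \<le> C * (s\<^sup>2 * exp s)"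
proof
  let ?m = "\<bar>p\<bar> + 1"
  define C where "C = \<bar>p * (p - 1)\<bar> * ?m powr ?m"
  show "C \<ge> 0" by (simp add: C_def)
  fix s :: real assume s: "s \<ge> 0"
  let ?w = "1 + \<i> * s / 2"
  define F where "F = (\<lambda>(i::nat) z. if i = 0 then z powr complex_of_real p else if i = 1 then p * z powr (complex_of_real p - 1)
      else p * (complex_of_real p - 1) * z powr (complex_of_real p - 2))"
  let ?S = "closed_segment 1 ?w"
  have S: "\<exists>u\<in>{0..1}. z = 1 + \<i> * (u * s / 2)" if "z \<in> ?S" for z
  proof -
    from that obtain u where "0 \<le> u" "u \<le> 1" "z = (1 - u) *\<^sub>R 1 + u *\<^sub>R ?w" by (auto simp: in_segment)
    moreover from this(3) have "z = 1 + \<i> * (u * s / 2)" by (simp add: complex_eq_iff)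
    ultimately show ?thesis by force
  qed
  have "norm (F 0 ?w - (\<Sum>i\<le>1. F i 1 * (?w - 1) ^ i / fact i)) \<le> (\<bar>p * (p - 1)\<bar> * (1 + s) powr ?m) * norm (?w - 1) ^ Suc 1 / fact 1"
  proof (rule complex_Taylor)
    show "convex ?S" by simp
    show "(F i has_field_derivative F (Suc i) z) (at z within ?S)" if z: "z \<in> ?S" and i: "i \<le> 1" for i z
    proof -
      have "Re z = 1" using S[OF z] by auto
      then have nz: "z \<notin> \<real>\<^sub>\<le>\<^sub>0" by (auto simp: complex_nonpos_Reals_iff)
      have "(F i has_field_derivative F (Suc i) z) (at z)"
      proof (cases "i = 0")
        case True
        then show ?thesis using has_field_derivative_powr[OF nz, of "complex_of_real p"] by (simp add: F_def)
      next
        case False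
        with i have "i = 1" by simp
        then show ?thesis using DERIV_cmult[OF has_field_derivative_powr[OF nz, of "complex_of_real p - 1"], of "complex_of_real p"]
          by (simp add: F_def mult.assoc diff_diff_eq)
      qed
      then show ?thesis by (rule has_field_derivative_at_within)
    qed
    show "norm (F (Suc 1) z) \<le> \<bar>p * (p - 1)\<bar> * (1 + s) powr ?m" if z: "z \<in> ?S" for z
    proof -
      obtain u where u: "u \<in> {0..1}" "z = 1 + \<i> * (u * s / 2)" using S[OF z] by auto
      have "norm z \<le> 1 + norm (\<i> * (u * s / 2))" unfolding u(2) by (rule norm_triangle_ineq[THEN order_trans]) simp
      also have "\<dots> = 1 + u * s / 2" using u s by (simp add: norm_mult)
      also have "u * s \<le> 1 * s" using u s by (intro mult_right_mono) auto
      finally have up: "norm z \<le> 1 + s" using s by simp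
      have lo: "1 \<le> norm z" using complex_Re_le_cmod[of z] u(2) by simp
      have "norm (z powr (complex_of_real p - 2)) = norm z powr (p - 2)"
        using norm_powr_real_powr'[of "complex_of_real p - 2" z] by simp
      also have "\<dots> \<le> norm z powr ?m" using lo by (intro powr_mono) auto
      also have "\<dots> \<le> (1 + s) powr ?m" using up by (intro powr_mono2) auto
      finally have "norm (z powr (complex_of_real p - 2)) \<le> (1 + s) powr ?m" .
      moreover have "norm (complex_of_real p * (complex_of_real p - 1)) = \<bar>p * (p - 1)\<bar>"
        by (metis norm_of_real of_real_1 of_real_diff of_real_mult)
      ultimately show ?thesis by (simp add: F_def norm_mult mult_left_mono del: of_real_mult)
    qed
  qed auto
  moreover have "F 0 ?w - (\<Sum>i\<le>1. F i 1 * (?w - 1) ^ i / fact i) = ?w powr complex_of_real p - (1 + \<i> * p * s / 2)"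
    by (simp add: F_def)
  moreover have "norm (?w - 1) ^ Suc 1 = s\<^sup>2 / 4" using s by (simp add: norm_mult power2_eq_square)
  ultimately have "norm (?w powr complex_of_real p - (1 + \<i> * p * s / 2)) \<le> \<bar>p * (p - 1)\<bar> * (1 + s) powr ?m * (s\<^sup>2 / 4)"
    by simp
  \<comment> \<open>A power of 1 + s is traded for exp(s): in a Laplace integral against exp(-z s)
    this merely replaces z by z - 1.\<close>
  also have "\<dots> \<le> \<bar>p * (p - 1)\<bar> * (?m powr ?m * exp s) * s\<^sup>2"
    using s exp_growth_bound[of ?m s] by (intro mult_mono mult_left_mono) auto
  finally show "norm (?w powr complex_of_real p - (1 + \<i> * p * s / 2)) \<le> C * (s\<^sup>2 * exp s)"
    by (simp add: C_def mult_ac)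
qed

text \<open>Factor s^2 - 2 i s = 2 s (-i) (1 + i s / 2). The arguments of the last two factors are
  -pi/2 and a number in (-pi/2, pi/2), so their sum stays in (-pi, 0) and the principal logarithm is
  additive without a multiple of 2 pi i.\<close>

lemma contour_power_factor:
  fixes p s :: real
  assumes "s > 0"
  shows "(complex_of_real (s\<^sup>2) - 2 * \<i> * s) powr complex_of_real p
    = complex_of_real (s powr p) * (complex_of_real (2 powr p) * cis (- pi * p / 2)) * (1 + \<i> * s / 2) powr complex_of_real p"
proof -
  let ?w = "1 + \<i> * s / 2"
  have w0: "?w \<noteq> 0" by (simp add: complex_eq_iff)
  have im: "\<bar>Im (Ln ?w)\<bar> < pi / 2" by (rule Re_Ln_pos_lt_imp) simp
  have e: "complex_of_real (s\<^sup>2) - 2 * \<i> * s = complex_of_real (2 * s) * (- \<i> * ?w)"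
    by (simp add: complex_eq_iff power2_eq_square)
  have "Ln (complex_of_real (s\<^sup>2) - 2 * \<i> * s) = ln (2 * s) + Ln (- \<i> * ?w)"
    unfolding e using Ln_times_of_real[of "2 * s" "- \<i> * ?w"] Ln_of_real[of "2 * s"] assms w0
    by (simp del: of_real_mult)
  also have "Ln (- \<i> * ?w) = Ln (- \<i>) + Ln ?w"
    using im w0 by (intro Ln_times_simple) (auto simp: abs_less_iff)
  also have "Ln (- \<i>) = - (\<i> * pi / 2)" by simp
  finally have L: "Ln (complex_of_real (s\<^sup>2) - 2 * \<i> * s) = ln (2 * s) + (- (\<i> * pi / 2) + Ln ?w)" .
  have nz: "complex_of_real (s\<^sup>2) - 2 * \<i> * s \<noteq> 0" using assms by (simp add: complex_eq_iff)
  have "(complex_of_real (s\<^sup>2) - 2 * \<i> * s) powr complex_of_real p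
      = exp (complex_of_real (p * ln (2 * s)) + (\<i> * complex_of_real (- pi * p / 2) + p * Ln ?w))"
    unfolding powr_def L using nz by (simp add: algebra_simps)
  also have "\<dots> = complex_of_real (exp (p * ln (2 * s))) * (cis (- pi * p / 2) * ?w powr complex_of_real p)"
    using w0 by (simp only: exp_add exp_of_real cis_conv_exp powr_def if_False)
  also have "exp (p * ln (2 * s)) = 2 powr p * s powr p"
    using assms by (simp add: powr_def ln_mult exp_add algebra_simps)
  finally show ?thesis by simp
qed

text \<open>Amplitude and phase in \<open>bess p z\<close> ~ z^(-p-1) Re(cis z *
  \<open>bess_lead p\<close>), that is, of the cosine in the classical asymptotics of the Bessel
  function of order p + 1/2.\<close>

definition bess_lead :: "real \<Rightarrow> complex" where
  "bess_lead p = complex_of_real (2 powr (p + 1)) * cis (- pi * (p + 1) / 2)"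

text \<open>Watson's lemma: the Taylor expansion is inserted into the Laplace representation and
  integrated term by term with Gamma integrals. The second term is needed because the main term of
  the theorem arises by integrating this expansion against a power of r, and only an error of
  relative order z^(-2) then leaves a convergent integral for all \<alpha> < 1.\<close>

lemma bess_asymp2:
  assumes p: "p > -1"
  obtains c1 :: complex and C :: real where "C \<ge> 0"
    "\<And>z. z \<ge> 2 \<Longrightarrow> \<bar>bess p z - Re (cis z * (bess_lead p * z powr (- p - 1) + c1 * z powr (- p - 2)))\<bar> \<le> C * z powr (- p - 3)"
proof -
  obtain C0 where C0: "C0 \<ge> 0" "\<And>s::real. s \<ge> 0 \<Longrightarrow>
    norm ((1 + \<i> * s / 2) powr complex_of_real p - (1 + \<i> * p * s / 2)) \<le> C0 * (s\<^sup>2 * exp s)"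
    using powr_one_plus_Taylor by metis
  define K where "K = complex_of_real (2 powr p) * cis (- pi * p / 2)"
  have normK: "norm K = 2 powr p" by (simp add: K_def norm_mult)
  have G0: "Gamma (p + 1) > 0" using p by (intro Gamma_real_pos) auto
  \<comment> \<open>The linear Taylor term i p s / 2 raises the Gamma integral from p + 1 to p + 2.
    In the factor -2 i, the 2 comes from the Laplace representation and -i turns imaginary parts
    into real parts.\<close>
  define c1 where "c1 = - 2 * \<i> * K * (\<i> * p / 2) * (Gamma (p + 2) / Gamma (p + 1))"
  define C where "C = 2 * (2 powr p * C0 * Gamma (p + 3) * 2 powr (p + 3)) / Gamma (p + 1)"
  have c0: "bess_lead p = - 2 * \<i> * K"
  proof -
    have "- pi * (p + 1) / 2 = - pi / 2 + - pi * p / 2" by (simp add: field_simps)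
    then have "cis (- pi * (p + 1) / 2) = cis (- pi / 2) * cis (- pi * p / 2)" by (simp only: cis_mult)
    also have "cis (- pi / 2) = - \<i>" by (simp add: complex_eq_iff)
    finally show ?thesis by (simp add: bess_lead_def K_def powr_add)
  qed
  show thesis
  proof (rule that[of C c1])
    show "C \<ge> 0" using C0 G0 Gamma_real_pos[of "p + 3"] p by (simp add: C_def)
    fix z :: real assume z: "z \<ge> 2"
    define h where "h = (\<lambda>s::real. (complex_of_real (s\<^sup>2) - 2 * \<i> * s) powr complex_of_real p * exp (\<i> * z) * exp (- z * s))"
    define A where "A = cis z * K"
    define B where "B = A * (\<i> * p / 2)"
    define g0 where "g0 = (\<lambda>s. indicator {0<..} s * (s powr p * exp (- z * s)))"
    define g1 where "g1 = (\<lambda>s. indicator {0<..} s * (s powr (p + 1) * exp (- z * s)))"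
    define g2 where "g2 = (\<lambda>s. indicator {0<..} s * (s powr (p + 2) * exp (- (z - 1) * s)))"
    have hb0: "has_bochner_integral lborel g0 (Gamma (p + 1) * z powr (- p - 1))"
      using has_bochner_integral_laplace_powr[of "p + 1" z] p z by (simp add: g0_def)
    have hb1: "has_bochner_integral lborel g1 (Gamma (p + 2) * z powr (- p - 2))"
      using has_bochner_integral_laplace_powr[of "p + 2" z] p z by (simp add: g1_def add.commute)
    have hb2: "has_bochner_integral lborel g2 (Gamma (p + 3) * (z - 1) powr (- p - 3))"
      using has_bochner_integral_laplace_powr[of "p + 3" "z - 1"] p z by (simp add: g2_def add.commute)
    have z0: "z > 0" using z by simp
    have lap1: "integrable lborel (\<lambda>s. indicator {0<..} s * Im (h s))"
      unfolding h_def by (rule pospow_cos_laplace(1)[OF p z0])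
    have lap2: "(LINT t|lborel. pospow p (1 - t\<^sup>2) * cos (z * t)) = 2 * (LINT s|lborel. indicator {0<..} s * Im (h s))"
      unfolding h_def by (rule pospow_cos_laplace(2)[OF p z0])
    have hbm: "has_bochner_integral lborel (\<lambda>s. Im A * g0 s + Im B * g1 s)
        (Im A * (Gamma (p + 1) * z powr (- p - 1)) + Im B * (Gamma (p + 2) * z powr (- p - 2)))"
      by (intro has_bochner_integral_add has_bochner_integral_mult_right hb0 hb1)
    have hbm1: "integrable lborel (\<lambda>s. Im A * g0 s + Im B * g1 s)"
      and hbm2: "(LINT s|lborel. Im A * g0 s + Im B * g1 s) = Im A * (Gamma (p + 1) * z powr (- p - 1)) + Im B * (Gamma (p + 2) * z powr (- p - 2))"
      and hb2': "integrable lborel g2"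
      using hbm hb2 by (auto simp only: has_bochner_integral_iff)
    have bound: "norm (indicator {0<..} s * Im (h s) - (Im A * g0 s + Im B * g1 s)) \<le> 2 powr p * C0 * g2 s" for s
    proof (cases "s > 0")
      case True
      define \<rho> where "\<rho> = (1 + \<i> * s / 2) powr complex_of_real p - (1 + \<i> * p * s / 2)"
      have w: "(1 + \<i> * s / 2) powr complex_of_real p = \<rho> + 1 + \<i> * p * s / 2" by (simp add: \<rho>_def)
      have "h s = (s powr p * exp (- z * s)) * (A * (\<rho> + 1 + \<i> * p * s / 2))"
        unfolding h_def contour_power_factor[OF True] w A_def K_def cis_conv_exp by (simp add: mult_ac)
      also have "\<dots> = (s powr p * exp (- z * s)) * (A * \<rho>) + ((s powr p * exp (- z * s)) * A + (s powr (p + 1) * exp (- z * s)) * B)"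
        using True by (simp add: B_def algebra_simps powr_add)
      finally have "Im (h s) - (Im A * g0 s + Im B * g1 s) = s powr p * exp (- z * s) * Im (A * \<rho>)"
        using True by (simp add: g0_def g1_def del: of_real_mult flip: of_real_mult)
      then have "norm (indicator {0<..} s * Im (h s) - (Im A * g0 s + Im B * g1 s)) = s powr p * exp (- z * s) * \<bar>Im (A * \<rho>)\<bar>"
        using True by (simp add: abs_mult)
      also have "\<dots> \<le> s powr p * exp (- z * s) * (2 powr p * (C0 * (s\<^sup>2 * exp s)))"
      proof (intro mult_left_mono)
        have "\<bar>Im (A * \<rho>)\<bar> \<le> norm A * norm \<rho>" using abs_Im_le_cmod[of "A * \<rho>"] by (simp add: norm_mult)
        also have "norm A = 2 powr p" by (simp add: A_def norm_mult normK)
        also have "norm \<rho> \<le> C0 * (s\<^sup>2 * exp s)" unfolding \<rho>_def using True by (intro C0) auto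
        finally show "\<bar>Im (A * \<rho>)\<bar> \<le> 2 powr p * (C0 * (s\<^sup>2 * exp s))" by simp
      qed auto
      also have "\<dots> = 2 powr p * C0 * g2 s"
      proof -
        have "s powr p * s\<^sup>2 = s powr (p + 2)" using True by (simp add: powr_add)
        moreover have "exp (- z * s) * exp s = exp (- (z - 1) * s)" by (simp add: exp_add[symmetric] algebra_simps)
        ultimately have "s powr p * exp (- z * s) * (s\<^sup>2 * exp s) = s powr (p + 2) * exp (- (z - 1) * s)"
          by (metis (no_types) mult.assoc mult.commute mult.left_commute)
        then show ?thesis using True by (simp add: g2_def mult_ac)
      qed
      finally show ?thesis .
    qed (simp add: g0_def g1_def g2_def)
    have "\<bar>(LINT s|lborel. indicator {0<..} s * Im (h s)) - (Im A * (Gamma (p + 1) * z powr (- p - 1)) + Im B * (Gamma (p + 2) * z powr (- p - 2)))\<bar>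
       = \<bar>LINT s|lborel. indicator {0<..} s * Im (h s) - (Im A * g0 s + Im B * g1 s)\<bar>"
      unfolding Bochner_Integration.integral_diff[OF lap1 hbm1] hbm2 ..
    also have "\<dots> \<le> (LINT s|lborel. 2 powr p * C0 * g2 s)"
      using bound by (intro integral_abs_bound_integral Bochner_Integration.integrable_diff lap1 hbm1 integrable_mult_right hb2') auto
    also have "\<dots> = 2 powr p * C0 * (Gamma (p + 3) * (z - 1) powr (- p - 3))"
      using hb2 by (simp add: has_bochner_integral_iff)
    also have "\<dots> \<le> 2 powr p * C0 * (Gamma (p + 3) * (2 powr (p + 3) * z powr (- p - 3)))"
    proof (intro mult_left_mono)
      \<comment> \<open>For z \<ge> 2 one has z - 1 \<ge> z / 2, which undoes the shift caused by
        exp(s).\<close>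
      have "(z - 1) powr (- p - 3) \<le> (z / 2) powr (- p - 3)" using z p by (intro powr_mono2') auto
      also have "\<dots> = 2 powr (p + 3) * z powr (- p - 3)"
        using z by (simp add: powr_divide powr_minus_divide[of 2 "p + 3", symmetric] powr_diff powr_minus field_simps powr_add)
      finally show "(z - 1) powr (- p - 3) \<le> 2 powr (p + 3) * z powr (- p - 3)" .
    qed (use C0 p Gamma_real_pos[of "p + 3"] in auto)
    finally have main: "\<bar>(LINT s|lborel. indicator {0<..} s * Im (h s)) - (Im A * (Gamma (p + 1) * z powr (- p - 1)) + Im B * (Gamma (p + 2) * z powr (- p - 2)))\<bar>
       \<le> 2 powr p * C0 * (Gamma (p + 3) * (2 powr (p + 3) * z powr (- p - 3)))" .
    have "Re (cis z * (bess_lead p * z powr (- p - 1) + c1 * z powr (- p - 2)))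
       = 2 * (Im A * (Gamma (p + 1) * z powr (- p - 1)) + Im B * (Gamma (p + 2) * z powr (- p - 2))) / Gamma (p + 1)"
    proof -
      have "cis z * (bess_lead p * z powr (- p - 1) + c1 * z powr (- p - 2))
        = - 2 * \<i> * (A * complex_of_real (z powr (- p - 1)) + B * complex_of_real (Gamma (p + 2) / Gamma (p + 1) * z powr (- p - 2)))"
        by (simp add: c0 c1_def A_def B_def algebra_simps)
      then have "Re (cis z * (bess_lead p * z powr (- p - 1) + c1 * z powr (- p - 2)))
         = 2 * (Im A * z powr (- p - 1) + Im B * (Gamma (p + 2) / Gamma (p + 1) * z powr (- p - 2)))"
        by (simp del: of_real_mult of_real_divide)
      then show ?thesis using G0 by (simp add: field_simps)
    qed
    then have "bess p z - Re (cis z * (bess_lead p * z powr (- p - 1) + c1 * z powr (- p - 2)))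
       = 2 / Gamma (p + 1) * ((LINT s|lborel. indicator {0<..} s * Im (h s)) - (Im A * (Gamma (p + 1) * z powr (- p - 1)) + Im B * (Gamma (p + 2) * z powr (- p - 2))))"
      unfolding bess_def lap2 by (simp only: right_diff_distrib times_divide_eq_left)
    then have "\<bar>bess p z - Re (cis z * (bess_lead p * z powr (- p - 1) + c1 * z powr (- p - 2)))\<bar>
       \<le> 2 / Gamma (p + 1) * (2 powr p * C0 * (Gamma (p + 3) * (2 powr (p + 3) * z powr (- p - 3))))"
      using G0 mult_left_mono[OF main, of "2 / Gamma (p + 1)"]
      by (simp only: abs_mult abs_of_pos divide_pos_pos zero_less_numeral less_imp_le simp_thms)
    also have "\<dots> = C * z powr (- p - 3)" by (simp add: C_def)
    finally show "\<bar>bess p z - Re (cis z * (bess_lead p * z powr (- p - 1) + c1 * z powr (- p - 2)))\<bar> \<le> C * z powr (- p - 3)" .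
  qed
qed

lemma bess_asymp1:
  assumes p: "p > -1"
  obtains C :: real where "C \<ge> 0"
    "\<And>z. z \<ge> 2 \<Longrightarrow> \<bar>bess p z - z powr (- p - 1) * Re (cis z * bess_lead p)\<bar> \<le> C * z powr (- p - 2)"
proof -
  obtain c1 :: complex and C where C: "C \<ge> 0"
    "\<And>z. z \<ge> 2 \<Longrightarrow> \<bar>bess p z - Re (cis z * (bess_lead p * z powr (- p - 1) + c1 * z powr (- p - 2)))\<bar> \<le> C * z powr (- p - 3)"
    using bess_asymp2[OF p] by metis
  show thesis
  proof (rule that[of "C + norm c1"])
    show "C + norm c1 \<ge> 0" using C by simp
    fix z :: real assume z: "z \<ge> 2"
    have "Re (cis z * (bess_lead p * z powr (- p - 1) + c1 * z powr (- p - 2)))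
       = z powr (- p - 1) * Re (cis z * bess_lead p) + z powr (- p - 2) * Re (cis z * c1)"
      by (simp add: algebra_simps)
    moreover have "\<bar>z powr (- p - 2) * Re (cis z * c1)\<bar> \<le> z powr (- p - 2) * norm c1"
      using abs_Re_le_cmod[of "cis z * c1"] by (simp add: abs_mult norm_mult mult_left_mono)
    moreover have "C * z powr (- p - 3) \<le> C * z powr (- p - 2)" using z C by (intro mult_left_mono powr_mono) auto
    ultimately show "\<bar>bess p z - z powr (- p - 1) * Re (cis z * bess_lead p)\<bar> \<le> (C + norm c1) * z powr (- p - 2)"
      using C(2)[OF z] by (simp add: algebra_simps)
  qed
qed

text \<open>The asymptotics cover z \<ge> 2; for smaller z the bound by the value at 0 suffices,
  because z^(-p-1) \<ge> 2^(-p-1) there. Validity for all z > 0 avoids case distinctions at small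
  arguments later.\<close>

lemma bess_decay:
  assumes p: "p > -1"
  obtains C :: real where "C \<ge> 0" "\<And>z. z > 0 \<Longrightarrow> \<bar>bess p z\<bar> \<le> C * z powr (- p - 1)"
proof -
  obtain C where C: "C \<ge> 0"
    "\<And>z. z \<ge> 2 \<Longrightarrow> \<bar>bess p z - z powr (- p - 1) * Re (cis z * bess_lead p)\<bar> \<le> C * z powr (- p - 2)"
    using bess_asymp1[OF p] by metis
  show thesis
  proof (rule that[of "C + norm (bess_lead p) + bess p 0 * 2 powr (p + 1)"])
    have g0: "bess p 0 \<ge> 0" using abs_bess_le[OF p, of 0] by simp
    then show "C + norm (bess_lead p) + bess p 0 * 2 powr (p + 1) \<ge> 0" using C by simp
    fix z :: real assume z: "z > 0"
    show "\<bar>bess p z\<bar> \<le> (C + norm (bess_lead p) + bess p 0 * 2 powr (p + 1)) * z powr (- p - 1)"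
    proof (cases "z \<ge> 2")
      case True
      have "\<bar>z powr (- p - 1) * Re (cis z * bess_lead p)\<bar> \<le> z powr (- p - 1) * norm (bess_lead p)"
        using abs_Re_le_cmod[of "cis z * bess_lead p"] by (simp add: abs_mult norm_mult mult_left_mono)
      moreover have "C * z powr (- p - 2) \<le> C * z powr (- p - 1)" using True C by (intro mult_left_mono powr_mono) auto
      moreover have "0 \<le> bess p 0 * 2 powr (p + 1) * z powr (- p - 1)" using g0 by simp
      ultimately show ?thesis using C(2)[OF True] by (simp add: algebra_simps)
    next
      case False
      have "1 = 2 powr (p + 1) * 2 powr (- p - 1)" by (simp add: powr_add[symmetric])
      also have "\<dots> \<le> 2 powr (p + 1) * z powr (- p - 1)" using z False p by (intro mult_left_mono powr_mono2') auto
      finally have "bess p 0 * 1 \<le> bess p 0 * (2 powr (p + 1) * z powr (- p - 1))" using g0 by (intro mult_left_mono)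
      moreover have "0 \<le> (C + norm (bess_lead p)) * z powr (- p - 1)" using C by simp
      ultimately show ?thesis using abs_bess_le[OF p, of z] by (simp add: algebra_simps)
    qed
  qed
qed

section \<open>Fourier transform of the radial powers\<close>

lemma borel_measurable_cis [measurable]: "cis \<in> borel_measurable borel"
  by (intro borel_measurable_continuous_onI continuous_intros)

lemma real_CARD_ge_1: "1 \<le> real CARD('n::finite)"
  by (simp add: Suc_le_eq)

lemma CARD_shift_gt: "p > -1 \<Longrightarrow> p + (real CARD('n::finite) - 1) / 2 > -1"
proof -
  assume p: "p > -1"
  have "p + (c - 1) / 2 > -1" if "1 \<le> c" for c :: real using p that by (simp add: field_simps)
  from this[OF real_CARD_ge_1] show ?thesis .
qed

lemma pospow_mult: "B > 0 \<Longrightarrow> pospow p (B * x) = B powr p * pospow p x"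
  by (auto simp: pospow_def powr_mult zero_less_mult_iff)

text \<open>Scaling by sqrt B reduces to B = 1. Integrating out one variable thus raises the
  exponent by 1/2; iterating this rule produces the exponents and Gamma quotients of the hyperplane
  slices.\<close>

lemma nn_integral_pospow:
  assumes p: "p > -1"
  shows "(\<integral>\<^sup>+v. ennreal (pospow p (B - v\<^sup>2)) \<partial>lborel)
     = ennreal (sqrt pi * Gamma (p + 1) / Gamma (p + 3/2) * pospow (p + 1/2) B)"
proof (cases "B > 0")
  case False
  have "pospow p (B - v\<^sup>2) = 0" for v
  proof -
    have "\<not> 0 < B - v\<^sup>2" using zero_le_power2[of v] False by linarith
    then show ?thesis unfolding pospow_def by simp
  qed
  then show ?thesis using False by (simp add: pospow_def)
next
  case True
  have "(\<integral>\<^sup>+v. ennreal (pospow p (B - v\<^sup>2)) \<partial>lborel) = ennreal (sqrt B) * (\<integral>\<^sup>+t. ennreal (pospow p (B - (0 + sqrt B * t)\<^sup>2)) \<partial>lborel)"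
    using True by (subst nn_integral_real_affine[where c = "sqrt B" and t = 0]) auto
  also have "(\<lambda>t. pospow p (B - (0 + sqrt B * t)\<^sup>2)) = (\<lambda>t. B powr p * pospow p (1 - t\<^sup>2))"
  proof
    fix t
    have "B - (0 + sqrt B * t)\<^sup>2 = B * (1 - t\<^sup>2)" using True by (simp add: power_mult_distrib algebra_simps)
    then show "pospow p (B - (0 + sqrt B * t)\<^sup>2) = B powr p * pospow p (1 - t\<^sup>2)" using True by (simp only: pospow_mult)
  qed
  also have "(\<integral>\<^sup>+t. ennreal (B powr p * pospow p (1 - t\<^sup>2)) \<partial>lborel) = ennreal (B powr p) * (\<integral>\<^sup>+t. ennreal (pospow p (1 - t\<^sup>2)) \<partial>lborel)"
    by (subst nn_integral_cmult[symmetric]) (auto simp: ennreal_mult')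
  also have "\<dots> = ennreal (B powr p) * ennreal (sqrt pi * Gamma (p + 1) / Gamma (p + 3/2))"
    by (simp only: nn_integral_pospow_unit[OF p])
  also have "ennreal (sqrt B) * \<dots> = ennreal (sqrt B * (B powr p * (sqrt pi * Gamma (p + 1) / Gamma (p + 3/2))))"
    using True by (simp only: ennreal_mult'[symmetric] real_sqrt_ge_zero less_imp_le powr_ge_zero)
  also have "sqrt B * (B powr p * (sqrt pi * Gamma (p + 1) / Gamma (p + 3/2))) = sqrt pi * Gamma (p + 1) / Gamma (p + 3/2) * pospow (p + 1/2) B"
    using True by (simp add: pospow_def powr_add powr_half_sqrt)
  finally show ?thesis .
qed

section \<open>Slicing radial powers by hyperplanes\<close>

lemma nn_integral_reflect:
  fixes f :: "real \<Rightarrow> ennreal"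
  assumes [measurable]: "f \<in> borel_measurable borel"
  shows "(\<integral>\<^sup>+x. f (- x) \<partial>lborel) = (\<integral>\<^sup>+x. f x \<partial>lborel)"
  by (subst (2) nn_integral_real_affine[where c = "-1" and t = 0]) auto

text \<open>The rotation is factored into shears, so that one-dimensional substitutions suffice.\<close>

lemma nn_integral_rotate_plane:
  fixes h g :: "real \<Rightarrow> ennreal" and \<xi> r :: real
  assumes [measurable]: "h \<in> borel_measurable borel" "g \<in> borel_measurable borel"
    and r: "r \<ge> 0"
  defines "\<rho> \<equiv> sqrt (\<xi>\<^sup>2 + r\<^sup>2)"
  shows "(\<integral>\<^sup>+y. \<integral>\<^sup>+t. h (y\<^sup>2 + t\<^sup>2) * g (\<xi> * y + r * t) \<partial>lborel \<partial>lborel)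
       = (\<integral>\<^sup>+u. \<integral>\<^sup>+v. h (u\<^sup>2 + v\<^sup>2) * g (\<rho> * u) \<partial>lborel \<partial>lborel)"
proof (cases "r = 0")
  case True
  then have \<rho>: "\<rho> = \<bar>\<xi>\<bar>" by (simp add: \<rho>_def)
  define F where "F = (\<lambda>u. \<integral>\<^sup>+v. h (u\<^sup>2 + v\<^sup>2) * g (\<xi> * u) \<partial>lborel)"
  have [measurable]: "F \<in> borel_measurable borel" unfolding F_def by measurable
  show ?thesis
  proof (cases "\<xi> \<ge> 0")
    case True
    then show ?thesis using \<open>r = 0\<close> by (simp add: \<rho>)
  next
    case False
    have "(\<integral>\<^sup>+u. F (- u) \<partial>lborel) = (\<integral>\<^sup>+u. F u \<partial>lborel)" by (rule nn_integral_reflect) measurable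
    then show ?thesis using False \<open>r = 0\<close> by (simp add: \<rho> F_def)
  qed
next
  case False
  with r have r0: "r > 0" by simp
  have \<rho>2: "\<rho>\<^sup>2 = \<xi>\<^sup>2 + r\<^sup>2" unfolding \<rho>_def by simp
  have \<rho>0: "\<rho> > 0" using r0 by (simp add: \<rho>_def add_nonneg_pos)
  \<comment> \<open>First shear: for fixed y the variable t gives way to u = (\<xi> y + r t) /
    \<rho>, which requires r > 0 and has Jacobian \<rho> / r.\<close>
  have "(\<integral>\<^sup>+t. h (y\<^sup>2 + t\<^sup>2) * g (\<xi> * y + r * t) \<partial>lborel)
      = (\<integral>\<^sup>+u. ennreal (\<rho> / r) * (h (y\<^sup>2 + ((\<rho> * u - \<xi> * y) / r)\<^sup>2) * g (\<rho> * u)) \<partial>lborel)" for y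
  proof -
    have e1: "\<xi> * y + r * (- \<xi> * y / r + \<rho> / r * u) = \<rho> * u" for u using r0 by (simp add: field_simps)
    have e2: "- \<xi> * y / r + \<rho> / r * u = (\<rho> * u - \<xi> * y) / r" for u by (simp add: diff_divide_distrib)
    have "(\<integral>\<^sup>+t. h (y\<^sup>2 + t\<^sup>2) * g (\<xi> * y + r * t) \<partial>lborel)
      = ennreal \<bar>\<rho> / r\<bar> * (\<integral>\<^sup>+u. h (y\<^sup>2 + (- \<xi> * y / r + \<rho> / r * u)\<^sup>2) * g (\<xi> * y + r * (- \<xi> * y / r + \<rho> / r * u)) \<partial>lborel)"
      using r0 \<rho>0 by (subst nn_integral_real_affine[where c = "\<rho> / r" and t = "- \<xi> * y / r"]) auto
    then show ?thesis using r0 \<rho>0 unfolding e1 e2 by (subst nn_integral_cmult) auto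
  qed
  then have "(\<integral>\<^sup>+y. \<integral>\<^sup>+t. h (y\<^sup>2 + t\<^sup>2) * g (\<xi> * y + r * t) \<partial>lborel \<partial>lborel)
      = (\<integral>\<^sup>+y. \<integral>\<^sup>+u. ennreal (\<rho> / r) * (h (y\<^sup>2 + ((\<rho> * u - \<xi> * y) / r)\<^sup>2) * g (\<rho> * u)) \<partial>lborel \<partial>lborel)"
    by simp
  also have "\<dots> = (\<integral>\<^sup>+u. \<integral>\<^sup>+y. ennreal (\<rho> / r) * (h (y\<^sup>2 + ((\<rho> * u - \<xi> * y) / r)\<^sup>2) * g (\<rho> * u)) \<partial>lborel \<partial>lborel)"
    by (rule lborel_pair.Fubini') measurable
  \<comment> \<open>Second shear, for fixed u: y = (\<xi> u + r v) / \<rho> with Jacobian r /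
    \<rho>. The Jacobians cancel and the sum of squares becomes u^2 + v^2.\<close>
  also have "\<dots> = (\<integral>\<^sup>+u. \<integral>\<^sup>+v. h (u\<^sup>2 + v\<^sup>2) * g (\<rho> * u) \<partial>lborel \<partial>lborel)"
  proof (rule nn_integral_cong)
    fix u :: real
    have sq: "(\<xi> * u / \<rho> + r / \<rho> * v)\<^sup>2 + ((\<rho> * u - \<xi> * (\<xi> * u / \<rho> + r / \<rho> * v)) / r)\<^sup>2 = u\<^sup>2 + v\<^sup>2" for v
    proof -
      have a: "\<xi> * u / \<rho> + r / \<rho> * v = (\<xi> * u + r * v) / \<rho>" by (simp add: add_divide_distrib)
      have "\<rho> * u - \<xi> * ((\<xi> * u + r * v) / \<rho>) = (\<rho>\<^sup>2 * u - \<xi> * (\<xi> * u + r * v)) / \<rho>"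
        using \<rho>0 by (simp add: field_simps power2_eq_square)
      also have "\<dots> = r * (r * u - \<xi> * v) / \<rho>" unfolding \<rho>2 by (simp add: algebra_simps power2_eq_square)
      finally have b: "(\<rho> * u - \<xi> * ((\<xi> * u + r * v) / \<rho>)) / r = (r * u - \<xi> * v) / \<rho>" using r0 by simp
      have "((\<xi> * u + r * v) / \<rho>)\<^sup>2 + ((r * u - \<xi> * v) / \<rho>)\<^sup>2 = ((\<xi> * u + r * v)\<^sup>2 + (r * u - \<xi> * v)\<^sup>2) / \<rho>\<^sup>2"
        unfolding power_divide by (simp only: add_divide_distrib)
      also have "(\<xi> * u + r * v)\<^sup>2 + (r * u - \<xi> * v)\<^sup>2 = \<rho>\<^sup>2 * (u\<^sup>2 + v\<^sup>2)"
        unfolding \<rho>2 by (simp add: power2_eq_square algebra_simps)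
      finally show ?thesis unfolding a b using \<rho>0 by simp
    qed
    have "(\<integral>\<^sup>+y. ennreal (\<rho> / r) * (h (y\<^sup>2 + ((\<rho> * u - \<xi> * y) / r)\<^sup>2) * g (\<rho> * u)) \<partial>lborel)
        = ennreal \<bar>r / \<rho>\<bar> * (\<integral>\<^sup>+v. ennreal (\<rho> / r) * (h ((\<xi> * u / \<rho> + r / \<rho> * v)\<^sup>2 + ((\<rho> * u - \<xi> * (\<xi> * u / \<rho> + r / \<rho> * v)) / r)\<^sup>2) * g (\<rho> * u)) \<partial>lborel)"
      using r0 \<rho>0 by (subst nn_integral_real_affine[where c = "r / \<rho>" and t = "\<xi> * u / \<rho>"]) auto
    also have "\<dots> = ennreal \<bar>r / \<rho>\<bar> * (\<integral>\<^sup>+v. ennreal (\<rho> / r) * (h (u\<^sup>2 + v\<^sup>2) * g (\<rho> * u)) \<partial>lborel)"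
      by (simp only: sq)
    also have "ennreal \<bar>r / \<rho>\<bar> * (\<integral>\<^sup>+v. ennreal (\<rho> / r) * (h (u\<^sup>2 + v\<^sup>2) * g (\<rho> * u)) \<partial>lborel)
        = (ennreal (r / \<rho>) * ennreal (\<rho> / r)) * (\<integral>\<^sup>+v. h (u\<^sup>2 + v\<^sup>2) * g (\<rho> * u) \<partial>lborel)"
      using r0 \<rho>0 by (subst nn_integral_cmult) (auto simp: mult.assoc)
    also have "ennreal (r / \<rho>) * ennreal (\<rho> / r) = 1"
      using r0 \<rho>0 by (simp add: ennreal_mult'[symmetric])
    finally show "(\<integral>\<^sup>+y. ennreal (\<rho> / r) * (h (y\<^sup>2 + ((\<rho> * u - \<xi> * y) / r)\<^sup>2) * g (\<rho> * u)) \<partial>lborel)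
        = (\<integral>\<^sup>+v. h (u\<^sup>2 + v\<^sup>2) * g (\<rho> * u) \<partial>lborel)" by simp
  qed
  finally show ?thesis .
qed

text \<open>The integral of the p-th power of the positive part of A - t^2 - |y|^2 over y in
  dimension n - 1 is this constant times the power p + (n - 1)/2 of the positive part of A -
  t^2.\<close>

definition slice_const :: "real \<Rightarrow> nat \<Rightarrow> real" where
  "slice_const p n = pi powr ((real n - 1) / 2) * Gamma (p + 1) / Gamma (p + (real n - 1) / 2 + 1)"

lemma slice_const_pos: "p > -1 \<Longrightarrow> n \<ge> 1 \<Longrightarrow> slice_const p n > 0"
  unfolding slice_const_def by (intro divide_pos_pos mult_pos_pos Gamma_real_pos) (auto simp: field_simps)

lemma slice_const_Suc:
  assumes "p > -1" "n \<ge> 1"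
  shows "slice_const p n * (sqrt pi * Gamma (p + (real n - 1) / 2 + 1) / Gamma (p + (real n - 1) / 2 + 3/2)) = slice_const p (Suc n)"
proof -
  have G: "Gamma (p + (real n - 1) / 2 + 1) > 0" using assms by (intro Gamma_real_pos) (auto simp: field_simps)
  have "pi powr ((real n - 1) / 2) * sqrt pi = pi powr ((real n - 1) / 2 + 1/2)"
    by (simp add: powr_add powr_half_sqrt)
  also have "(real n - 1) / 2 + 1/2 = (real (Suc n) - 1) / 2" by (simp add: field_simps)
  finally have a: "pi powr ((real n - 1) / 2) * sqrt pi = pi powr ((real (Suc n) - 1) / 2)" .
  have b: "p + (real n - 1) / 2 + 3/2 = p + (real (Suc n) - 1) / 2 + 1" by (simp add: field_simps)
  show ?thesis using G unfolding slice_const_def b a[symmetric] by simp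
qed

text \<open>Induction on the number of coordinates: the hypothesis replaces all but one coordinate
  by a single variable t, the remaining plane is rotated until \<open>g\<close> sees only one
  variable, and the other one is integrated out. \<open>A\<close> and \<open>g\<close> have to vary,
  since fixing the new coordinate y turns them into A - y^2 and a translate of
  \<open>g\<close>.\<close>

lemma nn_integral_PiM_pospow:
  fixes \<xi> :: "'i \<Rightarrow> real"
  assumes "finite I" "I \<noteq> {}" and p: "p > -1"
    and "g \<in> borel_measurable borel"
  shows "(\<integral>\<^sup>+x. ennreal (pospow p (A - (\<Sum>i\<in>I. (x i)\<^sup>2))) * g (\<Sum>i\<in>I. \<xi> i * x i) \<partial>Pi\<^sub>M I (\<lambda>_. lborel))
       = (\<integral>\<^sup>+t. ennreal (slice_const p (card I) * pospow (p + (real (card I) - 1) / 2) (A - t\<^sup>2)) * g (sqrt (\<Sum>i\<in>I. (\<xi> i)\<^sup>2) * t) \<partial>lborel)"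
  using assms(1,2,4)
proof (induction I arbitrary: A g rule: finite_ne_induct)
  case (singleton i)
  interpret product_sigma_finite "\<lambda>_::'i. lborel :: real measure" by standard
  note [measurable] = singleton
  have "Gamma (p + 1) > 0" using p by (intro Gamma_real_pos) auto
  then have K1: "slice_const p 1 = 1" by (simp add: slice_const_def)
  define F where "F = (\<lambda>u. ennreal (pospow p (A - u\<^sup>2)) * g (\<xi> i * u))"
  have [measurable]: "F \<in> borel_measurable borel" unfolding F_def by measurable
  have "(\<integral>\<^sup>+x. ennreal (pospow p (A - (\<Sum>i\<in>{i}. (x i)\<^sup>2))) * g (\<Sum>i\<in>{i}. \<xi> i * x i) \<partial>Pi\<^sub>M {i} (\<lambda>_. lborel)) = (\<integral>\<^sup>+u. F u \<partial>lborel)"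
    unfolding F_def by (simp add: product_nn_integral_singleton[where f = "\<lambda>u. ennreal (pospow p (A - u\<^sup>2)) * g (\<xi> i * u)"])
  also have "\<dots> = (\<integral>\<^sup>+u. ennreal (pospow p (A - u\<^sup>2)) * g (\<bar>\<xi> i\<bar> * u) \<partial>lborel)"
  proof (cases "\<xi> i \<ge> 0")
    case False
    have "(\<integral>\<^sup>+u. F (- u) \<partial>lborel) = (\<integral>\<^sup>+u. F u \<partial>lborel)" by (rule nn_integral_reflect) measurable
    then show ?thesis using False by (simp add: F_def)
  qed (simp add: F_def)
  finally show ?case using K1 by simp
next
  case (insert i I)
  interpret product_sigma_finite "\<lambda>_::'i. lborel :: real measure" by standard
  note [measurable] = insert.prems
  let ?n = "card I" let ?q = "p + (real ?n - 1) / 2"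
  have n1: "?n \<ge> 1" using insert.hyps by (simp add: Suc_leI card_gt_0_iff)
  have q: "?q > -1" using p n1 by (auto simp: field_simps)
  have K0: "slice_const p ?n \<ge> 0" using slice_const_pos[OF p n1] by simp
  let ?r = "sqrt (\<Sum>i\<in>I. (\<xi> i)\<^sup>2)"
  let ?c = "sqrt pi * Gamma (?q + 1) / Gamma (?q + 3/2)"
  have "(\<integral>\<^sup>+x. ennreal (pospow p (A - (\<Sum>j\<in>insert i I. (x j)\<^sup>2))) * g (\<Sum>j\<in>insert i I. \<xi> j * x j) \<partial>Pi\<^sub>M (insert i I) (\<lambda>_. lborel))
     = (\<integral>\<^sup>+y. \<integral>\<^sup>+x. ennreal (pospow p (A - (\<Sum>j\<in>insert i I. ((x(i := y)) j)\<^sup>2))) * g (\<Sum>j\<in>insert i I. \<xi> j * (x(i := y)) j) \<partial>Pi\<^sub>M I (\<lambda>_. lborel) \<partial>lborel)"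
    using insert.hyps by (intro product_nn_integral_insert_rev) auto
  also have "\<dots> = (\<integral>\<^sup>+y. \<integral>\<^sup>+x. ennreal (pospow p (A - y\<^sup>2 - (\<Sum>j\<in>I. (x j)\<^sup>2))) * g (\<xi> i * y + (\<Sum>j\<in>I. \<xi> j * x j)) \<partial>Pi\<^sub>M I (\<lambda>_. lborel) \<partial>lborel)"
  proof -
    have "(\<Sum>j\<in>insert i I. ((x(i := y)) j)\<^sup>2) = y\<^sup>2 + (\<Sum>j\<in>I. (x j)\<^sup>2)"
      and "(\<Sum>j\<in>insert i I. \<xi> j * (x(i := y)) j) = \<xi> i * y + (\<Sum>j\<in>I. \<xi> j * x j)" for x :: "'i \<Rightarrow> real" and y
    proof -
      have "(\<Sum>j\<in>I. ((x(i := y)) j)\<^sup>2) = (\<Sum>j\<in>I. (x j)\<^sup>2)" "(\<Sum>j\<in>I. \<xi> j * (x(i := y)) j) = (\<Sum>j\<in>I. \<xi> j * x j)"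
        using insert.hyps by (intro sum.cong refl; auto)+
      then show "(\<Sum>j\<in>insert i I. ((x(i := y)) j)\<^sup>2) = y\<^sup>2 + (\<Sum>j\<in>I. (x j)\<^sup>2)"
        and "(\<Sum>j\<in>insert i I. \<xi> j * (x(i := y)) j) = \<xi> i * y + (\<Sum>j\<in>I. \<xi> j * x j)"
        using insert.hyps by simp_all
    qed
    then show ?thesis by (simp only: diff_diff_eq)
  qed
  also have "\<dots> = (\<integral>\<^sup>+y. \<integral>\<^sup>+t. ennreal (slice_const p ?n * pospow ?q (A - y\<^sup>2 - t\<^sup>2)) * g (\<xi> i * y + ?r * t) \<partial>lborel \<partial>lborel)"
    by (intro nn_integral_cong insert.IH) measurable
  also have "\<dots> = (\<integral>\<^sup>+y. \<integral>\<^sup>+t. (\<lambda>w. ennreal (slice_const p ?n * pospow ?q (A - w))) (y\<^sup>2 + t\<^sup>2) * g (\<xi> i * y + ?r * t) \<partial>lborel \<partial>lborel)"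
    by (simp only: diff_diff_eq)
  also have "\<dots> = (\<integral>\<^sup>+u. \<integral>\<^sup>+v. (\<lambda>w. ennreal (slice_const p ?n * pospow ?q (A - w))) (u\<^sup>2 + v\<^sup>2) * g (sqrt ((\<xi> i)\<^sup>2 + ?r\<^sup>2) * u) \<partial>lborel \<partial>lborel)"
    by (rule nn_integral_rotate_plane) (auto intro!: sum_nonneg)
  also have "\<dots> = (\<integral>\<^sup>+u. ennreal (slice_const p (card (insert i I)) * pospow (p + (real (card (insert i I)) - 1) / 2) (A - u\<^sup>2))
      * g (sqrt (\<Sum>j\<in>insert i I. (\<xi> j)\<^sup>2) * u) \<partial>lborel)"
  proof (rule nn_integral_cong)
    fix u :: real
    have s: "(\<xi> i)\<^sup>2 + ?r\<^sup>2 = (\<Sum>j\<in>insert i I. (\<xi> j)\<^sup>2)"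
      using insert.hyps by (simp add: sum_nonneg)
    have ci: "card (insert i I) = Suc ?n" using insert.hyps by simp
    have q': "?q + 1/2 = p + (real (Suc ?n) - 1) / 2" by (simp add: field_simps)
    have "(\<integral>\<^sup>+v. ennreal (slice_const p ?n * pospow ?q (A - (u\<^sup>2 + v\<^sup>2))) * g (sqrt ((\<xi> i)\<^sup>2 + ?r\<^sup>2) * u) \<partial>lborel)
        = (\<integral>\<^sup>+v. ennreal (slice_const p ?n) * ennreal (pospow ?q ((A - u\<^sup>2) - v\<^sup>2)) * g (sqrt ((\<xi> i)\<^sup>2 + ?r\<^sup>2) * u) \<partial>lborel)"
      using K0 by (simp only: ennreal_mult' diff_diff_eq)
    also have "\<dots> = ennreal (slice_const p ?n) * (\<integral>\<^sup>+v. ennreal (pospow ?q ((A - u\<^sup>2) - v\<^sup>2)) \<partial>lborel) * g (sqrt ((\<xi> i)\<^sup>2 + ?r\<^sup>2) * u)"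
      by (subst nn_integral_multc) (auto simp: nn_integral_cmult)
    also have "\<dots> = ennreal (slice_const p ?n) * ennreal (?c * pospow (?q + 1/2) (A - u\<^sup>2)) * g (sqrt ((\<xi> i)\<^sup>2 + ?r\<^sup>2) * u)"
      by (simp only: nn_integral_pospow[OF q])
    also have "ennreal (slice_const p ?n) * ennreal (?c * pospow (?q + 1/2) (A - u\<^sup>2)) = ennreal (slice_const p (Suc ?n) * pospow (?q + 1/2) (A - u\<^sup>2))"
      using K0 by (simp only: ennreal_mult'[symmetric] mult.assoc[symmetric] slice_const_Suc[OF p n1])
    finally show "(\<integral>\<^sup>+v. ennreal (slice_const p ?n * pospow ?q (A - (u\<^sup>2 + v\<^sup>2))) * g (sqrt ((\<xi> i)\<^sup>2 + ?r\<^sup>2) * u) \<partial>lborel)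
        = ennreal (slice_const p (card (insert i I)) * pospow (p + (real (card (insert i I)) - 1) / 2) (A - u\<^sup>2))
      * g (sqrt (\<Sum>j\<in>insert i I. (\<xi> j)\<^sup>2) * u)" unfolding s ci q' .
  qed
  finally show ?case .
qed

lemma nn_integral_radial_pospow:
  fixes \<xi> :: "'a::euclidean_space"
  assumes p: "p > -1" and [measurable]: "g \<in> borel_measurable borel"
  shows "(\<integral>\<^sup>+x. ennreal (pospow p (A - (norm x)\<^sup>2)) * g (\<xi> \<bullet> x) \<partial>(lborel :: 'a measure))
       = (\<integral>\<^sup>+t. ennreal (slice_const p DIM('a) * pospow (p + (real DIM('a) - 1) / 2) (A - t\<^sup>2)) * g (norm \<xi> * t) \<partial>lborel)"
proof -
  have n: "(norm (\<Sum>b\<in>Basis. f b *\<^sub>R b :: 'a))\<^sup>2 = (\<Sum>b\<in>Basis. (f b)\<^sup>2)" for f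
    unfolding power2_norm_eq_inner
    by (simp add: inner_sum_left inner_sum_right inner_Basis if_distrib power2_eq_square cong: if_cong)
  have i: "\<xi> \<bullet> (\<Sum>b\<in>Basis. f b *\<^sub>R b) = (\<Sum>b\<in>Basis. (\<xi> \<bullet> b) * f b)" for f
    by (simp add: inner_sum_right mult.commute)
  have x: "sqrt (\<Sum>b\<in>Basis. (\<xi> \<bullet> b)\<^sup>2) = norm \<xi>"
    unfolding norm_eq_sqrt_inner by (subst euclidean_inner) (simp add: power2_eq_square)
  have "(\<integral>\<^sup>+x. ennreal (pospow p (A - (norm x)\<^sup>2)) * g (\<xi> \<bullet> x) \<partial>(lborel :: 'a measure))
     = (\<integral>\<^sup>+f. ennreal (pospow p (A - (\<Sum>b\<in>Basis. (f b)\<^sup>2))) * g (\<Sum>b\<in>Basis. (\<xi> \<bullet> b) * f b) \<partial>Pi\<^sub>M (Basis :: 'a set) (\<lambda>_. lborel))"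
    by (subst lborel_eq, subst nn_integral_distr) (simp_all only: n i, measurable)
  also have "\<dots> = (\<integral>\<^sup>+t. ennreal (slice_const p DIM('a) * pospow (p + (real DIM('a) - 1) / 2) (A - t\<^sup>2)) * g (sqrt (\<Sum>b\<in>Basis. (\<xi> \<bullet> b)\<^sup>2) * t) \<partial>lborel)"
    by (rule nn_integral_PiM_pospow[OF finite_Basis nonempty_Basis p]) measurable
  finally show ?thesis unfolding x .
qed

text \<open>As an equality of image measures, the identity for nonnegative integrands becomes
  applicable to complex ones such as characters.\<close>

lemma distr_radial_pospow:
  fixes \<xi> :: "'a::euclidean_space"
  assumes p: "p > -1"
  shows "distr (density (lborel :: 'a measure) (\<lambda>x. ennreal (pospow p (A - (norm x)\<^sup>2)))) borel (\<lambda>x. \<xi> \<bullet> x)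
       = distr (density lborel (\<lambda>t. ennreal (slice_const p DIM('a) * pospow (p + (real DIM('a) - 1) / 2) (A - t\<^sup>2)))) borel (\<lambda>t. norm \<xi> * t)"
    (is "?M = ?N")
proof (rule measure_eqI)
  fix S assume "S \<in> sets ?M"
  then have S[measurable]: "S \<in> sets borel" by simp
  have "emeasure ?M S = (\<integral>\<^sup>+x. indicator S x \<partial>?M)" by simp
  also have "\<dots> = (\<integral>\<^sup>+x. ennreal (pospow p (A - (norm x)\<^sup>2)) * indicator S (\<xi> \<bullet> x) \<partial>(lborel :: 'a measure))"
    by (subst nn_integral_distr, measurable, subst nn_integral_density, measurable)
  also have "\<dots> = (\<integral>\<^sup>+t. ennreal (slice_const p DIM('a) * pospow (p + (real DIM('a) - 1) / 2) (A - t\<^sup>2)) * indicator S (norm \<xi> * t) \<partial>lborel)"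
    by (rule nn_integral_radial_pospow[OF p]) measurable
  also have "\<dots> = (\<integral>\<^sup>+x. indicator S x \<partial>?N)"
    by (subst nn_integral_distr, measurable, subst nn_integral_density, measurable)
  also have "\<dots> = emeasure ?N S" by simp
  finally show "emeasure ?M S = emeasure ?N S" .
qed simp

lemma integrable_pospow_ball:
  assumes q: "q > -1" and a: "a > 0"
  shows "integrable lborel (\<lambda>t. pospow q (a\<^sup>2 - t\<^sup>2))"
proof -
  have "(\<integral>\<^sup>+t. ennreal (pospow q (a\<^sup>2 - t\<^sup>2)) \<partial>lborel) < \<infinity>"
    using nn_integral_pospow[OF q, of "a\<^sup>2"] by simp
  then show ?thesis by (intro integrableI_bounded) auto
qed

lemma integral_pospow_cis:
  fixes a c q :: real
  assumes q: "q > -1" and a: "a > 0"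
  shows "(LINT t|lborel. complex_of_real (pospow q (a\<^sup>2 - t\<^sup>2)) * cis (- (c * t)))
       = complex_of_real (a powr (2 * q + 1) * Gamma (q + 1) * bess q (a * c))"
proof -
  have int: "integrable lborel (\<lambda>t. complex_of_real (pospow q (a\<^sup>2 - t\<^sup>2)))"
    using integrable_pospow_ball[OF q a] by simp
  have ic: "integrable lborel (\<lambda>t. complex_of_real (pospow q (a\<^sup>2 - t\<^sup>2)) * cis (- (c * t)))"
    by (rule integrable_mult_bounded[OF int, where B = 1]) (auto simp: cis_conv_exp)
  have Re: "(LINT t|lborel. pospow q (a\<^sup>2 - t\<^sup>2) * cos (c * t)) = a powr (2 * q + 1) * Gamma (q + 1) * bess q (a * c)"
  proof -
    have "(LINT t|lborel. pospow q (a\<^sup>2 - t\<^sup>2) * cos (c * t)) = a * (LINT t|lborel. pospow q (a\<^sup>2 - (0 + a * t)\<^sup>2) * cos (c * (0 + a * t)))"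
      using a by (subst lborel_integral_real_affine[where c = a and t = 0]) auto
    also have "(\<lambda>t. pospow q (a\<^sup>2 - (0 + a * t)\<^sup>2) * cos (c * (0 + a * t))) = (\<lambda>t. a powr (2 * q) * (pospow q (1 - t\<^sup>2) * cos (a * c * t)))"
    proof
      fix t
      have "a\<^sup>2 - (0 + a * t)\<^sup>2 = a\<^sup>2 * (1 - t\<^sup>2)" by (simp add: power_mult_distrib algebra_simps)
      moreover have "(a\<^sup>2) powr q = a powr (2 * q)" using a by (simp add: powr_powr[symmetric] powr_numeral)
      ultimately show "pospow q (a\<^sup>2 - (0 + a * t)\<^sup>2) * cos (c * (0 + a * t)) = a powr (2 * q) * (pospow q (1 - t\<^sup>2) * cos (a * c * t))"
        using a by (simp add: pospow_mult mult_ac)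
    qed
    also have "(LINT t|lborel. a powr (2 * q) * (pospow q (1 - t\<^sup>2) * cos (a * c * t))) = a powr (2 * q) * (Gamma (q + 1) * bess q (a * c))"
    proof -
      have "Gamma (q + 1) > 0" using q by (intro Gamma_real_pos) auto
      then show ?thesis by (simp add: bess_def)
    qed
    finally show ?thesis using a by (simp add: powr_add)
  qed
  have Im: "(LINT t|lborel. pospow q (a\<^sup>2 - t\<^sup>2) * sin (c * t)) = 0"
  proof -
    have "(LINT t|lborel. pospow q (a\<^sup>2 - t\<^sup>2) * sin (c * t)) = \<bar>-1\<bar> *\<^sub>R (LINT t|lborel. pospow q (a\<^sup>2 - (0 + -1 * t)\<^sup>2) * sin (c * (0 + -1 * t)))"
      by (rule lborel_integral_real_affine) simp
    then show ?thesis by simp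
  qed
  show ?thesis
  proof (rule complex_eqI)
    have "Re (LINT t|lborel. complex_of_real (pospow q (a\<^sup>2 - t\<^sup>2)) * cis (- (c * t)))
      = (LINT t|lborel. Re (complex_of_real (pospow q (a\<^sup>2 - t\<^sup>2)) * cis (- (c * t))))"
      by (rule integral_Re[OF ic, symmetric])
    then show "Re (LINT t|lborel. complex_of_real (pospow q (a\<^sup>2 - t\<^sup>2)) * cis (- (c * t)))
      = Re (complex_of_real (a powr (2 * q + 1) * Gamma (q + 1) * bess q (a * c)))" using Re by simp
    have "Im (LINT t|lborel. complex_of_real (pospow q (a\<^sup>2 - t\<^sup>2)) * cis (- (c * t)))
      = (LINT t|lborel. Im (complex_of_real (pospow q (a\<^sup>2 - t\<^sup>2)) * cis (- (c * t))))"
      by (rule integral_Im[OF ic, symmetric])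
    then show "Im (LINT t|lborel. complex_of_real (pospow q (a\<^sup>2 - t\<^sup>2)) * cis (- (c * t)))
      = Im (complex_of_real (a powr (2 * q + 1) * Gamma (q + 1) * bess q (a * c)))" using Im by simp
  qed
qed

section \<open>The Fourier transform of \<open>U_fun\<close>\<close>

lemma U_fun_eq_pospow: "a > 0 \<Longrightarrow> U_fun p a x = pospow p (a\<^sup>2 - (norm x)\<^sup>2)"
  by (auto simp: U_fun_def pospow_def power2_eq_iff_nonneg power_mono dest: power_less_imp_less_base intro: power_strict_mono)

text \<open>The classical pi^(-p) Gamma(p + 1) (a / r)^(p + d/2) J_(p + d/2)(2 pi a r), written with
  \<open>bess\<close> so that it is regular at r = 0.\<close>

definition U_hat :: "nat \<Rightarrow> real \<Rightarrow> real \<Rightarrow> real \<Rightarrow> real" where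
  "U_hat d p a r = pi powr ((real d - 1) / 2) * Gamma (p + 1) * a powr (2 * p + real d) * bess (p + (real d - 1) / 2) (2 * pi * a * r)"

lemma integrable_U_fun:
  assumes p: "p > -1" and a: "a > 0"
  shows "integrable lborel (U_fun p a :: real ^ 'n::finite \<Rightarrow> real)"
proof -
  have "(\<integral>\<^sup>+x. ennreal (pospow p (a\<^sup>2 - (norm x)\<^sup>2)) \<partial>(lborel :: (real^'n) measure)) < \<infinity>"
  proof -
    let ?q = "p + (real CARD('n) - 1) / 2"
    have q: "?q > -1" using p by (rule CARD_shift_gt)
    have "(\<integral>\<^sup>+x. ennreal (pospow p (a\<^sup>2 - (norm x)\<^sup>2)) \<partial>(lborel :: (real^'n) measure))
       = (\<integral>\<^sup>+t. ennreal (slice_const p DIM(real^'n)) * ennreal (pospow ?q (a\<^sup>2 - t\<^sup>2)) \<partial>lborel)"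
      using nn_integral_radial_pospow[OF p, of "\<lambda>_. 1" "a\<^sup>2" "0 :: real^'n"] by (simp add: ennreal_mult'')
    also have "\<dots> < \<infinity>"
      by (subst nn_integral_cmult) (auto simp: nn_integral_pospow[OF q] ennreal_mult_less_top)
    finally show ?thesis .
  qed
  then have "integrable lborel (\<lambda>x::real^'n. pospow p (a\<^sup>2 - (norm x)\<^sup>2))"
    by (intro integrableI_bounded) auto
  then show ?thesis by (simp add: U_fun_eq_pospow[OF a, abs_def])
qed

text \<open>Pushing forward along the linear form with coefficient vector \<xi> leaves a
  one-dimensional transform, whose Gamma factor cancels the denominator of
  \<open>slice_const\<close>.\<close>

lemma integral_U_fun_cis:
  fixes \<xi> :: "real ^ 'n::finite"
  assumes p: "p > -1" and a: "a > 0"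
  shows "(LINT x|lborel. complex_of_real (U_fun p a x) * cis (- (2 * pi * (\<xi> \<bullet> x)))) = complex_of_real (U_hat CARD('n) p a (norm \<xi>))"
proof -
  let ?d = "CARD('n)"
  let ?q = "p + (real ?d - 1) / 2"
  have q: "?q > -1" using p by (rule CARD_shift_gt)
  have K0: "slice_const p ?d \<ge> 0" using slice_const_pos[OF p, of ?d] by simp
  let ?G = "\<lambda>u::real. cis (- (2 * pi * u))"
  have G[measurable]: "?G \<in> borel_measurable borel" by (intro borel_measurable_continuous_onI continuous_intros)
  have "(LINT x|lborel. complex_of_real (U_fun p a x) * cis (- (2 * pi * (\<xi> \<bullet> x))))
     = (LINT x|density lborel (\<lambda>x::real^'n. ennreal (pospow p (a\<^sup>2 - (norm x)\<^sup>2))). ?G (\<xi> \<bullet> x))"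
    by (subst integral_density) (auto simp: U_fun_eq_pospow[OF a] scaleR_conv_of_real)
  also have "\<dots> = (LINT u|distr (density (lborel :: (real^'n) measure) (\<lambda>x. ennreal (pospow p (a\<^sup>2 - (norm x)\<^sup>2)))) borel (\<lambda>x. \<xi> \<bullet> x). ?G u)"
    by (subst integral_distr) auto
  also have "\<dots> = (LINT u|distr (density lborel (\<lambda>t. ennreal (slice_const p ?d * pospow ?q (a\<^sup>2 - t\<^sup>2)))) borel (\<lambda>t. norm \<xi> * t). ?G u)"
    by (subst distr_radial_pospow[OF p]) simp
  also have "\<dots> = (LINT t|density lborel (\<lambda>t. ennreal (slice_const p ?d * pospow ?q (a\<^sup>2 - t\<^sup>2))). ?G (norm \<xi> * t))"
    by (subst integral_distr) auto
  also have "\<dots> = (LINT t|lborel. complex_of_real (slice_const p ?d) * (complex_of_real (pospow ?q (a\<^sup>2 - t\<^sup>2)) * cis (- (2 * pi * norm \<xi> * t))))"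
    using K0 by (subst integral_density) (auto simp: scaleR_conv_of_real mult_ac)
  also have "\<dots> = complex_of_real (slice_const p ?d * (a powr (2 * ?q + 1) * Gamma (?q + 1) * bess ?q (a * (2 * pi * norm \<xi>))))"
    by (simp add: integral_pospow_cis[OF q a] del: of_real_mult flip: of_real_mult)
  also have "slice_const p ?d * (a powr (2 * ?q + 1) * Gamma (?q + 1) * bess ?q (a * (2 * pi * norm \<xi>))) = U_hat ?d p a (norm \<xi>)"
  proof -
    have "Gamma (?q + 1) > 0" using q by (intro Gamma_real_pos) auto
    moreover have "2 * ?q + 1 = 2 * p + real ?d" by (simp add: field_simps)
    ultimately show ?thesis unfolding slice_const_def U_hat_def by (simp only:) (simp add: mult_ac)
  qed
  finally show ?thesis .
qed

section \<open>The integer lattice and the torus\<close>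

lemma int_lattice_add: "m \<in> int_lattice \<Longrightarrow> k \<in> int_lattice \<Longrightarrow> m + k \<in> int_lattice"
  by (auto simp: int_lattice_def)

lemma int_lattice_uminus: "m \<in> int_lattice \<Longrightarrow> - m \<in> int_lattice"
  by (auto simp: int_lattice_def)

lemma int_lattice_diff: "m \<in> int_lattice \<Longrightarrow> k \<in> int_lattice \<Longrightarrow> m - k \<in> int_lattice"
  by (auto simp: int_lattice_def)

lemma zero_in_int_lattice [simp]: "0 \<in> int_lattice"
  by (simp add: int_lattice_def)

lemma countable_int_lattice [simp]: "countable (int_lattice :: (real ^ 'n::finite) set)"
proof -
  have "(int_lattice :: (real ^ 'n) set) = (\<Union>k::nat. {m. m \<in> int_lattice \<and> norm m < real k})"
    using reals_Archimedean2 by fastforce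
  from eq_refl[OF this] show ?thesis
    by (rule countable_subset) (intro countable_UN countable_finite finite_int_lattice_ball countableI_type)
qed

definition chr :: "real ^ 'n::finite \<Rightarrow> real ^ 'n \<Rightarrow> complex" where
  "chr k x = cis (2 * pi * (k \<bullet> x))"

lemma chr_add_left: "chr (k + l) x = chr k x * chr l x"
  by (simp add: chr_def cis_mult inner_add_left distrib_left)

lemma norm_chr [simp]: "norm (chr k x) = 1"
  by (simp add: chr_def)

lemma chr_0 [simp]: "chr 0 x = 1" "chr k 0 = 1"
  by (simp_all add: chr_def)

lemma continuous_on_chr [continuous_intros]: "continuous_on S f \<Longrightarrow> continuous_on S (\<lambda>x. chr k (f x))"
  unfolding chr_def by (intro continuous_intros)

lemma borel_measurable_chr [measurable]: "chr k \<in> borel_measurable borel"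
  by (intro borel_measurable_continuous_onI continuous_intros)

lemma chr_uminus_mult [simp]: "chr k x * chr (- k) x = 1"
  by (simp add: chr_add_left[symmetric])

lemma measurable_torus [measurable]: "torus \<in> sets (borel :: (real ^ 'n::finite) measure)"
proof -
  have "torus = (\<Inter>i::'n. {x :: real ^ 'n. - 1/2 < x $ i} \<inter> {x. x $ i \<le> 1/2})"
    by (auto simp: torus_def)
  moreover have "{x :: real ^ 'n. - 1/2 < x $ i} \<inter> {x. x $ i \<le> 1/2} \<in> sets borel" for i
    by (intro sets.Int borel_open borel_closed open_halfspace_component_gt_cart closed_halfspace_component_le_cart)
  ultimately have "(\<Inter>i::'n. {x :: real ^ 'n. - 1/2 < x $ i} \<inter> {x. x $ i \<le> 1/2}) \<in> sets borel"
    by (intro sets.finite_INT) auto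
  with \<open>torus = _\<close> show ?thesis by simp
qed

lemma norm_torus_le: "x \<in> torus \<Longrightarrow> norm (x :: real ^ 'n::finite) \<le> real CARD('n)"
proof -
  assume x: "x \<in> torus"
  have "norm x \<le> (\<Sum>i\<in>UNIV. \<bar>x $ i\<bar>)" by (rule norm_le_l1_cart)
  also have "\<dots> \<le> (\<Sum>i\<in>(UNIV::'n set). 1)"
  proof (rule sum_mono)
    fix i
    have "- 1/2 < x $ i" "x $ i \<le> 1/2" using x by (auto simp: torus_def)
    then show "\<bar>x $ i\<bar> \<le> 1" by linarith
  qed
  finally show ?thesis by simp
qed

lemma torus_shift_ex1: "\<exists>!m. m \<in> int_lattice \<and> x - m \<in> (torus :: (real ^ 'n::finite) set)"
proof
  \<comment> \<open>The domain contains 1/2 but not -1/2, so the right lattice coordinate is the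
    ceiling of x_i - 1/2 and not the floor of x_i + 1/2.\<close>
  let ?m = "\<chi> i. real_of_int \<lceil>x $ i - 1/2\<rceil>"
  show "?m \<in> int_lattice \<and> x - ?m \<in> torus"
    by (auto simp: int_lattice_def torus_def; linarith)
  fix m assume m: "m \<in> int_lattice \<and> x - m \<in> torus"
  show "m = ?m"
  proof (simp add: vec_eq_iff, rule allI)
    fix i
    from m obtain j where j: "m $ i = real_of_int j" by (auto simp: int_lattice_def Ints_def)
    from m have "- 1/2 < x $ i - j" "x $ i - j \<le> 1/2" by (auto simp: torus_def j[symmetric])
    then have "\<lceil>x $ i - 1/2\<rceil> = j" by linarith
    then show "m $ i = real_of_int \<lceil>x $ i - 1 / 2\<rceil>" using j by simp
  qed
qed

text \<open>The lattice translates of the torus tile the space and \<open>g\<close> is periodic.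
  Torus points have norm at most d, so a function supported in radius K meets only the translates by
  vectors shorter than K + d, and all sums are finite.\<close>

lemma integral_unfold_torus:
  fixes f :: "real ^ 'n::finite \<Rightarrow> complex"
  assumes f: "integrable lborel f" and supp: "\<And>x. norm x \<ge> K \<Longrightarrow> f x = 0"
    and g: "g \<in> borel_measurable borel" "\<And>x. norm (g x) \<le> B" "\<And>x m. m \<in> int_lattice \<Longrightarrow> g (x + m) = g x"
  defines "M \<equiv> {m. m \<in> int_lattice \<and> norm m < K + real CARD('n)}"
  shows "(LINT x|lborel. f x * g x) = (LINT x|lborel. indicator torus x * ((\<Sum>m\<in>M. f (x + m)) * g x))"
proof -
  have fin: "finite M" unfolding M_def by (rule finite_int_lattice_ball)
  have dec: "f x * g x = (\<Sum>m\<in>M. indicator torus (x - m) * (f x * g x))" for x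
  proof (cases "f x = 0")
    case False
    then have "norm x < K" using supp by (meson not_le)
    obtain m where m: "m \<in> int_lattice" "x - m \<in> torus" using torus_shift_ex1 by blast
    have "norm m \<le> norm x + norm (x - m)" using norm_triangle_ineq4[of x "x - m"] by simp
    then have "m \<in> M" using m \<open>norm x < K\<close> norm_torus_le[OF m(2)] by (auto simp: M_def)
    have "(\<Sum>m'\<in>M. indicator torus (x - m') * (f x * g x)) = (\<Sum>m'\<in>M. if m' = m then f x * g x else 0)"
      using m torus_shift_ex1[of x] by (intro sum.cong refl) (auto simp: indicator_def M_def)
    then show ?thesis using \<open>m \<in> M\<close> fin by simp
  qed simp
  have ifg: "integrable lborel (\<lambda>x. f x * g x)"
    using g by (intro integrable_mult_bounded[OF f]) auto
  note [measurable] = borel_measurable_integrable[OF f] g(1)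
  have i1: "integrable lborel (\<lambda>x. indicator torus (x - m) * (f x * g x))" for m
    using integrable_mult_bounded[OF ifg, of "\<lambda>x. indicator torus (x - m)" 1] by (simp add: mult.commute indicator_def)
  have shift: "(LINT x|lborel. h x) = (LINT x|lborel. h (m + x))" if [measurable]: "h \<in> borel_measurable borel" for h :: "real ^ 'n \<Rightarrow> complex" and m
    by (subst lborel_distr_plus[of m, symmetric], subst integral_distr) auto
  have gm: "g (m + x) = g x" if "m \<in> M" for m x
    using that g(3)[of m x] by (simp add: M_def add.commute[of m x])
  have shifted: "indicator torus (m + x - m) * (f (m + x) * g (m + x)) = indicator torus x * (f (x + m) * g x)" if "m \<in> M" for m x
    unfolding gm[OF that] by (simp add: add.commute)
  have i2: "integrable lborel (\<lambda>x. indicator torus x * (f (x + m) * g x))" if m: "m \<in> M" for m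
  proof -
    have "integrable (distr lborel borel ((+) m)) (\<lambda>x. indicator torus (x - m) * (f x * g x))"
      using i1 by (simp add: lborel_distr_plus)
    then have "integrable lborel (\<lambda>x. indicator torus (m + x - m) * (f (m + x) * g (m + x)))"
      by (subst (asm) integrable_distr_eq) auto
    then show ?thesis by (simp only: shifted[OF m])
  qed
  have "(LINT x|lborel. f x * g x) = (LINT x|lborel. (\<Sum>m\<in>M. indicator torus (x - m) * (f x * g x)))"
    using dec by simp
  also have "\<dots> = (\<Sum>m\<in>M. LINT x|lborel. indicator torus (x - m) * (f x * g x))"
    by (rule Bochner_Integration.integral_sum) (rule i1)
  also have "\<dots> = (\<Sum>m\<in>M. LINT x|lborel. indicator torus x * (f (x + m) * g x))"
  proof (rule sum.cong[OF refl])
    fix m assume m: "m \<in> M"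
    have "(LINT x|lborel. indicator torus (x - m) * (f x * g x)) = (LINT x|lborel. indicator torus (m + x - m) * (f (m + x) * g (m + x)))"
      by (rule shift) measurable
    also have "\<dots> = (LINT x|lborel. indicator torus x * (f (x + m) * g x))"
      by (simp only: shifted[OF m])
    finally show "(LINT x|lborel. indicator torus (x - m) * (f x * g x)) = (LINT x|lborel. indicator torus x * (f (x + m) * g x))" .
  qed
  also have "\<dots> = (LINT x|lborel. (\<Sum>m\<in>M. indicator torus x * (f (x + m) * g x)))"
    by (rule Bochner_Integration.integral_sum[symmetric]) (rule i2)
  finally show ?thesis by (simp add: sum_distrib_left sum_distrib_right)
qed

section \<open>Orthogonality of the characters\<close>

lemma integral_lborel_prod_cart:
  fixes f :: "'n::finite \<Rightarrow> real \<Rightarrow> 'b::{real_normed_field, banach, second_countable_topology}"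
  assumes "\<And>i. integrable lborel (f i)"
  shows "integrable lborel (\<lambda>x::real ^ 'n. \<Prod>i\<in>UNIV. f i (x $ i))"
    and "(LINT x|lborel. (\<Prod>i\<in>UNIV. f i ((x :: real ^ 'n) $ i))) = (\<Prod>i\<in>UNIV. (LINT t|lborel. f i t))"
proof -
  interpret product_sigma_finite "\<lambda>_::real^'n. lborel :: real measure" by standard
  have bij: "bij_betw (\<lambda>i. axis i 1) UNIV (Basis :: (real ^ 'n) set)"
    by (auto simp: bij_betw_def inj_on_def Basis_vec_def axis_eq_axis)
  have P: "(\<Prod>i\<in>UNIV. f i (x $ i)) = (\<Prod>b\<in>Basis. f (axis_index b) (x \<bullet> b))" for x :: "real ^ 'n"
    using prod.reindex_bij_betw[OF bij, of "\<lambda>b. f (axis_index b) (x \<bullet> b)"] by (simp add: inner_axis)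
  have P': "(\<Prod>i\<in>UNIV. (LINT t|lborel. f i t)) = (\<Prod>b\<in>Basis. (LINT t|lborel. f (axis_index (b :: real ^ 'n)) t))"
    using prod.reindex_bij_betw[OF bij, of "\<lambda>b. LINT t|lborel. f (axis_index b) t"] by simp
  have [measurable]: "f i \<in> borel_measurable borel" for i using borel_measurable_integrable[OF assms[of i]] by simp
  have c: "(\<Prod>b\<in>Basis. f (axis_index b) ((\<Sum>b\<in>Basis. g b *\<^sub>R b) \<bullet> b)) = (\<Prod>b\<in>Basis. f (axis_index b) (g b))" for g :: "real ^ 'n \<Rightarrow> real"
    by (intro prod.cong refl) simp
  have m: "(\<lambda>x::real ^ 'n. \<Prod>b\<in>Basis. f (axis_index b) (x \<bullet> b)) \<in> borel_measurable borel" by measurable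
  show "integrable lborel (\<lambda>x::real ^ 'n. \<Prod>i\<in>UNIV. f i (x $ i))"
    unfolding P by (subst lborel_eq, subst integrable_distr_eq) (use m in \<open>auto simp: c assms intro!: product_integrable_prod\<close>)
  have "(LINT x|lborel. (\<Prod>b\<in>Basis. f (axis_index b) ((x :: real ^ 'n) \<bullet> b))) = (LINT g|Pi\<^sub>M Basis (\<lambda>_. lborel). (\<Prod>b\<in>Basis. f (axis_index (b :: real ^ 'n)) (g b)))"
    by (subst lborel_eq, subst integral_distr) (use m in \<open>auto simp: c\<close>)
  also have "\<dots> = (\<Prod>b\<in>Basis. (LINT t|lborel. f (axis_index (b :: real ^ 'n)) t))"
    by (rule product_integral_prod) (auto intro: assms)
  finally show "(LINT x|lborel. (\<Prod>i\<in>UNIV. f i ((x :: real ^ 'n) $ i))) = (\<Prod>i\<in>UNIV. (LINT t|lborel. f i t))"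
    unfolding P P' .
qed

lemma indicator_complex: "(indicator S t :: complex) = complex_of_real (indicator S t)"
  by (auto simp: indicator_def)

lemma integral_cis_period:
  fixes j :: int
  shows "integrable lborel (\<lambda>t. indicator {-1/2<..1/2} t * cis (2 * pi * (real_of_int j * t)))"
    and "(LINT t|lborel. indicator {-1/2<..1/2} t * cis (2 * pi * (real_of_int j * t))) = (if j = 0 then 1 else 0)"
proof -
  have ii: "integrable lborel (\<lambda>t. indicator {-1/2<..1/2::real} t :: complex)"
    unfolding indicator_complex by simp
  show "integrable lborel (\<lambda>t. indicator {-1/2<..1/2} t * cis (2 * pi * (real_of_int j * t)))"
    by (rule integrable_mult_bounded[OF ii, where B = 1]) auto
  show "(LINT t|lborel. indicator {-1/2<..1/2} t * cis (2 * pi * (real_of_int j * t))) = (if j = 0 then 1 else 0)"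
  proof (cases "j = 0")
    case True
    have "(LINT t|lborel. (indicator {-1/2<..1/2::real} t :: complex)) = 1"
      unfolding indicator_complex by (subst integral_complex_of_real) simp
    then show ?thesis using True by simp
  next
    case False
    define w where "w = 2 * pi * real_of_int j"
    have w: "w \<noteq> 0" using False by (simp add: w_def)
    define F where "F = (\<lambda>t::real. cis (w * t) / (\<i> * w))"
    have der: "(F has_vector_derivative cis (w * t)) (at t within A)" for t A
    proof -
      have "((\<lambda>t. exp (\<i> * w * complex_of_real t) / (\<i> * w)) has_vector_derivative exp (\<i> * w * t)) (at t within A)"
        using w by (auto intro!: derivative_eq_intros has_vector_derivative_real_field simp: field_simps)
      then show ?thesis by (simp add: F_def cis_conv_exp mult_ac)
    qed
    have "(LINT t|lborel. indicator {-1/2<..1/2} t * cis (2 * pi * (real_of_int j * t))) = (LINT t|lborel. indicator {-1/2..1/2} t *\<^sub>R cis (w * t))"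
      by (intro integral_cong_AE eventually_mono[OF AE_lborel_singleton[of "-1/2"]])
         (auto simp: indicator_def w_def mult_ac)
    also have "\<dots> = F (1/2) - F (-1/2)"
      by (rule integral_FTC_Icc) (auto intro: der continuous_intros)
    also have "\<dots> = 0"
    proof -
      have "cis (w * (1/2)) = cis (w * (- 1/2) + 2 * pi * real_of_int j)" by (rule arg_cong[where f = cis]) (simp add: w_def)
      also have "\<dots> = cis (w * (- 1/2)) * cis (2 * pi * real_of_int j)" by (simp only: cis_mult)
      also have "cis (2 * pi * real_of_int j) = 1" by (rule cis_multiple_2pi) simp
      finally show ?thesis by (simp add: F_def)
    qed
    finally show ?thesis using False by simp
  qed
qed

lemma cis_sum: "cis (\<Sum>i\<in>I. f i) = (\<Prod>i\<in>I. cis (f i))"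
  by (induction I rule: infinite_finite_induct) (auto simp: cis_mult[symmetric])

lemma integral_torus_chr:
  assumes k: "k \<in> (int_lattice :: (real ^ 'n::finite) set)"
  shows "integrable lborel (\<lambda>x. indicator torus x * chr k x)"
    and "(LINT x|lborel. indicator torus x * chr k x) = (if k = 0 then 1 else 0)"
proof -
  obtain j where j: "\<And>i. k $ i = real_of_int (j i)"
    using k unfolding int_lattice_def Ints_def by (simp add: image_iff) metis
  let ?f = "\<lambda>i t. indicator {-1/2<..1/2} t * cis (2 * pi * (real_of_int (j i) * t))"
  have eq: "indicator torus x * chr k x = (\<Prod>i\<in>UNIV. ?f i (x $ i))" for x
  proof -
    have "chr k x = (\<Prod>i\<in>UNIV. cis (2 * pi * (real_of_int (j i) * x $ i)))"
      by (simp add: chr_def inner_vec_def sum_distrib_left cis_sum j)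
    moreover have "(indicator torus x :: complex) = (\<Prod>i\<in>UNIV. indicator {-1/2<..1/2} (x $ i))"
    proof (cases "x \<in> torus")
      case False
      then obtain i where "x $ i \<notin> {-1/2<..1/2}" by (auto simp: torus_def)
      then have "(\<Prod>i\<in>UNIV. indicator {-1/2<..1/2} (x $ i) :: complex) = 0"
        by (intro prod_zero bexI[of _ i]) auto
      then show ?thesis using False by simp
    qed (simp add: torus_def)
    ultimately show ?thesis by (simp add: prod.distrib)
  qed
  show "integrable lborel (\<lambda>x. indicator torus x * chr k x)"
    unfolding eq by (rule integral_lborel_prod_cart(1)) (rule integral_cis_period(1))
  have "(LINT x|lborel. indicator torus x * chr k x) = (\<Prod>i\<in>UNIV. if j i = 0 then 1 else 0)"
    unfolding eq by (subst integral_lborel_prod_cart(2)) (simp_all only: integral_cis_period)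
  also have "\<dots> = (if k = 0 then 1 else 0)"
  proof (cases "k = 0")
    case False
    then obtain i where "j i \<noteq> 0" using j by (auto simp: vec_eq_iff)
    then have "(\<Prod>i\<in>UNIV. if j i = 0 then 1 else 0 :: complex) = 0"
      by (intro prod_zero bexI[of _ i]) auto
    then show ?thesis using False by simp
  qed (use j in \<open>simp add: vec_eq_iff\<close>)
  finally show "(LINT x|lborel. indicator torus x * chr k x) = (if k = 0 then 1 else 0)" .
qed

section \<open>Poisson summation\<close>

text \<open>Closure under products is derived from this generation by monomials and sums; powers of
  a kernel are thereby expanded into characters without computing any coefficient.\<close>

inductive_set trig_poly :: "(real ^ 'n::finite \<Rightarrow> complex) set" where
  chr: "k \<in> int_lattice \<Longrightarrow> (\<lambda>x. c * chr k x) \<in> trig_poly"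
| add: "p \<in> trig_poly \<Longrightarrow> q \<in> trig_poly \<Longrightarrow> (\<lambda>x. p x + q x) \<in> trig_poly"

lemma trig_poly_const: "(\<lambda>x. c) \<in> trig_poly"
  using trig_poly.chr[of 0 c] by simp

lemma trig_poly_mult:
  assumes "p \<in> trig_poly" "q \<in> trig_poly"
  shows "(\<lambda>x. p x * q x) \<in> trig_poly"
  using assms
proof (induction p rule: trig_poly.induct)
  case (chr k c)
  from chr.prems show ?case
  proof (induction q rule: trig_poly.induct)
    case (chr l b)
    then have "(\<lambda>x. (c * b) * chr (k + l) x) \<in> trig_poly"
      using \<open>k \<in> int_lattice\<close> by (intro trig_poly.chr int_lattice_add)
    then show ?case by (simp add: chr_add_left mult_ac)
  next
    case (add p q)
    then show ?case using trig_poly.add[OF add.IH] by (simp add: distrib_left)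
  qed
next
  case (add p1 p2)
  then show ?case using trig_poly.add[OF add.IH(1)[OF add.prems] add.IH(2)[OF add.prems]] by (simp add: distrib_right)
qed

lemma trig_poly_power: "p \<in> trig_poly \<Longrightarrow> (\<lambda>x. p x ^ N) \<in> trig_poly"
  by (induction N) (auto intro: trig_poly_const trig_poly_mult)

lemma trig_poly_prod: "(\<And>i. i \<in> I \<Longrightarrow> p i \<in> trig_poly) \<Longrightarrow> (\<lambda>x. \<Prod>i\<in>I. p i x) \<in> trig_poly"
  by (induction I rule: infinite_finite_induct) (auto intro: trig_poly_const trig_poly_mult)

lemma trig_poly_expand:
  assumes "p \<in> trig_poly"
  obtains K c where "finite K" "K \<subseteq> int_lattice" "p = (\<lambda>x. \<Sum>k\<in>K. c k * chr k x)"
proof -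
  have "\<exists>K c. finite K \<and> K \<subseteq> int_lattice \<and> p = (\<lambda>x. \<Sum>k\<in>K. c k * chr k x)"
    using assms
  proof (induction p rule: trig_poly.induct)
    case (chr k c)
    then show ?case by (intro exI[of _ "{k}"] exI[of _ "\<lambda>_. c"]) auto
  next
    case (add p q)
    then obtain K c L b where K: "finite K" "K \<subseteq> int_lattice" "p = (\<lambda>x. \<Sum>k\<in>K. c k * chr k x)"
      and L: "finite L" "L \<subseteq> int_lattice" "q = (\<lambda>x. \<Sum>k\<in>L. b k * chr k x)" by blast
    let ?a = "\<lambda>k. (if k \<in> K then c k else 0) + (if k \<in> L then b k else 0)"
    have "(\<Sum>k\<in>K \<union> L. ?a k * chr k x) = p x + q x" for x
    proof -
      have "(\<Sum>k\<in>K \<union> L. (if k \<in> K then c k else 0) * chr k x) = p x"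
        unfolding K(3) using K(1) L(1) by (intro sum.mono_neutral_cong_right) auto
      moreover have "(\<Sum>k\<in>K \<union> L. (if k \<in> L then b k else 0) * chr k x) = q x"
        unfolding L(3) using K(1) L(1) by (intro sum.mono_neutral_cong_right) auto
      ultimately show ?thesis by (simp add: distrib_right sum.distrib)
    qed
    then show ?case using K L by (intro exI[of _ "K \<union> L"] exI[of _ ?a]) auto
  qed
  then show thesis using that by blast
qed

text \<open>The powers of this kernel are trigonometric polynomials concentrating at the lattice points.\<close>

definition cos_kernel :: "real ^ 'n::finite \<Rightarrow> real" where
  "cos_kernel x = (\<Prod>i\<in>UNIV. (cos (pi * x $ i))\<^sup>2)"

lemma cos_kernel_trig_poly: "(\<lambda>x. complex_of_real (cos_kernel (x :: real ^ 'n::finite))) \<in> trig_poly"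
proof -
  have "(\<lambda>x. complex_of_real ((cos (pi * x $ i))\<^sup>2)) \<in> trig_poly" for i :: 'n
  proof -
    let ?e = "axis i 1 :: real ^ 'n"
    have e: "?e \<in> int_lattice" by (auto simp: int_lattice_def axis_def)
    have "(\<lambda>x. (1/2 + 1/4 * chr ?e x) + 1/4 * chr (- ?e) x) \<in> trig_poly"
      by (intro trig_poly.add trig_poly_const trig_poly.chr e int_lattice_uminus)
    also have "(\<lambda>x. (1/2 + 1/4 * chr ?e x) + 1/4 * chr (- ?e) x) = (\<lambda>x. complex_of_real ((cos (pi * x $ i))\<^sup>2))"
    proof
      fix x :: "real ^ 'n"
      have "chr ?e x + chr (- ?e) x = complex_of_real (2 * cos (2 * (pi * x $ i)))"
        by (simp add: chr_def inner_axis' complex_eq_iff mult.assoc)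
      also have "2 * cos (2 * (pi * x $ i)) = 4 * (cos (pi * x $ i))\<^sup>2 - 2"
        by (simp only: cos_double_cos) simp
      finally have e: "chr ?e x + chr (- ?e) x = complex_of_real (4 * (cos (pi * x $ i))\<^sup>2 - 2)" .
      have "(1/2 + 1/4 * chr ?e x) + 1/4 * chr (- ?e) x = 1/2 + 1/4 * (chr ?e x + chr (- ?e) x)" by (simp add: distrib_left)
      also have "\<dots> = complex_of_real ((cos (pi * x $ i))\<^sup>2)" unfolding e by (simp add: field_simps)
      finally show "(1/2 + 1/4 * chr ?e x) + 1/4 * chr (- ?e) x = complex_of_real ((cos (pi * x $ i))\<^sup>2)" .
    qed
    finally show ?thesis .
  qed
  then show ?thesis unfolding cos_kernel_def of_real_prod by (intro trig_poly_prod)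
qed

lemma cos_kernel_bounds: "0 \<le> cos_kernel x" "cos_kernel x \<le> (cos (pi * x $ i))\<^sup>2" "cos_kernel x \<le> 1"
proof -
  show 0: "0 \<le> cos_kernel x" by (simp add: cos_kernel_def prod_nonneg)
  have "cos_kernel x = (cos (pi * x $ i))\<^sup>2 * (\<Prod>j\<in>UNIV - {i}. (cos (pi * x $ j))\<^sup>2)"
    unfolding cos_kernel_def by (simp add: prod.remove)
  also have "\<dots> \<le> (cos (pi * x $ i))\<^sup>2 * 1"
    by (intro mult_left_mono prod_le_1) (auto simp: abs_square_le_1)
  finally show 1: "cos_kernel x \<le> (cos (pi * x $ i))\<^sup>2" by simp
  also have "\<dots> \<le> 1" by (simp add: abs_square_le_1)
  finally show "cos_kernel x \<le> 1" .
qed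

lemma continuous_on_cos_kernel [continuous_intros]: "continuous_on S cos_kernel"
  unfolding cos_kernel_def by (intro continuous_intros)

lemma borel_measurable_cos_kernel [measurable]: "cos_kernel \<in> borel_measurable borel"
  by (intro borel_measurable_continuous_onI continuous_intros)

lemma cos_kernel_add_lattice: "m \<in> int_lattice \<Longrightarrow> cos_kernel (x + m) = cos_kernel x"
proof -
  assume "m \<in> int_lattice"
  then have "\<forall>i. \<exists>j::int. m $ i = of_int j" by (auto simp: int_lattice_def Ints_def)
  then obtain j :: "_ \<Rightarrow> int" where j: "\<And>i. m $ i = of_int (j i)" by metis
  have "(cos (pi * (x + m) $ i))\<^sup>2 = (cos (pi * x $ i))\<^sup>2" for i
  proof -
    have "sin (of_int (j i) * pi) = 0" using sin_zero_iff_int2[of "of_int (j i) * pi"] by auto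
    then have "cos (pi * (x + m) $ i) = cos (pi * x $ i) * cos (of_int (j i) * pi)"
      by (simp add: j distrib_left cos_add mult.commute[of pi "of_int _"])
    moreover have "(cos (of_int (j i) * pi))\<^sup>2 = 1"
      using sin_zero_iff_int2[of "of_int (j i) * pi"] by (auto simp: cos_squared_eq)
    ultimately show ?thesis by (simp add: power_mult_distrib)
  qed
  then show ?thesis by (simp add: cos_kernel_def)
qed

lemma emeasure_torus_finite: "emeasure lborel (torus :: (real ^ 'n::finite) set) < \<infinity>"
proof -
  have "(torus :: (real ^ 'n) set) \<subseteq> cbox (\<chi> i. -1/2) (\<chi> i. 1/2)"
    unfolding torus_def by (auto simp: mem_box_cart less_imp_le)
  then have "emeasure lborel (torus :: (real ^ 'n) set) \<le> emeasure lborel (cbox (\<chi> i. -1/2) (\<chi> i. 1/2) :: (real ^ 'n) set)"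
    by (intro emeasure_mono) auto
  also have "\<dots> < \<infinity>" by (rule emeasure_lborel_cbox_finite)
  finally show ?thesis .
qed

lemma integrable_torus_bounded:
  fixes h :: "real ^ 'n::finite \<Rightarrow> 'b::{real_normed_field, banach, second_countable_topology}"
  assumes [measurable]: "h \<in> borel_measurable borel" and b: "\<And>x. x \<in> torus \<Longrightarrow> norm (h x) \<le> B"
  shows "integrable lborel (\<lambda>x. indicator torus x * h x)"
proof -
  have "integrable lborel (\<lambda>x. indicator torus x *\<^sub>R h x)"
    by (rule integrableI_bounded_set_indicator[OF _ _ emeasure_torus_finite, where B = B]) (use b in auto)
  moreover have "indicator torus x *\<^sub>R h x = indicator torus x * h x" for x by (simp add: indicator_def)
  ultimately show ?thesis by simp
qed

text \<open>Restriction to a small cube bounds the mass of the N-th power from below by a geometric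
  sequence. Its ratio cos^2(pi \<eta>)^d can be brought as close to 1 as desired by shrinking
  \<eta>.\<close>

lemma cos_kernel_integral_lower:
  fixes \<eta> :: real
  assumes "0 < \<eta>" "\<eta> < 1/2"
  obtains v where "v > 0"
    "\<And>N. v * ((cos (pi * \<eta>))\<^sup>2 ^ CARD('n)) ^ N \<le> (LINT x|lborel. indicator torus x * cos_kernel (x :: real ^ 'n::finite) ^ N)"
proof
  let ?B = "box (\<chi> i. - \<eta>) (\<chi> i. \<eta>) :: (real ^ 'n) set"
  have mem: "x \<in> ?B \<longleftrightarrow> (\<forall>i. \<bar>x $ i\<bar> < \<eta>)" for x by (auto simp: mem_box_cart abs_less_iff; smt (verit))
  have "measure lborel ?B = (\<Prod>b\<in>Basis. ((\<chi> i. \<eta>) - (\<chi> i. - \<eta>) :: real ^ 'n) \<bullet> b)"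
    using assms by (intro measure_lborel_box) (auto simp: Basis_vec_def inner_axis)
  also have "\<dots> > 0" using assms by (intro prod_pos) (auto simp: Basis_vec_def inner_axis)
  finally show "measure lborel ?B > 0" .
  have sub: "?B \<subseteq> torus"
  proof
    fix x assume "x \<in> ?B"
    then have "\<bar>x $ i\<bar> < 1/2" for i using mem assms by (meson less_trans)
    then have "- 1/2 < x $ i \<and> x $ i \<le> 1/2" for i by (metis abs_less_iff less_imp_le minus_divide_left neg_less_iff_less minus_minus)
    then show "x \<in> torus" unfolding torus_def by auto
  qed
  fix N
  have pt: "((cos (pi * \<eta>))\<^sup>2 ^ CARD('n)) ^ N \<le> cos_kernel x ^ N" if "x \<in> ?B" for x
  proof (intro power_mono)
    have "(cos (pi * \<eta>))\<^sup>2 ^ CARD('n) = (\<Prod>i\<in>(UNIV::'n set). (cos (pi * \<eta>))\<^sup>2)" by simp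
    also have "\<dots> \<le> cos_kernel x" unfolding cos_kernel_def
    proof (rule prod_mono, intro conjI power_mono)
      fix i
      have "\<bar>x $ i\<bar> < \<eta>" using that mem by blast
      have "cos (pi * \<eta>) \<le> cos (pi * \<bar>x $ i\<bar>)"
        using assms \<open>\<bar>x $ i\<bar> < \<eta>\<close> by (intro cos_monotone_0_pi_le) (auto intro: mult_left_mono order_trans[of _ "1/2"])
      also have "\<dots> = cos (pi * x $ i)" by (cases "x $ i \<ge> 0") auto
      finally show "cos (pi * \<eta>) \<le> cos (pi * x $ i)" .
      have "0 \<le> pi * \<eta>" "pi * \<eta> \<le> pi * (1/2)" using assms by (auto intro!: mult_left_mono)
      then show "0 \<le> cos (pi * \<eta>)" by (intro cos_ge_zero) (auto intro: order_trans[of _ 0])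
    qed simp
    finally show "(cos (pi * \<eta>))\<^sup>2 ^ CARD('n) \<le> cos_kernel x" .
  qed simp
  have "measure lborel ?B * ((cos (pi * \<eta>))\<^sup>2 ^ CARD('n)) ^ N = (LINT x|lborel. indicator ?B x * ((cos (pi * \<eta>))\<^sup>2 ^ CARD('n)) ^ N)"
    by simp
  also have "\<dots> \<le> (LINT x|lborel. indicator torus x * cos_kernel (x :: real ^ 'n) ^ N)"
  proof (rule integral_mono')
    show "integrable lborel (\<lambda>x. indicator torus x * cos_kernel (x :: real ^ 'n) ^ N)"
      by (rule integrable_torus_bounded[where B = 1]) (auto simp: cos_kernel_bounds abs_le_iff power_le_one intro: order_trans[of _ 0])
    show "indicator ?B x * ((cos (pi * \<eta>))\<^sup>2 ^ CARD('n)) ^ N \<le> indicator torus x * cos_kernel x ^ N" for x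
      using pt[of x] sub cos_kernel_bounds(1)[of x] by (auto simp: indicator_def)
    show "0 \<le> indicator torus x * cos_kernel x ^ N" for x :: "real ^ 'n" using cos_kernel_bounds(1)[of x] by simp
  qed
  finally show "measure lborel ?B * ((cos (pi * \<eta>))\<^sup>2 ^ CARD('n)) ^ N \<le> (LINT x|lborel. indicator torus x * cos_kernel (x :: real ^ 'n) ^ N)" .
qed

text \<open>Off a small cube the N-th power of the kernel is at most \<rho>^N, while its total mass
  is at least v \<sigma>^N with \<sigma> > \<rho>; after normalization the part off the cube dies
  out geometrically.\<close>

lemma cos_kernel_approx_identity:
  fixes h :: "real ^ 'n::finite \<Rightarrow> complex"
  assumes [measurable]: "h \<in> borel_measurable borel" and B: "\<And>x. x \<in> torus \<Longrightarrow> norm (h x) \<le> B" and cont: "isCont h 0"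
  shows "(\<lambda>N. (LINT x|lborel. indicator torus x * (h x * complex_of_real (cos_kernel x ^ N)))
           / complex_of_real (LINT x|lborel. indicator torus x * cos_kernel (x :: real ^ 'n) ^ N)) \<longlonglongrightarrow> h 0"
proof -
  define I where "I = (\<lambda>N. LINT x|lborel. indicator torus x * cos_kernel (x :: real ^ 'n) ^ N)"
  have z: "(0 :: real ^ 'n) \<in> torus" by (simp add: torus_def)
  have B0: "0 \<le> B" using B[OF z] norm_ge_zero order_trans by blast
  have Ipos: "I N > 0" for N
  proof -
    obtain v where v: "v > 0" "\<And>N. v * ((cos (pi * (1/4)))\<^sup>2 ^ CARD('n)) ^ N \<le> I N"
      using cos_kernel_integral_lower[of "1/4", where 'n = 'n] unfolding I_def by auto
    have "cos (pi * (1/4)) > 0" by (intro cos_gt_zero_pi) auto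
    then have "0 < v * ((cos (pi * (1/4)))\<^sup>2 ^ CARD('n)) ^ N" using v(1) by simp
    also note v(2)
    finally show ?thesis .
  qed
  have Qint: "integrable lborel (\<lambda>x. indicator torus x * cos_kernel (x :: real ^ 'n) ^ N)" for N
    by (rule integrable_torus_bounded[where B = 1]) (auto simp: cos_kernel_bounds abs_le_iff power_le_one intro: order_trans[of _ 0])
  have hint: "integrable lborel (\<lambda>x. indicator torus x * (g x * complex_of_real (cos_kernel x ^ N)))"
    if [measurable]: "g \<in> borel_measurable borel" and b: "\<And>x. x \<in> torus \<Longrightarrow> norm (g x) \<le> C" for g :: "real ^ 'n \<Rightarrow> complex" and C N
  proof (rule integrable_torus_bounded[where B = C])
    show "(\<lambda>x. g x * complex_of_real (cos_kernel x ^ N)) \<in> borel_measurable borel" by measurable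
    fix x :: "real ^ 'n" assume "x \<in> torus"
    then have "norm (g x) * (cos_kernel x ^ N) \<le> C * 1"
      using b[of x] cos_kernel_bounds(1)[of x] cos_kernel_bounds(3)[of x] by (intro mult_mono power_le_one) (auto intro: order_trans[OF norm_ge_zero])
    then show "norm (g x * complex_of_real (cos_kernel x ^ N)) \<le> C"
      using cos_kernel_bounds(1)[of x] by (simp add: norm_mult norm_power)
  qed
  have Ic: "complex_of_real (I N) = (LINT x|lborel. indicator torus x * complex_of_real (cos_kernel (x :: real ^ 'n) ^ N))" for N
    unfolding I_def integral_complex_of_real[symmetric] by (intro Bochner_Integration.integral_cong) (auto simp: indicator_def)
  show ?thesis
  proof (rule LIMSEQ_I)
    fix r :: real assume r: "r > 0"
    obtain \<delta> where \<delta>: "\<delta> > 0" "\<And>x. norm x < \<delta> \<Longrightarrow> norm (h x - h 0) < r / 2"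
      using cont r unfolding continuous_at_eps_delta by (metis dist_norm diff_zero half_gt_zero)
    define \<eta> where "\<eta> = min (1/4) (\<delta> / (2 * real CARD('n)))"
    have \<eta>: "0 < \<eta>" "\<eta> \<le> 1/4" "real CARD('n) * \<eta> \<le> \<delta> / 2"
      using \<delta>(1) by (auto simp: \<eta>_def min_def field_simps)
    \<comment> \<open>Since d \<eta> \<le> \<delta> / 2, the l^1 bound on the norm puts the cube
      inside the ball of radius \<delta>.\<close>
    define \<rho> where "\<rho> = (cos (pi * \<eta>))\<^sup>2"
    have c1: "0 < cos (pi * \<eta>)" using \<eta> by (intro cos_gt_zero_pi) (auto simp: field_simps intro: less_le_trans[of _ 0])
    have "cos (pi * \<eta>) < cos 0" using \<eta> by (intro cos_monotone_0_pi) (auto simp: field_simps)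
    then have \<rho>: "0 < \<rho>" "\<rho> < 1" using c1 by (auto simp: \<rho>_def power_less_one_iff abs_square_less_1)
    \<comment> \<open>At the same radius \<eta> the lower mass bound has ratio \<rho>^d, which need
      not exceed \<rho>. A second, smaller radius \<eta>' makes the ratio exceed \<rho>.\<close>
    have "((\<lambda>t. (cos (pi * t))\<^sup>2 ^ CARD('n)) \<longlongrightarrow> (cos (pi * 0))\<^sup>2 ^ CARD('n)) (at_right 0)"
      by (intro tendsto_intros)
    then have "\<forall>\<^sub>F t in at_right 0. \<rho> < (cos (pi * t))\<^sup>2 ^ CARD('n)"
      using \<rho>(2) by (intro order_tendstoD(1)) auto
    moreover have "\<forall>\<^sub>F t in at_right 0. 0 < t \<and> t < (1/2::real)"
      unfolding eventually_at_right_field by (intro exI[of _ "1/2"]) auto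
    ultimately obtain \<eta>' where \<eta>': "\<rho> < (cos (pi * \<eta>'))\<^sup>2 ^ CARD('n)" "0 < \<eta>'" "\<eta>' < 1/2"
      using eventually_happens'[OF trivial_limit_at_right_real eventually_conj] by (metis (no_types, lifting))
    define \<sigma> where "\<sigma> = (cos (pi * \<eta>'))\<^sup>2 ^ CARD('n)"
    obtain v where v: "v > 0" "\<And>N. v * \<sigma> ^ N \<le> I N"
      using cos_kernel_integral_lower[OF \<eta>'(2,3), where 'n = 'n] unfolding I_def \<sigma>_def by auto
    have \<sigma>: "\<sigma> > 0" using \<eta>'(1) \<rho> by (simp add: \<sigma>_def)
    define V where "V = measure lborel (torus :: (real ^ 'n) set)"
    have V0: "V \<ge> 0" by (simp add: V_def)
    have bound: "norm ((LINT x|lborel. indicator torus x * (h x * complex_of_real (cos_kernel x ^ N))) / complex_of_real (I N) - h 0)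
        \<le> r / 2 + 2 * B * V / v * (\<rho> / \<sigma>) ^ N" for N
    proof -
      have hb: "norm (h x - h 0) \<le> 2 * B" if "x \<in> torus" for x
        using norm_triangle_ineq4[of "h x" "h 0"] B[OF that] B[OF z] by linarith
      have "(LINT x|lborel. indicator torus x * (h x * complex_of_real (cos_kernel x ^ N))) - h 0 * complex_of_real (I N)
         = (LINT x|lborel. indicator torus x * (h x * complex_of_real (cos_kernel x ^ N)) - h 0 * (indicator torus x * complex_of_real (cos_kernel x ^ N)))"
      proof -
        have "integrable lborel (\<lambda>x. indicator torus x * complex_of_real (cos_kernel (x :: real ^ 'n) ^ N))"
          using hint[of "\<lambda>_. 1" 1 N] by simp
        then have i1: "integrable lborel (\<lambda>x. h 0 * (indicator torus x * complex_of_real (cos_kernel (x :: real ^ 'n) ^ N)))"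
          by (intro integrable_mult_right) simp
        have i2: "integrable lborel (\<lambda>x. indicator torus x * (h x * complex_of_real (cos_kernel x ^ N)))"
          by (rule hint[OF assms(1) B])
        show ?thesis unfolding Ic Bochner_Integration.integral_diff[OF i2 i1] integral_mult_right_zero ..
      qed
      also have "\<dots> = (LINT x|lborel. indicator torus x * ((h x - h 0) * complex_of_real (cos_kernel x ^ N)))"
        by (simp add: algebra_simps)
      finally have e: "(LINT x|lborel. indicator torus x * (h x * complex_of_real (cos_kernel x ^ N))) / complex_of_real (I N) - h 0
         = (LINT x|lborel. indicator torus x * ((h x - h 0) * complex_of_real (cos_kernel x ^ N))) / complex_of_real (I N)"
        using Ipos[of N] by (simp add: field_simps)
      have "norm (LINT x|lborel. indicator torus x * ((h x - h 0) * complex_of_real (cos_kernel x ^ N)))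
         \<le> (LINT x|lborel. norm (indicator torus x * ((h x - h 0) * complex_of_real (cos_kernel x ^ N))))"
        by (rule Bochner_Integration.integral_norm_bound)
      also have "\<dots> \<le> (LINT x|lborel. r / 2 * (indicator torus x * cos_kernel (x :: real ^ 'n) ^ N) + 2 * B * \<rho> ^ N * indicator torus x)"
      proof (rule integral_mono')
        show "integrable lborel (\<lambda>x. r / 2 * (indicator torus x * cos_kernel (x :: real ^ 'n) ^ N) + 2 * B * \<rho> ^ N * indicator torus x)"
          using emeasure_torus_finite[where 'n = 'n] by (intro Bochner_Integration.integrable_add integrable_mult_right Qint) auto
        fix x :: "real ^ 'n"
        show "0 \<le> r / 2 * (indicator torus x * cos_kernel x ^ N) + 2 * B * \<rho> ^ N * indicator torus x"
          using r B0 \<rho> cos_kernel_bounds(1)[of x] by (intro add_nonneg_nonneg mult_nonneg_nonneg) auto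
        show "norm (indicator torus x * ((h x - h 0) * complex_of_real (cos_kernel x ^ N))) \<le> r / 2 * (indicator torus x * cos_kernel x ^ N) + 2 * B * \<rho> ^ N * indicator torus x"
        proof (cases "x \<in> torus")
          case True
          have nn: "norm (indicator torus x * ((h x - h 0) * complex_of_real (cos_kernel x ^ N))) = norm (h x - h 0) * cos_kernel x ^ N"
            using True cos_kernel_bounds(1)[of x] by (simp add: norm_mult norm_power)
          show ?thesis
          proof (cases "\<forall>i. \<bar>x $ i\<bar> < \<eta>")
            case True
            have "norm x \<le> (\<Sum>i\<in>UNIV. \<bar>x $ i\<bar>)" by (rule norm_le_l1_cart)
            also have "\<dots> \<le> (\<Sum>i\<in>(UNIV::'n set). \<eta>)" using True by (intro sum_mono) (auto simp: less_imp_le)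
            also have "\<dots> < \<delta>" using \<eta>(3) \<delta>(1) by simp
            finally have "norm (h x - h 0) * cos_kernel x ^ N \<le> r / 2 * cos_kernel x ^ N"
              using \<delta>(2)[of x] cos_kernel_bounds(1)[of x] by (intro mult_right_mono) auto
            moreover have "0 \<le> 2 * B * \<rho> ^ N" using B0 \<rho> by simp
            ultimately show ?thesis unfolding nn using \<open>x \<in> torus\<close> by simp
          next
            case False
            then obtain i where i: "\<eta> \<le> \<bar>x $ i\<bar>" by (auto simp: not_less)
            have "- 1/2 < x $ i" "x $ i \<le> 1/2" using True unfolding torus_def by auto
            then have x2: "\<bar>x $ i\<bar> \<le> 1/2" by linarith
            have ca: "cos (pi * x $ i) = cos (pi * \<bar>x $ i\<bar>)" by (cases "x $ i \<ge> 0") auto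
            also have "\<dots> \<le> cos (pi * \<eta>)" using \<eta>(1) i x2
              by (intro cos_monotone_0_pi_le) (auto simp: field_simps)
            finally have "cos (pi * x $ i) \<le> cos (pi * \<eta>)" .
            moreover have "0 \<le> cos (pi * x $ i)"
            proof -
              have "pi * \<bar>x $ i\<bar> \<le> pi * (1/2)" using x2 by (intro mult_left_mono) auto
              then have "0 \<le> cos (pi * \<bar>x $ i\<bar>)" by (intro cos_ge_zero) (auto intro: order_trans[of _ 0])
              then show ?thesis using ca by simp
            qed
            ultimately have "cos_kernel x \<le> \<rho>" unfolding \<rho>_def using cos_kernel_bounds(2)[of x i] by (meson order_trans power_mono)
            then have "norm (h x - h 0) * cos_kernel x ^ N \<le> (2 * B) * \<rho> ^ N"
              using hb[OF True] cos_kernel_bounds(1)[of x] B0 by (intro mult_mono power_mono) auto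
            moreover have "0 \<le> r / 2 * cos_kernel x ^ N" using r cos_kernel_bounds(1)[of x] by simp
            ultimately show ?thesis unfolding nn using True by simp
          qed
        qed simp
      qed
      also have "\<dots> = r / 2 * I N + 2 * B * \<rho> ^ N * V"
        using emeasure_torus_finite[where 'n = 'n] unfolding I_def V_def
        by (subst Bochner_Integration.integral_add) (auto intro!: integrable_mult_right Qint)
      finally have "norm (LINT x|lborel. indicator torus x * ((h x - h 0) * complex_of_real (cos_kernel x ^ N))) / I N \<le> (r / 2 * I N + 2 * B * \<rho> ^ N * V) / I N"
        using Ipos[of N] by (intro divide_right_mono) auto
      also have "\<dots> = r / 2 + 2 * B * \<rho> ^ N * V / I N" using Ipos[of N] by (simp add: field_simps)
      also have "2 * B * \<rho> ^ N * V / I N \<le> 2 * B * \<rho> ^ N * V / (v * \<sigma> ^ N)"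
        using B0 V0 \<rho> v \<sigma> Ipos[of N] by (intro divide_left_mono) auto
      also have "\<dots> = 2 * B * V / v * (\<rho> / \<sigma>) ^ N" by (simp add: power_divide)
      finally show ?thesis unfolding e using Ipos[of N] by (simp add: norm_divide)
    qed
    have "(\<lambda>N. 2 * B * V / v * (\<rho> / \<sigma>) ^ N) \<longlonglongrightarrow> 2 * B * V / v * 0"
      using \<rho> \<sigma> \<eta>'(1) by (intro tendsto_mult_left LIMSEQ_realpow_zero) (auto simp: \<sigma>_def)
    then have "\<forall>\<^sub>F N in sequentially. 2 * B * V / v * (\<rho> / \<sigma>) ^ N < r / 2"
      using r by (intro order_tendstoD(2)) auto
    then obtain N0 where N0: "\<And>N. N \<ge> N0 \<Longrightarrow> 2 * B * V / v * (\<rho> / \<sigma>) ^ N < r / 2"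
      unfolding eventually_sequentially by blast
    show "\<exists>N0. \<forall>N\<ge>N0. norm ((LINT x|lborel. indicator torus x * (h x * complex_of_real (cos_kernel x ^ N)))
           / complex_of_real (LINT x|lborel. indicator torus x * cos_kernel (x :: real ^ 'n) ^ N) - h 0) < r"
    proof (intro exI[of _ N0] allI impI)
      fix N assume "N \<ge> N0"
      from N0[OF this] bound[of N] show "norm ((LINT x|lborel. indicator torus x * (h x * complex_of_real (cos_kernel x ^ N)))
           / complex_of_real (LINT x|lborel. indicator torus x * cos_kernel (x :: real ^ 'n) ^ N) - h 0) < r"
        unfolding I_def by linarith
    qed
  qed
qed

lemma integral_trig_poly_coeff:
  fixes c :: "real ^ 'n::finite \<Rightarrow> complex"
  assumes K: "finite K" "K \<subseteq> int_lattice" and j: "j \<in> int_lattice"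
  shows "(LINT x|lborel. indicator torus x * ((\<Sum>k\<in>K. c k * chr k x) * chr (- j) x)) = (if j \<in> K then c j else 0)"
proof -
  have kj: "k - j \<in> int_lattice" if "k \<in> K" for k using that K j int_lattice_diff by blast
  have "indicator torus x * ((\<Sum>k\<in>K. c k * chr k x) * chr (- j) x) = (\<Sum>k\<in>K. c k * (indicator torus x * chr (k - j) x))" for x
    by (simp add: sum_distrib_left sum_distrib_right chr_add_left[of _ "- j", simplified] mult_ac)
  then have "(LINT x|lborel. indicator torus x * ((\<Sum>k\<in>K. c k * chr k x) * chr (- j) x))
      = (LINT x|lborel. (\<Sum>k\<in>K. c k * (indicator torus x * chr (k - j) x)))" by simp
  also have "\<dots> = (\<Sum>k\<in>K. LINT x|lborel. c k * (indicator torus x * chr (k - j) x))"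
    by (rule Bochner_Integration.integral_sum) (intro integrable_mult_right integral_torus_chr(1) kj)
  also have "\<dots> = (\<Sum>k\<in>K. if k = j then c k else 0)"
    by (intro sum.cong refl) (simp add: integral_torus_chr(2)[OF kj])
  also have "\<dots> = (if j \<in> K then c j else 0)" using K(1) by simp
  finally show ?thesis .
qed

text \<open>\<open>f\<close> is integrated against the normalized kernel powers in two ways.
  Unfolding to the torus yields the lattice sum by the approximate identity. Expanding into
  characters yields the series of a_N(k) times the transform at k, where |a_N(k)| \<le> 1 and a_N(k)
  tends to 1, so that dominated convergence over the lattice applies.\<close>

theorem Poisson_summation:
  fixes f :: "real ^ 'n::finite \<Rightarrow> complex"
  assumes cont: "continuous_on UNIV f" and supp: "\<And>x. norm x \<ge> K \<Longrightarrow> f x = 0"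
    and summ: "integrable (count_space int_lattice) (\<lambda>k. LINT x|lborel. f x * chr k x)"
  shows "(\<Sum>m | m \<in> int_lattice \<and> norm m < K. f m) = (LINT k|count_space int_lattice. (LINT x|lborel. f x * chr k x))"
proof -
  let ?T = "\<lambda>x. indicator torus x :: complex"
  define I where "I = (\<lambda>N. LINT x|lborel. indicator torus x * cos_kernel (x :: real ^ 'n) ^ N)"
  define \<phi> where "\<phi> = (\<lambda>k :: real ^ 'n. LINT x|lborel. f x * chr k x)"
  define a where "a = (\<lambda>N (k :: real ^ 'n). (LINT x|lborel. ?T x * (chr (- k) x * complex_of_real (cos_kernel x ^ N))) / complex_of_real (I N))"
  define M where "M = {m :: real ^ 'n. m \<in> int_lattice \<and> norm m < K + real CARD('n)}"
  have finM: "finite M" unfolding M_def by (rule finite_int_lattice_ball)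
  have fm[measurable]: "f \<in> borel_measurable borel" using cont by (rule borel_measurable_continuous_onI)
  obtain B where B: "\<And>x. norm (f x) \<le> B" "B \<ge> 0"
  proof -
    have "compact (f ` cball 0 K)" by (rule compact_continuous_image[OF continuous_on_subset[OF cont]]) auto
    then obtain B where "\<forall>y\<in>f ` cball 0 K. norm y \<le> B" using compact_imp_bounded bounded_iff by metis
    then have "norm (f x) \<le> max B 0" for x
      using supp[of x] by (cases "norm x \<le> K") (auto simp: le_max_iff_disj)
    then show thesis using that[of "max B 0"] by simp
  qed
  have fint: "integrable lborel f"
  proof (rule integrableI_bounded_set[where A = "cball 0 K" and B = B])
    show "emeasure lborel (cball (0 :: real ^ 'n) K) < \<infinity>" by (rule emeasure_lborel_cball_finite)
  qed (use B supp in \<open>auto simp: not_le\<close>)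
  have cont0: "isCont (chr k) 0" for k :: "real ^ 'n"
    using continuous_on_chr[of UNIV "\<lambda>x. x" k] by (simp add: continuous_on_eq_continuous_at continuous_on_id)
  have a_lim: "(\<lambda>N. a N k) \<longlonglongrightarrow> 1" for k
    using cos_kernel_approx_identity[of "chr (- k)" 1] cont0 unfolding a_def I_def by simp
  have I0: "I N \<ge> 0" for N unfolding I_def by (rule integral_nonneg_AE) (auto simp: cos_kernel_bounds)
  have a_le: "norm (a N k) \<le> 1" for N k
  proof -
    have "norm (LINT x|lborel. ?T x * (chr (- k) x * complex_of_real (cos_kernel x ^ N))) \<le> (LINT x|lborel. norm (?T x * (chr (- k) x * complex_of_real (cos_kernel x ^ N))))"
      by (rule Bochner_Integration.integral_norm_bound)
    also have "\<dots> = I N" unfolding I_def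
      by (intro Bochner_Integration.integral_cong) (auto simp: norm_mult norm_power cos_kernel_bounds abs_of_nonneg indicator_def)
    finally show ?thesis using I0[of N] unfolding a_def
      by (cases "I N = 0") (auto simp: norm_divide divide_le_eq)
  qed
  have eq: "(LINT x|lborel. f x * complex_of_real (cos_kernel x ^ N)) / complex_of_real (I N) = (LINT k|count_space int_lattice. a N k * \<phi> k)" for N
  proof -
    have "(\<lambda>x. complex_of_real (cos_kernel (x :: real ^ 'n)) ^ N) \<in> trig_poly" by (rule trig_poly_power[OF cos_kernel_trig_poly])
    then obtain S c where S: "finite S" "S \<subseteq> int_lattice" "(\<lambda>x. complex_of_real (cos_kernel (x :: real ^ 'n)) ^ N) = (\<lambda>x. \<Sum>k\<in>S. c k * chr k x)"
      by (rule trig_poly_expand)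
    have Q: "complex_of_real (cos_kernel x ^ N) = (\<Sum>k\<in>S. c k * chr k x)" for x :: "real ^ 'n"
      using fun_cong[OF S(3), of x] by simp
    have ak: "a N k = (if k \<in> S then c k else 0) / complex_of_real (I N)" if "k \<in> int_lattice" for k
      unfolding a_def Q using integral_trig_poly_coeff[OF S(1,2) that, of c] by (simp add: mult.commute)
    have fc: "integrable lborel (\<lambda>x. f x * chr k x)" for k
      by (rule integrable_mult_bounded[OF fint, where B = 1]) auto
    have "(LINT x|lborel. f x * complex_of_real (cos_kernel x ^ N)) = (LINT x|lborel. (\<Sum>k\<in>S. c k * (f x * chr k x)))"
      unfolding Q by (simp add: sum_distrib_left mult_ac)
    also have "\<dots> = (\<Sum>k\<in>S. c k * \<phi> k)"
      unfolding \<phi>_def by (subst Bochner_Integration.integral_sum) (auto intro!: integrable_mult_right fc)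
    finally have "(LINT x|lborel. f x * complex_of_real (cos_kernel x ^ N)) / complex_of_real (I N) = (\<Sum>k\<in>S. a N k * \<phi> k)"
      using S(2) by (simp add: sum_divide_distrib ak subset_iff)
    also have "\<dots> = (LINT k|count_space int_lattice. a N k * \<phi> k)"
    proof (rule lebesgue_integral_count_space_finite_support[THEN trans, symmetric])
      have sub: "{k \<in> int_lattice. a N k * \<phi> k \<noteq> 0} \<subseteq> S" by (auto simp: ak split: if_splits)
      then show "finite {k \<in> int_lattice. a N k * \<phi> k \<noteq> 0}" using S(1) finite_subset by blast
      show "(\<Sum>k | k \<in> int_lattice \<and> a N k * \<phi> k \<noteq> 0. a N k * \<phi> k) = (\<Sum>k\<in>S. a N k * \<phi> k)"
        using S sub by (intro sum.mono_neutral_left) auto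
    qed
    finally show ?thesis .
  qed
  have "(\<lambda>N. LINT k|count_space int_lattice. a N k * \<phi> k) \<longlonglongrightarrow> (LINT k|count_space int_lattice. \<phi> k)"
  proof (rule integral_dominated_convergence[where w = "\<lambda>k. norm (\<phi> k)"])
    show "integrable (count_space int_lattice) (\<lambda>k. norm (\<phi> k))" using summ unfolding \<phi>_def by (rule integrable_norm)
    show "AE k in count_space int_lattice. (\<lambda>N. a N k * \<phi> k) \<longlonglongrightarrow> \<phi> k"
      using tendsto_mult_right[OF a_lim] by (intro AE_I2) fastforce
    show "AE k in count_space int_lattice. norm (a N k * \<phi> k) \<le> norm (\<phi> k)" for N
      using a_le by (intro AE_I2) (simp add: norm_mult mult_left_le_one_le)
  qed auto
  moreover have "(\<lambda>N. (LINT x|lborel. f x * complex_of_real (cos_kernel x ^ N)) / complex_of_real (I N)) \<longlonglongrightarrow> (\<Sum>m\<in>M. f (0 + m))"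
  proof -
    have "(LINT x|lborel. f x * complex_of_real (cos_kernel x ^ N)) = (LINT x|lborel. indicator torus x * ((\<Sum>m\<in>M. f (x + m)) * complex_of_real (cos_kernel x ^ N)))" for N
      unfolding M_def
    proof (rule integral_unfold_torus[OF fint supp, where B = 1])
      show "norm (complex_of_real (cos_kernel x ^ N)) \<le> 1" for x :: "real ^ 'n"
        using cos_kernel_bounds(1)[of x] cos_kernel_bounds(3)[of x] by (simp add: norm_power power_le_one)
    qed (auto simp: cos_kernel_add_lattice)
    moreover have "(\<lambda>N. (LINT x|lborel. indicator torus x * ((\<Sum>m\<in>M. f (x + m)) * complex_of_real (cos_kernel x ^ N))) / complex_of_real (I N)) \<longlonglongrightarrow> (\<Sum>m\<in>M. f (0 + m))"
      unfolding I_def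
    proof (rule cos_kernel_approx_identity[where B = "real (card M) * B"])
      show "norm (\<Sum>m\<in>M. f (x + m)) \<le> real (card M) * B" for x by (rule sum_norm_bound) (rule B)
      have c: "continuous_on UNIV (\<lambda>x. \<Sum>m\<in>M. f (x + m))"
        by (intro continuous_on_sum continuous_on_compose2[OF cont]) (auto intro!: continuous_intros)
      then show "isCont (\<lambda>x. \<Sum>m\<in>M. f (x + m)) 0" by (simp add: continuous_on_eq_continuous_at)
    qed measurable
    ultimately show ?thesis by simp
  qed
  ultimately have "(\<Sum>m\<in>M. f (0 + m)) = (LINT k|count_space int_lattice. \<phi> k)"
    unfolding eq by (rule LIMSEQ_unique[rotated])
  moreover have "(\<Sum>m\<in>M. f (0 + m)) = (\<Sum>m | m \<in> int_lattice \<and> norm m < K. f m)"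
    using finM supp by (intro sum.mono_neutral_cong_right) (auto simp: M_def not_less)
  ultimately show ?thesis unfolding \<phi>_def by simp
qed

section \<open>Riesz kernels on the torus\<close>

text \<open>In product form, summability over the lattice reduces to the one-dimensional inverse
  squares. Along the diagonal the weight behaves like |n|^(-2 d), so it dominates |n|^(-q) for q
  \<ge> 2 d; this is the source of the condition J \<ge> 2 d.\<close>

definition lattice_weight :: "real ^ 'n::finite \<Rightarrow> real" where
  "lattice_weight n = (\<Prod>i\<in>UNIV. 1 / (max 1 \<bar>n $ i\<bar>)\<^sup>2)"

lemma lattice_weight_nonneg [simp]: "0 \<le> lattice_weight n"
  by (simp add: lattice_weight_def prod_nonneg)

lemma abs_summable_int_inverse_square: "Infinite_Set_Sum.abs_summable_on ((\<lambda>k::int. 1 / (max 1 \<bar>real_of_int k\<bar>)\<^sup>2)) (UNIV)"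
proof -
  have s: "summable (\<lambda>n::nat. 1 / (max 1 (real n))\<^sup>2)"
  proof (rule summable_comparison_test'[where N = 1])
    show "summable (\<lambda>n::nat. 1 / (real n)\<^sup>2)" using inverse_power_summable[of 2, where 'a = real] by (simp add: field_simps)
  qed auto
  have n: "Infinite_Set_Sum.abs_summable_on ((\<lambda>n::nat. 1 / (max 1 (real n))\<^sup>2)) (UNIV)"
    unfolding Infinite_Set_Sum.abs_summable_on_nat_iff' using s by simp
  have 1: "Infinite_Set_Sum.abs_summable_on ((\<lambda>k::int. 1 / (max 1 \<bar>real_of_int k\<bar>)\<^sup>2)) (range int)"
    by (subst Infinite_Set_Sum.abs_summable_on_reindex_iff[of int UNIV, symmetric]) (use n in auto)
  have 2: "Infinite_Set_Sum.abs_summable_on ((\<lambda>k::int. 1 / (max 1 \<bar>real_of_int k\<bar>)\<^sup>2)) (range (\<lambda>n. - int n))"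
    by (subst Infinite_Set_Sum.abs_summable_on_reindex_iff[of "\<lambda>n. - int n" UNIV, symmetric]) (use n in \<open>auto simp: inj_on_def\<close>)
  have "(UNIV :: int set) = range int \<union> range (\<lambda>n. - int n)"
    by (auto simp: image_iff) (metis int_cases2)
  then show ?thesis using Infinite_Set_Sum.abs_summable_on_union[OF 1 2] by simp
qed

lemma integrable_lattice_weight: "integrable (count_space (int_lattice :: (real ^ 'n::finite) set)) lattice_weight"
proof -
  have "Infinite_Set_Sum.abs_summable_on ((\<lambda>g. \<Prod>i\<in>(UNIV::'n set). 1 / (max 1 \<bar>real_of_int (g i)\<bar>)\<^sup>2)) (PiE UNIV (\<lambda>_. UNIV :: int set))"
    by (rule Infinite_Set_Sum.abs_summable_on_prod_PiE) (auto intro: abs_summable_int_inverse_square)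
  then have "Infinite_Set_Sum.abs_summable_on ((\<lambda>g. lattice_weight (\<chi> i::'n. real_of_int (g i)))) (UNIV)"
    by (simp add: lattice_weight_def)
  moreover have "bij_betw (\<lambda>g. \<chi> i::'n. real_of_int (g i)) UNIV int_lattice"
  proof (rule bij_betwI')
    fix y :: "real ^ 'n" assume "y \<in> int_lattice"
    then have "\<forall>i. \<exists>j::int. y $ i = of_int j" by (auto simp: int_lattice_def Ints_def)
    then obtain j where "\<And>i. y $ i = of_int (j i)" by metis
    then show "\<exists>g\<in>UNIV. y = (\<chi> i. real_of_int (g i))" by (auto simp: vec_eq_iff)
  qed (auto simp: int_lattice_def vec_eq_iff fun_eq_iff)
  ultimately have "Infinite_Set_Sum.abs_summable_on (lattice_weight) ((int_lattice :: (real ^ 'n) set))"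
    by (subst (asm) Infinite_Set_Sum.abs_summable_on_reindex_bij_betw)
  then show ?thesis by (simp add: Infinite_Set_Sum.abs_summable_on_def)
qed

text \<open>If n_i is not 0, then |x_i| \<le> 1/2 gives |x_i + n_i| \<ge> |n_i| / 2. Hence 2 |x + n|
  dominates max(1, |n_i|) for every i, and the product of the squares of these maxima is at most (2
  |x + n|)^(2 d).\<close>

lemma norm_lattice_shift:
  assumes n: "n \<in> int_lattice" "n \<noteq> 0" and x: "x \<in> torus" and q: "q \<ge> 2 * real CARD('n)"
  shows "norm (x + n :: real ^ 'n::finite) \<ge> 1/2" "norm (x + n) powr - q \<le> 2 powr q * lattice_weight n"
proof -
  let ?t = "2 * norm (x + n)"
  have comp: "max 1 \<bar>n $ i\<bar> \<le> ?t" if "n $ i \<noteq> 0" for i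
  proof -
    obtain j where j: "n $ i = real_of_int j" using n(1) by (auto simp: int_lattice_def Ints_def)
    with that have "\<bar>n $ i\<bar> \<ge> 1" by simp
    moreover have "- 1/2 < x $ i" "x $ i \<le> 1/2" using x by (auto simp: torus_def)
    ultimately have "\<bar>n $ i\<bar> \<le> 2 * \<bar>(x + n) $ i\<bar>" by (simp add: abs_if split: if_splits)
    then show ?thesis using component_le_norm_cart[of "x + n" i] \<open>\<bar>n $ i\<bar> \<ge> 1\<close> by linarith
  qed
  obtain i0 where "n $ i0 \<noteq> 0" using n(2) by (auto simp: vec_eq_iff)
  from comp[OF this] have t1: "1 \<le> ?t" by simp
  then show "norm (x + n) \<ge> 1/2" by simp
  have all: "max 1 \<bar>n $ i\<bar> \<le> ?t" for i using comp[of i] t1 by (cases "n $ i = 0") auto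
  have "(\<Prod>i\<in>UNIV. (max 1 \<bar>n $ i\<bar>)\<^sup>2) \<le> (\<Prod>i\<in>(UNIV::'n set). ?t\<^sup>2)"
    by (intro prod_mono conjI power_mono all) auto
  also have "\<dots> = ?t powr (2 * real CARD('n))"
  proof -
    have "(?t\<^sup>2) ^ CARD('n) = ?t ^ (2 * CARD('n))" by (simp only: power_mult)
    also have "\<dots> = ?t powr real (2 * CARD('n))" using t1 by (intro powr_realpow[symmetric]) linarith
    finally show ?thesis by simp
  qed
  also have "\<dots> \<le> ?t powr q" using t1 q by (intro powr_mono) auto
  finally have le: "(\<Prod>i\<in>UNIV. (max 1 \<bar>n $ i\<bar>)\<^sup>2) \<le> ?t powr q" .
  have "?t powr - q = 1 / ?t powr q" by (simp add: powr_minus_divide)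
  also have "\<dots> \<le> 1 / (\<Prod>i\<in>UNIV. (max 1 \<bar>n $ i\<bar>)\<^sup>2)"
    using le by (intro divide_left_mono mult_pos_pos prod_pos) (use t1 in auto)
  also have "\<dots> = lattice_weight n" by (simp add: lattice_weight_def prod_dividef)
  finally have "?t powr - q \<le> lattice_weight n" .
  moreover have "norm (x + n) powr - q = 2 powr q * ?t powr - q"
    by (simp add: powr_mult powr_add[symmetric])
  ultimately show "norm (x + n) powr - q \<le> 2 powr q * lattice_weight n" by simp
qed

text \<open>The decay of \<open>bess\<close> of order parameter \<mu> contributes
  \<Lambda>^(-\<mu>-1), which leaves \<Lambda>^\<mu> out of \<Lambda>^(2 J + d). Uniformity in x
  matters: x = 0 serves the discrepancy, general x the Riesz kernels as an approximate
  identity.\<close>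

lemma U_hat_shift_bound:
  assumes J: "real J \<ge> 2 * real CARD('n)"
  defines "\<mu> \<equiv> real J + (real CARD('n) - 1) / 2"
  obtains C where "C \<ge> 0"
    "\<And>\<Lambda> x n. \<Lambda> > 0 \<Longrightarrow> x \<in> torus \<Longrightarrow> n \<in> int_lattice \<Longrightarrow> n \<noteq> 0 \<Longrightarrow>
       \<bar>U_hat CARD('n) (real J) \<Lambda> (norm (x + n :: real ^ 'n::finite))\<bar> \<le> C * \<Lambda> powr \<mu> * lattice_weight n"
proof -
  have \<mu>: "\<mu> > -1" unfolding \<mu>_def by (rule CARD_shift_gt) simp
  have q: "\<mu> + 1 \<ge> 2 * real CARD('n)" using J real_CARD_ge_1[where 'n = 'n] unfolding \<mu>_def by (simp add: field_simps)
  obtain C where C: "C \<ge> 0" "\<And>z. z > 0 \<Longrightarrow> \<bar>bess \<mu> z\<bar> \<le> C * z powr (- \<mu> - 1)" using bess_decay[OF \<mu>] by metis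
  define A where "A = pi powr ((real CARD('n) - 1) / 2) * Gamma (real J + 1)"
  have A: "A > 0" unfolding A_def by (intro mult_pos_pos Gamma_real_pos) auto
  define D where "D = A * C * (2 * pi) powr (- \<mu> - 1) * 2 powr (\<mu> + 1)"
  show thesis
  proof (rule that[of D])
    show "D \<ge> 0" using A C by (simp add: D_def)
    fix \<Lambda> :: real and x n :: "real ^ 'n"
    assume \<Lambda>: "\<Lambda> > 0" and x: "x \<in> torus" and n: "n \<in> int_lattice" "n \<noteq> 0"
    let ?r = "norm (x + n)"
    have r: "?r > 0" using norm_lattice_shift(1)[OF n x q] by linarith
    have "\<bar>U_hat CARD('n) (real J) \<Lambda> ?r\<bar> = A * \<Lambda> powr (2 * real J + real CARD('n)) * \<bar>bess \<mu> (2 * pi * \<Lambda> * ?r)\<bar>"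
      using A by (simp add: U_hat_def A_def \<mu>_def abs_mult)
    also have "\<dots> \<le> A * \<Lambda> powr (2 * real J + real CARD('n)) * (C * (2 * pi * \<Lambda> * ?r) powr (- \<mu> - 1))"
      using A \<Lambda> r by (intro mult_left_mono C) auto
    also have "\<dots> = A * C * (2 * pi) powr (- \<mu> - 1) * (\<Lambda> powr (2 * real J + real CARD('n)) * \<Lambda> powr (- \<mu> - 1)) * ?r powr - (\<mu> + 1)"
      using \<Lambda> r by (simp add: powr_mult mult_ac)
    also have "\<Lambda> powr (2 * real J + real CARD('n)) * \<Lambda> powr (- \<mu> - 1) = \<Lambda> powr \<mu>"
      unfolding powr_add[symmetric] by (rule arg_cong[where f = "\<lambda>e. \<Lambda> powr e"]) (simp add: \<mu>_def field_simps)
    also have "A * C * (2 * pi) powr (- \<mu> - 1) * \<Lambda> powr \<mu> * ?r powr - (\<mu> + 1) \<le> A * C * (2 * pi) powr (- \<mu> - 1) * \<Lambda> powr \<mu> * (2 powr (\<mu> + 1) * lattice_weight n)"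
      using A C by (intro mult_left_mono norm_lattice_shift(2)[OF n x q]) auto
    finally show "\<bar>U_hat CARD('n) (real J) \<Lambda> ?r\<bar> \<le> D * \<Lambda> powr \<mu> * lattice_weight n" by (simp add: D_def mult_ac)
  qed
qed

text \<open>The bound on the shifted transform excludes the index 0; a finite exceptional set does
  no harm to summability.\<close>

lemma integrable_count_space_Diff_finite:
  fixes f :: "'a \<Rightarrow> 'b::{banach, second_countable_topology}"
  assumes "integrable (count_space (A - F)) f" "finite F"
  shows "integrable (count_space A) f"
proof -
  have "Infinite_Set_Sum.abs_summable_on (f) ((A - F))" "Infinite_Set_Sum.abs_summable_on (f) (F)"
    using assms by (auto simp: Infinite_Set_Sum.abs_summable_on_def intro: integrable_count_space)
  then have "Infinite_Set_Sum.abs_summable_on (f) (((A - F) \<union> F))" by (rule Infinite_Set_Sum.abs_summable_on_union)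
  then have "Infinite_Set_Sum.abs_summable_on (f) (A)" by (rule Infinite_Set_Sum.abs_summable_on_subset) auto
  then show ?thesis by (simp add: Infinite_Set_Sum.abs_summable_on_def)
qed

lemma integrable_U_hat_shift:
  assumes J: "real J \<ge> 2 * real CARD('n)" and \<Lambda>: "\<Lambda> > 0" and x: "x \<in> torus"
  shows "integrable (count_space int_lattice) (\<lambda>k. U_hat CARD('n) (real J) \<Lambda> (norm (x + k :: real ^ 'n::finite)))"
proof -
  obtain C where C: "C \<ge> 0"
    "\<And>\<Lambda> x n. \<Lambda> > 0 \<Longrightarrow> x \<in> torus \<Longrightarrow> n \<in> int_lattice \<Longrightarrow> n \<noteq> 0 \<Longrightarrow>
       \<bar>U_hat CARD('n) (real J) \<Lambda> (norm (x + n :: real ^ 'n))\<bar> \<le> C * \<Lambda> powr (real J + (real CARD('n) - 1) / 2) * lattice_weight n"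
    using U_hat_shift_bound[OF J] by metis
  have "Infinite_Set_Sum.abs_summable_on ((lattice_weight :: real ^ 'n \<Rightarrow> real)) (int_lattice)" using integrable_lattice_weight by (simp add: Infinite_Set_Sum.abs_summable_on_def)
  then have "Infinite_Set_Sum.abs_summable_on ((lattice_weight :: real ^ 'n \<Rightarrow> real)) ((int_lattice - {0}))" by (rule Infinite_Set_Sum.abs_summable_on_subset) auto
  then have "integrable (count_space (int_lattice - {0})) (\<lambda>k :: real ^ 'n. C * \<Lambda> powr (real J + (real CARD('n) - 1) / 2) * lattice_weight k)"
    by (intro integrable_mult_right) (simp add: Infinite_Set_Sum.abs_summable_on_def)
  then have "integrable (count_space (int_lattice - {0})) (\<lambda>k. U_hat CARD('n) (real J) \<Lambda> (norm (x + k :: real ^ 'n)))"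
    by (rule Bochner_Integration.integrable_bound) (use C(2)[OF \<Lambda> x] C(1) in \<open>auto intro!: AE_I2 simp: abs_mult\<close>)
  then show ?thesis by (rule integrable_count_space_Diff_finite) simp
qed

text \<open>The Riesz weight is itself a truncated power, with exponent J and radius \<Lambda>, so
  its transform is \<open>U_hat\<close> with these parameters; multiplication by a character
  translates the dual variable by x. The dual series converges absolutely because J \<ge> 2
  d.\<close>

lemma Riesz_kernel:
  fixes x :: "real ^ 'n::finite"
  assumes J: "real J \<ge> 2 * real CARD('n)" and \<Lambda>: "\<Lambda> > 0" and x: "x \<in> torus"
  shows "(\<Sum>m | m \<in> int_lattice \<and> norm m < \<Lambda>. complex_of_real ((\<Lambda>\<^sup>2 - (norm m)\<^sup>2) ^ J) * chr x m)
     = complex_of_real (LINT k|count_space int_lattice. U_hat CARD('n) (real J) \<Lambda> (norm (x + k)))"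
proof -
  have J0: "J > 0" using J real_CARD_ge_1[where 'n = 'n] by linarith
  have J1: "real J > -1" by simp
  let ?f = "\<lambda>\<xi>. complex_of_real (U_fun (real J) \<Lambda> \<xi>) * chr x \<xi>"
  have U: "U_fun (real J) \<Lambda> \<xi> = (if norm \<xi> < \<Lambda> then (\<Lambda>\<^sup>2 - (norm \<xi>)\<^sup>2) ^ J else 0)" for \<xi> :: "real ^ 'n"
  proof (cases "norm \<xi> < \<Lambda>")
    case True
    then have "(norm \<xi>)\<^sup>2 < \<Lambda>\<^sup>2" by (intro power_strict_mono) auto
    then show ?thesis using True by (simp add: U_fun_def powr_realpow)
  qed (simp add: U_fun_def)
  \<comment> \<open>The form with \<open>max\<close> exhibits continuity across the sphere of radius
    \<Lambda>.\<close>
  have U': "U_fun (real J) \<Lambda> \<xi> = (max 0 (\<Lambda>\<^sup>2 - (norm \<xi>)\<^sup>2)) ^ J" for \<xi> :: "real ^ 'n"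
  proof (cases "norm \<xi> < \<Lambda>")
    case True
    then have "(norm \<xi>)\<^sup>2 < \<Lambda>\<^sup>2" by (intro power_strict_mono) auto
    then show ?thesis using True unfolding U by simp
  next
    case False
    then have "\<Lambda>\<^sup>2 \<le> (norm \<xi>)\<^sup>2" using \<Lambda> by (intro power_mono) auto
    then show ?thesis using False J0 unfolding U by simp
  qed
  have hat: "(LINT \<xi>|lborel. ?f \<xi> * chr k \<xi>) = complex_of_real (U_hat CARD('n) (real J) \<Lambda> (norm (x + k)))" for k
  proof -
    have "?f \<xi> * chr k \<xi> = complex_of_real (U_fun (real J) \<Lambda> \<xi>) * cis (- (2 * pi * (- (x + k) \<bullet> \<xi>)))" for \<xi>
      by (simp add: chr_def cis_mult inner_add_left inner_diff_left algebra_simps)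
    then show ?thesis using integral_U_fun_cis[OF J1 \<Lambda>, of "- (x + k)"] unfolding norm_minus_cancel by (simp only:)
  qed
  have "(\<Sum>m | m \<in> int_lattice \<and> norm m < \<Lambda>. ?f m) = (LINT k|count_space int_lattice. (LINT \<xi>|lborel. ?f \<xi> * chr k \<xi>))"
  proof (rule Poisson_summation)
    show "continuous_on UNIV ?f" unfolding U' by (intro continuous_intros)
    show "?f \<xi> = 0" if "\<Lambda> \<le> norm \<xi>" for \<xi> using that by (simp add: U)
    show "integrable (count_space int_lattice) (\<lambda>k. LINT \<xi>|lborel. ?f \<xi> * chr k \<xi>)"
      unfolding hat using integrable_U_hat_shift[OF J \<Lambda> x] by simp
  qed
  also have "\<dots> = complex_of_real (LINT k|count_space int_lattice. U_hat CARD('n) (real J) \<Lambda> (norm (x + k)))"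
    unfolding hat by (rule integral_complex_of_real)
  finally show ?thesis by (simp only: U) simp
qed

lemma integral_count_space_split_0:
  fixes f :: "'a::zero \<Rightarrow> real"
  assumes "integrable (count_space A) f" "0 \<in> A"
  shows "integrable (count_space (A - {0})) f" "(LINT k|count_space A. f k) = f 0 + (LINT k|count_space (A - {0}). f k)"
proof -
  have "Infinite_Set_Sum.abs_summable_on (f) (A)" using assms by (simp add: Infinite_Set_Sum.abs_summable_on_def)
  then have s: "Infinite_Set_Sum.abs_summable_on (f) ((A - {0}))" by (rule Infinite_Set_Sum.abs_summable_on_subset) auto
  then show "integrable (count_space (A - {0})) f" by (simp add: Infinite_Set_Sum.abs_summable_on_def)
  have "infsetsum f ({0} \<union> (A - {0})) = infsetsum f {0} + infsetsum f (A - {0})"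
    by (rule infsetsum_Un_disjoint) (use s in auto)
  moreover have "{0} \<union> (A - {0}) = A" using assms by auto
  ultimately show "(LINT k|count_space A. f k) = f 0 + (LINT k|count_space (A - {0}). f k)"
    by (simp add: infsetsum_def lebesgue_integral_count_space_finite)
qed

section \<open>Lattice point discrepancies\<close>

primrec fdiff :: "nat \<Rightarrow> real \<Rightarrow> (real \<Rightarrow> real) \<Rightarrow> real \<Rightarrow> real" where
  "fdiff 0 h f s = f s"
| "fdiff (Suc k) h f s = fdiff k h f (s + h) - fdiff k h f s"

lemma fdiff_diff: "fdiff k h (\<lambda>x. f x - g x) s = fdiff k h f s - fdiff k h g s"
  by (induction k arbitrary: s) auto

lemma fdiff_shift: "fdiff k h (\<lambda>x. f (x + h)) s = fdiff k h f (s + h)"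
  by (induction k arbitrary: s) auto

lemma fdiff_Suc': "fdiff (Suc k) h f s = fdiff k h (\<lambda>x. f (x + h) - f x) s"
  by (simp add: fdiff_diff fdiff_shift)

lemma fdiff_bound:
  assumes "h \<ge> 0" "\<And>x. s \<le> x \<Longrightarrow> x \<le> s + real k * h \<Longrightarrow> \<bar>f x\<bar> \<le> M"
  shows "\<bar>fdiff k h f s\<bar> \<le> 2 ^ k * M"
  using assms(2)
proof (induction k arbitrary: s)
  case (Suc k)
  have "\<bar>fdiff k h f (s + h)\<bar> \<le> 2 ^ k * M"
    using assms(1) by (intro Suc.IH Suc.prems) (auto simp: algebra_simps)
  moreover have "\<bar>fdiff k h f s\<bar> \<le> 2 ^ k * M"
    using assms(1) by (intro Suc.IH Suc.prems) (auto simp: algebra_simps)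
  ultimately show ?case by simp
qed simp

text \<open>Since \<open>f k\<close> is a k-fold antiderivative of \<open>f 0\<close>, this is an
  iterated mean value theorem. The induction hypothesis is applied to the chain of first
  differences, and a final mean value theorem leaves a single intermediate point.\<close>

lemma fdiff_mvt:
  assumes "s > 0" "h > 0" "\<And>i x. i < k \<Longrightarrow> x > 0 \<Longrightarrow> (f (Suc i) has_real_derivative f i x) (at x)"
  shows "\<exists>\<zeta>. s \<le> \<zeta> \<and> \<zeta> \<le> s + real k * h \<and> fdiff k h (f k) s = h ^ k * f 0 \<zeta>"
  using assms(3)
proof (induction k arbitrary: f)
  case 0
  show ?case by (intro exI[of _ s]) simp
next
  case (Suc k)
  have "\<exists>\<zeta>. s \<le> \<zeta> \<and> \<zeta> \<le> s + real k * h \<and> fdiff k h ((\<lambda>i x. f (Suc i) (x + h) - f (Suc i) x) k) s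
      = h ^ k * (\<lambda>i x. f (Suc i) (x + h) - f (Suc i) x) 0 \<zeta>"
  proof (rule Suc.IH)
    fix i x assume "i < k" "(0::real) < x"
    then show "((\<lambda>x. f (Suc (Suc i)) (x + h) - f (Suc (Suc i)) x) has_real_derivative f (Suc i) (x + h) - f (Suc i) x) (at x)"
      using assms(2) by (intro DERIV_diff iffD1[OF DERIV_shift] Suc.prems) auto
  qed
  then obtain \<zeta> where \<zeta>: "s \<le> \<zeta>" "\<zeta> \<le> s + real k * h" "fdiff (Suc k) h (f (Suc k)) s = h ^ k * (f 1 (\<zeta> + h) - f 1 \<zeta>)"
    unfolding fdiff_Suc' by auto
  have "\<exists>z. \<zeta> < z \<and> z < \<zeta> + h \<and> f 1 (\<zeta> + h) - f 1 \<zeta> = (\<zeta> + h - \<zeta>) * f 0 z"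
    using assms \<zeta>(1) Suc.prems[of 0] by (intro MVT2) auto
  then obtain z where "\<zeta> < z" "z < \<zeta> + h" "f 1 (\<zeta> + h) - f 1 \<zeta> = h * f 0 z" by auto
  then show ?case using \<zeta> assms(2) by (intro exI[of _ z]) (auto simp: algebra_simps)
qed

text \<open>Two-sided differentiability at 0 requires exponent at least 2. This is why
  differentiation of the lattice sums stops at order 1 and the passage from order 1 to order 0 has
  to use monotonicity.\<close>

lemma DERIV_pos_part_power: "((\<lambda>x. max 0 x ^ Suc (Suc i)) has_real_derivative real (Suc (Suc i)) * max 0 x ^ Suc i) (at (x::real))"
proof -
  consider "x > 0" | "x < 0" | "x = 0" by linarith
  then show ?thesis
  proof cases
    case 1
    have "((\<lambda>x. x ^ Suc (Suc i)) has_real_derivative real (Suc (Suc i)) * x ^ Suc i) (at x)"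
      using DERIV_pow[of "Suc (Suc i)" x] by simp
    then have "((\<lambda>x. max 0 x ^ Suc (Suc i)) has_real_derivative real (Suc (Suc i)) * x ^ Suc i) (at x)"
      by (rule has_field_derivative_transform_within_open[of _ _ _ "{0<..}"]) (use 1 in auto)
    then show ?thesis using 1 by simp
  next
    case 2
    have "((\<lambda>x. max 0 x ^ Suc (Suc i)) has_real_derivative 0) (at x)"
      by (rule has_field_derivative_transform_within_open[of "\<lambda>_. 0" _ _ "{..<0}"]) (use 2 in auto)
    then show ?thesis using 2 by simp
  next
    case 3
    have "(\<lambda>h. (max 0 (0 + h) ^ Suc (Suc i) - max 0 0 ^ Suc (Suc i)) / h) \<midarrow>0\<rightarrow> (0::real)"
    proof (rule Lim_null_comparison)
      show "\<forall>\<^sub>F h in at 0. norm ((max 0 (0 + h) ^ Suc (Suc i) - max 0 0 ^ Suc (Suc i)) / h) \<le> \<bar>h\<bar> ^ Suc i"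
      proof (intro always_eventually allI)
        fix h :: real
        show "norm ((max 0 (0 + h) ^ Suc (Suc i) - max 0 0 ^ Suc (Suc i)) / h) \<le> \<bar>h\<bar> ^ Suc i"
        proof (cases "h \<ge> 0")
          case False
          then have "max 0 (0 + h) = 0" by simp
          then show ?thesis by (simp del: power_Suc add: power_0_Suc)
        qed (auto simp: max_def)
      qed
      show "((\<lambda>h. \<bar>h\<bar> ^ Suc i) \<longlongrightarrow> (0::real)) (at 0)" by (rule tendsto_eq_intros | simp)+
    qed
    then show ?thesis using 3 by (simp add: DERIV_def)
  qed
qed

text \<open>Here \<open>s\<close> is the square of the radius, and the factor \<open>1 / j!\<close> makes differentiation in \<open>s\<close> lower
  the order \<open>j\<close> by one.\<close>

definition lattice_Riesz :: "'n::finite itself \<Rightarrow> nat \<Rightarrow> real \<Rightarrow> real" where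
  "lattice_Riesz T j s = (\<Sum>m | (m :: real ^ 'n) \<in> int_lattice \<and> (norm m)\<^sup>2 < s. (s - (norm m)\<^sup>2) ^ j / fact j)"

text \<open>The closed form of 1 / j! times the integral of (s - |x|^2)^j over the ball |x|^2 <
  s.\<close>

definition volume_Riesz :: "nat \<Rightarrow> nat \<Rightarrow> real \<Rightarrow> real" where
  "volume_Riesz d j s = pi powr (real d / 2) * s powr (real d / 2 + real j) / Gamma (real d / 2 + real j + 1)"

lemma norm_sq_less_iff: "s > 0 \<Longrightarrow> (norm m)\<^sup>2 < s \<longleftrightarrow> norm m < sqrt s"
  by (metis norm_ge_zero real_sqrt_less_iff real_sqrt_pow2 real_sqrt_unique real_less_rsqrt real_sqrt_power real_sqrt_ge_zero abs_norm_cancel real_sqrt_abs)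

lemma finite_lattice_sq: "finite {m :: real ^ 'n::finite. m \<in> int_lattice \<and> (norm m)\<^sup>2 < s}"
proof (cases "s > 0")
  case True
  then show ?thesis using finite_int_lattice_ball[of "sqrt s"] by (simp add: norm_sq_less_iff)
next
  case False
  then have "\<not> (norm m)\<^sup>2 < s" for m :: "real ^ 'n" using zero_le_power2[of "norm m"] by linarith
  then show ?thesis by simp
qed

text \<open>With positive parts one finite index set serves all s \<le> S, so the sum can be
  differentiated term by term although the ball grows with s. For j = 0 the extra points would
  contribute 1 each instead of 0.\<close>

lemma lattice_Riesz_pos_part:
  assumes "s \<le> S" "j \<ge> 1"
  shows "lattice_Riesz TYPE('n::finite) j s = (\<Sum>m | (m :: real ^ 'n) \<in> int_lattice \<and> (norm m)\<^sup>2 < S. max 0 (s - (norm m)\<^sup>2) ^ j / fact j)"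
  unfolding lattice_Riesz_def
  by (rule sum.mono_neutral_cong_left) (use assms finite_lattice_sq[where s = S] in \<open>auto simp: max_def\<close>)

lemma DERIV_lattice_Riesz: "(lattice_Riesz TYPE('n::finite) (Suc (Suc i)) has_real_derivative lattice_Riesz TYPE('n) (Suc i) s) (at s)"
proof -
  let ?F = "{m :: real ^ 'n. m \<in> int_lattice \<and> (norm m)\<^sup>2 < s + 1}"
  have "((\<lambda>x. \<Sum>m\<in>?F. max 0 (x - (norm m)\<^sup>2) ^ Suc (Suc i) / fact (Suc (Suc i))) has_real_derivative
      (\<Sum>m\<in>?F. max 0 (s - (norm m)\<^sup>2) ^ Suc i / fact (Suc i))) (at s)"
  proof (rule DERIV_sum)
    fix m :: "real ^ 'n"
    have "((\<lambda>x. max 0 (x - (norm m)\<^sup>2) ^ Suc (Suc i)) has_real_derivative real (Suc (Suc i)) * max 0 (s - (norm m)\<^sup>2) ^ Suc i * 1) (at s)"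
      by (rule DERIV_chain2[OF DERIV_pos_part_power]) (auto intro!: derivative_eq_intros)
    from DERIV_cdivide[OF this, of "fact (Suc (Suc i))"]
    show "((\<lambda>x. max 0 (x - (norm m)\<^sup>2) ^ Suc (Suc i) / fact (Suc (Suc i))) has_real_derivative max 0 (s - (norm m)\<^sup>2) ^ Suc i / fact (Suc i)) (at s)"
      by (simp add: fact_Suc[of "Suc i"] del: fact_Suc power_Suc of_nat_Suc)
  qed
  then have "((\<lambda>x. lattice_Riesz TYPE('n) (Suc (Suc i)) x) has_real_derivative (\<Sum>m\<in>?F. max 0 (s - (norm m)\<^sup>2) ^ Suc i / fact (Suc i))) (at s)"
    by (rule has_field_derivative_transform_within_open[of _ _ _ "{..<s + 1}"]) (auto simp: lattice_Riesz_pos_part[where S = "s + 1"] simp del: fact_Suc)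
  then show ?thesis by (subst lattice_Riesz_pos_part[where S = "s + 1"]) auto
qed

lemma lattice_Riesz_0_mono: "s \<le> t \<Longrightarrow> lattice_Riesz TYPE('n::finite) 0 s \<le> lattice_Riesz TYPE('n) 0 t"
  by (simp add: lattice_Riesz_def) (intro card_mono finite_lattice_sq, auto)

text \<open>The substitute for a derivative at order 1: the increment contributed by a single m lies
  between h times the indicator of |m|^2 < s and h times that of |m|^2 < s + h.\<close>

lemma lattice_Riesz_1_diff:
  assumes h: "h \<ge> 0"
  shows "h * lattice_Riesz TYPE('n::finite) 0 s \<le> lattice_Riesz TYPE('n) 1 (s + h) - lattice_Riesz TYPE('n) 1 s"
    and "lattice_Riesz TYPE('n) 1 (s + h) - lattice_Riesz TYPE('n) 1 s \<le> h * lattice_Riesz TYPE('n) 0 (s + h)"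
proof -
  let ?F = "{m :: real ^ 'n. m \<in> int_lattice \<and> (norm m)\<^sup>2 < s + h}"
  have d: "lattice_Riesz TYPE('n) 1 (s + h) - lattice_Riesz TYPE('n) 1 s = (\<Sum>m\<in>?F. max 0 (s + h - (norm m)\<^sup>2) - max 0 (s - (norm m)\<^sup>2))"
    using h by (simp add: lattice_Riesz_pos_part[where S = "s + h"] sum_subtractf)
  have "h * lattice_Riesz TYPE('n) 0 s = (\<Sum>m\<in>{m\<in>?F. (norm m)\<^sup>2 < s}. h)"
  proof -
    have "{m\<in>?F. (norm m)\<^sup>2 < s} = {m. m \<in> int_lattice \<and> (norm m)\<^sup>2 < s}" using h by auto
    then show ?thesis unfolding lattice_Riesz_def by (simp add: mult.commute)
  qed
  also have "\<dots> = (\<Sum>m\<in>?F. if (norm m)\<^sup>2 < s then h else 0)"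
    by (rule sum.inter_filter) (rule finite_lattice_sq)
  also have "\<dots> \<le> (\<Sum>m\<in>?F. max 0 (s + h - (norm m)\<^sup>2) - max 0 (s - (norm m)\<^sup>2))"
    using h by (intro sum_mono) auto
  finally show "h * lattice_Riesz TYPE('n::finite) 0 s \<le> lattice_Riesz TYPE('n) 1 (s + h) - lattice_Riesz TYPE('n) 1 s" unfolding d .
  have "(\<Sum>m\<in>?F. max 0 (s + h - (norm m)\<^sup>2) - max 0 (s - (norm m)\<^sup>2)) \<le> (\<Sum>m\<in>?F. h)"
    using h by (intro sum_mono) auto
  also have "\<dots> = h * lattice_Riesz TYPE('n) 0 (s + h)" unfolding lattice_Riesz_def by (simp add: mult.commute)
  finally show "lattice_Riesz TYPE('n) 1 (s + h) - lattice_Riesz TYPE('n) 1 s \<le> h * lattice_Riesz TYPE('n) 0 (s + h)" unfolding d .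
qed

lemma DERIV_volume_Riesz:
  assumes "s > 0"
  shows "(volume_Riesz d (Suc j) has_real_derivative volume_Riesz d j s) (at s)"
proof -
  let ?e = "real d / 2 + real j + 1"
  have e: "real d / 2 + real (Suc j) = ?e" by simp
  have "Gamma (?e + 1) = ?e * Gamma ?e" by (intro Gamma_plus1) (auto simp: nonpos_Ints_def)
  moreover have "Gamma ?e > 0" by (intro Gamma_real_pos) (auto simp: add_nonneg_pos)
  moreover have "?e > 0" by (simp add: add_nonneg_pos)
  moreover have "((\<lambda>s. s powr ?e) has_real_derivative ?e * s powr (?e - 1)) (at s)"
    by (rule has_real_derivative_powr[OF assms])
  from DERIV_cdivide[OF DERIV_cmult[OF this]]
  have "((\<lambda>s. pi powr (real d / 2) * s powr ?e / Gamma (?e + 1)) has_real_derivative pi powr (real d / 2) * (?e * s powr (?e - 1)) / Gamma (?e + 1)) (at s)" .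
  ultimately show ?thesis unfolding volume_Riesz_def e by simp
qed

lemma volume_Riesz_mono: "0 \<le> s \<Longrightarrow> s \<le> t \<Longrightarrow> volume_Riesz d j s \<le> volume_Riesz d j t"
  unfolding volume_Riesz_def by (intro divide_right_mono mult_left_mono powr_mono2 less_imp_le[OF Gamma_real_pos]) (auto simp: add_nonneg_pos)

definition discrepancy :: "'n::finite itself \<Rightarrow> nat \<Rightarrow> real \<Rightarrow> real" where
  "discrepancy T j s = lattice_Riesz TYPE('n) j s - volume_Riesz CARD('n) j s"

lemma DERIV_discrepancy: "s > 0 \<Longrightarrow> (discrepancy TYPE('n::finite) (Suc (Suc i)) has_real_derivative discrepancy TYPE('n) (Suc i) s) (at s)"
  unfolding discrepancy_def[abs_def] by (intro DERIV_diff DERIV_lattice_Riesz DERIV_volume_Riesz)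

text \<open>By the value of \<open>bess\<close> at 0 and Gamma(J + 1) = J!, the k = 0 term of the
  Poisson series is exactly J! times the volume term. The oscillating terms remain.\<close>

lemma discrepancy_series:
  assumes J: "real J \<ge> 2 * real CARD('n::finite)" and r: "r > 0"
  shows "discrepancy TYPE('n) J (r\<^sup>2) = (LINT k|count_space (int_lattice - {0}). U_hat CARD('n) (real J) r (norm (k :: real ^ 'n))) / fact J"
proof -
  have t0: "(0 :: real ^ 'n) \<in> torus" by (simp add: torus_def)
  have sq: "(norm m)\<^sup>2 < r\<^sup>2 \<longleftrightarrow> norm m < r" for m :: "real ^ 'n" using r by (auto intro: power_strict_mono dest: power_less_imp_less_base)
  have "complex_of_real (\<Sum>m | (m :: real ^ 'n) \<in> int_lattice \<and> norm m < r. (r\<^sup>2 - (norm m)\<^sup>2) ^ J)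
      = complex_of_real (LINT k|count_space int_lattice. U_hat CARD('n) (real J) r (norm (0 + k :: real ^ 'n)))"
    using Riesz_kernel[OF J r t0] by simp
  then have "(\<Sum>m | (m :: real ^ 'n) \<in> int_lattice \<and> norm m < r. (r\<^sup>2 - (norm m)\<^sup>2) ^ J)
      = (LINT k|count_space int_lattice. U_hat CARD('n) (real J) r (norm (0 + k :: real ^ 'n)))"
    by (simp only: of_real_eq_iff)
  also have "\<dots> = U_hat CARD('n) (real J) r 0 + (LINT k|count_space (int_lattice - {0}). U_hat CARD('n) (real J) r (norm (k :: real ^ 'n)))"
    using integral_count_space_split_0(2)[OF integrable_U_hat_shift[OF J r t0]] by simp
  also have "U_hat CARD('n) (real J) r 0 = fact J * volume_Riesz CARD('n) J (r\<^sup>2)"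
  proof -
    have g: "bess (real J + (real CARD('n) - 1) / 2) 0 = sqrt pi / Gamma (real CARD('n) / 2 + real J + 1)"
      using bess_0[OF CARD_shift_gt[where 'n = 'n, of "real J"]] by (simp add: diff_divide_distrib add.commute)
    have p: "pi powr ((real CARD('n) - 1) / 2) * sqrt pi = pi powr (real CARD('n) / 2)"
      by (simp add: powr_half_sqrt[symmetric] powr_add[symmetric] diff_divide_distrib)
    have "(r\<^sup>2) powr (real CARD('n) / 2 + real J) = (r powr 2) powr (real CARD('n) / 2 + real J)"
      using r by (simp add: powr_numeral)
    also have "\<dots> = r powr (2 * real J + real CARD('n))" unfolding powr_powr by (simp add: algebra_simps)
    finally show ?thesis unfolding U_hat_def volume_Riesz_def p[symmetric] by (simp add: g Gamma_fact[symmetric] add.commute)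
  qed
  finally show ?thesis
    by (simp add: discrepancy_def lattice_Riesz_def sq sum_divide_distrib[symmetric] field_simps)
qed

lemma discrepancy_top_bound:
  assumes J: "real J \<ge> 2 * real CARD('n::finite)"
  obtains C where "C \<ge> 0" "\<And>r. r > 0 \<Longrightarrow> \<bar>discrepancy TYPE('n) J (r\<^sup>2)\<bar> \<le> C * r powr (real J + (real CARD('n) - 1) / 2)"
proof -
  let ?\<mu> = "real J + (real CARD('n) - 1) / 2"
  have t0: "(0 :: real ^ 'n) \<in> torus" by (simp add: torus_def)
  obtain C where C: "C \<ge> 0"
    "\<And>\<Lambda> x n. \<Lambda> > 0 \<Longrightarrow> x \<in> torus \<Longrightarrow> n \<in> int_lattice \<Longrightarrow> n \<noteq> 0 \<Longrightarrow>
       \<bar>U_hat CARD('n) (real J) \<Lambda> (norm (x + n :: real ^ 'n))\<bar> \<le> C * \<Lambda> powr ?\<mu> * lattice_weight n"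
    using U_hat_shift_bound[OF J] by metis
  define S where "S = (LINT k|count_space (int_lattice - {0}). lattice_weight (k :: real ^ 'n))"
  have S: "S \<ge> 0" unfolding S_def by (rule integral_nonneg_AE) simp
  have iw: "integrable (count_space (int_lattice - {0})) (lattice_weight :: real ^ 'n \<Rightarrow> real)"
    by (rule integral_count_space_split_0(1)[OF integrable_lattice_weight]) simp
  show thesis
  proof (rule that[of "C * S"])
    show "C * S \<ge> 0" using C S by simp
    fix r :: real assume r: "r > 0"
    have iu: "integrable (count_space (int_lattice - {0})) (\<lambda>k. U_hat CARD('n) (real J) r (norm (k :: real ^ 'n)))"
      using integral_count_space_split_0(1)[OF integrable_U_hat_shift[OF J r t0]] by simp
    have "\<bar>LINT k|count_space (int_lattice - {0}). U_hat CARD('n) (real J) r (norm (k :: real ^ 'n))\<bar>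
        \<le> (LINT k|count_space (int_lattice - {0}). C * r powr ?\<mu> * lattice_weight (k :: real ^ 'n))"
      using C(2)[OF r t0] by (intro integral_abs_bound_integral iu integrable_mult_right iw) auto
    also have "\<dots> = C * r powr ?\<mu> * S" by (simp add: S_def)
    finally have "\<bar>discrepancy TYPE('n) J (r\<^sup>2)\<bar> \<le> C * r powr ?\<mu> * S / fact J"
      unfolding discrepancy_series[OF J r] by (simp add: abs_divide divide_right_mono)
    also have "\<dots> \<le> C * r powr ?\<mu> * S / 1"
      using C S by (intro divide_left_mono) (auto simp: fact_ge_1)
    finally show "\<bar>discrepancy TYPE('n) J (r\<^sup>2)\<bar> \<le> C * S * r powr ?\<mu>" by (simp add: mult_ac)
  qed
qed

text \<open>The constant \<open>C\<close> is needed for \<open>d = 1\<close>, where the derivative of the volume is decreasing.\<close>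

lemma volume_Riesz_0_diff_bound:
  obtains C where "C \<ge> 0"
    "\<And>r h. r > 0 \<Longrightarrow> 0 \<le> h \<Longrightarrow> h \<le> r\<^sup>2 \<Longrightarrow> volume_Riesz d 0 (r\<^sup>2 + h) - volume_Riesz d 0 (r\<^sup>2) \<le> C * h * r powr (real d - 2)"
proof
  define K where "K = pi powr (real d / 2) / Gamma (real d / 2 + 1)"
  have K: "K > 0" unfolding K_def by (intro divide_pos_pos Gamma_real_pos) (auto simp: add_nonneg_pos)
  let ?C = "K * (real d / 2) * 2 powr \<bar>real d / 2 - 1\<bar>"
  show "?C \<ge> 0" using K by simp
  fix r h :: real assume r: "r > 0" and h: "0 \<le> h" "h \<le> r\<^sup>2"
  show "volume_Riesz d 0 (r\<^sup>2 + h) - volume_Riesz d 0 (r\<^sup>2) \<le> ?C * h * r powr (real d - 2)"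
  proof (cases "h = 0")
    case False
    with h have h0: "h > 0" by simp
    have r2: "r\<^sup>2 > 0" using r by simp
    have der: "((\<lambda>s. K * s powr (real d / 2)) has_real_derivative K * (real d / 2 * x powr (real d / 2 - 1))) (at x)" if "x > 0" for x
      using DERIV_cmult[OF has_real_derivative_powr[OF that]] .
    have "\<exists>z. r\<^sup>2 < z \<and> z < r\<^sup>2 + h \<and> K * (r\<^sup>2 + h) powr (real d / 2) - K * (r\<^sup>2) powr (real d / 2) = (r\<^sup>2 + h - r\<^sup>2) * (K * (real d / 2 * z powr (real d / 2 - 1)))"
      using h0 by (intro MVT2 der) (auto intro: less_le_trans[OF r2])
    then obtain z where z: "r\<^sup>2 < z" "z < r\<^sup>2 + h" "K * (r\<^sup>2 + h) powr (real d / 2) - K * (r\<^sup>2) powr (real d / 2) = h * (K * (real d / 2 * z powr (real d / 2 - 1)))"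
      by auto
    have zr: "1 \<le> z / r\<^sup>2" "z / r\<^sup>2 \<le> 2" using z(1,2) h r2 by (auto simp: field_simps)
    have "(r\<^sup>2) powr (real d / 2 - 1) = (r powr 2) powr (real d / 2 - 1)" using r by (simp add: powr_numeral)
    also have "\<dots> = r powr (real d - 2)" unfolding powr_powr by (simp add: algebra_simps)
    finally have e: "(r\<^sup>2) powr (real d / 2 - 1) = r powr (real d - 2)" .
    have "z powr (real d / 2 - 1) = (r\<^sup>2 * (z / r\<^sup>2)) powr (real d / 2 - 1)" using r2 by simp
    also have "\<dots> = r powr (real d - 2) * (z / r\<^sup>2) powr (real d / 2 - 1)" unfolding e[symmetric] using zr r2 by (intro powr_mult)
    also have "\<dots> \<le> r powr (real d - 2) * 2 powr \<bar>real d / 2 - 1\<bar>"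
    proof (rule mult_left_mono)
      have "(z / r\<^sup>2) powr (real d / 2 - 1) \<le> (z / r\<^sup>2) powr \<bar>real d / 2 - 1\<bar>" using zr by (intro powr_mono) auto
      also have "\<dots> \<le> 2 powr \<bar>real d / 2 - 1\<bar>" using zr by (intro powr_mono2) auto
      finally show "(z / r\<^sup>2) powr (real d / 2 - 1) \<le> 2 powr \<bar>real d / 2 - 1\<bar>" .
    qed simp
    finally have "z powr (real d / 2 - 1) \<le> r powr (real d - 2) * 2 powr \<bar>real d / 2 - 1\<bar>" .
    then have "h * (K * (real d / 2 * z powr (real d / 2 - 1))) \<le> h * (K * (real d / 2 * (r powr (real d - 2) * 2 powr \<bar>real d / 2 - 1\<bar>)))"
      using h K by (intro mult_left_mono) auto
    then show ?thesis unfolding z(3)[symmetric] by (simp add: volume_Riesz_def K_def mult_ac)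
  qed simp
qed

text \<open>Of the k + 1 differences, k are resolved by the mean value theorem down to order 1, the
  last by the monotone comparison. For the smooth volume the whole difference is a value of order 0,
  and the bound \<open>M\<close> on the top discrepancy links the two sides.\<close>

lemma lattice_Riesz_0_fdiff:
  assumes s: "s > 0" and h: "h > 0" and M: "\<And>x. s \<le> x \<Longrightarrow> x \<le> s + real (Suc k) * h \<Longrightarrow> \<bar>discrepancy TYPE('n::finite) (Suc k) x\<bar> \<le> M"
  shows "lattice_Riesz TYPE('n) 0 s \<le> volume_Riesz CARD('n) 0 (s + real (Suc k) * h) + 2 ^ Suc k * M / h ^ Suc k"
    and "volume_Riesz CARD('n) 0 s \<le> lattice_Riesz TYPE('n) 0 (s + real (Suc k) * h) + 2 ^ Suc k * M / h ^ Suc k"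
proof -
  let ?S = "s + real (Suc k) * h"
  let ?N = "lattice_Riesz TYPE('n)" and ?V = "volume_Riesz CARD('n)" and ?D = "discrepancy TYPE('n)"
  have "\<exists>\<zeta>. s \<le> \<zeta> \<and> \<zeta> \<le> s + real k * h \<and> fdiff k h ((\<lambda>i x. ?N (Suc i) (x + h) - ?N (Suc i) x) k) s = h ^ k * (\<lambda>i x. ?N (Suc i) (x + h) - ?N (Suc i) x) 0 \<zeta>"
    by (rule fdiff_mvt[OF s h]) (intro DERIV_diff iffD1[OF DERIV_shift] DERIV_lattice_Riesz)
  then obtain \<zeta> where \<zeta>: "s \<le> \<zeta>" "\<zeta> \<le> s + real k * h" "fdiff (Suc k) h (?N (Suc k)) s = h ^ k * (?N 1 (\<zeta> + h) - ?N 1 \<zeta>)"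
    unfolding fdiff_Suc' by auto
  have N1: "h ^ Suc k * ?N 0 s \<le> fdiff (Suc k) h (?N (Suc k)) s"
  proof -
    have "h * ?N 0 s \<le> h * ?N 0 \<zeta>" using \<zeta>(1) h by (intro mult_left_mono lattice_Riesz_0_mono) auto
    also have "\<dots> \<le> ?N 1 (\<zeta> + h) - ?N 1 \<zeta>" using h by (intro lattice_Riesz_1_diff) auto
    finally have "h ^ k * (h * ?N 0 s) \<le> h ^ k * (?N 1 (\<zeta> + h) - ?N 1 \<zeta>)" using h by (intro mult_left_mono) auto
    then show ?thesis unfolding \<zeta>(3) by (simp add: mult_ac)
  qed
  have N2: "fdiff (Suc k) h (?N (Suc k)) s \<le> h ^ Suc k * ?N 0 ?S"
  proof -
    have "?N 1 (\<zeta> + h) - ?N 1 \<zeta> \<le> h * ?N 0 (\<zeta> + h)" using h by (intro lattice_Riesz_1_diff) auto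
    also have "\<dots> \<le> h * ?N 0 ?S" using \<zeta>(2) h by (intro mult_left_mono lattice_Riesz_0_mono) (auto simp: algebra_simps)
    finally have "h ^ k * (?N 1 (\<zeta> + h) - ?N 1 \<zeta>) \<le> h ^ k * (h * ?N 0 ?S)" using h by (intro mult_left_mono) auto
    then show ?thesis unfolding \<zeta>(3) by (simp add: mult_ac)
  qed
  have "\<exists>\<zeta>. s \<le> \<zeta> \<and> \<zeta> \<le> ?S \<and> fdiff (Suc k) h (?V (Suc k)) s = h ^ Suc k * ?V 0 \<zeta>"
    by (rule fdiff_mvt[OF s h]) (rule DERIV_volume_Riesz)
  then obtain z where z: "s \<le> z" "z \<le> ?S" "fdiff (Suc k) h (?V (Suc k)) s = h ^ Suc k * ?V 0 z" by blast
  have V: "h ^ Suc k * ?V 0 s \<le> fdiff (Suc k) h (?V (Suc k)) s" "fdiff (Suc k) h (?V (Suc k)) s \<le> h ^ Suc k * ?V 0 ?S"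
    unfolding z(3) using z(1,2) s h by (auto intro!: mult_left_mono volume_Riesz_mono simp del: of_nat_Suc)
  have D: "\<bar>fdiff (Suc k) h (?N (Suc k)) s - fdiff (Suc k) h (?V (Suc k)) s\<bar> \<le> 2 ^ Suc k * M"
    unfolding fdiff_diff[symmetric] using h by (intro fdiff_bound M[unfolded discrepancy_def]) auto
  have hk: "h ^ Suc k > 0" using h by simp
  have div: "(h ^ Suc k * a + b) / h ^ Suc k = a + b / h ^ Suc k" for a b :: real
    using hk by (metis add_divide_distrib less_irrefl nonzero_mult_div_cancel_left)
  have "h ^ Suc k * ?N 0 s \<le> h ^ Suc k * ?V 0 ?S + 2 ^ Suc k * M" using N1 V(2) D by linarith
  then have "?N 0 s \<le> (h ^ Suc k * ?V 0 ?S + 2 ^ Suc k * M) / h ^ Suc k"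
    using hk by (simp only: pos_le_divide_eq mult.commute)
  then show "?N 0 s \<le> ?V 0 ?S + 2 ^ Suc k * M / h ^ Suc k" unfolding div .
  have "h ^ Suc k * ?V 0 s \<le> h ^ Suc k * ?N 0 ?S + 2 ^ Suc k * M" using N2 V(1) D by linarith
  then have "?V 0 s \<le> (h ^ Suc k * ?N 0 ?S + 2 ^ Suc k * M) / h ^ Suc k"
    using hk by (simp only: pos_le_divide_eq mult.commute)
  then show "?V 0 s \<le> ?N 0 ?S + 2 ^ Suc k * M / h ^ Suc k" unfolding div .
qed

text \<open>The bound is affine in a free parameter \<open>\<tau>\<close>: \<open>\<tau> = 1\<close> gives an \<open>O\<close>-estimate, \<open>\<tau> \<rightarrow> 0\<close> an
  \<open>o\<close>-estimate as soon as \<open>d \<ge> 2\<close>.\<close>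

definition discrepancy_bound :: "nat \<Rightarrow> nat \<Rightarrow> (real \<Rightarrow> real) \<Rightarrow> bool" where
  "discrepancy_bound d i f \<longleftrightarrow> (\<exists>C\<ge>0. \<exists>r0\<ge>1. \<forall>\<tau>. 0 < \<tau> \<longrightarrow> \<tau> \<le> 1 \<longrightarrow> (\<exists>C'\<ge>0. \<forall>r\<ge>r0.
     \<bar>f (r\<^sup>2)\<bar> \<le> C * \<tau> * r powr (real d - 1 + real i) + C' * r powr ((real d - 1) / 2 + real i)))"

section \<open>Bounds for the discrepancies of all orders\<close>

lemma powr_window:
  fixes r x p :: real
  assumes "r \<ge> 1" "r\<^sup>2 \<le> x" "x \<le> 4 * r\<^sup>2" "p \<ge> 0"
  shows "sqrt x \<ge> r" "sqrt x powr p \<le> 2 powr p * r powr p"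
proof -
  show "sqrt x \<ge> r" using assms by (intro real_le_rsqrt)
  have "sqrt x \<le> sqrt (4 * r\<^sup>2)" using assms by (intro real_sqrt_le_mono)
  also have "\<dots> = 2 * r" using assms by (simp add: real_sqrt_mult)
  finally have "sqrt x powr p \<le> (2 * r) powr p" using assms by (intro powr_mono2) auto
  then show "sqrt x powr p \<le> 2 powr p * r powr p" using assms by (simp add: powr_mult)
qed

text \<open>Finite differences with step h = \<tau> r: moving r^2 by J h changes the volume by
  O(\<tau> r^(d-1)), while the bound of order J divided by h^J is of size \<tau>^(-J) r^((d-1)/2).
  These are the two terms of \<open>discrepancy_bound\<close>.\<close>

lemma discrepancy_bound_0:
  assumes J: "real J \<ge> 2 * real CARD('n::finite)"
  shows "discrepancy_bound CARD('n) 0 (discrepancy TYPE('n) 0)"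
proof -
  let ?d = "real CARD('n)"
  let ?\<mu> = "real J + (?d - 1) / 2"
  have d1: "?d \<ge> 1" by (rule real_CARD_ge_1)
  then have "real J \<ge> 2" using J by linarith
  then have J2: "J \<ge> 2" by simp
  then obtain k where k: "J = Suc k" by (cases J) auto
  have \<mu>0: "?\<mu> \<ge> 0" using d1 by simp
  obtain CJ where CJ: "CJ \<ge> 0" "\<And>r. r > 0 \<Longrightarrow> \<bar>discrepancy TYPE('n) J (r\<^sup>2)\<bar> \<le> CJ * r powr ?\<mu>" using discrepancy_top_bound[OF J] by metis
  obtain CV where CV: "CV \<ge> 0"
    "\<And>r h. r > 0 \<Longrightarrow> 0 \<le> h \<Longrightarrow> h \<le> r\<^sup>2 \<Longrightarrow> volume_Riesz CARD('n) 0 (r\<^sup>2 + h) - volume_Riesz CARD('n) 0 (r\<^sup>2) \<le> CV * h * r powr (?d - 2)"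
    using volume_Riesz_0_diff_bound by metis
  \<comment> \<open>For r \<ge> 2 J and \<tau> \<le> 1 the total shift J h is at most r^2 / 2, so
    all radii that occur stay comparable to r.\<close>
  define r0 where "r0 = 2 * real J + 2"
  define B where "B = CJ * 2 powr ?\<mu>"
  \<comment> \<open>In the lower estimate sqrt s, which lies between r/2 and r, is replaced by r in
    a power with exponent d - 2, negative for d = 1; the factor covers both signs and is at least
    1.\<close>
  define CV' where "CV' = CV * 2 powr \<bar>?d - 2\<bar>"
  have CV': "CV' \<ge> CV" "CV' \<ge> 0" using CV(1) ge_one_powr_ge_zero[of 2 "\<bar>?d - 2\<bar>"] by (auto simp: CV'_def mult_le_cancel_left1)
  show ?thesis unfolding discrepancy_bound_def
  proof (rule exI[of _ "CV' * real J"], intro conjI)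
    show "0 \<le> CV' * real J" using CV' by simp
    show "\<exists>r0\<ge>1. \<forall>\<tau>>0. \<tau> \<le> 1 \<longrightarrow> (\<exists>C'\<ge>0. \<forall>r\<ge>r0. \<bar>discrepancy TYPE('n) 0 (r\<^sup>2)\<bar> \<le> CV' * real J * \<tau> * r powr (?d - 1 + real 0) + C' * r powr ((?d - 1) / 2 + real 0))"
    proof (rule exI[of _ r0], intro conjI allI impI)
      show "1 \<le> r0" by (simp add: r0_def)
      fix \<tau> :: real assume \<tau>: "0 < \<tau>" "\<tau> \<le> 1"
      define E where "E = 2 ^ J * B / \<tau> ^ J"
      have E0: "E \<ge> 0" using CJ \<tau> by (simp add: E_def B_def)
      define E' where "E' = E * 2 powr ?\<mu>"
      show "\<exists>C'\<ge>0. \<forall>r\<ge>r0. \<bar>discrepancy TYPE('n) 0 (r\<^sup>2)\<bar> \<le> CV' * real J * \<tau> * r powr (?d - 1 + real 0) + C' * r powr ((?d - 1) / 2 + real 0)"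
      proof (rule exI[of _ "E"], intro conjI allI impI)
        show "0 \<le> E" by fact
        fix r assume r: "r0 \<le> r"
        have r1: "r \<ge> 1" "r > 0" using r by (auto simp: r0_def)
        define h where "h = \<tau> * r"
        have h0: "h > 0" using \<tau> r1 by (simp add: h_def)
        have Jh: "real J * h \<le> r\<^sup>2 / 2"
        proof -
          have "real J * h \<le> real J * (1 * r)" unfolding h_def using \<tau> r1 by (intro mult_left_mono mult_right_mono) auto
          also have "\<dots> \<le> (r / 2) * r" using r r1 by (simp add: r0_def mult_right_mono)
          finally show ?thesis by (simp add: power2_eq_square)
        qed
        have r2: "r\<^sup>2 > 0" using r1 by simp
        have Jh2: "real J * h \<le> r\<^sup>2" using Jh r2 by linarith
        have M: "\<bar>discrepancy TYPE('n) J x\<bar> \<le> B * r powr ?\<mu>" if "r\<^sup>2 / 4 \<le> x" "x \<le> 4 * r\<^sup>2" for x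
        proof -
          have x0: "x > 0" using that(1) r1 by (auto intro: less_le_trans[of _ "r\<^sup>2 / 4"])
          have "sqrt x \<le> sqrt (4 * r\<^sup>2)" using that by (intro real_sqrt_le_mono)
          also have "\<dots> = 2 * r" using r1 by (simp add: real_sqrt_mult)
          finally have "sqrt x powr ?\<mu> \<le> (2 * r) powr ?\<mu>" using x0 \<mu>0 by (intro powr_mono2) auto
          then have "CJ * sqrt x powr ?\<mu> \<le> B * r powr ?\<mu>" using CJ(1) r1 by (simp add: B_def powr_mult mult.assoc mult_left_mono)
          then show ?thesis using CJ(2)[of "sqrt x"] x0 by simp
        qed
        have Eh: "2 ^ Suc k * (B * r powr ?\<mu>) / h ^ Suc k = E * r powr ((?d - 1) / 2)"
        proof -
          have "r powr ?\<mu> / r ^ J = r powr ((?d - 1) / 2)"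
            using r1 by (simp add: powr_add powr_realpow)
          moreover have "2 ^ J * (B * r powr ?\<mu>) / h ^ J = E * (r powr ?\<mu> / r ^ J)"
            unfolding h_def E_def by (simp add: power_mult_distrib)
          ultimately show ?thesis unfolding k[symmetric] by simp
        qed
        have hr: "h * r powr (?d - 2) = \<tau> * r powr (?d - 1)"
        proof -
          have "r * r powr (?d - 2) = r powr 1 * r powr (?d - 2)" using r1 by simp
          also have "\<dots> = r powr (?d - 1)" unfolding powr_add[symmetric] by simp
          finally show ?thesis by (simp add: h_def)
        qed
        have up: "discrepancy TYPE('n) 0 (r\<^sup>2) \<le> CV' * real J * \<tau> * r powr (?d - 1) + E * r powr ((?d - 1) / 2)"
        proof -
          have f1: "lattice_Riesz TYPE('n) 0 (r\<^sup>2) \<le> volume_Riesz CARD('n) 0 (r\<^sup>2 + real (Suc k) * h) + 2 ^ Suc k * (B * r powr ?\<mu>) / h ^ Suc k"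
          proof (rule lattice_Riesz_0_fdiff(1)[OF r2 h0])
            fix x assume "r\<^sup>2 \<le> x" "x \<le> r\<^sup>2 + real (Suc k) * h"
            then have "r\<^sup>2 / 4 \<le> x" "x \<le> 4 * r\<^sup>2" using Jh r2 unfolding k[symmetric] by auto
            from M[OF this] show "\<bar>discrepancy TYPE('n) (Suc k) x\<bar> \<le> B * r powr ?\<mu>" unfolding k .
          qed
          have f2: "volume_Riesz CARD('n) 0 (r\<^sup>2 + real (Suc k) * h) - volume_Riesz CARD('n) 0 (r\<^sup>2) \<le> CV * (real J * h) * r powr (?d - 2)"
            unfolding k[symmetric] using Jh2 r1 h0 by (intro CV(2)) auto
          have f3: "CV * (real J * h) * r powr (?d - 2) \<le> CV' * (real J * h) * r powr (?d - 2)"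
            using CV' h0 by (intro mult_right_mono) auto
          have f4: "CV' * (real J * h) * r powr (?d - 2) = CV' * real J * \<tau> * r powr (?d - 1)"
            using hr by (metis mult.assoc)
          show ?thesis unfolding discrepancy_def using f1 f2 f3 f4 unfolding Eh by linarith
        qed
        have lo: "- discrepancy TYPE('n) 0 (r\<^sup>2) \<le> CV' * real J * \<tau> * r powr (?d - 1) + E * r powr ((?d - 1) / 2)"
        proof -
          \<comment> \<open>For the lower bound the window lies to the left of r^2 and ends exactly
            there.\<close>
          define s where "s = r\<^sup>2 - real J * h"
          have s1: "s \<ge> r\<^sup>2 / 2" using Jh unfolding s_def by linarith
          then have s2: "s > 0" using r2 by linarith
          have s3: "s \<le> r\<^sup>2" using h0 by (simp add: s_def)
          note s = s1 s2 s3
          have ss: "s + real (Suc k) * h = r\<^sup>2" by (simp add: s_def k)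
          have a: "volume_Riesz CARD('n) 0 s \<le> lattice_Riesz TYPE('n) 0 (r\<^sup>2) + E * r powr ((?d - 1) / 2)"
            unfolding Eh[symmetric] ss[symmetric]
          proof (rule lattice_Riesz_0_fdiff(2)[OF s(2) h0])
            fix x assume "s \<le> x" "x \<le> s + real (Suc k) * h"
            then have "r\<^sup>2 / 4 \<le> x" "x \<le> 4 * r\<^sup>2" using s r2 unfolding ss by auto
            from M[OF this] show "\<bar>discrepancy TYPE('n) (Suc k) x\<bar> \<le> B * r powr ?\<mu>" unfolding k .
          qed
          have b: "volume_Riesz CARD('n) 0 (r\<^sup>2) - volume_Riesz CARD('n) 0 s \<le> CV * (real J * h) * sqrt s powr (?d - 2)"
          proof -
            have "volume_Riesz CARD('n) 0 ((sqrt s)\<^sup>2 + real J * h) - volume_Riesz CARD('n) 0 ((sqrt s)\<^sup>2) \<le> CV * (real J * h) * sqrt s powr (?d - 2)"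
              using s Jh h0 by (intro CV(2)) auto
            then show ?thesis using s(2) ss by (simp add: k)
          qed
          have c: "sqrt s powr (?d - 2) \<le> 2 powr \<bar>?d - 2\<bar> * r powr (?d - 2)"
          proof -
            have q: "r / 2 \<le> sqrt s"
              using s r1 by (intro real_le_rsqrt) (simp add: power_divide)
            have q2: "sqrt s \<le> r" using s(3) r1 by (intro real_le_lsqrt) (auto simp: less_imp_le s(2))
            show ?thesis
            proof (cases "?d - 2 \<ge> 0")
              case True
              then have "sqrt s powr (?d - 2) \<le> 1 * r powr (?d - 2)" using q2 s by (simp add: powr_mono2)
              also have "\<dots> \<le> 2 powr \<bar>?d - 2\<bar> * r powr (?d - 2)" by (intro mult_right_mono ge_one_powr_ge_zero) auto
              finally show ?thesis .
            next
              case False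
              then have "sqrt s powr (?d - 2) \<le> (r / 2) powr (?d - 2)" using q r1 by (intro powr_mono2') auto
              also have "\<dots> = 2 powr \<bar>?d - 2\<bar> * r powr (?d - 2)" using False r1 by (simp add: powr_divide powr_minus field_simps powr_diff)
              finally show ?thesis .
            qed
          qed
          have "CV * (real J * h) * sqrt s powr (?d - 2) \<le> CV * (real J * h) * (2 powr \<bar>?d - 2\<bar> * r powr (?d - 2))"
            using CV(1) h0 by (intro mult_left_mono c) auto
          also have "\<dots> = CV' * real J * (h * r powr (?d - 2))" by (simp add: CV'_def mult_ac)
          finally show ?thesis using a b unfolding hr discrepancy_def by (simp add: mult.assoc)
        qed
        show "\<bar>discrepancy TYPE('n) 0 (r\<^sup>2)\<bar> \<le> CV' * real J * \<tau> * r powr (?d - 1 + real 0) + E * r powr ((?d - 1) / 2 + real 0)"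
          using up lo by simp
      qed
    qed
  qed
qed

lemma discrepancy_bound_imp_O:
  assumes "discrepancy_bound d i f" "d \<ge> 1"
  obtains K r0 where "K \<ge> 0" "r0 \<ge> 1" "\<And>r. r \<ge> r0 \<Longrightarrow> \<bar>f (r\<^sup>2)\<bar> \<le> K * r powr (real d - 1 + real i)"
proof -
  obtain C r0 C' where C: "C \<ge> 0" "r0 \<ge> 1" "C' \<ge> 0"
    "\<And>r. r \<ge> r0 \<Longrightarrow> \<bar>f (r\<^sup>2)\<bar> \<le> C * 1 * r powr (real d - 1 + real i) + C' * r powr ((real d - 1) / 2 + real i)"
    using assms(1) unfolding discrepancy_bound_def by (metis zero_less_one order_refl)
  show thesis
  proof (rule that[of "C + C'" r0])
    fix r assume r: "r \<ge> r0"
    have "C' * r powr ((real d - 1) / 2 + real i) \<le> C' * r powr (real d - 1 + real i)"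
      using r C assms(2) by (intro mult_left_mono powr_mono) auto
    then show "\<bar>f (r\<^sup>2)\<bar> \<le> (C + C') * r powr (real d - 1 + real i)" using C(4)[OF r] by (simp add: distrib_right)
  qed (use C in auto)
qed

text \<open>The increment of order i + 1 is governed by order i, whose size is known. For i \<ge> 1
  this is the mean value theorem. For i = 0 the lattice sum of order 1 is not differentiable and the
  monotone comparison is used instead, at the price of the volume change over a window of length at
  most A r.\<close>

lemma discrepancy_Lipschitz:
  assumes O: "K \<ge> 0" "r0 \<ge> 1" "\<And>r. r \<ge> r0 \<Longrightarrow> \<bar>discrepancy TYPE('n::finite) i (r\<^sup>2)\<bar> \<le> K * r powr (real CARD('n) - 1 + real i)"
  obtains K' where "K' \<ge> 0" "\<And>r y h. r \<ge> r0 \<Longrightarrow> r \<ge> A \<Longrightarrow> A \<ge> 0 \<Longrightarrow> r\<^sup>2 \<le> y \<Longrightarrow> 0 \<le> h \<Longrightarrow> y + h \<le> r\<^sup>2 + A * r \<Longrightarrow>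
     \<bar>discrepancy TYPE('n) (Suc i) (y + h) - discrepancy TYPE('n) (Suc i) y\<bar> \<le> K' * r powr (real CARD('n) - 1 + real i) * h"
proof -
  let ?d = "real CARD('n)"
  let ?e = "?d - 1 + real i"
  have d1: "?d \<ge> 1" by (rule real_CARD_ge_1)
  have e0: "?e \<ge> 0" using d1 by simp
  define K1 where "K1 = K * 2 powr ?e"
  have K1: "K1 \<ge> 0" using O by (simp add: K1_def)
  have win: "\<bar>discrepancy TYPE('n) i x\<bar> \<le> K1 * r powr ?e" if "r \<ge> r0" "r\<^sup>2 \<le> x" "x \<le> 4 * r\<^sup>2" for r x
  proof -
    have r1: "r \<ge> 1" using that O(2) by simp
    note w = powr_window[OF r1 that(2,3) e0]
    have "x \<ge> 0" using that(2) zero_le_power2[of r] by linarith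
    then have "\<bar>discrepancy TYPE('n) i x\<bar> \<le> K * sqrt x powr ?e" using O(3)[of "sqrt x"] w(1) that(1) by simp
    also have "\<dots> \<le> K * (2 powr ?e * r powr ?e)" using O(1) w(2) by (intro mult_left_mono)
    finally show ?thesis by (simp add: K1_def mult.assoc)
  qed
  have in4: "x \<le> 4 * r\<^sup>2" if "r \<ge> r0" "r \<ge> A" "x \<le> r\<^sup>2 + A * r" for r x
  proof -
    have "A * r \<le> r * r" using that O(2) by (intro mult_right_mono) auto
    moreover have "0 \<le> r\<^sup>2" by simp
    ultimately show ?thesis using that(3) unfolding power2_eq_square by linarith
  qed
  obtain CV where CV: "CV \<ge> 0"
    "\<And>r h. r > 0 \<Longrightarrow> 0 \<le> h \<Longrightarrow> h \<le> r\<^sup>2 \<Longrightarrow> volume_Riesz CARD('n) 0 (r\<^sup>2 + h) - volume_Riesz CARD('n) 0 (r\<^sup>2) \<le> CV * h * r powr (?d - 2)"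
    using volume_Riesz_0_diff_bound by metis
  show thesis
  proof (cases i)
    case (Suc l)
    show thesis
    proof (rule that[OF K1])
      fix r y h assume r: "r \<ge> r0" "r \<ge> A" "A \<ge> 0" "r\<^sup>2 \<le> y" "0 \<le> h" "y + h \<le> r\<^sup>2 + A * r"
      show "\<bar>discrepancy TYPE('n) (Suc i) (y + h) - discrepancy TYPE('n) (Suc i) y\<bar> \<le> K1 * r powr ?e * h"
      proof (cases "h = 0")
        case False
        with r have h0: "h > 0" by simp
        have "r\<^sup>2 > 0" using r O(2) by simp
        then have y0: "y > 0" using r(4) by linarith
        have "\<exists>z. y < z \<and> z < y + h \<and> discrepancy TYPE('n) (Suc i) (y + h) - discrepancy TYPE('n) (Suc i) y = (y + h - y) * discrepancy TYPE('n) i z"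
          unfolding Suc using h0 by (intro MVT2 DERIV_discrepancy) (auto intro: less_le_trans[OF y0])
        then obtain z where z: "y < z" "z < y + h" "discrepancy TYPE('n) (Suc i) (y + h) - discrepancy TYPE('n) (Suc i) y = h * discrepancy TYPE('n) i z" by auto
        have "\<bar>discrepancy TYPE('n) i z\<bar> \<le> K1 * r powr ?e" using z r in4[OF r(1,2), of z] by (intro win) auto
        then show ?thesis unfolding z(3) using h0 by (simp add: abs_mult mult.commute mult_left_mono)
      qed simp
    qed
  next
    case 0
    define K2 where "K2 = K1 + CV * A * 2 powr \<bar>?d - 2\<bar>"
    show thesis
    proof (cases "A \<ge> 0")
      case False
      show thesis by (rule that[of 0]) (use False in auto)
    next
      case A0: True
      have K2: "K2 \<ge> 0" using K1 CV A0 by (simp add: K2_def)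
      show thesis
      proof (rule that[OF K2])
        fix r y h assume r: "r \<ge> r0" "r \<ge> A" "A \<ge> 0" "r\<^sup>2 \<le> y" "0 \<le> h" "y + h \<le> r\<^sup>2 + A * r"
        have r1: "r \<ge> 1" using r O(2) by simp
        have y0: "y > 0" using r(4) r1 by (auto intro: less_le_trans[of _ "r\<^sup>2"])
        have hA: "h \<le> A * r" using r by linarith
        have Ar: "A * r \<le> r\<^sup>2" unfolding power2_eq_square using r r1 by (intro mult_right_mono) auto
        have Vd: "volume_Riesz CARD('n) 0 (y + h) - volume_Riesz CARD('n) 0 y \<le> CV * A * 2 powr \<bar>?d - 2\<bar> * r powr ?e"
        proof -
          have sy: "r \<le> sqrt y" using r by (intro real_le_rsqrt)
          have sy2: "sqrt y \<le> 2 * r"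
          proof (rule real_le_lsqrt)
            show "y \<le> (2 * r)\<^sup>2" using in4[OF r(1,2), of y] r(5,6) by (simp add: power_mult_distrib)
          qed (use y0 r1 in auto)
          have "volume_Riesz CARD('n) 0 ((sqrt y)\<^sup>2 + h) - volume_Riesz CARD('n) 0 ((sqrt y)\<^sup>2) \<le> CV * h * sqrt y powr (?d - 2)"
            using y0 r hA Ar by (intro CV(2)) auto
          then have 1: "volume_Riesz CARD('n) 0 (y + h) - volume_Riesz CARD('n) 0 y \<le> CV * h * sqrt y powr (?d - 2)" using y0 by simp
          have 2: "sqrt y powr (?d - 2) \<le> 2 powr \<bar>?d - 2\<bar> * r powr (?d - 2)"
          proof (cases "?d - 2 \<ge> 0")
            case True
            then have "sqrt y powr (?d - 2) \<le> (2 * r) powr (?d - 2)" using sy2 y0 by (intro powr_mono2) auto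
            then show ?thesis using True r1 by (simp add: powr_mult)
          next
            case False
            then have "sqrt y powr (?d - 2) \<le> r powr (?d - 2)" using sy r1 by (intro powr_mono2') auto
            also have "\<dots> = 1 * r powr (?d - 2)" by simp
            also have "\<dots> \<le> 2 powr \<bar>?d - 2\<bar> * r powr (?d - 2)" by (intro mult_right_mono ge_one_powr_ge_zero) auto
            finally show ?thesis .
          qed
          have "CV * h * sqrt y powr (?d - 2) \<le> CV * (A * r) * (2 powr \<bar>?d - 2\<bar> * r powr (?d - 2))"
            using CV(1) r hA by (intro mult_mono mult_left_mono 2) auto
          also have "\<dots> = CV * A * 2 powr \<bar>?d - 2\<bar> * (r powr 1 * r powr (?d - 2))" using r1 by simp
          also have "r powr 1 * r powr (?d - 2) = r powr ?e" unfolding powr_add[symmetric] 0 by simp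
          finally show ?thesis using 1 by linarith
        qed
        have V1: "h * volume_Riesz CARD('n) 0 y \<le> volume_Riesz CARD('n) 1 (y + h) - volume_Riesz CARD('n) 1 y \<and> volume_Riesz CARD('n) 1 (y + h) - volume_Riesz CARD('n) 1 y \<le> h * volume_Riesz CARD('n) 0 (y + h)"
        proof (cases "h = 0")
          case False
          with r have h0: "h > 0" by simp
          have "\<exists>z. y < z \<and> z < y + h \<and> volume_Riesz CARD('n) (Suc 0) (y + h) - volume_Riesz CARD('n) (Suc 0) y = (y + h - y) * volume_Riesz CARD('n) 0 z"
            using h0 y0 by (intro MVT2 DERIV_volume_Riesz) auto
          then obtain z where z: "y < z" "z < y + h" "volume_Riesz CARD('n) 1 (y + h) - volume_Riesz CARD('n) 1 y = h * volume_Riesz CARD('n) 0 z" by auto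
          show ?thesis unfolding z(3) using z(1,2) h0 y0 by (auto intro!: mult_left_mono volume_Riesz_mono)
        qed simp
        note N1 = lattice_Riesz_1_diff[OF r(5), of y, where 'n = 'n]
        have D0: "\<bar>discrepancy TYPE('n) 0 y\<bar> \<le> K1 * r powr ?e" "\<bar>discrepancy TYPE('n) 0 (y + h)\<bar> \<le> K1 * r powr ?e"
          using win[OF r(1), of y] win[OF r(1), of "y + h"] in4[OF r(1,2), of y] in4[OF r(1,2), of "y + h"] r 0 by auto
        have "discrepancy TYPE('n) 1 (y + h) - discrepancy TYPE('n) 1 y \<le> h * (lattice_Riesz TYPE('n) 0 (y + h) - volume_Riesz CARD('n) 0 y)"
          using V1 N1 unfolding discrepancy_def right_diff_distrib by linarith
        also have "\<dots> \<le> h * (K2 * r powr ?e)"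
          using D0 Vd r(5) unfolding K2_def distrib_right by (intro mult_left_mono) (auto simp: discrepancy_def)
        finally have u: "discrepancy TYPE('n) 1 (y + h) - discrepancy TYPE('n) 1 y \<le> h * (K2 * r powr ?e)" .
        have "- (discrepancy TYPE('n) 1 (y + h) - discrepancy TYPE('n) 1 y) \<le> h * (volume_Riesz CARD('n) 0 (y + h) - lattice_Riesz TYPE('n) 0 y)"
          using V1 N1 unfolding discrepancy_def right_diff_distrib by linarith
        also have "\<dots> \<le> h * (K2 * r powr ?e)"
          using D0 Vd r(5) unfolding K2_def distrib_right by (intro mult_left_mono) (auto simp: discrepancy_def)
        finally show "\<bar>discrepancy TYPE('n) (Suc i) (y + h) - discrepancy TYPE('n) (Suc i) y\<bar> \<le> K2 * r powr ?e * h"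
          using u unfolding 0 by (simp add: abs_le_iff mult.commute)
      qed
    qed
  qed
qed

text \<open>A (J - i - 1)-fold difference controls order i + 1 only at some unknown point \<zeta> of
  a window of length at most J \<tau> r. The Lipschitz bound transports the estimate from \<zeta> to
  r^2; its cost, O(\<tau> r) times r^(d-1+i), is the \<tau>-term of the claim.\<close>

lemma discrepancy_bound_Suc:
  assumes J: "real J \<ge> 2 * real CARD('n::finite)" and i: "Suc i \<le> J" and IH: "discrepancy_bound CARD('n) i (discrepancy TYPE('n) i)"
  shows "discrepancy_bound CARD('n) (Suc i) (discrepancy TYPE('n) (Suc i))"
proof -
  let ?d = "real CARD('n)"
  let ?\<mu> = "real J + (?d - 1) / 2"
  let ?D = "discrepancy TYPE('n)"
  have d1: "?d \<ge> 1" by (rule real_CARD_ge_1)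
  have \<mu>0: "?\<mu> \<ge> 0" using d1 by simp
  obtain K r0 where O: "K \<ge> 0" "r0 \<ge> 1" "\<And>r. r \<ge> r0 \<Longrightarrow> \<bar>?D i (r\<^sup>2)\<bar> \<le> K * r powr (?d - 1 + real i)"
    using discrepancy_bound_imp_O[OF IH] by (metis One_nat_def Suc_leI zero_less_card_finite)
  obtain K' where K': "K' \<ge> 0" "\<And>r y h. r \<ge> r0 \<Longrightarrow> r \<ge> real J \<Longrightarrow> real J \<ge> 0 \<Longrightarrow> r\<^sup>2 \<le> y \<Longrightarrow> 0 \<le> h \<Longrightarrow> y + h \<le> r\<^sup>2 + real J * r \<Longrightarrow>
     \<bar>?D (Suc i) (y + h) - ?D (Suc i) y\<bar> \<le> K' * r powr (?d - 1 + real i) * h"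
    using discrepancy_Lipschitz[OF O, of "real J"] by metis
  obtain CJ where CJ: "CJ \<ge> 0" "\<And>r. r > 0 \<Longrightarrow> \<bar>?D J (r\<^sup>2)\<bar> \<le> CJ * r powr ?\<mu>" using discrepancy_top_bound[OF J] by metis
  define k where "k = J - Suc i"
  have kJ: "J = Suc i + k" using i by (simp add: k_def)
  define R where "R = max r0 (real J)"
  define B where "B = CJ * 2 powr ?\<mu>"
  show ?thesis unfolding discrepancy_bound_def
  proof (rule exI[of _ "K' * real J"], intro conjI, goal_cases)
    case 1
    show "0 \<le> K' * real J" using K' by simp
  next
    case 2
    show ?case
    proof (rule exI[of _ R], intro conjI allI impI)
    show "1 \<le> R" using O by (simp add: R_def)
    fix \<tau> :: real assume \<tau>: "0 < \<tau>" "\<tau> \<le> 1"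
    show "\<exists>C'\<ge>0. \<forall>r\<ge>R. \<bar>?D (Suc i) (r\<^sup>2)\<bar> \<le> K' * real J * \<tau> * r powr (?d - 1 + real (Suc i)) + C' * r powr ((?d - 1) / 2 + real (Suc i))"
    proof (rule exI[of _ "2 ^ k * B / \<tau> ^ k"], intro conjI allI impI)
      show "0 \<le> 2 ^ k * B / \<tau> ^ k" using CJ \<tau> by (simp add: B_def)
      fix r assume r: "R \<le> r"
      have r1: "r \<ge> 1" "r \<ge> r0" "r \<ge> real J" "r > 0" using r O(2) by (auto simp: R_def)
      define h where "h = \<tau> * r"
      have h0: "h > 0" using \<tau> r1 by (simp add: h_def)
      have kh: "real k * h \<le> real J * \<tau> * r" unfolding h_def kJ using \<tau> r1 by (simp add: mult.assoc mult_right_mono)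
      have kh2: "real k * h \<le> real J * r"
      proof -
        have "real J * \<tau> * r \<le> real J * 1 * r" using \<tau> r1 by (intro mult_right_mono mult_left_mono) auto
        then show ?thesis using kh by simp
      qed
      have Jr: "real J * r \<le> r\<^sup>2" unfolding power2_eq_square using r1 by (intro mult_right_mono) auto
      have r2: "r\<^sup>2 > 0" using r1 by simp
      have M: "\<bar>?D J x\<bar> \<le> B * r powr ?\<mu>" if "r\<^sup>2 \<le> x" "x \<le> r\<^sup>2 + real k * h" for x
      proof -
        have "x \<le> 4 * r\<^sup>2" using that kh2 Jr r2 by linarith
        from powr_window(2)[OF r1(1) that(1) this \<mu>0] CJ(1) have "CJ * sqrt x powr ?\<mu> \<le> B * r powr ?\<mu>"
          by (simp add: B_def mult.assoc mult_left_mono)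
        moreover have "x > 0" using that r2 by linarith
        ultimately show ?thesis using CJ(2)[of "sqrt x"] by simp
      qed
      have "\<exists>\<zeta>. r\<^sup>2 \<le> \<zeta> \<and> \<zeta> \<le> r\<^sup>2 + real k * h \<and> fdiff k h ((\<lambda>j. ?D (Suc (i + j))) k) (r\<^sup>2) = h ^ k * (\<lambda>j. ?D (Suc (i + j))) 0 \<zeta>"
        by (rule fdiff_mvt[OF r2 h0]) (simp add: DERIV_discrepancy)
      then obtain \<zeta> where \<zeta>: "r\<^sup>2 \<le> \<zeta>" "\<zeta> \<le> r\<^sup>2 + real k * h" "fdiff k h (?D J) (r\<^sup>2) = h ^ k * ?D (Suc i) \<zeta>"
        unfolding kJ by auto
      have "\<bar>h ^ k * ?D (Suc i) \<zeta>\<bar> \<le> 2 ^ k * (B * r powr ?\<mu>)"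
        unfolding \<zeta>(3)[symmetric] using h0 by (intro fdiff_bound M) auto
      then have "\<bar>?D (Suc i) \<zeta>\<bar> \<le> 2 ^ k * (B * r powr ?\<mu>) / h ^ k"
        using h0 by (simp add: abs_mult pos_le_divide_eq mult.commute)
      also have "\<dots> = 2 ^ k * B / \<tau> ^ k * (r powr ?\<mu> / r ^ k)" unfolding h_def by (simp add: power_mult_distrib)
      also have "r powr ?\<mu> / r ^ k = r powr ((?d - 1) / 2 + real (Suc i))"
      proof -
        have "?\<mu> = ((?d - 1) / 2 + real (Suc i)) + real k" by (simp add: kJ)
        then show ?thesis using r1 by (simp only: powr_add powr_realpow) simp
      qed
      finally have a: "\<bar>?D (Suc i) \<zeta>\<bar> \<le> 2 ^ k * B / \<tau> ^ k * r powr ((?d - 1) / 2 + real (Suc i))" .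
      have "\<bar>?D (Suc i) (r\<^sup>2 + (\<zeta> - r\<^sup>2)) - ?D (Suc i) (r\<^sup>2)\<bar> \<le> K' * r powr (?d - 1 + real i) * (\<zeta> - r\<^sup>2)"
        using \<zeta> kh2 r1 by (intro K'(2)) auto
      also have "\<dots> \<le> K' * r powr (?d - 1 + real i) * (real J * \<tau> * r)"
        using \<zeta>(2) kh K'(1) by (intro mult_left_mono) auto
      also have "\<dots> = K' * real J * \<tau> * (r powr (?d - 1 + real i) * r powr 1)" using r1 by simp
      also have "r powr (?d - 1 + real i) * r powr 1 = r powr (?d - 1 + real (Suc i))" unfolding powr_add[symmetric] by (simp add: add_ac)
      finally show "\<bar>?D (Suc i) (r\<^sup>2)\<bar> \<le> K' * real J * \<tau> * r powr (?d - 1 + real (Suc i)) + 2 ^ k * B / \<tau> ^ k * r powr ((?d - 1) / 2 + real (Suc i))"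
        using a by simp
    qed
  qed
  qed
qed

lemma discrepancy_bound_discrepancy:
  assumes J: "real J \<ge> 2 * real CARD('n::finite)" and "i \<le> J"
  shows "discrepancy_bound CARD('n) i (discrepancy TYPE('n) i)"
  using assms(2) by (induction i) (auto intro: discrepancy_bound_0[OF J] discrepancy_bound_Suc[OF J])

lemma discrepancy_bigo:
  assumes "real J \<ge> 2 * real CARD('n::finite)" "i \<le> J"
  shows "(\<lambda>r. discrepancy TYPE('n) i (r\<^sup>2)) \<in> O(\<lambda>r. r powr (real CARD('n) - 1 + real i))"
proof -
  obtain K r0 where O: "K \<ge> 0" "r0 \<ge> 1" "\<And>r. r \<ge> r0 \<Longrightarrow> \<bar>discrepancy TYPE('n) i (r\<^sup>2)\<bar> \<le> K * r powr (real CARD('n) - 1 + real i)"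
    using discrepancy_bound_imp_O[OF discrepancy_bound_discrepancy[OF assms]] by (metis One_nat_def Suc_leI zero_less_card_finite)
  show ?thesis
    by (rule bigoI[where c = K]) (use O(3) in \<open>auto intro!: eventually_mono[OF eventually_ge_at_top[of r0]]\<close>)
qed

text \<open>For d \<ge> 2 the second term of the bound has the smaller exponent, (d-1)/2 + i against
  d - 1 + i, so it vanishes in the limit once \<tau> has been fixed to make the first term
  small.\<close>

lemma discrepancy_smallo:
  assumes "real J \<ge> 2 * real CARD('n::finite)" "i \<le> J" and d: "CARD('n) \<ge> 2"
  shows "(\<lambda>r. discrepancy TYPE('n) i (r\<^sup>2)) \<in> o(\<lambda>r. r powr (real CARD('n) - 1 + real i))"
proof (rule landau_o.smallI)
  fix c :: real assume c: "c > 0"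
  let ?d = "real CARD('n)"
  obtain C r0 where C: "C \<ge> 0" "r0 \<ge> 1"
    "\<And>\<tau>. 0 < \<tau> \<Longrightarrow> \<tau> \<le> 1 \<Longrightarrow> \<exists>C'\<ge>0. \<forall>r\<ge>r0. \<bar>discrepancy TYPE('n) i (r\<^sup>2)\<bar> \<le> C * \<tau> * r powr (?d - 1 + real i) + C' * r powr ((?d - 1) / 2 + real i)"
    using discrepancy_bound_discrepancy[OF assms(1,2)] unfolding discrepancy_bound_def by metis
  define \<tau> where "\<tau> = min 1 (c / (2 * (C + 1)))"
  have \<tau>: "0 < \<tau>" "\<tau> \<le> 1" using c C by (auto simp: \<tau>_def)
  have "C * \<tau> \<le> C * (c / (2 * (C + 1)))" using C by (intro mult_left_mono) (auto simp: \<tau>_def)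
  also have "\<dots> \<le> c / 2" using c C by (simp add: field_simps)
  finally have C\<tau>: "C * \<tau> \<le> c / 2" .
  obtain C' where C': "C' \<ge> 0" "\<And>r. r \<ge> r0 \<Longrightarrow> \<bar>discrepancy TYPE('n) i (r\<^sup>2)\<bar> \<le> C * \<tau> * r powr (?d - 1 + real i) + C' * r powr ((?d - 1) / 2 + real i)"
    using C(3)[OF \<tau>] by metis
  have "((\<lambda>r. C' * r powr (- ((?d - 1) / 2))) \<longlongrightarrow> C' * 0) at_top"
    using d by (intro tendsto_mult_left tendsto_neg_powr filterlim_ident) auto
  then have "\<forall>\<^sub>F r in at_top. C' * r powr (- ((?d - 1) / 2)) < c / 2"
    using c by (intro order_tendstoD(2)) auto
  then show "\<forall>\<^sub>F r in at_top. norm (discrepancy TYPE('n) i (r\<^sup>2)) \<le> c * norm (r powr (?d - 1 + real i))"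
    using eventually_ge_at_top[of r0]
  proof eventually_elim
    case (elim r)
    have "C' * r powr ((?d - 1) / 2 + real i) = C' * r powr (- ((?d - 1) / 2)) * r powr (?d - 1 + real i)"
      unfolding mult.assoc powr_add[symmetric] by (simp add: field_simps)
    also have "\<dots> \<le> c / 2 * r powr (?d - 1 + real i)" using elim by (intro mult_right_mono) auto
    finally have "C' * r powr ((?d - 1) / 2 + real i) \<le> c / 2 * r powr (?d - 1 + real i)" .
    moreover have "C * \<tau> * r powr (?d - 1 + real i) \<le> c / 2 * r powr (?d - 1 + real i)" using C\<tau> by (intro mult_right_mono) auto
    ultimately show ?case using C'(2)[OF elim(2)] by simp
  qed
qed

section \<open>Partial summation\<close>

text \<open>Differentiating one summand raises the index of \<open>f\<close> or lowers that of
  \<open>W\<close>. With alternating signs neighbouring terms cancel and only the two ends survive;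
  \<open>w\<close> plays the part of \<open>W\<close> at index -1.\<close>

lemma DERIV_alternating_sum:
  fixes f W :: "nat \<Rightarrow> real \<Rightarrow> real"
  assumes f: "\<And>j. (f j has_real_derivative 2 * r * f (Suc j) r) (at r)"
    and W: "\<And>i. i < J \<Longrightarrow> (W (Suc i) has_real_derivative W i (r\<^sup>2)) (at (r\<^sup>2))" "(W 0 has_real_derivative w) (at (r\<^sup>2))"
  shows "((\<lambda>r. \<Sum>i\<le>J. (-1) ^ i * f i r * W i (r\<^sup>2)) has_real_derivative
           2 * r * (f 0 r * w + (-1) ^ J * f (Suc J) r * W J (r\<^sup>2))) (at r)"
  using W
proof (induction J)
  case 0
  have "((\<lambda>r. W 0 (r\<^sup>2)) has_real_derivative w * (2 * r)) (at r)"
    by (rule DERIV_chain2[where f = "W 0" and g = "\<lambda>r. r\<^sup>2", OF 0(2)]) (auto intro!: derivative_eq_intros)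
  from DERIV_mult[OF f[of 0] this] show ?case by (simp add: algebra_simps)
next
  case (Suc J)
  have "((\<lambda>r. W (Suc J) (r\<^sup>2)) has_real_derivative W J (r\<^sup>2) * (2 * r)) (at r)"
    by (rule DERIV_chain2[where f = "W (Suc J)" and g = "\<lambda>r. r\<^sup>2", OF Suc.prems(1)]) (auto intro!: derivative_eq_intros)
  from DERIV_cmult[OF DERIV_mult[OF f[of "Suc J"] this], of "(-1) ^ Suc J"]
  have 1: "((\<lambda>r. (-1) ^ Suc J * (f (Suc J) r * W (Suc J) (r\<^sup>2))) has_real_derivative
     (-1) ^ Suc J * (2 * r * f (Suc (Suc J)) r * W (Suc J) (r\<^sup>2) + W J (r\<^sup>2) * (2 * r) * f (Suc J) r)) (at r)" .
  have 2: "((\<lambda>r. \<Sum>i\<le>J. (-1) ^ i * f i r * W i (r\<^sup>2)) has_real_derivative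
           2 * r * (f 0 r * w + (-1) ^ J * f (Suc J) r * W J (r\<^sup>2))) (at r)"
    by (rule Suc.IH) (use Suc.prems in auto)
  from DERIV_add[OF 2 1] show ?case by (simp add: algebra_simps)
qed

section \<open>Chains of iterates of (1 / (2 r)) d/dr\<close>

context
  fixes f :: "nat \<Rightarrow> real \<Rightarrow> real" and J :: nat
  assumes f: "\<And>j r. (f j has_real_derivative 2 * r * f (Suc j) r) (at r)"
begin

lemma continuous_on_chain: "continuous_on S (f j)"
  by (rule DERIV_continuous_on[where D = "\<lambda>r. 2 * r * f (Suc j) r"]) (use f has_field_derivative_at_within in blast)

text \<open>Taylor's formula with integral remainder in the variable r^2, expanded at \<Lambda>^2
  and evaluated at \<rho>^2. The positive part extends the integral to [0, \<Lambda>], the same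
  interval for every \<rho>, so that the formula can be summed over lattice points.\<close>

lemma Taylor_chain:
  assumes \<rho>: "0 \<le> \<rho>" "\<rho> \<le> \<Lambda>" and J: "J \<ge> 1"
  shows "((\<lambda>r. 2 * r * f (Suc J) r * (max 0 (r\<^sup>2 - \<rho>\<^sup>2) ^ J / fact J)) has_integral
      (-1) ^ J * ((\<Sum>i\<le>J. (-1) ^ i * f i \<Lambda> * ((\<Lambda>\<^sup>2 - \<rho>\<^sup>2) ^ i / fact i)) - f 0 \<rho>)) {0..\<Lambda>}"
proof -
  define W where "W = (\<lambda>i s. (s - \<rho>\<^sup>2) ^ i / fact i :: real)"
  have W: "(W (Suc i) has_real_derivative W i s) (at s)" for i s
  proof -
    have "((\<lambda>s. (s - \<rho>\<^sup>2) ^ Suc i) has_real_derivative real (Suc i) * (s - \<rho>\<^sup>2) ^ i) (at s)"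
      by (rule DERIV_cong[OF DERIV_power_Suc[where D = 1]]) (auto intro!: derivative_eq_intros)
    from DERIV_cdivide[OF this, of "fact (Suc i)"] show ?thesis
      unfolding W_def by (simp add: field_simps del: of_nat_Suc)
  qed
  have W0: "(W 0 has_real_derivative 0) (at s)" for s unfolding W_def by simp
  let ?T = "\<lambda>r. \<Sum>i\<le>J. (-1) ^ i * f i r * W i (r\<^sup>2)"
  have der: "(?T has_real_derivative 2 * r * (f 0 r * 0 + (-1) ^ J * f (Suc J) r * W J (r\<^sup>2))) (at r)" for r
    by (rule DERIV_alternating_sum[where f = f and W = W and w = 0 and r = r and J = J]) (rule f W W0)+
  have der': "(?T has_vector_derivative 2 * r * (f 0 r * 0 + (-1) ^ J * f (Suc J) r * W J (r\<^sup>2))) (at r within S)" for r S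
    unfolding has_real_derivative_iff_has_vector_derivative[symmetric] by (rule has_field_derivative_at_within[OF der])
  have T\<rho>: "?T \<rho> = f 0 \<rho>"
  proof -
    have "?T \<rho> = (\<Sum>i\<le>J. if i = 0 then f 0 \<rho> else 0)" unfolding W_def by (intro sum.cong) auto
    then show ?thesis by simp
  qed
  have "((\<lambda>r. 2 * r * (f 0 r * 0 + (-1) ^ J * f (Suc J) r * W J (r\<^sup>2))) has_integral (?T \<Lambda> - ?T \<rho>)) {\<rho>..\<Lambda>}"
    by (rule fundamental_theorem_of_calculus[OF \<rho>(2) der'])
  from has_integral_mult_right[OF this, of "(-1) ^ J"]
  have "((\<lambda>r. 2 * r * f (Suc J) r * W J (r\<^sup>2)) has_integral (-1) ^ J * (?T \<Lambda> - f 0 \<rho>)) {\<rho>..\<Lambda>}"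
    unfolding T\<rho> by (simp add: mult_ac power_add[symmetric] mult_2[symmetric])
  then have 1: "((\<lambda>r. 2 * r * f (Suc J) r * (max 0 (r\<^sup>2 - \<rho>\<^sup>2) ^ J / fact J)) has_integral (-1) ^ J * (?T \<Lambda> - f 0 \<rho>)) {\<rho>..\<Lambda>}"
    by (rule has_integral_eq[rotated]) (use \<rho> in \<open>auto simp: W_def max_def power_mono\<close>)
  have 2: "((\<lambda>r. 2 * r * f (Suc J) r * (max 0 (r\<^sup>2 - \<rho>\<^sup>2) ^ J / fact J)) has_integral 0) {0..\<rho>}"
  proof (rule has_integral_is_0)
    fix r assume "r \<in> {0..\<rho>}"
    then have "r\<^sup>2 \<le> \<rho>\<^sup>2" by (intro power_mono) auto
    then show "2 * r * f (Suc J) r * (max 0 (r\<^sup>2 - \<rho>\<^sup>2) ^ J / fact J) = 0" using J by (simp add: max_def)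
  qed
  from has_integral_combine[OF \<rho> 2 1] show ?thesis by (simp add: W_def)
qed

text \<open>The Taylor formula summed over the points of the ball. At radius r the points beyond r
  have positive part 0, so the summed integrand is the lattice sum at r^2.\<close>

lemma lattice_partial_summation:
  assumes \<Lambda>: "\<Lambda> > 0" and J: "J \<ge> 1"
  shows "((\<lambda>r. 2 * r * f (Suc J) r * lattice_Riesz TYPE('n::finite) J (r\<^sup>2)) has_integral
      (-1) ^ J * ((\<Sum>i\<le>J. (-1) ^ i * f i \<Lambda> * lattice_Riesz TYPE('n) i (\<Lambda>\<^sup>2)) - (\<Sum>m | (m :: real ^ 'n) \<in> int_lattice \<and> norm m < \<Lambda>. f 0 (norm m)))) {0..\<Lambda>}"
proof -
  let ?F = "{m :: real ^ 'n. m \<in> int_lattice \<and> norm m < \<Lambda>}"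
  have fin: "finite ?F" by (rule finite_int_lattice_ball)
  have sq: "(norm m)\<^sup>2 < \<Lambda>\<^sup>2 \<longleftrightarrow> norm m < \<Lambda>" for m :: "real ^ 'n" using \<Lambda> by (auto intro: power_strict_mono dest: power_less_imp_less_base)
  have "((\<lambda>r. \<Sum>m\<in>?F. 2 * r * f (Suc J) r * (max 0 (r\<^sup>2 - (norm m)\<^sup>2) ^ J / fact J)) has_integral
     (\<Sum>m\<in>?F. (-1) ^ J * ((\<Sum>i\<le>J. (-1) ^ i * f i \<Lambda> * ((\<Lambda>\<^sup>2 - (norm m)\<^sup>2) ^ i / fact i)) - f 0 (norm m)))) {0..\<Lambda>}"
    by (intro has_integral_sum fin Taylor_chain J) auto
  moreover have "(\<Sum>m\<in>?F. (-1) ^ J * ((\<Sum>i\<le>J. (-1) ^ i * f i \<Lambda> * ((\<Lambda>\<^sup>2 - (norm m)\<^sup>2) ^ i / fact i)) - f 0 (norm m)))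
     = (-1) ^ J * ((\<Sum>i\<le>J. (-1) ^ i * f i \<Lambda> * lattice_Riesz TYPE('n) i (\<Lambda>\<^sup>2)) - (\<Sum>m\<in>?F. f 0 (norm m)))"
  proof -
    have "(\<Sum>m\<in>?F. \<Sum>i\<le>J. (-1) ^ i * f i \<Lambda> * ((\<Lambda>\<^sup>2 - (norm m)\<^sup>2) ^ i / fact i)) = (\<Sum>i\<le>J. (-1) ^ i * f i \<Lambda> * lattice_Riesz TYPE('n) i (\<Lambda>\<^sup>2))"
      unfolding lattice_Riesz_def sq by (subst sum.swap) (simp only: sum_distrib_left)
    then show ?thesis by (simp only: sum_distrib_left[symmetric] sum_subtractf)
  qed
  ultimately have "((\<lambda>r. \<Sum>m\<in>?F. 2 * r * f (Suc J) r * (max 0 (r\<^sup>2 - (norm m)\<^sup>2) ^ J / fact J)) has_integral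
     (-1) ^ J * ((\<Sum>i\<le>J. (-1) ^ i * f i \<Lambda> * lattice_Riesz TYPE('n) i (\<Lambda>\<^sup>2)) - (\<Sum>m\<in>?F. f 0 (norm m)))) {0..\<Lambda>}" by simp
  then show ?thesis
  proof (rule has_integral_eq[rotated])
    fix r assume "r \<in> {0..\<Lambda>}"
    then have "r\<^sup>2 \<le> \<Lambda>\<^sup>2" by (intro power_mono) auto
    then show "(\<Sum>m\<in>?F. 2 * r * f (Suc J) r * (max 0 (r\<^sup>2 - (norm m)\<^sup>2) ^ J / fact J)) = 2 * r * f (Suc J) r * lattice_Riesz TYPE('n) J (r\<^sup>2)"
      using lattice_Riesz_pos_part[of "r\<^sup>2" "\<Lambda>\<^sup>2" J, where 'n = 'n] J by (simp only: sq sum_distrib_left)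
  qed
qed

text \<open>The integral starts at 1 because the derivatives of the volume terms are taken only at s
  > 0. The values at 1 will go into a constant.\<close>

lemma volume_partial_summation:
  assumes \<Lambda>: "\<Lambda> \<ge> 1" and w: "\<And>s. s > 0 \<Longrightarrow> (volume_Riesz d 0 has_real_derivative w s) (at s)"
  shows "((\<lambda>r. 2 * r * (f 0 r * w (r\<^sup>2) + (-1) ^ J * f (Suc J) r * volume_Riesz d J (r\<^sup>2))) has_integral
      (\<Sum>i\<le>J. (-1) ^ i * f i \<Lambda> * volume_Riesz d i (\<Lambda>\<^sup>2)) - (\<Sum>i\<le>J. (-1) ^ i * f i 1 * volume_Riesz d i (1\<^sup>2))) {1..\<Lambda>}"
proof (rule fundamental_theorem_of_calculus[OF \<Lambda>])
  fix r assume "r \<in> {1..\<Lambda>}"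
  then have "r\<^sup>2 > 0" by simp
  have "((\<lambda>r. \<Sum>i\<le>J. (-1) ^ i * f i r * volume_Riesz d i (r\<^sup>2)) has_real_derivative
      2 * r * (f 0 r * w (r\<^sup>2) + (-1) ^ J * f (Suc J) r * volume_Riesz d J (r\<^sup>2))) (at r)"
    by (rule DERIV_alternating_sum[where f = f and W = "volume_Riesz d" and w = "w (r\<^sup>2)" and r = r and J = J])
      (rule f DERIV_volume_Riesz[OF \<open>r\<^sup>2 > 0\<close>] w[OF \<open>r\<^sup>2 > 0\<close>])+
  then show "((\<lambda>r. \<Sum>i\<le>J. (-1) ^ i * f i r * volume_Riesz d i (r\<^sup>2)) has_vector_derivative
      2 * r * (f 0 r * w (r\<^sup>2) + (-1) ^ J * f (Suc J) r * volume_Riesz d J (r\<^sup>2))) (at r within {1..\<Lambda>})"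
    unfolding has_real_derivative_iff_has_vector_derivative[symmetric] by (rule has_field_derivative_at_within)
qed

text \<open>Difference of the lattice and the volume identity. \<open>K\<close> absorbs everything
  independent of \<Lambda>; it stays implicit, since the resulting limit is determined later by
  averaging.\<close>

lemma discrepancy_partial_summation:
  assumes J: "J \<ge> 2" and w: "\<And>s. s > 0 \<Longrightarrow> (volume_Riesz CARD('n::finite) 0 has_real_derivative w s) (at s)" and wc: "continuous_on {0<..} w"
  obtains K where "\<And>\<Lambda>. \<Lambda> \<ge> 1 \<Longrightarrow> (\<Sum>m | (m :: real ^ 'n) \<in> int_lattice \<and> norm m < \<Lambda>. f 0 (norm m))
     = K + (\<Sum>i\<le>J. (-1) ^ i * f i \<Lambda> * discrepancy TYPE('n) i (\<Lambda>\<^sup>2)) + integral {1..\<Lambda>} (\<lambda>r. 2 * r * (f 0 r * w (r\<^sup>2)))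
       - (-1) ^ J * integral {1..\<Lambda>} (\<lambda>r. 2 * r * (f (Suc J) r * discrepancy TYPE('n) J (r\<^sup>2)))"
proof -
  obtain j where j: "J = Suc (Suc j)" using J by (metis Suc_le_D numeral_2_eq_2 Suc_le_mono)
  let ?n = "\<lambda>r. 2 * r * f (Suc J) r * lattice_Riesz TYPE('n) J (r\<^sup>2)"
  define K where "K = (\<Sum>i\<le>J. (-1) ^ i * f i 1 * volume_Riesz CARD('n) i (1\<^sup>2)) - (-1) ^ J * integral {0..1} ?n"
  have cN: "continuous_on S (lattice_Riesz TYPE('n) J)" for S
    unfolding j by (rule DERIV_continuous_on) (rule has_field_derivative_at_within[OF DERIV_lattice_Riesz])
  have cN': "continuous_on S (\<lambda>r. lattice_Riesz TYPE('n) J (r\<^sup>2))" for S :: "real set"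
    by (rule continuous_on_compose2[OF cN[of UNIV]]) (auto intro!: continuous_intros)
  have cV: "continuous_on {0<..} (volume_Riesz CARD('n) J)"
    unfolding j by (rule DERIV_continuous_on) (rule has_field_derivative_at_within[OF DERIV_volume_Riesz], simp)
  have cV': "continuous_on {1..\<Lambda>} (\<lambda>r. volume_Riesz CARD('n) J (r\<^sup>2))" for \<Lambda> :: real
    by (rule continuous_on_compose2[OF cV]) (auto intro!: continuous_intros)
  have cw: "continuous_on {1..\<Lambda>} (\<lambda>r. w (r\<^sup>2))" for \<Lambda> :: real
    by (rule continuous_on_compose2[OF wc]) (auto intro!: continuous_intros)
  show thesis
  proof (rule that[of K])
    fix \<Lambda> :: real assume \<Lambda>: "\<Lambda> \<ge> 1"
    have iN: "?n integrable_on {0..\<Lambda>}" "?n integrable_on {1..\<Lambda>}"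
      by (intro integrable_continuous_real continuous_intros continuous_on_chain cN')+
    have iw: "(\<lambda>r. 2 * r * (f 0 r * w (r\<^sup>2))) integrable_on {1..\<Lambda>}"
      by (intro integrable_continuous_real continuous_intros continuous_on_chain cw)
    have iV: "(\<lambda>r. 2 * r * f (Suc J) r * volume_Riesz CARD('n) J (r\<^sup>2)) integrable_on {1..\<Lambda>}"
      by (intro integrable_continuous_real continuous_intros continuous_on_chain cV')
    have comb: "integral {0..\<Lambda>} ?n = integral {0..1} ?n + integral {1..\<Lambda>} ?n"
      using \<Lambda> iN by (intro Henstock_Kurzweil_Integration.integral_combine[symmetric]) auto
    have eN: "integral {0..\<Lambda>} ?n = (-1) ^ J * ((\<Sum>i\<le>J. (-1) ^ i * f i \<Lambda> * lattice_Riesz TYPE('n) i (\<Lambda>\<^sup>2)) - (\<Sum>m | (m :: real ^ 'n) \<in> int_lattice \<and> norm m < \<Lambda>. f 0 (norm m)))"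
      using \<Lambda> J by (intro integral_unique lattice_partial_summation) auto
    have eV: "(\<Sum>i\<le>J. (-1) ^ i * f i \<Lambda> * volume_Riesz CARD('n) i (\<Lambda>\<^sup>2)) - (\<Sum>i\<le>J. (-1) ^ i * f i 1 * volume_Riesz CARD('n) i (1\<^sup>2))
       = integral {1..\<Lambda>} (\<lambda>r. 2 * r * (f 0 r * w (r\<^sup>2))) + (-1) ^ J * integral {1..\<Lambda>} (\<lambda>r. 2 * r * f (Suc J) r * volume_Riesz CARD('n) J (r\<^sup>2))"
    proof -
      have "integral {1..\<Lambda>} (\<lambda>r. 2 * r * (f 0 r * w (r\<^sup>2) + (-1) ^ J * f (Suc J) r * volume_Riesz CARD('n) J (r\<^sup>2)))
         = integral {1..\<Lambda>} (\<lambda>r. 2 * r * (f 0 r * w (r\<^sup>2)) + (-1) ^ J * (2 * r * f (Suc J) r * volume_Riesz CARD('n) J (r\<^sup>2)))"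
        by (intro Henstock_Kurzweil_Integration.integral_cong) (simp add: algebra_simps)
      also have "\<dots> = integral {1..\<Lambda>} (\<lambda>r. 2 * r * (f 0 r * w (r\<^sup>2))) + (-1) ^ J * integral {1..\<Lambda>} (\<lambda>r. 2 * r * f (Suc J) r * volume_Riesz CARD('n) J (r\<^sup>2))"
        by (subst Henstock_Kurzweil_Integration.integral_add[OF iw integrable_on_mult_right[OF iV]]) simp
      finally show ?thesis using integral_unique[OF volume_partial_summation[OF \<Lambda> w]] by simp
    qed
    have eD: "integral {1..\<Lambda>} (\<lambda>r. 2 * r * (f (Suc J) r * discrepancy TYPE('n) J (r\<^sup>2)))
       = integral {1..\<Lambda>} ?n - integral {1..\<Lambda>} (\<lambda>r. 2 * r * f (Suc J) r * volume_Riesz CARD('n) J (r\<^sup>2))"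
      unfolding Henstock_Kurzweil_Integration.integral_diff[OF iN(2) iV, symmetric]
      by (intro Henstock_Kurzweil_Integration.integral_cong) (simp add: discrepancy_def algebra_simps)
    have sD: "(\<Sum>i\<le>J. (-1) ^ i * f i \<Lambda> * discrepancy TYPE('n) i (\<Lambda>\<^sup>2)) = (\<Sum>i\<le>J. (-1) ^ i * f i \<Lambda> * lattice_Riesz TYPE('n) i (\<Lambda>\<^sup>2)) - (\<Sum>i\<le>J. (-1) ^ i * f i \<Lambda> * volume_Riesz CARD('n) i (\<Lambda>\<^sup>2))"
      by (simp only: discrepancy_def right_diff_distrib sum_subtractf)
    have sg: "(-1) ^ J * ((-1) ^ J * x) = (x::real)" for x by (simp add: mult.assoc[symmetric] power_add[symmetric] mult_2[symmetric])
    have "(\<Sum>m | (m :: real ^ 'n) \<in> int_lattice \<and> norm m < \<Lambda>. f 0 (norm m)) = (\<Sum>i\<le>J. (-1) ^ i * f i \<Lambda> * lattice_Riesz TYPE('n) i (\<Lambda>\<^sup>2)) - (-1) ^ J * integral {0..\<Lambda>} ?n"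
      unfolding eN sg by simp
    then show "(\<Sum>m | (m :: real ^ 'n) \<in> int_lattice \<and> norm m < \<Lambda>. f 0 (norm m))
     = K + (\<Sum>i\<le>J. (-1) ^ i * f i \<Lambda> * discrepancy TYPE('n) i (\<Lambda>\<^sup>2)) + integral {1..\<Lambda>} (\<lambda>r. 2 * r * (f 0 r * w (r\<^sup>2)))
       - (-1) ^ J * integral {1..\<Lambda>} (\<lambda>r. 2 * r * (f (Suc J) r * discrepancy TYPE('n) J (r\<^sup>2)))"
      using eV unfolding sD eD comb K_def by (simp add: algebra_simps)
  qed
qed

end

section \<open>Oscillatory integrals at infinity\<close>

lemma tendsto_at_top_of_Cauchy_bound:
  fixes I :: "real \<Rightarrow> real"
  assumes e: "e > 0" and C: "\<And>x y. R \<le> x \<Longrightarrow> x \<le> y \<Longrightarrow> \<bar>I y - I x\<bar> \<le> C * x powr - e"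
  obtains L where "(I \<longlongrightarrow> L) at_top"
proof -
  have lim: "((\<lambda>x. C * x powr - e) \<longlongrightarrow> 0) at_top"
    using tendsto_mult_left[OF tendsto_neg_powr[OF _ filterlim_ident, of "-e"], of C] e by simp
  have "Cauchy (\<lambda>n. I (real n))"
  proof (rule CauchyI)
    fix \<epsilon> :: real assume "\<epsilon> > 0"
    then have "\<forall>\<^sub>F x in at_top. C * x powr - e < \<epsilon>" by (rule order_tendstoD(2)[OF lim])
    then obtain X where X: "\<And>x. x \<ge> X \<Longrightarrow> C * x powr - e < \<epsilon>" unfolding eventually_at_top_linorder by blast
    obtain M where M: "real M \<ge> max X R" using real_arch_simple by blast
    have *: "norm (I (real m) - I (real n)) < \<epsilon>" if "M \<le> n" "n \<le> m" for m n
      using C[of "real n" "real m"] X[of "real n"] that M by (auto simp: le_less_trans)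
    show "\<exists>M. \<forall>m\<ge>M. \<forall>n\<ge>M. norm (I (real m) - I (real n)) < \<epsilon>"
    proof (intro exI[of _ M] allI impI)
      fix m n assume "M \<le> m" "M \<le> n"
      then show "norm (I (real m) - I (real n)) < \<epsilon>"
        using *[of n m] *[of m n] by (cases "n \<le> m") (auto simp: norm_minus_commute)
    qed
  qed
  then obtain L where L: "(\<lambda>n. I (real n)) \<longlonglongrightarrow> L" using Cauchy_convergent convergent_def by blast
  have "\<forall>\<^sub>F x in at_top. norm (I x - L) \<le> norm (C * x powr - e)"
  proof (rule eventually_mono[OF eventually_ge_at_top[of R]])
    fix x assume x: "R \<le> x"
    have "(\<lambda>n. \<bar>I (real n) - I x\<bar>) \<longlonglongrightarrow> \<bar>L - I x\<bar>" by (intro tendsto_intros L)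
    moreover have "\<forall>\<^sub>F n in sequentially. \<bar>I (real n) - I x\<bar> \<le> C * x powr - e"
    proof -
      obtain M where "real M \<ge> x" using real_arch_simple by blast
      then show ?thesis by (intro eventually_sequentiallyI[of M] C[OF x]) auto
    qed
    ultimately have "\<bar>L - I x\<bar> \<le> C * x powr - e" by (intro tendsto_upperbound) auto
    then show "norm (I x - L) \<le> norm (C * x powr - e)" by (simp add: abs_minus_commute)
  qed
  then have "((\<lambda>x. I x - L) \<longlongrightarrow> 0) at_top" by (rule Lim_transform_bound[OF _ lim])
  then have "(I \<longlongrightarrow> L) at_top" by (rule LIM_zero_cancel)
  then show thesis by (rule that)
qed

lemma DERIV_powr_osc:
  fixes c :: complex and \<omega> p r :: real
  assumes r: "r > 0" and \<omega>: "\<omega> \<noteq> 0"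
  shows "((\<lambda>r. r powr p * Re (c * cis (\<omega> * r) / (\<i> * \<omega>))) has_real_derivative
     r powr p * Re (c * cis (\<omega> * r)) + p * r powr (p - 1) * Re (c * cis (\<omega> * r) / (\<i> * \<omega>))) (at r)"
proof -
  have e: "Re (c * cis (\<omega> * r) / (\<i> * \<omega>)) = (Re c * sin (\<omega> * r) + Im c * cos (\<omega> * r)) / \<omega>" for r
  proof -
    have "c * cis (\<omega> * r) / (\<i> * \<omega>) = - \<i> * (c * cis (\<omega> * r)) / \<omega>" using \<omega> by (simp add: field_simps)
    then show ?thesis using \<omega> by (simp add: Re_divide_of_real) (simp add: field_simps)
  qed
  have "((\<lambda>r. (Re c * sin (\<omega> * r) + Im c * cos (\<omega> * r)) / \<omega>) has_real_derivative Re (c * cis (\<omega> * r))) (at r)"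
    using \<omega> by (auto intro!: derivative_eq_intros simp: field_simps)
  from DERIV_mult[OF has_real_derivative_powr[OF r, of p] this]
  show ?thesis unfolding e by (simp add: algebra_simps)
qed

text \<open>Integration by parts yields decay for every p < 0, even where r^p is not integrable at
  infinity. The remaining integral of |p| r^(p-1) equals x^p - y^p, which combines with the boundary
  terms to the factor 2.\<close>

lemma osc_integral_bound:
  fixes c :: complex and \<omega> p x y :: real
  assumes x: "0 < x" "x \<le> y" and \<omega>: "\<omega> \<noteq> 0" and p: "p < 0"
  shows "\<bar>integral {x..y} (\<lambda>r. r powr p * Re (c * cis (\<omega> * r)))\<bar> \<le> 2 * norm c / \<bar>\<omega>\<bar> * x powr p"
proof -
  let ?F = "\<lambda>r. r powr p * Re (c * cis (\<omega> * r) / (\<i> * \<omega>))"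
  let ?h = "\<lambda>r. p * r powr (p - 1) * Re (c * cis (\<omega> * r) / (\<i> * \<omega>))"
  let ?g = "\<lambda>r. r powr p * Re (c * cis (\<omega> * r))"
  let ?B = "norm c / \<bar>\<omega>\<bar>"
  have b: "\<bar>Re (c * cis (\<omega> * r) / (\<i> * \<omega>))\<bar> \<le> ?B" for r
    using abs_Re_le_cmod[of "c * cis (\<omega> * r) / (\<i> * \<omega>)"] by (simp add: norm_divide norm_mult)
  have 1: "((\<lambda>r. ?g r + ?h r) has_integral (?F y - ?F x)) {x..y}"
  proof (rule fundamental_theorem_of_calculus[OF x(2)])
    fix r assume "r \<in> {x..y}"
    then have "r > 0" using x by simp
    then show "(?F has_vector_derivative ?g r + ?h r) (at r within {x..y})"
      unfolding has_real_derivative_iff_has_vector_derivative[symmetric]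
      by (rule has_field_derivative_at_within[OF DERIV_powr_osc[OF _ \<omega>]])
  qed
  have ih: "?h integrable_on {x..y}" using x \<omega>
    by (intro integrable_continuous_real continuous_intros) auto
  have ig: "?g integrable_on {x..y}" using x
    by (intro integrable_continuous_real continuous_intros) auto
  have 2: "((\<lambda>r. - p * r powr (p - 1) * ?B) has_integral ((- (y powr p)) * ?B - (- (x powr p)) * ?B)) {x..y}"
  proof (rule fundamental_theorem_of_calculus[OF x(2)])
    fix r assume "r \<in> {x..y}"
    then have "((\<lambda>r. - (r powr p) * ?B) has_real_derivative - (p * r powr (p - 1)) * ?B) (at r)"
      using x by (intro DERIV_cmult_right DERIV_minus has_real_derivative_powr) auto
    from has_field_derivative_at_within[OF this] show "((\<lambda>r. (- (r powr p)) * ?B) has_vector_derivative - p * r powr (p - 1) * ?B) (at r within {x..y})"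
      unfolding has_real_derivative_iff_has_vector_derivative[symmetric] by simp
  qed
  have "norm (integral {x..y} ?h) \<le> integral {x..y} (\<lambda>r. - p * r powr (p - 1) * ?B)"
  proof (rule Henstock_Kurzweil_Integration.integral_norm_bound_integral[OF ih])
    show "(\<lambda>r. - p * r powr (p - 1) * ?B) integrable_on {x..y}" using 2 by blast
    fix r assume "r \<in> {x..y}"
    have "\<bar>p\<bar> * r powr (p - 1) * \<bar>Re (c * cis (\<omega> * r) / (\<i> * \<omega>))\<bar> \<le> \<bar>p\<bar> * r powr (p - 1) * ?B"
      by (intro mult_left_mono b) auto
    then show "norm (?h r) \<le> - p * r powr (p - 1) * ?B" using p by (simp add: abs_mult)
  qed
  also have "\<dots> = x powr p * ?B - y powr p * ?B" unfolding integral_unique[OF 2] by argo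
  finally have 3: "\<bar>integral {x..y} ?h\<bar> \<le> x powr p * ?B - y powr p * ?B" unfolding real_norm_def .
  have "integral {x..y} ?g + integral {x..y} ?h = ?F y - ?F x"
    using integral_unique[OF 1] unfolding Henstock_Kurzweil_Integration.integral_add[OF ig ih] .
  moreover have "\<bar>?F y\<bar> \<le> y powr p * ?B" "\<bar>?F x\<bar> \<le> x powr p * ?B"
    unfolding abs_mult abs_of_nonneg[OF powr_ge_zero] by (intro mult_left_mono b powr_ge_zero)+
  ultimately have "\<bar>integral {x..y} ?g\<bar> \<le> 2 * (x powr p * ?B)" using 3 by linarith
  then show ?thesis by (simp add: mult_ac)
qed

section \<open>Convergence of the remainder integral\<close>

lemma Re_mult_Re: "Re u * Re v = (Re (u * v) + Re (u * cnj v)) / 2"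
  by simp

text \<open>The product of the two oscillations splits into frequencies s + \<omega> and s -
  \<omega>, both at distance at least 1 from 0, so integration by parts applies to each. The error
  r^(p-1) is absolutely integrable because p < 0.\<close>

lemma osc_product_integral_bound:
  fixes b c :: complex and g :: "real \<Rightarrow> real"
  assumes x: "0 < x" "x \<le> y" and p: "p < 0" and \<omega>: "\<bar>s + \<omega>\<bar> \<ge> 1" "\<bar>s - \<omega>\<bar> \<ge> 1" and gc: "continuous_on {x..y} g"
    and g: "\<And>r. r \<in> {x..y} \<Longrightarrow> \<bar>g r - A * r powr p * (Re (cis (\<omega> * r) * b) * Re (cis (s * r) * c))\<bar> \<le> B * r powr (p - 1)"
  shows "\<bar>integral {x..y} g\<bar> \<le> (2 * \<bar>A\<bar> * norm b * norm c + \<bar>B\<bar> / \<bar>p\<bar>) * x powr p"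
proof -
  let ?m1 = "\<lambda>r. r powr p * Re ((b * c) * cis ((s + \<omega>) * r))"
  let ?m2 = "\<lambda>r. r powr p * Re ((cnj b * c) * cis ((s - \<omega>) * r))"
  let ?m = "\<lambda>r. A * r powr p * (Re (cis (\<omega> * r) * b) * Re (cis (s * r) * c))"
  have m: "?m r = A / 2 * ?m1 r + A / 2 * ?m2 r" for r
  proof -
    have cis_sum: "cis ((s + \<omega>) * r) = cis (s * r) * cis (\<omega> * r)" "cis ((s - \<omega>) * r) = cis (s * r) * cnj (cis (\<omega> * r))"
      by (simp_all add: cis_cnj cis_mult left_diff_distrib distrib_right)
    have 1: "(b * c) * cis ((s + \<omega>) * r) = (cis (s * r) * c) * (cis (\<omega> * r) * b)"
      unfolding cis_sum by (simp only: mult_ac)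
    have 2: "(cnj b * c) * cis ((s - \<omega>) * r) = (cis (s * r) * c) * cnj (cis (\<omega> * r) * b)"
      unfolding cis_sum complex_cnj_mult by (simp only: mult_ac)
    show ?thesis unfolding 1 2 using Re_mult_Re[of "cis (s * r) * c" "cis (\<omega> * r) * b"] by (simp add: algebra_simps add_divide_distrib)
  qed
  have c1: "?m1 integrable_on {x..y}" "?m2 integrable_on {x..y}"
    using x by (intro integrable_continuous_real continuous_intros; auto)+
  have cm: "?m integrable_on {x..y}" using x by (intro integrable_continuous_real continuous_intros; auto)
  have gi: "g integrable_on {x..y}" by (rule integrable_continuous_real[OF gc])
  have eq: "integral {x..y} ?m = A / 2 * integral {x..y} ?m1 + A / 2 * integral {x..y} ?m2"
    unfolding m Henstock_Kurzweil_Integration.integral_add[OF integrable_on_mult_right[OF c1(1)] integrable_on_mult_right[OF c1(2)]]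
    by (simp only: Henstock_Kurzweil_Integration.integral_mult_right)
  have b1: "\<bar>integral {x..y} ?m1\<bar> \<le> 2 * (norm b * norm c) * x powr p"
  proof -
    have "\<bar>integral {x..y} ?m1\<bar> \<le> 2 * norm (b * c) / \<bar>s + \<omega>\<bar> * x powr p"
      using \<omega>(1) by (intro osc_integral_bound x p) auto
    also have "\<dots> \<le> 2 * norm (b * c) / 1 * x powr p" using \<omega>(1) by (intro mult_right_mono divide_left_mono) auto
    finally show ?thesis by (simp add: norm_mult)
  qed
  have b2: "\<bar>integral {x..y} ?m2\<bar> \<le> 2 * (norm b * norm c) * x powr p"
  proof -
    have "\<bar>integral {x..y} ?m2\<bar> \<le> 2 * norm (cnj b * c) / \<bar>s - \<omega>\<bar> * x powr p"
      using \<omega>(2) by (intro osc_integral_bound x p) auto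
    also have "\<dots> \<le> 2 * norm (cnj b * c) / 1 * x powr p" using \<omega>(2) by (intro mult_right_mono divide_left_mono) auto
    finally show ?thesis by (simp add: norm_mult)
  qed
  have bm: "\<bar>integral {x..y} ?m\<bar> \<le> 2 * \<bar>A\<bar> * norm b * norm c * x powr p"
  proof -
    have "\<bar>integral {x..y} ?m\<bar> \<le> \<bar>A\<bar> / 2 * \<bar>integral {x..y} ?m1\<bar> + \<bar>A\<bar> / 2 * \<bar>integral {x..y} ?m2\<bar>"
      unfolding eq by (rule order_trans[OF abs_triangle_ineq]) (simp add: abs_mult)
    also have "\<dots> \<le> \<bar>A\<bar> / 2 * (2 * (norm b * norm c) * x powr p) + \<bar>A\<bar> / 2 * (2 * (norm b * norm c) * x powr p)"
      by (intro add_mono mult_left_mono b1 b2) auto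
    finally show ?thesis by (simp add: algebra_simps)
  qed
  have h: "((\<lambda>r. \<bar>B\<bar> * r powr (p - 1)) has_integral (\<bar>B\<bar> / p * y powr p - \<bar>B\<bar> / p * x powr p)) {x..y}"
  proof (rule fundamental_theorem_of_calculus[OF x(2)])
    fix r assume "r \<in> {x..y}"
    then have "((\<lambda>r. \<bar>B\<bar> / p * r powr p) has_real_derivative \<bar>B\<bar> / p * (p * r powr (p - 1))) (at r)"
      using x by (intro DERIV_cmult has_real_derivative_powr) auto
    from has_field_derivative_at_within[OF this] show "((\<lambda>r. \<bar>B\<bar> / p * r powr p) has_vector_derivative \<bar>B\<bar> * r powr (p - 1)) (at r within {x..y})"
      unfolding has_real_derivative_iff_has_vector_derivative[symmetric] using p by simp
  qed
  have "norm (integral {x..y} (\<lambda>r. g r - ?m r)) \<le> integral {x..y} (\<lambda>r. \<bar>B\<bar> * r powr (p - 1))"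
  proof (rule Henstock_Kurzweil_Integration.integral_norm_bound_integral)
    show "(\<lambda>r. g r - ?m r) integrable_on {x..y}" by (rule Henstock_Kurzweil_Integration.integrable_diff[OF gi cm])
    show "(\<lambda>r. \<bar>B\<bar> * r powr (p - 1)) integrable_on {x..y}" using h by blast
    fix r assume r: "r \<in> {x..y}"
    have "B * r powr (p - 1) \<le> \<bar>B\<bar> * r powr (p - 1)" by (intro mult_right_mono) auto
    with g[OF r] show "norm (g r - ?m r) \<le> \<bar>B\<bar> * r powr (p - 1)" by (simp only: real_norm_def)
  qed
  also have "\<dots> \<le> \<bar>B\<bar> / \<bar>p\<bar> * x powr p"
    unfolding integral_unique[OF h] using p by (simp add: divide_nonneg_neg mult_nonpos_nonneg)
  finally have "\<bar>integral {x..y} g - integral {x..y} ?m\<bar> \<le> \<bar>B\<bar> / \<bar>p\<bar> * x powr p"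
    unfolding Henstock_Kurzweil_Integration.integral_diff[OF gi cm] real_norm_def .
  with bm show ?thesis unfolding distrib_right by linarith
qed

text \<open>The power of s is kept explicit in main term and error, because s will run over the
  values 2 pi |k| and the estimates have to be summed over k.\<close>

lemma bess_product_asymp:
  assumes p: "p1 > -1" "p2 > -1" and \<omega>: "\<omega> > 0"
  obtains C where "C \<ge> 0"
    "\<And>s r. s \<ge> 1 \<Longrightarrow> r \<ge> 2 \<Longrightarrow> \<omega> * r \<ge> 2 \<Longrightarrow>
      \<bar>bess p1 (\<omega> * r) * bess p2 (s * r) - \<omega> powr (- p1 - 1) * s powr (- p2 - 1) * r powr (- p1 - p2 - 2) *
        (Re (cis (\<omega> * r) * bess_lead p1) * Re (cis (s * r) * bess_lead p2))\<bar> \<le> C * s powr (- p2 - 1) * r powr (- p1 - p2 - 3)"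
proof -
  obtain C1 where C1: "C1 \<ge> 0" "\<And>z. z \<ge> 2 \<Longrightarrow> \<bar>bess p1 z - z powr (- p1 - 1) * Re (cis z * bess_lead p1)\<bar> \<le> C1 * z powr (- p1 - 2)"
    using bess_asymp1[OF p(1)] by metis
  obtain C2 where C2: "C2 \<ge> 0" "\<And>z. z \<ge> 2 \<Longrightarrow> \<bar>bess p2 z - z powr (- p2 - 1) * Re (cis z * bess_lead p2)\<bar> \<le> C2 * z powr (- p2 - 2)"
    using bess_asymp1[OF p(2)] by metis
  obtain C3 where C3: "C3 \<ge> 0" "\<And>z. z > 0 \<Longrightarrow> \<bar>bess p2 z\<bar> \<le> C3 * z powr (- p2 - 1)"
    using bess_decay[OF p(2)] by metis
  define C where "C = C1 * \<omega> powr (- p1 - 2) * C3 + \<omega> powr (- p1 - 1) * norm (bess_lead p1) * C2"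
  show thesis
  proof (rule that[of C])
    show "C \<ge> 0" using C1 C2 C3 by (simp add: C_def)
    fix s r :: real assume s: "s \<ge> 1" and r: "r \<ge> 2" "\<omega> * r \<ge> 2"
    have sr: "s * r \<ge> 2" using s r mult_mono[of 1 s 2 r] by simp
    let ?m1 = "(\<omega> * r) powr (- p1 - 1) * Re (cis (\<omega> * r) * bess_lead p1)"
    let ?m2 = "(s * r) powr (- p2 - 1) * Re (cis (s * r) * bess_lead p2)"
    have n1: "\<bar>?m1\<bar> \<le> (\<omega> * r) powr (- p1 - 1) * norm (bess_lead p1)"
    proof -
      have "\<bar>Re (cis (\<omega> * r) * bess_lead p1)\<bar> \<le> norm (bess_lead p1)"
        using abs_Re_le_cmod[of "cis (\<omega> * r) * bess_lead p1"] by (simp only: norm_mult norm_cis mult_1_left)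
      then show ?thesis unfolding abs_mult abs_of_nonneg[OF powr_ge_zero] by (intro mult_left_mono) auto
    qed
    have e: "bess p1 (\<omega> * r) * bess p2 (s * r) - ?m1 * ?m2 = (bess p1 (\<omega> * r) - ?m1) * bess p2 (s * r) + ?m1 * (bess p2 (s * r) - ?m2)"
      by (simp add: algebra_simps)
    have "\<bar>bess p1 (\<omega> * r) * bess p2 (s * r) - ?m1 * ?m2\<bar>
      \<le> (C1 * (\<omega> * r) powr (- p1 - 2)) * (C3 * (s * r) powr (- p2 - 1)) + ((\<omega> * r) powr (- p1 - 1) * norm (bess_lead p1)) * (C2 * (s * r) powr (- p2 - 2))"
      unfolding e by (rule order_trans[OF abs_triangle_ineq], unfold abs_mult[of "_ - _"] abs_mult[of ?m1])
        (intro add_mono mult_mono C1 C2 C3 n1; use sr r C1 C2 C3 in \<open>auto\<close>)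
    also have "(s * r) powr (- p2 - 2) = s powr (- p2 - 2) * r powr (- p2 - 2)" using s r by (simp add: powr_mult)
    also have "((\<omega> * r) powr (- p1 - 1) * norm (bess_lead p1)) * (C2 * (s powr (- p2 - 2) * r powr (- p2 - 2)))
      \<le> ((\<omega> * r) powr (- p1 - 1) * norm (bess_lead p1)) * (C2 * (s powr (- p2 - 1) * r powr (- p2 - 2)))"
      using s C2 by (intro mult_left_mono mult_right_mono powr_mono) auto
    also have "(C1 * (\<omega> * r) powr (- p1 - 2)) * (C3 * (s * r) powr (- p2 - 1)) + ((\<omega> * r) powr (- p1 - 1) * norm (bess_lead p1)) * (C2 * (s powr (- p2 - 1) * r powr (- p2 - 2)))
      = C1 * \<omega> powr (- p1 - 2) * C3 * s powr (- p2 - 1) * (r powr (- p1 - 2) * r powr (- p2 - 1))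
        + \<omega> powr (- p1 - 1) * norm (bess_lead p1) * C2 * s powr (- p2 - 1) * (r powr (- p1 - 1) * r powr (- p2 - 2))"
      using s r \<omega> by (simp add: powr_mult mult_ac)
    also have "r powr (- p1 - 2) * r powr (- p2 - 1) = r powr (- p1 - p2 - 3)"
      unfolding powr_add[symmetric] by (rule arg_cong[where f = "\<lambda>e. r powr e"]) simp
    also have "r powr (- p1 - 1) * r powr (- p2 - 2) = r powr (- p1 - p2 - 3)"
      unfolding powr_add[symmetric] by (rule arg_cong[where f = "\<lambda>e. r powr e"]) simp
    finally have main: "\<bar>bess p1 (\<omega> * r) * bess p2 (s * r) - ?m1 * ?m2\<bar> \<le> C * s powr (- p2 - 1) * r powr (- p1 - p2 - 3)"
      by (simp add: C_def algebra_simps)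
    have pr: "r powr (- p1 - p2 - 2) = r powr (- p1 - 1) * r powr (- p2 - 1)"
      unfolding powr_add[symmetric] by (rule arg_cong[where f = "\<lambda>e. r powr e"]) simp
    have pm: "(\<omega> * r) powr e = \<omega> powr e * r powr e" "(s * r) powr e = s powr e * r powr e" for e
      using s r \<omega> by (auto simp: powr_mult)
    have mm: "?m1 * ?m2 = \<omega> powr (- p1 - 1) * s powr (- p2 - 1) * r powr (- p1 - p2 - 2) *
        (Re (cis (\<omega> * r) * bess_lead p1) * Re (cis (s * r) * bess_lead p2))"
      unfolding pr pm by (simp only: mult_ac)
    show "\<bar>bess p1 (\<omega> * r) * bess p2 (s * r) - \<omega> powr (- p1 - 1) * s powr (- p2 - 1) * r powr (- p1 - p2 - 2) *
        (Re (cis (\<omega> * r) * bess_lead p1) * Re (cis (s * r) * bess_lead p2))\<bar> \<le> C * s powr (- p2 - 1) * r powr (- p1 - p2 - 3)"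
      using main unfolding mm .
  qed
qed

lemma bess_product_integral_bound:
  assumes p: "p1 > -1" "p2 > -1" and \<omega>: "\<omega> > 0" and q: "q - p1 - p2 - 2 < 0"
  obtains C where "C \<ge> 0"
    "\<And>s x y. s \<ge> 1 \<Longrightarrow> \<bar>s - \<omega>\<bar> \<ge> 1 \<Longrightarrow> x \<ge> max 2 (2 / \<omega>) \<Longrightarrow> x \<le> y \<Longrightarrow>
      \<bar>integral {x..y} (\<lambda>r. r powr q * (bess p1 (\<omega> * r) * bess p2 (s * r)))\<bar> \<le> C * s powr (- p2 - 1) * x powr (q - p1 - p2 - 2)"
proof -
  obtain C where C: "C \<ge> 0"
    "\<And>s r. s \<ge> 1 \<Longrightarrow> r \<ge> 2 \<Longrightarrow> \<omega> * r \<ge> 2 \<Longrightarrow>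
      \<bar>bess p1 (\<omega> * r) * bess p2 (s * r) - \<omega> powr (- p1 - 1) * s powr (- p2 - 1) * r powr (- p1 - p2 - 2) *
        (Re (cis (\<omega> * r) * bess_lead p1) * Re (cis (s * r) * bess_lead p2))\<bar> \<le> C * s powr (- p2 - 1) * r powr (- p1 - p2 - 3)"
    using bess_product_asymp[OF p \<omega>] by metis
  let ?q = "q - p1 - p2 - 2"
  define D where "D = 2 * \<omega> powr (- p1 - 1) * norm (bess_lead p1) * norm (bess_lead p2) + C / \<bar>?q\<bar>"
  show thesis
  proof (rule that[of D])
    show "D \<ge> 0" using C by (simp add: D_def)
    fix s x y :: real assume s: "s \<ge> 1" "\<bar>s - \<omega>\<bar> \<ge> 1" and x: "x \<ge> max 2 (2 / \<omega>)" "x \<le> y"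
    let ?A = "\<omega> powr (- p1 - 1) * s powr (- p2 - 1)"
    have "\<bar>integral {x..y} (\<lambda>r. r powr q * (bess p1 (\<omega> * r) * bess p2 (s * r)))\<bar>
       \<le> (2 * \<bar>?A\<bar> * norm (bess_lead p1) * norm (bess_lead p2) + \<bar>C * s powr (- p2 - 1)\<bar> / \<bar>?q\<bar>) * x powr ?q"
    proof (rule osc_product_integral_bound[where \<omega> = \<omega> and s = s])
      show "continuous_on {x..y} (\<lambda>r. r powr q * (bess p1 (\<omega> * r) * bess p2 (s * r)))"
        using x by (intro continuous_intros p) auto
      fix r assume "r \<in> {x..y}"
      then have r: "r \<ge> 2" "r \<ge> 2 / \<omega>" using x by auto
      then have r': "\<omega> * r \<ge> 2" using \<omega> by (simp add: field_simps)
      let ?g = "bess p1 (\<omega> * r) * bess p2 (s * r)"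
      let ?n = "Re (cis (\<omega> * r) * bess_lead p1) * Re (cis (s * r) * bess_lead p2)"
      have e1: "r powr q * r powr (- p1 - p2 - 2) = r powr ?q"
        unfolding powr_add[symmetric] by (rule arg_cong[where f = "\<lambda>e. r powr e"]) simp
      have e2: "r powr q * r powr (- p1 - p2 - 3) = r powr (?q - 1)"
        unfolding powr_add[symmetric] by (rule arg_cong[where f = "\<lambda>e. r powr e"]) simp
      have "\<bar>r powr q * ?g - ?A * r powr ?q * ?n\<bar> = r powr q * \<bar>?g - ?A * r powr (- p1 - p2 - 2) * ?n\<bar>"
      proof -
        have "r powr q * ?g - ?A * r powr ?q * ?n = r powr q * (?g - ?A * r powr (- p1 - p2 - 2) * ?n)"
          unfolding e1[symmetric] by (simp only: right_diff_distrib mult_ac)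
        then show ?thesis by (simp only: abs_mult abs_of_nonneg[OF powr_ge_zero])
      qed
      also have "\<dots> \<le> r powr q * (C * s powr (- p2 - 1) * r powr (- p1 - p2 - 3))"
        by (intro mult_left_mono C s r(1) r') auto
      also have "\<dots> = C * s powr (- p2 - 1) * r powr (?q - 1)" unfolding e2[symmetric] by (simp add: mult_ac)
      finally show "\<bar>r powr q * ?g - ?A * r powr ?q * ?n\<bar> \<le> C * s powr (- p2 - 1) * r powr (?q - 1)" .
    qed (use x s \<omega> q in auto)
    also have "\<dots> = D * s powr (- p2 - 1) * x powr ?q" using C by (simp add: D_def abs_mult algebra_simps)
    finally show "\<bar>integral {x..y} (\<lambda>r. r powr q * (bess p1 (\<omega> * r) * bess p2 (s * r)))\<bar> \<le> D * s powr (- p2 - 1) * x powr ?q" .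
  qed
qed

text \<open>Fubini on a bounded interval, where a summable majorant exists; the approach to infinity
  is controlled separately, by oscillation.\<close>

lemma integral_count_space_interchange:
  fixes h :: "'a \<Rightarrow> real \<Rightarrow> real"
  assumes A: "countable A" and xy: "x \<le> y" and c: "\<And>k. k \<in> A \<Longrightarrow> continuous_on {x..y} (h k)"
    and b: "\<And>k r. k \<in> A \<Longrightarrow> r \<in> {x..y} \<Longrightarrow> \<bar>h k r\<bar> \<le> w k" and w: "integrable (count_space A) w"
  shows "((\<lambda>r. LINT k|count_space A. h k r) has_integral (LINT k|count_space A. integral {x..y} (h k))) {x..y}"
proof -
  let ?g = "\<lambda>k r. indicator {x..y} r *\<^sub>R h k r"
  interpret C: sigma_finite_measure "count_space A" using A by (rule sigma_finite_measure_count_space_countable)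
  interpret P: pair_sigma_finite "count_space A" lborel by standard
  have si: "set_integrable lborel {x..y} (h k)" if "k \<in> A" for k
    by (rule borel_integrable_atLeastAtMost'[OF c[OF that]])
  then have gi: "integrable lborel (?g k)" if "k \<in> A" for k using that by (simp add: set_integrable_def)
  have gI: "(LINT r|lborel. ?g k r) = integral {x..y} (h k)" if "k \<in> A" for k
    using set_borel_integral_eq_integral(2)[OF si[OF that]] by (simp add: set_lebesgue_integral_def)
  have m: "case_prod ?g \<in> borel_measurable (count_space A \<Otimes>\<^sub>M lborel)"
    by (rule measurable_pair_measure_countable1[OF A]) (use gi in \<open>auto dest: borel_measurable_integrable\<close>)
  have gn: "(LINT r|lborel. norm (?g k r)) \<le> w k * (y - x)" if k: "k \<in> A" for k
  proof -
    have "(LINT r|lborel. norm (?g k r)) \<le> (LINT r|lborel. indicator {x..y} r *\<^sub>R w k)"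
    proof (rule integral_mono)
      show "integrable lborel (\<lambda>r. norm (?g k r))" by (intro integrable_norm gi k)
      show "integrable lborel (\<lambda>r. indicator {x..y} r *\<^sub>R w k)" by (intro integrable_scaleR_left integrable_real_indicator) (simp_all add: emeasure_lborel_Icc[OF xy])
      show "norm (?g k r) \<le> indicator {x..y} r *\<^sub>R w k" for r using b[OF k] by (auto simp: indicator_def)
    qed
    also have "\<dots> = w k * (y - x)" using xy by simp
    finally show ?thesis .
  qed
  have pi: "integrable (count_space A \<Otimes>\<^sub>M lborel) (case_prod ?g)"
  proof (rule P.Fubini_integrable[OF m])
    show "integrable (count_space A) (\<lambda>k. LINT r|lborel. norm (case_prod ?g (k, r)))"
    proof (rule Bochner_Integration.integrable_bound[where f = "\<lambda>k. w k * (y - x)"])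
      show "integrable (count_space A) (\<lambda>k. w k * (y - x))" using w by simp
      show "AE k in count_space A. norm (LINT r|lborel. norm (case_prod ?g (k, r))) \<le> norm (w k * (y - x))"
        using gn by (intro AE_I2) (auto intro: order_trans[OF _ abs_ge_self] simp: abs_of_nonneg[OF integral_nonneg])
    qed simp
    show "AE k in count_space A. integrable lborel (\<lambda>r. case_prod ?g (k, r))"
      using gi by (intro AE_I2) auto
  qed
  have e: "(LINT k|count_space A. ?g k r) = indicator {x..y} r *\<^sub>R (LINT k|count_space A. h k r)" for r
    by (auto simp: indicator_def)
  have "set_integrable lborel {x..y} (\<lambda>r. LINT k|count_space A. h k r)"
    using P.integrable_snd[OF pi] unfolding e set_integrable_def .
  moreover have "(LINT r:{x..y}|lborel. LINT k|count_space A. h k r) = (LINT k|count_space A. integral {x..y} (h k))"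
    unfolding set_lebesgue_integral_def e[symmetric] P.Fubini_integral[OF pi]
    by (intro Bochner_Integration.integral_cong refl gI) simp
  ultimately show ?thesis
    using set_borel_integral_eq_integral[of "{x..y}" "\<lambda>r. LINT k|count_space A. h k r"] by (simp add: has_integral_iff)
qed

text \<open>The iterates of the operator \<open>(1 / (2 r)) d/dr\<close> on \<open>U_hat\<close>.\<close>

definition U_chain :: "nat \<Rightarrow> real \<Rightarrow> real \<Rightarrow> nat \<Rightarrow> real \<Rightarrow> real" where
  "U_chain d \<beta> a j r = pi powr ((real d - 1) / 2) * Gamma (\<beta> + 1) * (- pi\<^sup>2) ^ j * a powr (2 * \<beta> + real d + 2 * real j)
     * bess (\<beta> + (real d - 1) / 2 + real j) (2 * pi * a * r)"

lemma U_chain_0: "U_chain d \<beta> a 0 r = U_hat d \<beta> a r"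
  by (simp add: U_chain_def U_hat_def)

text \<open>Each step raises the order of \<open>bess\<close> by one and, through the inner factor 2
  pi a, contributes -pi^2 a^2.\<close>

lemma DERIV_U_chain:
  assumes "\<beta> > -1" "a > 0" "d \<ge> 1"
  shows "(U_chain d \<beta> a j has_real_derivative 2 * r * U_chain d \<beta> a (Suc j) r) (at r)"
proof -
  let ?p = "\<beta> + (real d - 1) / 2 + real j"
  have p: "?p > -1" using assms by (simp add: field_simps)
  have "((\<lambda>r. bess ?p (2 * pi * a * r)) has_real_derivative (- ((2 * pi * a * r) / 2) * bess (?p + 1) (2 * pi * a * r)) * (2 * pi * a)) (at r)"
    by (rule DERIV_chain2[OF DERIV_bess[OF p]]) (auto intro!: derivative_eq_intros)
  from DERIV_cmult[OF this, of "pi powr ((real d - 1) / 2) * Gamma (\<beta> + 1) * (- pi\<^sup>2) ^ j * a powr (2 * \<beta> + real d + 2 * real j)"]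
  have 1: "(U_chain d \<beta> a j has_real_derivative pi powr ((real d - 1) / 2) * Gamma (\<beta> + 1) * (- pi\<^sup>2) ^ j * a powr (2 * \<beta> + real d + 2 * real j) *
     ((- ((2 * pi * a * r) / 2) * bess (?p + 1) (2 * pi * a * r)) * (2 * pi * a))) (at r)"
    unfolding U_chain_def[abs_def] .
  have pw: "a powr (2 * \<beta> + real d + 2 * real (Suc j)) = a powr (2 * \<beta> + real d + 2 * real j) * a\<^sup>2"
  proof -
    have "a powr (2 * \<beta> + real d + 2 * real (Suc j)) = a powr (2 * \<beta> + real d + 2 * real j) * a powr 2"
      unfolding powr_add[symmetric] by (rule arg_cong[where f = "\<lambda>e. a powr e"]) simp
    then show ?thesis using assms by simp
  qed
  have q: "\<beta> + (real d - 1) / 2 + real (Suc j) = ?p + 1" by simp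
  show ?thesis
    by (rule DERIV_cong[OF 1]) (unfold U_chain_def pw q power_Suc, simp add: power2_eq_square mult_ac)
qed

lemma U_chain_bound:
  assumes "\<beta> > -1" "a > 0" "d \<ge> 1"
  obtains C where "C \<ge> 0" "\<And>r. r > 0 \<Longrightarrow> \<bar>U_chain d \<beta> a j r\<bar> \<le> C * r powr (- (\<beta> + (real d - 1) / 2 + real j) - 1)"
proof -
  let ?p = "\<beta> + (real d - 1) / 2 + real j"
  have p: "?p > -1" using assms by (simp add: field_simps)
  obtain C where C: "C \<ge> 0" "\<And>z. z > 0 \<Longrightarrow> \<bar>bess ?p z\<bar> \<le> C * z powr (- ?p - 1)" using bess_decay[OF p] by metis
  let ?A = "\<bar>pi powr ((real d - 1) / 2) * Gamma (\<beta> + 1) * (- pi\<^sup>2) ^ j * a powr (2 * \<beta> + real d + 2 * real j)\<bar>"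
  show thesis
  proof (rule that[of "?A * (C * (2 * pi * a) powr (- ?p - 1))"])
    show "0 \<le> ?A * (C * (2 * pi * a) powr (- ?p - 1))" using C by simp
    fix r :: real assume r: "r > 0"
    have "\<bar>U_chain d \<beta> a j r\<bar> = ?A * \<bar>bess ?p (2 * pi * a * r)\<bar>" unfolding U_chain_def by (simp only: abs_mult)
    also have "\<dots> \<le> ?A * (C * (2 * pi * a * r) powr (- ?p - 1))" using r assms by (intro mult_left_mono C) auto
    also have "(2 * pi * a * r) powr (- ?p - 1) = (2 * pi * a) powr (- ?p - 1) * r powr (- ?p - 1)"
      by (rule powr_mult)
    finally show "\<bar>U_chain d \<beta> a j r\<bar> \<le> ?A * (C * (2 * pi * a) powr (- ?p - 1)) * r powr (- ?p - 1)" by (simp only: mult_ac)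
  qed
qed

lemma int_lattice_norm_ge_1:
  assumes "k \<in> int_lattice" "k \<noteq> 0" shows "norm (k :: real ^ 'n::finite) \<ge> 1"
proof -
  obtain i where i: "k $ i \<noteq> 0" using assms(2) by (auto simp: vec_eq_iff)
  obtain j where "k $ i = real_of_int j" using assms(1) by (auto simp: int_lattice_def Ints_def)
  then have "1 \<le> \<bar>k $ i\<bar>" using i by simp
  then show ?thesis using component_le_norm_cart[of k i] by linarith
qed

lemma continuous_on_discrepancy_square:
  assumes "J \<ge> 2" shows "continuous_on {1..y} (\<lambda>r. discrepancy TYPE('n::finite) J (r\<^sup>2))"
proof -
  obtain j where j: "J = Suc (Suc j)" using assms by (metis Suc_le_D numeral_2_eq_2 Suc_le_mono)
  have "continuous_on {0<..} (discrepancy TYPE('n) J)" unfolding j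
    by (rule DERIV_continuous_on) (rule has_field_derivative_at_within[OF DERIV_discrepancy], simp)
  then show ?thesis by (rule continuous_on_compose2) (auto intro!: continuous_intros)
qed

text \<open>For each k the integrand has size r^(-(1 + \<beta>)), whatever J is. For \<beta> \<le> 0
  this is not integrable at infinity, so cancellation is essential. The frequencies 2 pi |k| and 2
  pi a stay at least pi apart, which makes the Cauchy estimate uniform in k, with constants summable
  over the lattice.\<close>

lemma discrepancy_remainder_converges:
  fixes \<beta> a :: real
  assumes \<beta>: "\<beta> > -1" and a: "0 < a" "a < 1/2" and J: "real J \<ge> 2 * real CARD('n::finite)"
  obtains L where "((\<lambda>\<Lambda>. integral {1..\<Lambda>} (\<lambda>r. 2 * r * (U_chain CARD('n) \<beta> a (Suc J) r * discrepancy TYPE('n) J (r\<^sup>2)))) \<longlongrightarrow> L) at_top"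
proof -
  let ?d = "real CARD('n)"
  let ?L = "int_lattice - {0} :: (real ^ 'n) set"
  let ?f = "U_chain CARD('n) \<beta> a (Suc J)"
  let ?p1 = "\<beta> + (?d - 1) / 2 + real (Suc J)"
  let ?p2 = "real J + (?d - 1) / 2"
  let ?q = "2 * real J + ?d + 1"
  have d1: "CARD('n) \<ge> 1" by (simp add: Suc_leI)
  have p: "?p1 > -1" "?p2 > -1" using \<beta> real_CARD_ge_1[where 'n = 'n] by (auto simp: field_simps)
  have q: "?q - ?p1 - ?p2 - 2 = - (1 + \<beta>)" by (simp add: field_simps)
  define \<omega> where "\<omega> = 2 * pi * a"
  have \<omega>: "\<omega> > 0" using a by (simp add: \<omega>_def)
  have fc: "continuous_on S ?f" for S
    by (rule DERIV_continuous_on[where D = "\<lambda>r. 2 * r * U_chain CARD('n) \<beta> a (Suc (Suc J)) r"])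
      (rule has_field_derivative_at_within[OF DERIV_U_chain[OF \<beta> a(1) d1]])
  have "?q - ?p1 - ?p2 - 2 < 0" using \<beta> unfolding q by simp
  from bess_product_integral_bound[OF p \<omega> this] obtain C where C: "C \<ge> 0"
    "\<And>s x y. s \<ge> 1 \<Longrightarrow> \<bar>s - \<omega>\<bar> \<ge> 1 \<Longrightarrow> x \<ge> max 2 (2 / \<omega>) \<Longrightarrow> x \<le> y \<Longrightarrow>
      \<bar>integral {x..y} (\<lambda>r. r powr ?q * (bess ?p1 (\<omega> * r) * bess ?p2 (s * r)))\<bar> \<le> C * s powr (- ?p2 - 1) * x powr - (1 + \<beta>)"
    unfolding q by blast
  obtain Cb where Cb: "Cb \<ge> 0"
    "\<And>\<Lambda> x n. \<Lambda> > 0 \<Longrightarrow> x \<in> torus \<Longrightarrow> n \<in> int_lattice \<Longrightarrow> n \<noteq> 0 \<Longrightarrow>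
       \<bar>U_hat CARD('n) (real J) \<Lambda> (norm (x + n :: real ^ 'n))\<bar> \<le> Cb * \<Lambda> powr ?p2 * lattice_weight n"
    using U_hat_shift_bound[OF J] by blast
  have t0: "(0 :: real ^ 'n) \<in> torus" by (simp add: torus_def)
  have Ub: "\<bar>U_hat CARD('n) (real J) r (norm k)\<bar> \<le> Cb * r powr ?p2 * lattice_weight k" if "r > 0" "k \<in> ?L" for r and k :: "real ^ 'n"
    using Cb(2)[OF that(1) t0, of k] that(2) by simp
  define K where "K = 2 * (pi powr ((?d - 1) / 2) * Gamma (\<beta> + 1) * (- pi\<^sup>2) ^ (Suc J) * a powr (2 * \<beta> + ?d + 2 * real (Suc J)))
      * (pi powr ((?d - 1) / 2) * Gamma (real J + 1))"
  have hK: "2 * r * (?f r * U_hat CARD('n) (real J) r \<rho>) = K * (r powr ?q * (bess ?p1 (\<omega> * r) * bess ?p2 (2 * pi * \<rho> * r)))" if r: "r > 0" for r \<rho>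
  proof -
    have e: "r powr ?q = r * r powr (2 * real J + ?d)" using r by (simp add: powr_mult_base add_ac)
    show ?thesis unfolding U_chain_def U_hat_def K_def \<omega>_def e by (simp only: mult_ac)
  qed
  define h where "h = (\<lambda>(k :: real ^ 'n) r. 2 * r * (?f r * U_hat CARD('n) (real J) r (norm k)))"
  have cnt: "countable ?L" by (rule countable_subset[OF _ countable_int_lattice]) auto
  have iw: "integrable (count_space ?L) (\<lambda>k. lattice_weight k)" by (rule integral_count_space_split_0(1)[OF integrable_lattice_weight zero_in_int_lattice])
  define I where "I = (\<lambda>\<Lambda>. integral {1..\<Lambda>} (\<lambda>r. 2 * r * (?f r * discrepancy TYPE('n) J (r\<^sup>2))))"
  define E where "E = \<bar>K\<bar> * C * (2 * pi) powr (- ?p2 - 1) * 2 powr (?p2 + 1)"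
  define D where "D = E * (LINT k|count_space ?L. lattice_weight k) / fact J"
  have kk: "norm k powr (- ?p2 - 1) \<le> 2 powr (?p2 + 1) * lattice_weight k" if "k \<in> ?L" for k
  proof -
    have "?p2 + 1 \<ge> 2 * ?d" using J real_CARD_ge_1[where 'n = 'n] by (simp add: field_simps)
    from norm_lattice_shift(2)[OF _ _ t0 this, of k] that show "norm k powr (- ?p2 - 1) \<le> 2 powr (?p2 + 1) * lattice_weight k" by simp
  qed
  have J2: "J \<ge> 2" using J real_CARD_ge_1[where 'n = 'n] by linarith
  have main: "\<bar>I y - I x\<bar> \<le> D * x powr - (1 + \<beta>)" if x: "x \<ge> max 2 (2 / \<omega>)" and y: "x \<le> y" for x y
  proof -
    have x1: "x \<ge> 1" using x by simp
    have cN: "continuous_on {1..y} (\<lambda>r. 2 * r * (?f r * discrepancy TYPE('n) J (r\<^sup>2)))"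
      by (intro continuous_intros fc continuous_on_discrepancy_square J2)
    have s1: "I x + integral {x..y} (\<lambda>r. 2 * r * (?f r * discrepancy TYPE('n) J (r\<^sup>2))) = I y"
      unfolding I_def using x1 y by (intro Henstock_Kurzweil_Integration.integral_combine integrable_continuous_real cN) auto
    have s2: "integral {x..y} (\<lambda>r. 2 * r * (?f r * discrepancy TYPE('n) J (r\<^sup>2))) = (LINT k|count_space ?L. integral {x..y} (h k)) / fact J"
    proof -
      \<comment> \<open>On the compact interval all factors except the weight are bounded, which
        provides the majorant for the interchange.\<close>
      have cb: "continuous_on {x..y} (\<lambda>r. 2 * r * (?f r * r powr ?p2))" using x1 by (intro continuous_intros fc) auto
      have "bounded ((\<lambda>r. 2 * r * (?f r * r powr ?p2)) ` {x..y})" by (intro compact_imp_bounded compact_continuous_image compact_Icc cb)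
      then obtain B where bB: "\<forall>z \<in> (\<lambda>r. 2 * r * (?f r * r powr ?p2)) ` {x..y}. norm z \<le> B"
        unfolding bounded_iff by blast
      have B: "\<bar>2 * r * (?f r * r powr ?p2)\<bar> \<le> B" if "r \<in> {x..y}" for r
        using bspec[OF bB imageI[OF that]] unfolding real_norm_def .
      have "((\<lambda>r. LINT k|count_space ?L. h k r) has_integral (LINT k|count_space ?L. integral {x..y} (h k))) {x..y}"
      proof (rule integral_count_space_interchange[OF cnt y, where w = "\<lambda>k. B * Cb * lattice_weight k"])
        show "integrable (count_space ?L) (\<lambda>k. B * Cb * lattice_weight k)" using iw by simp
        fix k :: "real ^ 'n" assume k: "k \<in> ?L"
        show "continuous_on {x..y} (h k)" unfolding h_def U_hat_def using x1 p by (intro continuous_intros fc) auto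
        fix r assume r: "r \<in> {x..y}"
        then have r0: "r > 0" using x1 by simp
        have "\<bar>h k r\<bar> = \<bar>2 * r * ?f r\<bar> * \<bar>U_hat CARD('n) (real J) r (norm k)\<bar>" unfolding h_def by (simp add: abs_mult)
        also have "\<dots> \<le> \<bar>2 * r * ?f r\<bar> * (Cb * r powr ?p2 * lattice_weight k)"
          by (intro mult_left_mono Ub r0 k) auto
        also have "\<dots> = \<bar>2 * r * (?f r * r powr ?p2)\<bar> * Cb * lattice_weight k" by (simp add: abs_mult)
        also have "\<dots> \<le> B * Cb * lattice_weight k" by (intro mult_right_mono B r Cb(1) lattice_weight_nonneg)
        finally show "\<bar>h k r\<bar> \<le> B * Cb * lattice_weight k" .
      qed
      from has_integral_divide[OF this, of "fact J"]
      have "((\<lambda>r. 2 * r * (?f r * discrepancy TYPE('n) J (r\<^sup>2))) has_integral (LINT k|count_space ?L. integral {x..y} (h k)) / fact J) {x..y}"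
      proof (rule has_integral_eq[rotated])
        fix r assume "r \<in> {x..y}"
        then have r0: "r > 0" using x1 by simp
        show "(LINT k|count_space ?L. h k r) / fact J = 2 * r * (?f r * discrepancy TYPE('n) J (r\<^sup>2))"
          unfolding discrepancy_series[OF J r0] h_def by (simp add: mult.assoc)
      qed
      then show ?thesis by (rule integral_unique)
    qed
    have hb: "norm (integral {x..y} (h k)) \<le> E * x powr - (1 + \<beta>) * lattice_weight k" if k: "k \<in> ?L" for k
    proof -
      let ?s = "2 * pi * norm k"
      have n1: "norm k \<ge> 1" using int_lattice_norm_ge_1 k by blast
      \<comment> \<open>Absence of resonance: a < 1/2 and |k| \<ge> 1 keep the difference of the
        frequencies at least pi, hence above 1.\<close>
      have "norm k - a \<ge> 1/2" using n1 a by linarith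
      then have "2 * pi * (norm k - a) \<ge> 2 * pi * (1/2)" by (intro mult_left_mono) auto
      then have s\<omega>: "\<bar>?s - \<omega>\<bar> \<ge> 1" using pi_gt3 unfolding \<omega>_def by (simp add: right_diff_distrib)
      have s1: "?s \<ge> 1" using mult_mono[of 1 "2 * pi" 1 "norm k"] pi_gt3 n1 by simp
      have "integral {x..y} (h k) = K * integral {x..y} (\<lambda>r. r powr ?q * (bess ?p1 (\<omega> * r) * bess ?p2 (?s * r)))"
        unfolding Henstock_Kurzweil_Integration.integral_mult_right[symmetric] h_def
        by (intro Henstock_Kurzweil_Integration.integral_cong hK) (use x1 in auto)
      then have "norm (integral {x..y} (h k)) = \<bar>K\<bar> * \<bar>integral {x..y} (\<lambda>r. r powr ?q * (bess ?p1 (\<omega> * r) * bess ?p2 (?s * r)))\<bar>"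
        by (simp only: real_norm_def abs_mult)
      also have "\<dots> \<le> \<bar>K\<bar> * (C * ?s powr (- ?p2 - 1) * x powr - (1 + \<beta>))"
        by (intro mult_left_mono C(2) s1 s\<omega> x y) auto
      also have "?s powr (- ?p2 - 1) = (2 * pi) powr (- ?p2 - 1) * norm k powr (- ?p2 - 1)"
        by (rule powr_mult)
      also have "\<bar>K\<bar> * (C * ((2 * pi) powr (- ?p2 - 1) * norm k powr (- ?p2 - 1)) * x powr - (1 + \<beta>))
          \<le> \<bar>K\<bar> * (C * ((2 * pi) powr (- ?p2 - 1) * (2 powr (?p2 + 1) * lattice_weight k)) * x powr - (1 + \<beta>))"
        using C(1) by (intro mult_left_mono mult_right_mono kk[OF k]) auto
      finally show ?thesis by (simp only: E_def mult_ac)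
    qed
    have iw': "integrable (count_space ?L) (\<lambda>k. E * x powr - (1 + \<beta>) * lattice_weight k)" using iw by simp
    have s3: "norm (LINT k|count_space ?L. integral {x..y} (h k)) \<le> (LINT k|count_space ?L. E * x powr - (1 + \<beta>) * lattice_weight k)"
    proof (rule Bochner_Integration.integral_norm_bound_integral)
      show "integrable (count_space ?L) (\<lambda>k. integral {x..y} (h k))"
      proof (rule Bochner_Integration.integrable_bound[OF iw'])
        show "AE k in count_space ?L. norm (integral {x..y} (h k)) \<le> norm (E * x powr - (1 + \<beta>) * lattice_weight k)"
          using hb by (intro AE_I2) (force intro: order_trans[OF _ abs_ge_self])
      qed simp
    qed (use hb iw' in auto)
    have "\<bar>I y - I x\<bar> = norm (LINT k|count_space ?L. integral {x..y} (h k)) / fact J"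
    proof -
      have "I y - I x = (LINT k|count_space ?L. integral {x..y} (h k)) / fact J" using s1 s2 by linarith
      then show ?thesis by (simp add: abs_divide)
    qed
    also have "\<dots> \<le> (LINT k|count_space ?L. E * x powr - (1 + \<beta>) * lattice_weight k) / fact J"
      using s3 by (intro divide_right_mono) auto
    also have "\<dots> = D * x powr - (1 + \<beta>)" by (simp add: D_def)
    finally show ?thesis .
  qed
  have e: "1 + \<beta> > 0" using \<beta> by simp
  from tendsto_at_top_of_Cauchy_bound[OF e main] obtain L where "(I \<longlongrightarrow> L) at_top" by blast
  then show thesis unfolding I_def by (rule that)
qed

section \<open>The oscillating main term\<close>

lemma Re_of_real_mult: "Re (complex_of_real x * z) = x * Re z"
  by simp

text \<open>The explicit \<open>F\<close> has a derivative that agrees with the two leading terms of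
  \<open>g\<close> up to O(r^(\<alpha>-2)). For \<alpha> < 1 this error is integrable at infinity
  and leaves only a constant; for \<alpha> > 0 its integral is o(\<Lambda>^\<alpha>).\<close>

lemma osc_main_term:
  fixes g :: "real \<Rightarrow> real" and b0 b1 :: complex
  assumes \<omega>: "\<omega> \<noteq> 0" and R: "R \<ge> 1" and gc: "\<And>y. continuous_on {1..y} g"
    and g: "\<And>r. r \<ge> R \<Longrightarrow> \<bar>g r - (r powr \<alpha> * Re (b0 * cis (\<omega> * r)) + r powr (\<alpha> - 1) * Re (b1 * cis (\<omega> * r)))\<bar> \<le> C * r powr (\<alpha> - 2)"
  defines "rest \<equiv> \<lambda>\<Lambda>. integral {1..\<Lambda>} g - \<Lambda> powr \<alpha> * Re (b0 * cis (\<omega> * \<Lambda>) / (\<i> * \<omega>))"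
  shows "\<alpha> < 1 \<Longrightarrow> \<exists>L. (rest \<longlongrightarrow> L) at_top" and "\<alpha> > 0 \<Longrightarrow> ((\<lambda>\<Lambda>. rest \<Lambda> / \<Lambda> powr \<alpha>) \<longlongrightarrow> 0) at_top"
proof -
  \<comment> \<open>The correction cancels the term that appears when r^\<alpha> is differentiated
    in the first summand of \<open>F\<close>.\<close>
  define e1 where "e1 = b1 - \<alpha> * b0 / (\<i> * \<omega>)"
  define F where "F = (\<lambda>r. r powr \<alpha> * Re (b0 * cis (\<omega> * r) / (\<i> * \<omega>)) + r powr (\<alpha> - 1) * Re (e1 * cis (\<omega> * r) / (\<i> * \<omega>)))"
  define F' where "F' = (\<lambda>r. (r powr \<alpha> * Re (b0 * cis (\<omega> * r)) + \<alpha> * r powr (\<alpha> - 1) * Re (b0 * cis (\<omega> * r) / (\<i> * \<omega>)))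
     + (r powr (\<alpha> - 1) * Re (e1 * cis (\<omega> * r)) + (\<alpha> - 1) * r powr (\<alpha> - 1 - 1) * Re (e1 * cis (\<omega> * r) / (\<i> * \<omega>))))"
  have DF: "(F has_real_derivative F' r) (at r)" if "r > 0" for r
    unfolding F_def F'_def by (intro DERIV_add DERIV_powr_osc that \<omega>)
  define D where "D = \<bar>C\<bar> + \<bar>\<alpha> - 1\<bar> * (norm e1 / \<bar>\<omega>\<bar>)"
  have D0: "D \<ge> 0" by (simp add: D_def)
  have b: "\<bar>Re (c * cis (\<omega> * r) / (\<i> * \<omega>))\<bar> \<le> norm c / \<bar>\<omega>\<bar>" for c r
    using abs_Re_le_cmod[of "c * cis (\<omega> * r) / (\<i> * \<omega>)"] by (simp add: norm_divide norm_mult)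
  have gF: "\<bar>g r - F' r\<bar> \<le> D * r powr (\<alpha> - 2)" if r: "r \<ge> R" for r
  proof -
    have eqE: "Re (e1 * cis (\<omega> * r)) = Re (b1 * cis (\<omega> * r)) - \<alpha> * Re (b0 * cis (\<omega> * r) / (\<i> * \<omega>))"
    proof -
      have "e1 * cis (\<omega> * r) = b1 * cis (\<omega> * r) - \<alpha> * (b0 * cis (\<omega> * r) / (\<i> * \<omega>))" by (simp add: e1_def left_diff_distrib)
      then show ?thesis by (simp only: minus_complex.sel Re_of_real_mult)
    qed
    have "F' r = (r powr \<alpha> * Re (b0 * cis (\<omega> * r)) + r powr (\<alpha> - 1) * Re (b1 * cis (\<omega> * r))) + (\<alpha> - 1) * r powr (\<alpha> - 2) * Re (e1 * cis (\<omega> * r) / (\<i> * \<omega>))"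
      unfolding F'_def eqE by (simp add: algebra_simps del: times_complex.sel cis.sel)
    moreover have "\<bar>(\<alpha> - 1) * r powr (\<alpha> - 2) * Re (e1 * cis (\<omega> * r) / (\<i> * \<omega>))\<bar> \<le> \<bar>\<alpha> - 1\<bar> * r powr (\<alpha> - 2) * (norm e1 / \<bar>\<omega>\<bar>)"
      unfolding abs_mult abs_of_nonneg[OF powr_ge_zero] by (intro mult_left_mono b) auto
    moreover have "C * r powr (\<alpha> - 2) \<le> \<bar>C\<bar> * r powr (\<alpha> - 2)" by (intro mult_right_mono) auto
    ultimately show ?thesis using g[OF r] unfolding D_def distrib_right by (simp only: mult_ac)
  qed
  define H where "H = (\<lambda>y. integral {1..y} g - F y)"
  have H: "\<bar>H y - H x\<bar> \<le> (D * y powr p - D * x powr p) / p" if x: "R \<le> x" "x \<le> y" and p: "p \<ge> \<alpha> - 1" "p \<noteq> 0" for x y p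
  proof -
    have x1: "x \<ge> 1" using x R by simp
    have gi: "g integrable_on {1..y}" by (intro integrable_continuous_real gc)
    have gi': "g integrable_on {x..y}" using integrable_subinterval_real[OF gi] x1 by auto
    have F': "(F' has_integral (F y - F x)) {x..y}"
    proof (rule fundamental_theorem_of_calculus[OF x(2)])
      fix r assume "r \<in> {x..y}"
      then have "r > 0" using x1 by simp
      from has_field_derivative_at_within[OF DF[OF this]] show "(F has_vector_derivative F' r) (at r within {x..y})"
        unfolding has_real_derivative_iff_has_vector_derivative .
    qed
    have "integral {1..x} g + integral {x..y} g = integral {1..y} g"
      using x1 x gi by (intro Henstock_Kurzweil_Integration.integral_combine) auto
    moreover have "integral {x..y} (\<lambda>r. g r - F' r) = integral {x..y} g - (F y - F x)"
      using Henstock_Kurzweil_Integration.integral_diff[OF gi' has_integral_integrable[OF F']] integral_unique[OF F'] by simp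
    ultimately have e: "H y - H x = integral {x..y} (\<lambda>r. g r - F' r)" unfolding H_def by simp
    have h: "((\<lambda>r. D * r powr (p - 1)) has_integral (D / p * y powr p - D / p * x powr p)) {x..y}"
    proof (rule fundamental_theorem_of_calculus[OF x(2)])
      fix r assume "r \<in> {x..y}"
      then have "((\<lambda>r. D / p * r powr p) has_real_derivative D / p * (p * r powr (p - 1))) (at r)"
        using x1 by (intro DERIV_cmult has_real_derivative_powr) auto
      from has_field_derivative_at_within[OF this] show "((\<lambda>r. D / p * r powr p) has_vector_derivative D * r powr (p - 1)) (at r within {x..y})"
        unfolding has_real_derivative_iff_has_vector_derivative[symmetric] using p by simp
    qed
    have "norm (integral {x..y} (\<lambda>r. g r - F' r)) \<le> integral {x..y} (\<lambda>r. D * r powr (p - 1))"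
    proof (rule Henstock_Kurzweil_Integration.integral_norm_bound_integral)
      show "(\<lambda>r. g r - F' r) integrable_on {x..y}"
        by (rule Henstock_Kurzweil_Integration.integrable_diff[OF gi' has_integral_integrable[OF F']])
      show "(\<lambda>r. D * r powr (p - 1)) integrable_on {x..y}" using h by blast
      fix r assume r: "r \<in> {x..y}"
      have "\<bar>g r - F' r\<bar> \<le> D * r powr (\<alpha> - 2)" using r x by (intro gF) auto
      also have "\<dots> \<le> D * r powr (p - 1)" using r x1 p D0 by (intro mult_left_mono powr_mono) auto
      finally show "norm (g r - F' r) \<le> D * r powr (p - 1)" by simp
    qed
    also have "\<dots> = (D * y powr p - D * x powr p) / p" unfolding integral_unique[OF h] by (simp add: diff_divide_distrib)
    finally show ?thesis unfolding e by simp
  qed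
  have rest: "rest y = H y + y powr (\<alpha> - 1) * Re (e1 * cis (\<omega> * y) / (\<i> * \<omega>))" for y
    unfolding rest_def H_def F_def by simp
  have lim2: "((\<lambda>y. y powr p * Re (e1 * cis (\<omega> * y) / (\<i> * \<omega>))) \<longlongrightarrow> 0) at_top" if p: "p < 0" for p
  proof (rule Lim_null_comparison[where g = "\<lambda>y. y powr p * (norm e1 / \<bar>\<omega>\<bar>)"])
    show "\<forall>\<^sub>F y in at_top. norm (y powr p * Re (e1 * cis (\<omega> * y) / (\<i> * \<omega>))) \<le> y powr p * (norm e1 / \<bar>\<omega>\<bar>)"
      by (intro always_eventually allI) (simp only: real_norm_def abs_mult abs_of_nonneg[OF powr_ge_zero] mult_left_mono b powr_ge_zero)
    show "((\<lambda>y. y powr p * (norm e1 / \<bar>\<omega>\<bar>)) \<longlongrightarrow> 0) at_top"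
      by (rule tendsto_mult_left_zero[OF tendsto_neg_powr[OF p filterlim_ident]])
  qed
  show "\<exists>L. (rest \<longlongrightarrow> L) at_top" if \<alpha>: "\<alpha> < 1"
  proof -
    have e: "1 - \<alpha> > 0" using \<alpha> by simp
    obtain L where "(H \<longlongrightarrow> L) at_top"
    proof (rule tendsto_at_top_of_Cauchy_bound[OF e, of R H "D / (1 - \<alpha>)"])
      fix x y assume x: "R \<le> x" "x \<le> y"
      have "\<bar>H y - H x\<bar> \<le> (D * y powr (\<alpha> - 1) - D * x powr (\<alpha> - 1)) / (\<alpha> - 1)" using \<alpha> by (intro H x) auto
      also have "\<dots> = (D * x powr (\<alpha> - 1) - D * y powr (\<alpha> - 1)) / (1 - \<alpha>)" using \<alpha> by (simp add: field_simps)
      also have "\<dots> \<le> D * x powr (\<alpha> - 1) / (1 - \<alpha>)" using \<alpha> D0 by (intro divide_right_mono) auto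
      finally show "\<bar>H y - H x\<bar> \<le> D / (1 - \<alpha>) * x powr - (1 - \<alpha>)" by simp
    qed blast
    from tendsto_add[OF this lim2[of "\<alpha> - 1"]] \<alpha> have "(rest \<longlongrightarrow> L) at_top" unfolding rest[abs_def] by simp
    then show ?thesis by blast
  qed
  show "((\<lambda>\<Lambda>. rest \<Lambda> / \<Lambda> powr \<alpha>) \<longlongrightarrow> 0) at_top" if \<alpha>: "\<alpha> > 0"
  proof -
    \<comment> \<open>Any p > 0 with \<alpha> - 1 \<le> p < \<alpha> would do. Taking \<alpha> / 2
      when it is larger keeps p away from 0, where the antiderivative would be a logarithm.\<close>
    define p where "p = max (\<alpha> - 1) (\<alpha> / 2)"
    have p: "p > 0" "p < \<alpha>" "p \<ge> \<alpha> - 1" using \<alpha> by (auto simp: p_def)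
    have 1: "((\<lambda>y. H y / y powr \<alpha>) \<longlongrightarrow> 0) at_top"
    proof (rule Lim_null_comparison[where g = "\<lambda>y. \<bar>H R\<bar> * y powr - \<alpha> + D / p * y powr (p - \<alpha>)"])
      show "\<forall>\<^sub>F y in at_top. norm (H y / y powr \<alpha>) \<le> \<bar>H R\<bar> * y powr - \<alpha> + D / p * y powr (p - \<alpha>)"
      proof (rule eventually_mono[OF eventually_ge_at_top[of R]])
        fix y assume y: "R \<le> y"
        have "\<bar>H y - H R\<bar> \<le> (D * y powr p - D * R powr p) / p" using p y by (intro H) auto
        also have "\<dots> \<le> D * y powr p / p" using D0 p by (intro divide_right_mono) auto
        finally have "\<bar>H y\<bar> \<le> \<bar>H R\<bar> + D * y powr p / p" by linarith
        then have "\<bar>H y\<bar> / y powr \<alpha> \<le> (\<bar>H R\<bar> + D * y powr p / p) / y powr \<alpha>" by (intro divide_right_mono) auto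
        also have "\<dots> = \<bar>H R\<bar> * y powr - \<alpha> + D / p * y powr (p - \<alpha>)"
          by (simp add: powr_minus_divide powr_diff add_divide_distrib)
        finally show "norm (H y / y powr \<alpha>) \<le> \<bar>H R\<bar> * y powr - \<alpha> + D / p * y powr (p - \<alpha>)" by (simp add: abs_divide)
      qed
      have "((\<lambda>y. \<bar>H R\<bar> * y powr - \<alpha> + D / p * y powr (p - \<alpha>)) \<longlongrightarrow> \<bar>H R\<bar> * 0 + D / p * 0) at_top"
        using \<alpha> p by (intro tendsto_intros tendsto_neg_powr filterlim_ident) auto
      then show "((\<lambda>y. \<bar>H R\<bar> * y powr - \<alpha> + D / p * y powr (p - \<alpha>)) \<longlongrightarrow> 0) at_top" by simp
    qed
    have 2: "((\<lambda>y. y powr (- 1) * Re (e1 * cis (\<omega> * y) / (\<i> * \<omega>))) \<longlongrightarrow> 0) at_top" by (rule lim2) simp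
    have "((\<lambda>\<Lambda>. H \<Lambda> / \<Lambda> powr \<alpha> + \<Lambda> powr (- 1) * Re (e1 * cis (\<omega> * \<Lambda>) / (\<i> * \<omega>))) \<longlongrightarrow> 0) at_top"
      using tendsto_add[OF 1 2] by simp
    moreover have "\<forall>\<^sub>F \<Lambda> in at_top. H \<Lambda> / \<Lambda> powr \<alpha> + \<Lambda> powr (- 1) * Re (e1 * cis (\<omega> * \<Lambda>) / (\<i> * \<omega>)) = rest \<Lambda> / \<Lambda> powr \<alpha>"
    proof (rule eventually_mono[OF eventually_gt_at_top[of 0]])
      fix y :: real assume "y > 0"
      then have "y powr (- 1) = y powr (\<alpha> - 1) / y powr \<alpha>" unfolding powr_diff[symmetric] by simp
      then show "H y / y powr \<alpha> + y powr (- 1) * Re (e1 * cis (\<omega> * y) / (\<i> * \<omega>)) = rest y / y powr \<alpha>"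
        unfolding rest by (simp only: add_divide_distrib times_divide_eq_left)
    qed
    ultimately show ?thesis by (rule Lim_transform_eventually)
  qed
qed

lemma DERIV_volume_Riesz_0:
  assumes "d \<ge> 1" "s > 0"
  shows "(volume_Riesz d 0 has_real_derivative pi powr (real d / 2) / Gamma (real d / 2) * s powr (real d / 2 - 1)) (at s)"
proof -
  have G: "Gamma (real d / 2 + 1) = real d / 2 * Gamma (real d / 2)" using assms by (intro Gamma_plus1) (auto simp: nonpos_Ints_def)
  have V: "volume_Riesz d 0 = (\<lambda>s. pi powr (real d / 2) / Gamma (real d / 2 + 1) * s powr (real d / 2))"
    by (simp add: volume_Riesz_def fun_eq_iff)
  have D: "(volume_Riesz d 0 has_real_derivative pi powr (real d / 2) / Gamma (real d / 2 + 1) * (real d / 2 * s powr (real d / 2 - 1))) (at s)"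
    unfolding V by (intro DERIV_cmult has_real_derivative_powr assms)
  show ?thesis
    by (rule DERIV_cong[OF D]) (use assms in \<open>simp add: G\<close>)
qed

text \<open>Here the constant P arises. With \<nu> = \<beta> + (d-1)/2 and \<omega> = 2 pi a, the
  integrand is M r^(d-1) times \<open>bess\<close> of order \<nu> at \<omega> r, and integrating its
  leading oscillation gives the amplitude M \<omega>^(-\<nu>-2) 2^(\<nu>+1). The powers of 2 cancel,
  those of a and pi combine to P.\<close>

lemma volume_main_term:
  assumes \<beta>: "\<beta> > -1" and a: "a > 0" and d: "d \<ge> 1"
  defines "\<alpha> \<equiv> (real d - 3) / 2 - \<beta>"
  obtains b :: complex where "norm b = P_const d \<beta> a"
    "\<alpha> < 1 \<Longrightarrow> \<exists>L. ((\<lambda>\<Lambda>. integral {1..\<Lambda>} (\<lambda>r. 2 * r * (U_chain d \<beta> a 0 r * (pi powr (real d / 2) / Gamma (real d / 2) * (r\<^sup>2) powr (real d / 2 - 1))))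
       - \<Lambda> powr \<alpha> * Re (b * cis (2 * pi * a * \<Lambda>))) \<longlongrightarrow> L) at_top"
    "\<alpha> > 0 \<Longrightarrow> ((\<lambda>\<Lambda>. (integral {1..\<Lambda>} (\<lambda>r. 2 * r * (U_chain d \<beta> a 0 r * (pi powr (real d / 2) / Gamma (real d / 2) * (r\<^sup>2) powr (real d / 2 - 1))))
       - \<Lambda> powr \<alpha> * Re (b * cis (2 * pi * a * \<Lambda>))) / \<Lambda> powr \<alpha>) \<longlongrightarrow> 0) at_top"
proof -
  define \<nu> where "\<nu> = \<beta> + (real d - 1) / 2"
  define \<omega> where "\<omega> = 2 * pi * a"
  have \<omega>: "\<omega> > 0" using a by (simp add: \<omega>_def)
  have \<nu>: "\<nu> > -1" using \<beta> d by (simp add: \<nu>_def field_simps)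
  have \<alpha>: "\<alpha> = real d - 2 - \<nu>" by (simp add: \<alpha>_def \<nu>_def field_simps)
  obtain c1 :: complex and C where C: "C \<ge> 0"
    "\<And>z. z \<ge> 2 \<Longrightarrow> \<bar>bess \<nu> z - Re (cis z * (bess_lead \<nu> * z powr (- \<nu> - 1) + c1 * z powr (- \<nu> - 2)))\<bar> \<le> C * z powr (- \<nu> - 3)"
    using bess_asymp2[OF \<nu>] by metis
  define M where "M = 2 * pi powr (real d / 2) / Gamma (real d / 2) * (pi powr ((real d - 1) / 2) * Gamma (\<beta> + 1) * a powr (2 * \<beta> + real d))"
  have Gp: "Gamma (real d / 2) > 0" "Gamma (\<beta> + 1) > 0" using d \<beta> by (auto intro!: Gamma_real_pos)
  have M: "M > 0" unfolding M_def using Gp a by (intro mult_pos_pos divide_pos_pos) auto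
  let ?g = "\<lambda>r. 2 * r * (U_chain d \<beta> a 0 r * (pi powr (real d / 2) / Gamma (real d / 2) * (r\<^sup>2) powr (real d / 2 - 1)))"
  have g: "?g r = M * (r powr (real d - 1) * bess \<nu> (\<omega> * r))" if r: "r > 0" for r
  proof -
    have "r * (r\<^sup>2) powr (real d / 2 - 1) = r powr 1 * r powr (2 * (real d / 2 - 1))"
      using r powr_powr[of r 2 "real d / 2 - 1"] by simp
    also have "\<dots> = r powr (real d - 1)" unfolding powr_add[symmetric] by (rule arg_cong[where f = "\<lambda>e. r powr e"]) simp
    finally have e: "r powr (real d - 1) = r * (r\<^sup>2) powr (real d / 2 - 1)" by simp
    show ?thesis unfolding e by (simp add: U_chain_def M_def \<nu>_def \<omega>_def)
  qed
  define b0 where "b0 = complex_of_real (M * \<omega> powr (- \<nu> - 1)) * bess_lead \<nu>"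
  define b1 where "b1 = complex_of_real (M * \<omega> powr (- \<nu> - 2)) * c1"
  define R where "R = max 1 (2 / \<omega>)"
  define b where "b = b0 / (\<i> * \<omega>)"
  have gc: "continuous_on {1..y} ?g" for y
  proof -
    have "continuous_on {1..y} (\<lambda>r. M * (r powr (real d - 1) * bess \<nu> (\<omega> * r)))" by (intro continuous_intros \<nu>) auto
    then show ?thesis by (rule continuous_on_eq) (use g in auto)
  qed
  have ga: "\<bar>?g r - (r powr \<alpha> * Re (b0 * cis (\<omega> * r)) + r powr (\<alpha> - 1) * Re (b1 * cis (\<omega> * r)))\<bar> \<le> (M * C * \<omega> powr (- \<nu> - 3)) * r powr (\<alpha> - 2)" if rR: "r \<ge> R" for r
  proof -
    have r: "r \<ge> 1" "r \<ge> 2 / \<omega>" using rR by (auto simp: R_def)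
    then have z: "\<omega> * r \<ge> 2" using \<omega> by (simp add: field_simps)
    have pw: "r powr (real d - 1) * (\<omega> * r) powr (- \<nu> - e) = \<omega> powr (- \<nu> - e) * r powr (\<alpha> + 1 - e)" for e
    proof -
      have "r powr (real d - 1) * r powr (- \<nu> - e) = r powr (\<alpha> + 1 - e)"
        unfolding powr_add[symmetric] \<alpha> by (rule arg_cong[where f = "\<lambda>e. r powr e"]) simp
      then show ?thesis by (simp add: powr_mult)
    qed
    have Rd: "M * (r powr (real d - 1) * Re (cis (\<omega> * r) * (bess_lead \<nu> * (\<omega> * r) powr (- \<nu> - 1) + c1 * (\<omega> * r) powr (- \<nu> - 2))))
       = r powr \<alpha> * Re (b0 * cis (\<omega> * r)) + r powr (\<alpha> - 1) * Re (b1 * cis (\<omega> * r))"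
    proof -
      have "Re (cis (\<omega> * r) * (bess_lead \<nu> * (\<omega> * r) powr (- \<nu> - 1) + c1 * (\<omega> * r) powr (- \<nu> - 2)))
         = (\<omega> * r) powr (- \<nu> - 1) * Re (bess_lead \<nu> * cis (\<omega> * r)) + (\<omega> * r) powr (- \<nu> - 2) * Re (c1 * cis (\<omega> * r))"
        by (simp add: algebra_simps)
      then have "M * (r powr (real d - 1) * Re (cis (\<omega> * r) * (bess_lead \<nu> * (\<omega> * r) powr (- \<nu> - 1) + c1 * (\<omega> * r) powr (- \<nu> - 2))))
         = M * (r powr (real d - 1) * (\<omega> * r) powr (- \<nu> - 1)) * Re (bess_lead \<nu> * cis (\<omega> * r)) + M * (r powr (real d - 1) * (\<omega> * r) powr (- \<nu> - 2)) * Re (c1 * cis (\<omega> * r))"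
        by (simp only: distrib_left mult.assoc)
      also have "\<dots> = r powr \<alpha> * Re (b0 * cis (\<omega> * r)) + r powr (\<alpha> - 1) * Re (b1 * cis (\<omega> * r))"
        unfolding pw b0_def b1_def mult.assoc[of "complex_of_real _"] Re_of_real_mult by simp
      finally show ?thesis .
    qed
    have "\<bar>?g r - (r powr \<alpha> * Re (b0 * cis (\<omega> * r)) + r powr (\<alpha> - 1) * Re (b1 * cis (\<omega> * r)))\<bar>
       = M * r powr (real d - 1) * \<bar>bess \<nu> (\<omega> * r) - Re (cis (\<omega> * r) * (bess_lead \<nu> * (\<omega> * r) powr (- \<nu> - 1) + c1 * (\<omega> * r) powr (- \<nu> - 2)))\<bar>"
      using M r unfolding Rd[symmetric] by (subst g) (simp_all add: right_diff_distrib[symmetric] abs_mult del: Re_complex_of_real complex_Re_of_nat times_complex.sel plus_complex.sel cis.sel)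
    also have "\<dots> \<le> M * r powr (real d - 1) * (C * (\<omega> * r) powr (- \<nu> - 3))"
      using M by (intro mult_left_mono C z) auto
    also have "\<dots> = M * C * (r powr (real d - 1) * (\<omega> * r) powr (- \<nu> - 3))" by (simp only: mult_ac)
    also have "\<dots> = (M * C * \<omega> powr (- \<nu> - 3)) * r powr (\<alpha> - 2)" unfolding pw by (simp add: mult_ac)
    finally show ?thesis .
  qed
  have R1: "R \<ge> 1" by (simp add: R_def)
  have \<omega>0: "\<omega> \<noteq> 0" using \<omega> by simp
  have bb: "b0 * cis (\<omega> * \<Lambda>) / (\<i> * \<omega>) = b * cis (2 * pi * a * \<Lambda>)" for \<Lambda> by (simp add: b_def \<omega>_def)
  have main1: "\<exists>L. ((\<lambda>\<Lambda>. integral {1..\<Lambda>} ?g - \<Lambda> powr \<alpha> * Re (b * cis (2 * pi * a * \<Lambda>))) \<longlongrightarrow> L) at_top" if "\<alpha> < 1"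
    using osc_main_term(1)[OF \<omega>0 R1 gc ga that] unfolding bb .
  have main2: "((\<lambda>\<Lambda>. (integral {1..\<Lambda>} ?g - \<Lambda> powr \<alpha> * Re (b * cis (2 * pi * a * \<Lambda>))) / \<Lambda> powr \<alpha>) \<longlongrightarrow> 0) at_top" if "\<alpha> > 0"
    using osc_main_term(2)[OF \<omega>0 R1 gc ga that] unfolding bb .
  have nb: "norm b = P_const d \<beta> a"
  proof -
    have "norm (bess_lead \<nu>) = 2 powr (\<nu> + 1)" by (simp add: bess_lead_def norm_mult)
    then have "norm b = M * \<omega> powr (- \<nu> - 1) * 2 powr (\<nu> + 1) / \<omega>"
      using M \<omega> by (simp add: b_def b0_def norm_mult norm_divide)
    also have "\<dots> = M * \<omega> powr (- \<nu> - 2) * 2 powr (\<nu> + 1)"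
    proof -
      have "\<omega> powr (- \<nu> - 2) = \<omega> powr (- \<nu> - 1 - 1)" by (rule arg_cong[where f = "\<lambda>e. \<omega> powr e"]) simp
      also have "\<dots> = \<omega> powr (- \<nu> - 1) / \<omega>" using \<omega> by (subst powr_diff) simp
      finally show ?thesis by simp
    qed
    also have "\<omega> powr (- \<nu> - 2) = 2 powr (- \<nu> - 2) * pi powr (- \<nu> - 2) * a powr (- \<nu> - 2)"
      by (simp add: \<omega>_def powr_mult)
    also have "M * (2 powr (- \<nu> - 2) * pi powr (- \<nu> - 2) * a powr (- \<nu> - 2)) * 2 powr (\<nu> + 1)
       = Gamma (\<beta> + 1) / Gamma (real d / 2) * (2 powr 1 * 2 powr (- \<nu> - 2) * 2 powr (\<nu> + 1)) * (a powr (2 * \<beta> + real d) * a powr (- \<nu> - 2))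
          * (pi powr (real d / 2) * pi powr ((real d - 1) / 2) * pi powr (- \<nu> - 2))"
      by (simp add: M_def)
    also have "2 powr 1 * 2 powr (- \<nu> - 2) * 2 powr (\<nu> + 1) = (1::real)" unfolding powr_add[symmetric] by simp
    also have "a powr (2 * \<beta> + real d) * a powr (- \<nu> - 2) = a powr ((real d - 3) / 2 + \<beta>)"
      unfolding powr_add[symmetric] by (rule arg_cong[where f = "\<lambda>e. a powr e"]) (simp add: \<nu>_def field_simps)
    also have "pi powr (real d / 2) * pi powr ((real d - 1) / 2) * pi powr (- \<nu> - 2) = pi powr ((real d - 4) / 2 - \<beta>)"
      unfolding powr_add[symmetric] by (rule arg_cong[where f = "\<lambda>e. pi powr e"]) (simp add: \<nu>_def field_simps)
    finally show ?thesis by (simp add: P_const_def)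
  qed
  show thesis by (rule that[OF nb]) (erule main1, erule main2)
qed

lemma smallo_one_powr: "p < 0 \<Longrightarrow> (\<lambda>x::real. x powr p) \<in> o(\<lambda>x. 1 :: real)"
  by (rule smalloI_tendsto) (auto intro!: tendsto_neg_powr filterlim_ident)

text \<open>The sizes r^(-\<beta>-(d+1)/2-i) of the transform and r^(d-1+i) of the discrepancy
  multiply to r^\<alpha> for every i. For \<alpha> < 0 the O-bound is enough; \<alpha> \<ge> 0 with
  \<beta> > -1 forces d \<ge> 2, where the o-bound is available.\<close>

lemma boundary_term_asymp:
  assumes \<beta>: "\<beta> > -1" and a: "a > 0" and J: "real J \<ge> 2 * real CARD('n::finite)" and i: "i \<le> J"
  defines "\<alpha> \<equiv> (real CARD('n) - 3) / 2 - \<beta>"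
  shows "\<alpha> \<le> 0 \<Longrightarrow> (\<lambda>r. U_chain CARD('n) \<beta> a i r * discrepancy TYPE('n) i (r\<^sup>2)) \<in> o(\<lambda>_. 1)"
    and "\<alpha> > 0 \<Longrightarrow> (\<lambda>r. U_chain CARD('n) \<beta> a i r * discrepancy TYPE('n) i (r\<^sup>2)) \<in> o(\<lambda>r. r powr \<alpha>)"
proof -
  let ?d = "real CARD('n)"
  have d1: "CARD('n) \<ge> 1" by (simp add: Suc_leI)
  obtain C where C: "C \<ge> 0" "\<And>r. r > 0 \<Longrightarrow> \<bar>U_chain CARD('n) \<beta> a i r\<bar> \<le> C * r powr (- (\<beta> + (?d - 1) / 2 + real i) - 1)"
    using U_chain_bound[OF \<beta> a d1, of i] by metis
  have U: "(\<lambda>r. U_chain CARD('n) \<beta> a i r) \<in> O(\<lambda>r. r powr (- (\<beta> + (?d - 1) / 2 + real i) - 1))"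
    by (rule bigoI[where c = C], rule eventually_mono[OF eventually_gt_at_top[of 0]]) (use C in auto)
  have e: "(\<lambda>r::real. r powr (- (\<beta> + (?d - 1) / 2 + real i) - 1) * r powr (?d - 1 + real i)) = (\<lambda>r. r powr \<alpha>)"
    unfolding powr_add[symmetric] by (rule ext, rule arg_cong2[where f = "(powr)"]) (simp_all add: \<alpha>_def field_simps)
  have big: "(\<lambda>r. U_chain CARD('n) \<beta> a i r * discrepancy TYPE('n) i (r\<^sup>2)) \<in> O(\<lambda>r. r powr \<alpha>)"
    using landau_o.big.mult[OF U discrepancy_bigo[OF J i]] unfolding e .
  have small: "(\<lambda>r. U_chain CARD('n) \<beta> a i r * discrepancy TYPE('n) i (r\<^sup>2)) \<in> o(\<lambda>r. r powr \<alpha>)" if "CARD('n) \<ge> 2"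
    using landau_o.big_small_mult[OF U discrepancy_smallo[OF J i that]] unfolding e .
  show "(\<lambda>r. U_chain CARD('n) \<beta> a i r * discrepancy TYPE('n) i (r\<^sup>2)) \<in> o(\<lambda>r. r powr \<alpha>)" if "\<alpha> > 0"
  proof (rule small)
    have "?d > 1" using that \<beta> unfolding \<alpha>_def by (simp add: field_simps)
    then show "CARD('n) \<ge> 2" by simp
  qed
  show "(\<lambda>r. U_chain CARD('n) \<beta> a i r * discrepancy TYPE('n) i (r\<^sup>2)) \<in> o(\<lambda>_. 1)" if "\<alpha> \<le> 0"
  proof (cases "\<alpha> = 0")
    case False
    with that show ?thesis by (intro landau_o.big_small_trans[OF big smallo_one_powr]) simp
  next
    case True
    then have "?d > 1" using \<beta> unfolding \<alpha>_def by (simp add: field_simps)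
    then have "CARD('n) \<ge> 2" by simp
    note small[OF this]
    also have "(\<lambda>r::real. r powr \<alpha>) \<in> O(\<lambda>_. 1 :: real)"
      by (rule bigoI[where c = 1], rule eventually_mono[OF eventually_gt_at_top[of 0]]) (use True in auto)
    finally show ?thesis .
  qed
qed

text \<open>Two conclusions, because the constant and the convergent remainder matter only for
  \<alpha> \<le> 0; for \<alpha> > 0 they vanish on division by \<Lambda>^\<alpha>.\<close>

lemma lattice_sum_asymp:
  assumes \<beta>: "\<beta> > -1" and a: "0 < a" "a < 1/2"
  defines "\<alpha> \<equiv> (real CARD('n::finite) - 3) / 2 - \<beta>"
  defines "A \<equiv> \<lambda>\<Lambda>. \<Sum>m | (m :: real ^ 'n) \<in> int_lattice \<and> norm m < \<Lambda>. U_hat CARD('n) \<beta> a (norm m)"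
  obtains b :: complex where "norm b = P_const CARD('n) \<beta> a"
    "\<alpha> \<le> 0 \<Longrightarrow> \<exists>L. ((\<lambda>\<Lambda>. A \<Lambda> - \<Lambda> powr \<alpha> * Re (b * cis (2 * pi * a * \<Lambda>))) \<longlongrightarrow> L) at_top"
    "\<alpha> > 0 \<Longrightarrow> ((\<lambda>\<Lambda>. (A \<Lambda> - \<Lambda> powr \<alpha> * Re (b * cis (2 * pi * a * \<Lambda>))) / \<Lambda> powr \<alpha>) \<longlongrightarrow> 0) at_top"
proof -
  let ?d = "real CARD('n)"
  let ?f = "U_chain CARD('n) \<beta> a"
  define J where "J = 2 * CARD('n)"
  have d1: "CARD('n) \<ge> 1" by (simp add: Suc_leI)
  have J: "real J \<ge> 2 * ?d" "J \<ge> 2" using d1 by (auto simp: J_def)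
  define w where "w = (\<lambda>s. pi powr (?d / 2) / Gamma (?d / 2) * s powr (?d / 2 - 1))"
  have w: "(volume_Riesz CARD('n) 0 has_real_derivative w s) (at s)" if "s > 0" for s
    unfolding w_def by (rule DERIV_volume_Riesz_0[OF d1 that])
  have wc: "continuous_on {0<..} w" unfolding w_def by (intro continuous_intros) auto
  define bd where "bd = (\<lambda>\<Lambda>. \<Sum>i\<le>J. (-1) ^ i * ?f i \<Lambda> * discrepancy TYPE('n) i (\<Lambda>\<^sup>2))"
  define B where "B = (\<lambda>\<Lambda>. integral {1..\<Lambda>} (\<lambda>r. 2 * r * (?f 0 r * w (r\<^sup>2))))"
  define I where "I = (\<lambda>\<Lambda>. integral {1..\<Lambda>} (\<lambda>r. 2 * r * (?f (Suc J) r * discrepancy TYPE('n) J (r\<^sup>2))))"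
  obtain K where K: "\<And>\<Lambda>. \<Lambda> \<ge> 1 \<Longrightarrow> A \<Lambda> = K + bd \<Lambda> + B \<Lambda> - (-1) ^ J * I \<Lambda>"
    using discrepancy_partial_summation[where f = ?f and 'n = 'n, OF DERIV_U_chain[OF \<beta> a(1) d1] J(2) w wc]
    unfolding A_def bd_def B_def I_def U_chain_0 by blast
  obtain LI where I: "(I \<longlongrightarrow> LI) at_top"
    unfolding I_def by (rule discrepancy_remainder_converges[OF \<beta> a J(1)])
  obtain b where b: "norm b = P_const CARD('n) \<beta> a"
    "\<alpha> < 1 \<Longrightarrow> \<exists>L. ((\<lambda>\<Lambda>. B \<Lambda> - \<Lambda> powr \<alpha> * Re (b * cis (2 * pi * a * \<Lambda>))) \<longlongrightarrow> L) at_top"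
    "\<alpha> > 0 \<Longrightarrow> ((\<lambda>\<Lambda>. (B \<Lambda> - \<Lambda> powr \<alpha> * Re (b * cis (2 * pi * a * \<Lambda>))) / \<Lambda> powr \<alpha>) \<longlongrightarrow> 0) at_top"
    unfolding B_def w_def \<alpha>_def
  proof (rule volume_main_term[OF \<beta> a(1) d1], goal_cases)
    case (1 b)
    show ?case by (rule 1(1)[of b]) (fact 1(2), erule 1(3), erule 1(4))
  qed
  have bd1: "bd \<in> o(g)" if "\<And>i. i \<le> J \<Longrightarrow> (\<lambda>r. ?f i r * discrepancy TYPE('n) i (r\<^sup>2)) \<in> o(g)" for g :: "real \<Rightarrow> real"
    unfolding bd_def mult.assoc by (intro big_sum_in_smallo) (use that in auto)
  show thesis
  proof (rule that[OF b(1)])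
    assume \<alpha>: "\<alpha> \<le> 0"
    then obtain LB where LB: "((\<lambda>\<Lambda>. B \<Lambda> - \<Lambda> powr \<alpha> * Re (b * cis (2 * pi * a * \<Lambda>))) \<longlongrightarrow> LB) at_top"
      using b(2) by auto
    have "bd \<in> o(\<lambda>_. 1)" by (rule bd1, rule boundary_term_asymp(1)[OF \<beta> a(1) J(1)]) (use \<alpha> \<alpha>_def in auto)
    from smalloD_tendsto[OF this] have bd0: "(bd \<longlongrightarrow> 0) at_top" by simp
    have "((\<lambda>\<Lambda>. K + bd \<Lambda> + (B \<Lambda> - \<Lambda> powr \<alpha> * Re (b * cis (2 * pi * a * \<Lambda>))) - (-1) ^ J * I \<Lambda>) \<longlongrightarrow> K + 0 + LB - (-1) ^ J * LI) at_top"
      by (intro tendsto_intros bd0 LB I)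
    moreover have "\<forall>\<^sub>F \<Lambda> in at_top. K + bd \<Lambda> + (B \<Lambda> - \<Lambda> powr \<alpha> * Re (b * cis (2 * pi * a * \<Lambda>))) - (-1) ^ J * I \<Lambda> = A \<Lambda> - \<Lambda> powr \<alpha> * Re (b * cis (2 * pi * a * \<Lambda>))"
      by (rule eventually_mono[OF eventually_ge_at_top[of 1]]) (use K in auto)
    ultimately show "\<exists>L. ((\<lambda>\<Lambda>. A \<Lambda> - \<Lambda> powr \<alpha> * Re (b * cis (2 * pi * a * \<Lambda>))) \<longlongrightarrow> L) at_top"
      by (blast intro: Lim_transform_eventually)
  next
    assume \<alpha>: "\<alpha> > 0"
    have "bd \<in> o(\<lambda>r. r powr \<alpha>)" unfolding \<alpha>_def by (rule bd1, rule boundary_term_asymp(2)[OF \<beta> a(1) J(1)]) (use \<alpha> \<alpha>_def in auto)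
    from smalloD_tendsto[OF this] have bd0: "((\<lambda>\<Lambda>. bd \<Lambda> / \<Lambda> powr \<alpha>) \<longlongrightarrow> 0) at_top" .
    have p: "((\<lambda>\<Lambda>::real. \<Lambda> powr - \<alpha>) \<longlongrightarrow> 0) at_top" using \<alpha> by (intro tendsto_neg_powr filterlim_ident) auto
    have "((\<lambda>\<Lambda>. (K - (-1) ^ J * I \<Lambda>) * \<Lambda> powr - \<alpha> + bd \<Lambda> / \<Lambda> powr \<alpha> + (B \<Lambda> - \<Lambda> powr \<alpha> * Re (b * cis (2 * pi * a * \<Lambda>))) / \<Lambda> powr \<alpha>)
        \<longlongrightarrow> (K - (-1) ^ J * LI) * 0 + 0 + 0) at_top"
      by (intro tendsto_add tendsto_mult tendsto_diff tendsto_const I p bd0 b(3) \<alpha>)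
    moreover have "\<forall>\<^sub>F \<Lambda> in at_top. (K - (-1) ^ J * I \<Lambda>) * \<Lambda> powr - \<alpha> + bd \<Lambda> / \<Lambda> powr \<alpha> + (B \<Lambda> - \<Lambda> powr \<alpha> * Re (b * cis (2 * pi * a * \<Lambda>))) / \<Lambda> powr \<alpha>
        = (A \<Lambda> - \<Lambda> powr \<alpha> * Re (b * cis (2 * pi * a * \<Lambda>))) / \<Lambda> powr \<alpha>"
    proof (rule eventually_mono[OF eventually_ge_at_top[of 1]])
      fix \<Lambda> :: real assume "\<Lambda> \<ge> 1"
      from K[OF this] show "(K - (-1) ^ J * I \<Lambda>) * \<Lambda> powr - \<alpha> + bd \<Lambda> / \<Lambda> powr \<alpha> + (B \<Lambda> - \<Lambda> powr \<alpha> * Re (b * cis (2 * pi * a * \<Lambda>))) / \<Lambda> powr \<alpha>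
        = (A \<Lambda> - \<Lambda> powr \<alpha> * Re (b * cis (2 * pi * a * \<Lambda>))) / \<Lambda> powr \<alpha>"
        by (simp add: powr_minus_divide add_divide_distrib diff_divide_distrib)
    qed
    ultimately show "((\<lambda>\<Lambda>. (A \<Lambda> - \<Lambda> powr \<alpha> * Re (b * cis (2 * pi * a * \<Lambda>))) / \<Lambda> powr \<alpha>) \<longlongrightarrow> 0) at_top"
      by (simp add: Lim_transform_eventually)
  qed
qed

section \<open>Riesz means and the value at the origin\<close>

context
  fixes c :: "real ^ 'n::finite \<Rightarrow> real" and J :: nat
  assumes J: "J \<ge> 2"
begin

lemma Riesz_weight_integral:
  assumes "0 \<le> \<rho>" "\<rho> \<le> \<Lambda>"
  shows "((\<lambda>r. (if \<rho> < r then 1 else 0) * (2 * real J * r * (\<Lambda>\<^sup>2 - r\<^sup>2) ^ (J - 1))) has_integral (\<Lambda>\<^sup>2 - \<rho>\<^sup>2) ^ J) {0..\<Lambda>}"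
proof -
  have D: "((\<lambda>r. - ((\<Lambda>\<^sup>2 - r\<^sup>2) ^ J)) has_real_derivative 2 * real J * r * (\<Lambda>\<^sup>2 - r\<^sup>2) ^ (J - 1)) (at r)" for r
    by (rule derivative_eq_intros refl)+ simp
  have "((\<lambda>r. 2 * real J * r * (\<Lambda>\<^sup>2 - r\<^sup>2) ^ (J - 1)) has_integral (- ((\<Lambda>\<^sup>2 - \<Lambda>\<^sup>2) ^ J) - - ((\<Lambda>\<^sup>2 - \<rho>\<^sup>2) ^ J))) {\<rho>..\<Lambda>}"
    by (rule fundamental_theorem_of_calculus[OF assms(2)])
      (unfold has_real_derivative_iff_has_vector_derivative[symmetric], rule has_field_derivative_at_within[OF D])
  then have 1: "((\<lambda>r. 2 * real J * r * (\<Lambda>\<^sup>2 - r\<^sup>2) ^ (J - 1)) has_integral (\<Lambda>\<^sup>2 - \<rho>\<^sup>2) ^ J) {\<rho>..\<Lambda>}"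
    using J by (simp add: power_0_left)
  have 2: "((\<lambda>r. (if \<rho> < r then 1 else 0) * (2 * real J * r * (\<Lambda>\<^sup>2 - r\<^sup>2) ^ (J - 1))) has_integral (\<Lambda>\<^sup>2 - \<rho>\<^sup>2) ^ J) {\<rho>..\<Lambda>}"
    by (rule has_integral_spike_finite[OF _ _ 1, of "{\<rho>}"]) auto
  have 3: "((\<lambda>r. (if \<rho> < r then 1 else 0) * (2 * real J * r * (\<Lambda>\<^sup>2 - r\<^sup>2) ^ (J - 1))) has_integral 0) {0..\<rho>}"
    by (rule has_integral_is_0) auto
  show ?thesis using has_integral_combine[OF assms 3 2] by simp
qed

text \<open>The Riesz mean averages the sharp partial sums over all radii r < \<Lambda>, with the
  density 2 J r (\<Lambda>^2 - r^2)^(J-1) of total mass \<Lambda>^(2 J).\<close>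

lemma Riesz_mean_integral:
  assumes \<Lambda>: "\<Lambda> > 0"
  shows "((\<lambda>r. (\<Sum>m | m \<in> int_lattice \<and> norm m < r. c m) * (2 * real J * r * (\<Lambda>\<^sup>2 - r\<^sup>2) ^ (J - 1))) has_integral
     (\<Sum>m | m \<in> int_lattice \<and> norm m < \<Lambda>. c m * (\<Lambda>\<^sup>2 - (norm m)\<^sup>2) ^ J)) {0..\<Lambda>}"
proof -
  let ?F = "{m :: real ^ 'n. m \<in> int_lattice \<and> norm m < \<Lambda>}"
  have fin: "finite ?F" by (rule finite_int_lattice_ball)
  have "((\<lambda>r. \<Sum>m\<in>?F. c m * ((if norm m < r then 1 else 0) * (2 * real J * r * (\<Lambda>\<^sup>2 - r\<^sup>2) ^ (J - 1)))) has_integral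
     (\<Sum>m\<in>?F. c m * (\<Lambda>\<^sup>2 - (norm m)\<^sup>2) ^ J)) {0..\<Lambda>}"
    by (intro has_integral_sum fin has_integral_mult_right Riesz_weight_integral) auto
  then show ?thesis
  proof (rule has_integral_eq[rotated])
    fix r assume "r \<in> {0..\<Lambda>}"
    then have "(\<Sum>m | m \<in> int_lattice \<and> norm m < r. c m) = (\<Sum>m\<in>?F. c m * (if norm m < r then 1 else 0))"
      by (intro sum.mono_neutral_cong_left fin) auto
    then show "(\<Sum>m\<in>?F. c m * ((if norm m < r then 1 else 0) * (2 * real J * r * (\<Lambda>\<^sup>2 - r\<^sup>2) ^ (J - 1))))
       = (\<Sum>m | m \<in> int_lattice \<and> norm m < r. c m) * (2 * real J * r * (\<Lambda>\<^sup>2 - r\<^sup>2) ^ (J - 1))"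
      by (simp only: sum_distrib_right mult.assoc)
  qed
qed

text \<open>Integration by parts against the oscillation. The density vanishes at both ends because
  J \<ge> 2, and its derivative is O(\<Lambda>^(2 J - 2)), so the integral is smaller than the total
  mass by a factor of order \<Lambda>.\<close>

lemma Riesz_oscillation_bound:
  assumes \<Lambda>: "\<Lambda> > 0" and \<omega>: "\<omega> \<noteq> 0"
  shows "\<bar>integral {0..\<Lambda>} (\<lambda>r. Re (b * cis (\<omega> * r)) * (2 * real J * r * (\<Lambda>\<^sup>2 - r\<^sup>2) ^ (J - 1)))\<bar> \<le> norm b / \<bar>\<omega>\<bar> * (2 * real J + 4 * real J * real J) * \<Lambda> ^ (2 * J - 1)"
proof -
  obtain j where j: "J = Suc (Suc j)" using J by (metis Suc_le_D numeral_2_eq_2 Suc_le_mono)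
  let ?P = "\<lambda>r. Re (b * cis (\<omega> * r) / (\<i> * \<omega>))"
  let ?W = "\<lambda>r. 2 * real J * r * (\<Lambda>\<^sup>2 - r\<^sup>2) ^ (J - 1)"
  let ?W' = "\<lambda>r. 2 * real J * (\<Lambda>\<^sup>2 - r\<^sup>2) ^ (J - 1) - 4 * real J * real (J - 1) * (r\<^sup>2 * (\<Lambda>\<^sup>2 - r\<^sup>2) ^ (J - 2))"
  have Pb: "\<bar>?P r\<bar> \<le> norm b / \<bar>\<omega>\<bar>" for r
    using abs_Re_le_cmod[of "b * cis (\<omega> * r) / (\<i> * \<omega>)"] by (simp add: norm_divide norm_mult)
  have e: "?P r = (Re b * sin (\<omega> * r) + Im b * cos (\<omega> * r)) / \<omega>" for r
  proof -
    have "b * cis (\<omega> * r) / (\<i> * \<omega>) = - \<i> * (b * cis (\<omega> * r)) / \<omega>" using \<omega> by (simp add: field_simps)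
    then show ?thesis using \<omega> by (simp add: Re_divide_of_real) (simp add: field_simps)
  qed
  have DP: "(?P has_real_derivative Re (b * cis (\<omega> * r))) (at r)" for r
    unfolding e using \<omega> by (auto intro!: derivative_eq_intros simp: field_simps)
  have DW: "(?W has_real_derivative ?W' r) (at r)" for r
    unfolding j by (rule derivative_eq_intros refl)+ (simp add: algebra_simps power2_eq_square)
  have D: "((\<lambda>r. Re (b * cis (\<omega> * r)) * ?W r + ?W' r * ?P r) has_integral (?P \<Lambda> * ?W \<Lambda> - ?P 0 * ?W 0)) {0..\<Lambda>}"
  proof (rule fundamental_theorem_of_calculus)
    fix r assume "r \<in> {0..\<Lambda>}"
    show "((\<lambda>r. ?P r * ?W r) has_vector_derivative Re (b * cis (\<omega> * r)) * ?W r + ?W' r * ?P r) (at r within {0..\<Lambda>})"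
      unfolding has_real_derivative_iff_has_vector_derivative[symmetric]
      by (rule has_field_derivative_at_within[OF DERIV_mult[OF DP DW]])
  qed (use \<Lambda> in simp)
  have i1: "(\<lambda>r. Re (b * cis (\<omega> * r)) * ?W r) integrable_on {0..\<Lambda>}"
    by (intro integrable_continuous_real continuous_intros)
  have i2: "(\<lambda>r. ?W' r * ?P r) integrable_on {0..\<Lambda>}"
    using \<omega> by (intro integrable_continuous_real continuous_intros) auto
  have "integral {0..\<Lambda>} (\<lambda>r. Re (b * cis (\<omega> * r)) * ?W r) + integral {0..\<Lambda>} (\<lambda>r. ?W' r * ?P r) = ?P \<Lambda> * ?W \<Lambda> - ?P 0 * ?W 0"
    using integral_unique[OF D] unfolding Henstock_Kurzweil_Integration.integral_add[OF i1 i2] .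
  moreover have "?W \<Lambda> = 0" "?W 0 = 0" unfolding j by auto
  ultimately have eq: "integral {0..\<Lambda>} (\<lambda>r. Re (b * cis (\<omega> * r)) * ?W r) = - integral {0..\<Lambda>} (\<lambda>r. ?W' r * ?P r)"
    by (simp only: mult_zero_right)
  let ?K = "(2 * real J + 4 * real J * real J) * \<Lambda> ^ (2 * J - 2)"
  have "norm (integral {0..\<Lambda>} (\<lambda>r. ?W' r * ?P r)) \<le> ?K * (norm b / \<bar>\<omega>\<bar>) * (\<Lambda> - 0)"
  proof (rule integral_bound[OF _ _, of 0 \<Lambda>])
    show "continuous_on {0..\<Lambda>} (\<lambda>r. ?W' r * ?P r)" using \<omega> by (intro continuous_intros) auto
    fix r assume r: "r \<in> {0..\<Lambda>}"
    have sq: "0 \<le> r\<^sup>2" "r\<^sup>2 \<le> \<Lambda>\<^sup>2" using r by (auto intro: power_mono)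
    have p1: "(\<Lambda>\<^sup>2 - r\<^sup>2) ^ k \<le> (\<Lambda>\<^sup>2) ^ k" "0 \<le> (\<Lambda>\<^sup>2 - r\<^sup>2) ^ k" for k using sq by (auto intro!: power_mono)
    have w1: "(\<Lambda>\<^sup>2 - r\<^sup>2) ^ (J - 1) \<le> \<Lambda> ^ (2 * J - 2)" using p1(1)[of "J - 1"] by (simp add: power_mult[symmetric] diff_mult_distrib2)
    have w2: "r\<^sup>2 * (\<Lambda>\<^sup>2 - r\<^sup>2) ^ (J - 2) \<le> \<Lambda> ^ (2 * J - 2)"
    proof -
      have "r\<^sup>2 * (\<Lambda>\<^sup>2 - r\<^sup>2) ^ (J - 2) \<le> \<Lambda>\<^sup>2 * (\<Lambda>\<^sup>2) ^ (J - 2)" by (intro mult_mono sq p1) auto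
      also have "\<dots> = \<Lambda> ^ (2 * J - 2)" unfolding j by (simp add: power_mult[symmetric] power_add[symmetric])
      finally show ?thesis .
    qed
    have "\<bar>?W' r\<bar> \<le> 2 * real J * (\<Lambda>\<^sup>2 - r\<^sup>2) ^ (J - 1) + 4 * real J * real (J - 1) * (r\<^sup>2 * (\<Lambda>\<^sup>2 - r\<^sup>2) ^ (J - 2))"
      by (rule order_trans[OF abs_triangle_ineq4]) (use p1(2) sq in \<open>simp add: abs_mult\<close>)
    also have "\<dots> \<le> 2 * real J * \<Lambda> ^ (2 * J - 2) + 4 * real J * real J * \<Lambda> ^ (2 * J - 2)"
      using w1 w2 sq p1(2) by (intro add_mono mult_mono) auto
    finally have "\<bar>?W' r\<bar> \<le> ?K" by (simp only: distrib_right)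
    then show "norm (?W' r * ?P r) \<le> ?K * (norm b / \<bar>\<omega>\<bar>)"
      unfolding real_norm_def abs_mult[of "_ - _"] using \<Lambda> by (intro mult_mono Pb) auto
  qed (use \<Lambda> in auto)
  also have "?K * (norm b / \<bar>\<omega>\<bar>) * (\<Lambda> - 0) = norm b / \<bar>\<omega>\<bar> * (2 * real J + 4 * real J * real J) * \<Lambda> ^ (2 * J - 1)"
  proof -
    have "\<Lambda> ^ (2 * J - 1) = \<Lambda> ^ (2 * J - 2) * \<Lambda>" unfolding j by simp
    then show ?thesis by simp
  qed
  finally show ?thesis unfolding eq by simp
qed

lemma Riesz_mean_Abelian:
  assumes \<omega>: "\<omega> \<noteq> 0"
    and L: "((\<lambda>r. (\<Sum>m | m \<in> int_lattice \<and> norm m < r. c m) - Re (b * cis (\<omega> * r))) \<longlongrightarrow> L) at_top"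
  shows "((\<lambda>\<Lambda>. (\<Sum>m | m \<in> int_lattice \<and> norm m < \<Lambda>. c m * (\<Lambda>\<^sup>2 - (norm m)\<^sup>2) ^ J) / \<Lambda> ^ (2 * J)) \<longlongrightarrow> L) at_top"
proof (rule tendstoI)
  fix \<epsilon> :: real assume \<epsilon>: "\<epsilon> > 0"
  define A where "A = (\<lambda>r. \<Sum>m | m \<in> int_lattice \<and> norm m < r. c m)"
  define q where "q = (\<lambda>r. A r - Re (b * cis (\<omega> * r)) - L)"
  obtain R0 where R0: "\<And>r. r \<ge> R0 \<Longrightarrow> \<bar>q r\<bar> < \<epsilon> / 2"
    using tendstoD[OF L, of "\<epsilon> / 2"] \<epsilon> unfolding eventually_at_top_linorder q_def A_def dist_real_def by auto
  define R where "R = max R0 1"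
  have R: "\<bar>q r\<bar> \<le> \<epsilon> / 2" if "r \<ge> R" for r using R0[of r] that by (simp add: R_def)
  have Rp: "R > 0" by (simp add: R_def)
  \<comment> \<open>A bound for the deviation at radii up to \<open>R\<close>, where it need not be
    small; the density gives this range a share that tends to 0.\<close>
  define B where "B = (\<Sum>m | m \<in> int_lattice \<and> norm m < R. \<bar>c m\<bar>) + norm b + \<bar>L\<bar>"
  have B0: "B \<ge> 0" by (simp add: B_def sum_nonneg)
  have qB: "\<bar>q r\<bar> \<le> B" if "r \<le> R" for r
  proof -
    have "\<bar>A r\<bar> \<le> (\<Sum>m | m \<in> int_lattice \<and> norm m < r. \<bar>c m\<bar>)" unfolding A_def by (rule sum_abs)
    also have "\<dots> \<le> (\<Sum>m | m \<in> int_lattice \<and> norm m < R. \<bar>c m\<bar>)"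
      using that by (intro sum_mono2 finite_int_lattice_ball) auto
    finally have "\<bar>A r\<bar> \<le> (\<Sum>m | m \<in> int_lattice \<and> norm m < R. \<bar>c m\<bar>)" .
    moreover have "\<bar>Re (b * cis (\<omega> * r))\<bar> \<le> norm b" using abs_Re_le_cmod[of "b * cis (\<omega> * r)"] by (simp only: norm_mult norm_cis mult_1_right)
    ultimately show ?thesis unfolding q_def B_def by linarith
  qed
  define K where "K = norm b / \<bar>\<omega>\<bar> * (2 * real J + 4 * real J * real J)"
  have main: "\<bar>(\<Sum>m | m \<in> int_lattice \<and> norm m < \<Lambda>. c m * (\<Lambda>\<^sup>2 - (norm m)\<^sup>2) ^ J) / \<Lambda> ^ (2 * J) - L\<bar>
      \<le> \<epsilon> / 2 + B * (1 - (1 - R\<^sup>2 / \<Lambda>\<^sup>2) ^ J) + K / \<Lambda>" if \<Lambda>R: "\<Lambda> \<ge> R" for \<Lambda>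
  proof -
    have \<Lambda>: "\<Lambda> > 0" using that Rp by simp
    let ?W = "\<lambda>r. 2 * real J * r * (\<Lambda>\<^sup>2 - r\<^sup>2) ^ (J - 1)"
    let ?S = "\<Sum>m | m \<in> int_lattice \<and> norm m < \<Lambda>. c m * (\<Lambda>\<^sup>2 - (norm m)\<^sup>2) ^ J"
    have W0: "?W r \<ge> 0" if "r \<in> {0..\<Lambda>}" for r using that by (auto intro!: mult_nonneg_nonneg zero_le_power power_mono)
    have iA: "((\<lambda>r. A r * ?W r) has_integral ?S) {0..\<Lambda>}" unfolding A_def by (rule Riesz_mean_integral[OF \<Lambda>])
    have iW: "(?W has_integral \<Lambda> ^ (2 * J)) {0..\<Lambda>}"
    proof -
      have "((\<lambda>r. (if 0 < r then 1 else 0) * ?W r) has_integral (\<Lambda>\<^sup>2 - 0\<^sup>2) ^ J) {0..\<Lambda>}" by (rule Riesz_weight_integral) (use \<Lambda> in auto)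
      then have "(?W has_integral (\<Lambda>\<^sup>2 - 0\<^sup>2) ^ J) {0..\<Lambda>}" by (rule has_integral_spike_finite[of "{0}", rotated 2]) auto
      then show ?thesis by (simp add: power_mult)
    qed
    have iG: "((\<lambda>r. Re (b * cis (\<omega> * r)) * ?W r) has_integral integral {0..\<Lambda>} (\<lambda>r. Re (b * cis (\<omega> * r)) * ?W r)) {0..\<Lambda>}"
      by (intro integrable_integral integrable_continuous_real continuous_intros)
    have iq: "((\<lambda>r. q r * ?W r) has_integral (?S - integral {0..\<Lambda>} (\<lambda>r. Re (b * cis (\<omega> * r)) * ?W r) - L * \<Lambda> ^ (2 * J))) {0..\<Lambda>}"
      unfolding q_def left_diff_distrib by (intro has_integral_diff iA iG has_integral_mult_right iW)
    have iR: "((\<lambda>r. (if R < r then 1 else 0) * ?W r) has_integral (\<Lambda>\<^sup>2 - R\<^sup>2) ^ J) {0..\<Lambda>}"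
      by (rule Riesz_weight_integral) (use Rp \<Lambda>R in auto)
    have ib: "((\<lambda>r. \<epsilon> / 2 * ?W r + B * (?W r - (if R < r then 1 else 0) * ?W r)) has_integral (\<epsilon> / 2 * \<Lambda> ^ (2 * J) + B * (\<Lambda> ^ (2 * J) - (\<Lambda>\<^sup>2 - R\<^sup>2) ^ J))) {0..\<Lambda>}"
      by (intro has_integral_add has_integral_mult_right has_integral_diff iW iR)
    have "norm (integral {0..\<Lambda>} (\<lambda>r. q r * ?W r)) \<le> integral {0..\<Lambda>} (\<lambda>r. \<epsilon> / 2 * ?W r + B * (?W r - (if R < r then 1 else 0) * ?W r))"
    proof (rule Henstock_Kurzweil_Integration.integral_norm_bound_integral)
      show "(\<lambda>r. q r * ?W r) integrable_on {0..\<Lambda>}" using iq by blast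
      show "(\<lambda>r. \<epsilon> / 2 * ?W r + B * (?W r - (if R < r then 1 else 0) * ?W r)) integrable_on {0..\<Lambda>}" using ib by blast
      fix r assume r: "r \<in> {0..\<Lambda>}"
      have n: "norm (q r * ?W r) = \<bar>q r\<bar> * ?W r" by (simp only: real_norm_def abs_mult[of "q r"] abs_of_nonneg[OF W0[OF r]])
      show "norm (q r * ?W r) \<le> \<epsilon> / 2 * ?W r + B * (?W r - (if R < r then 1 else 0) * ?W r)"
      proof (cases "R < r")
        case True
        then show ?thesis unfolding n using mult_right_mono[OF R[of r] W0[OF r]] by simp
      next
        case False
        then have "\<bar>q r\<bar> * ?W r \<le> B * ?W r" using W0[OF r] by (intro mult_right_mono qB) auto
        moreover have "\<epsilon> / 2 * ?W r \<ge> 0" by (rule mult_nonneg_nonneg[OF _ W0[OF r]]) (use \<epsilon> in simp)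
        ultimately show ?thesis unfolding n using False by (simp only: if_False mult_zero_left diff_zero)
      qed
    qed
    then have "\<bar>?S - integral {0..\<Lambda>} (\<lambda>r. Re (b * cis (\<omega> * r)) * ?W r) - L * \<Lambda> ^ (2 * J)\<bar> \<le> \<epsilon> / 2 * \<Lambda> ^ (2 * J) + B * (\<Lambda> ^ (2 * J) - (\<Lambda>\<^sup>2 - R\<^sup>2) ^ J)"
      unfolding integral_unique[OF iq] integral_unique[OF ib] real_norm_def .
    moreover have "\<bar>integral {0..\<Lambda>} (\<lambda>r. Re (b * cis (\<omega> * r)) * ?W r)\<bar> \<le> K * \<Lambda> ^ (2 * J - 1)"
      unfolding K_def by (rule Riesz_oscillation_bound[OF \<Lambda> \<omega>])
    ultimately have "\<bar>?S - L * \<Lambda> ^ (2 * J)\<bar> \<le> \<epsilon> / 2 * \<Lambda> ^ (2 * J) + B * (\<Lambda> ^ (2 * J) - (\<Lambda>\<^sup>2 - R\<^sup>2) ^ J) + K * \<Lambda> ^ (2 * J - 1)"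
      by linarith
    then have "\<bar>?S - L * \<Lambda> ^ (2 * J)\<bar> / \<Lambda> ^ (2 * J) \<le> (\<epsilon> / 2 * \<Lambda> ^ (2 * J) + B * (\<Lambda> ^ (2 * J) - (\<Lambda>\<^sup>2 - R\<^sup>2) ^ J) + K * \<Lambda> ^ (2 * J - 1)) / \<Lambda> ^ (2 * J)"
      using \<Lambda> by (intro divide_right_mono) auto
    also have "\<dots> = \<epsilon> / 2 + B * (1 - (1 - R\<^sup>2 / \<Lambda>\<^sup>2) ^ J) + K / \<Lambda>"
    proof -
      have "(1 - R\<^sup>2 / \<Lambda>\<^sup>2) ^ J = (\<Lambda>\<^sup>2 - R\<^sup>2) ^ J / \<Lambda> ^ (2 * J)"
        using \<Lambda> by (simp add: power_mult power_divide[symmetric] diff_divide_distrib)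
      moreover have "\<Lambda> ^ (2 * J) = \<Lambda> ^ (2 * J - 1) * \<Lambda>" using J by (metis Suc_diff_1 mult.commute mult_pos_pos pos2 power_Suc zero_less_numeral less_le_trans)
      moreover have "(\<epsilon> / 2 * X + B * (X - Y) + K * Z) / X = \<epsilon> / 2 + B * (1 - Y / X) + K / \<Lambda>" if "X > 0" "X = Z * \<Lambda>" for X Y Z
      proof -
        have "Z \<noteq> 0" using that by auto
        have "(\<epsilon> / 2 * X + B * (X - Y) + K * Z) / X = \<epsilon> / 2 * (X / X) + B * (X / X - Y / X) + K * (Z / X)"
          by (simp only: add_divide_distrib diff_divide_distrib right_diff_distrib times_divide_eq_right)
        moreover have "X / X = 1" "Z / X = 1 / \<Lambda>" using that \<open>Z \<noteq> 0\<close> \<Lambda> by auto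
        ultimately show ?thesis by simp
      qed
      ultimately show ?thesis using \<Lambda> by (metis zero_less_power)
    qed
    also have "\<bar>?S - L * \<Lambda> ^ (2 * J)\<bar> / \<Lambda> ^ (2 * J) = \<bar>?S / \<Lambda> ^ (2 * J) - L\<bar>"
    proof -
      have "?S / \<Lambda> ^ (2 * J) - L = (?S - L * \<Lambda> ^ (2 * J)) / \<Lambda> ^ (2 * J)" using \<Lambda> by (simp add: field_simps)
      then show ?thesis using \<Lambda> by (simp add: abs_divide)
    qed
    finally show ?thesis .
  qed
  have "((\<lambda>\<Lambda>. \<epsilon> / 2 + B * (1 - (1 - R\<^sup>2 / \<Lambda>\<^sup>2) ^ J) + K / \<Lambda>) \<longlongrightarrow> \<epsilon> / 2 + B * (1 - (1 - 0) ^ J) + 0) at_top"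
    by (intro tendsto_intros) real_asymp+
  then have "((\<lambda>\<Lambda>. \<epsilon> / 2 + B * (1 - (1 - R\<^sup>2 / \<Lambda>\<^sup>2) ^ J) + K / \<Lambda>) \<longlongrightarrow> \<epsilon> / 2) at_top" by simp
  then have "\<forall>\<^sub>F \<Lambda> in at_top. \<epsilon> / 2 + B * (1 - (1 - R\<^sup>2 / \<Lambda>\<^sup>2) ^ J) + K / \<Lambda> < \<epsilon>"
    by (rule order_tendstoD(2)) (use \<epsilon> in simp)
  then show "\<forall>\<^sub>F \<Lambda> in at_top. dist ((\<Sum>m | m \<in> int_lattice \<and> norm m < \<Lambda>. c m * (\<Lambda>\<^sup>2 - (norm m)\<^sup>2) ^ J) / \<Lambda> ^ (2 * J)) L < \<epsilon>"
    using eventually_ge_at_top[of R] by eventually_elim (unfold dist_real_def, erule (1) order.strict_trans1[OF main])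
qed

end

section \<open>The Riesz kernels as an approximate identity\<close>

lemma integrable_inverse_1_plus_square: "integrable lborel (\<lambda>t::real. 1 / (1 + t\<^sup>2))"
proof -
  let ?g = "\<lambda>t::real. 1 / (1 + t\<^sup>2) * indicator {0..} t"
  have nz: "1 + t\<^sup>2 \<noteq> 0" for t :: real using zero_le_power2[of t] by linarith
  have "(\<integral>\<^sup>+t. ennreal (1 / (1 + t\<^sup>2)) * indicator {0..} t \<partial>lborel) = ennreal (pi / 2 - arctan 0)"
    by (rule nn_integral_FTC_atLeast[where F = arctan])
      (auto intro!: DERIV_cong[OF DERIV_arctan] tendsto_arctan_at_top simp: inverse_eq_divide)
  moreover have "(\<lambda>t. ennreal (?g t)) = (\<lambda>t. ennreal (1 / (1 + t\<^sup>2)) * indicator {0..} t)"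
    by (auto simp: indicator_def)
  ultimately have g: "integrable lborel ?g"
    by (intro integrableI_nonneg) (auto simp: indicator_def)
  have g': "integrable lborel (\<lambda>t. ?g (0 + (-1) * t))"
    by (rule lborel_integrable_real_affine[OF g]) simp
  show ?thesis
    by (rule Bochner_Integration.integrable_bound[OF Bochner_Integration.integrable_add[OF g g']]) (auto simp: indicator_def)
qed

text \<open>A product majorant can be integrated coordinate by coordinate, and after normalized
  rescaling its integral does not depend on the scale.\<close>

lemma bess_product_decay:
  assumes \<mu>: "\<mu> + 1 \<ge> 2 * real CARD('n::finite)"
  obtains C where "C \<ge> 0" "\<And>y :: real ^ 'n. \<bar>bess \<mu> (2 * pi * norm y)\<bar> \<le> C * (\<Prod>i\<in>UNIV. 1 / (1 + (y $ i)\<^sup>2))"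
proof -
  have \<mu>1: "\<mu> > -1" using \<mu> real_CARD_ge_1[where 'n = 'n] by linarith
  obtain C1 where C1: "C1 \<ge> 0" "\<And>z. z > 0 \<Longrightarrow> \<bar>bess \<mu> z\<bar> \<le> C1 * z powr (- \<mu> - 1)" using bess_decay[OF \<mu>1] by metis
  have g0: "bess \<mu> 0 \<ge> 0" using abs_bess_le[OF \<mu>1, of 0] by linarith
  show thesis
  proof (rule that[of "2 ^ CARD('n) * (bess \<mu> 0 + C1)"])
    show "2 ^ CARD('n) * (bess \<mu> 0 + C1) \<ge> 0" using g0 C1 by simp
    fix y :: "real ^ 'n"
    define s where "s = max 1 (norm y)"
    have s: "s \<ge> 1" by (simp add: s_def)
    have comp: "1 + (y $ i)\<^sup>2 \<le> 2 * s\<^sup>2" for i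
    proof -
      have "\<bar>y $ i\<bar> \<le> s" using component_le_norm_cart[of y i] by (simp add: s_def)
      then have "\<bar>y $ i\<bar>\<^sup>2 \<le> s\<^sup>2" by (intro power_mono) auto
      moreover have "1\<^sup>2 \<le> s\<^sup>2" using s by (intro power_mono) auto
      ultimately show ?thesis by simp
    qed
    have pos: "1 + (y $ i)\<^sup>2 > 0" for i using zero_le_power2[of "y $ i"] by linarith
    have P: "(\<Prod>i\<in>UNIV. 1 + (y $ i)\<^sup>2) > 0" by (intro prod_pos pos)
    have Ple: "(\<Prod>i\<in>UNIV. 1 + (y $ i)\<^sup>2) \<le> 2 ^ CARD('n) * s ^ (2 * CARD('n))"
    proof -
      have "(\<Prod>i\<in>UNIV. 1 + (y $ i)\<^sup>2) \<le> (\<Prod>i\<in>(UNIV :: 'n set). 2 * s\<^sup>2)"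
        using pos by (intro prod_mono conjI comp less_imp_le)
      also have "\<dots> = 2 ^ CARD('n) * s ^ (2 * CARD('n))" by (simp add: power_mult_distrib power_mult)
      finally show ?thesis .
    qed
    have gs: "\<bar>bess \<mu> (2 * pi * norm y)\<bar> * s ^ (2 * CARD('n)) \<le> bess \<mu> 0 + C1"
    proof (cases "norm y \<le> 1")
      case True
      then show ?thesis using abs_bess_le[OF \<mu>1, of "2 * pi * norm y"] C1(1) by (simp add: s_def)
    next
      case False
      then have y: "norm y > 1" "s = norm y" by (auto simp: s_def)
      have "\<bar>bess \<mu> (2 * pi * norm y)\<bar> \<le> C1 * (2 * pi * norm y) powr (- \<mu> - 1)" by (rule C1(2)) (use y in \<open>auto intro!: mult_pos_pos\<close>)
      also have "\<dots> \<le> C1 * norm y powr (- \<mu> - 1)"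
      proof (intro mult_left_mono powr_mono2')
        show "norm y \<le> 2 * pi * norm y" using mult_right_mono[of 1 "2 * pi" "norm y"] pi_gt3 by simp
      qed (use y \<mu>1 C1 in auto)
      also have "\<dots> \<le> C1 * norm y powr - real (2 * CARD('n))"
        using y \<mu> C1 by (intro mult_left_mono powr_mono) auto
      also have "norm y powr - real (2 * CARD('n)) = 1 / s ^ (2 * CARD('n))"
        using y by (simp only: powr_minus_divide powr_realpow)
      finally have "\<bar>bess \<mu> (2 * pi * norm y)\<bar> * s ^ (2 * CARD('n)) \<le> C1 * (1 / s ^ (2 * CARD('n))) * s ^ (2 * CARD('n))"
        using s by (intro mult_right_mono) auto
      then show ?thesis using g0 s by simp
    qed
    have "\<bar>bess \<mu> (2 * pi * norm y)\<bar> * (\<Prod>i\<in>UNIV. 1 + (y $ i)\<^sup>2) \<le> \<bar>bess \<mu> (2 * pi * norm y)\<bar> * (2 ^ CARD('n) * s ^ (2 * CARD('n)))"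
      by (intro mult_left_mono Ple) auto
    also have "\<dots> = 2 ^ CARD('n) * (\<bar>bess \<mu> (2 * pi * norm y)\<bar> * s ^ (2 * CARD('n)))" by simp
    also have "\<dots> \<le> 2 ^ CARD('n) * (bess \<mu> 0 + C1)" by (intro mult_left_mono gs) auto
    finally show "\<bar>bess \<mu> (2 * pi * norm y)\<bar> \<le> 2 ^ CARD('n) * (bess \<mu> 0 + C1) * (\<Prod>i\<in>UNIV. 1 / (1 + (y $ i)\<^sup>2))"
      using P by (simp add: prod_dividef pos_le_divide_eq)
  qed
qed

lemma U_fun_outside_torus:
  assumes a: "a < 1/2" and x: "x \<notin> (torus :: (real ^ 'n::finite) set)"
  shows "U_fun \<beta> a x = 0"
proof (rule ccontr)
  assume "U_fun \<beta> a x \<noteq> 0"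
  then have "norm x < 1/2" using a by (auto simp: U_fun_def split: if_splits)
  then have "- 1/2 < x $ i \<and> x $ i \<le> 1/2" for i using component_le_norm_cart[of x i] by linarith
  then have "x \<in> torus" unfolding torus_def by blast
  with x show False by simp
qed

text \<open>Continuity at the origin only, since for \<beta> < 0 the function is unbounded near the
  sphere |x| = a.\<close>

lemma U_fun_continuous_at_0:
  assumes a: "a > 0" and e: "e > 0"
  obtains \<delta> where "\<delta> > 0" "\<And>x :: real ^ 'n::finite. norm x < \<delta> \<Longrightarrow> \<bar>U_fun \<beta> a x - U_fun \<beta> a 0\<bar> < e"
proof -
  have "((\<lambda>r. (a\<^sup>2 - r\<^sup>2) powr \<beta>) \<longlongrightarrow> (a\<^sup>2 - 0\<^sup>2) powr \<beta>) (at 0)"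
    using a by (intro tendsto_intros) auto
  then obtain \<delta> where \<delta>: "\<delta> > 0" "\<And>r. r \<noteq> 0 \<Longrightarrow> \<bar>r\<bar> < \<delta> \<Longrightarrow> \<bar>(a\<^sup>2 - r\<^sup>2) powr \<beta> - (a\<^sup>2 - 0\<^sup>2) powr \<beta>\<bar> < e"
    using e unfolding LIM_eq by auto
  show thesis
  proof (rule that[of "min \<delta> a"])
    show "min \<delta> a > 0" using \<delta> a by simp
    fix x :: "real ^ 'n" assume x: "norm x < min \<delta> a"
    then show "\<bar>U_fun \<beta> a x - U_fun \<beta> a 0\<bar> < e"
      using \<delta>(2)[of "norm x"] a e by (cases "x = 0") (auto simp: U_fun_def)
  qed
qed

lemma U_hat_eq_integral_cos:
  assumes p: "p > -1" and a: "a > 0"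
  shows "integrable lborel (\<lambda>x :: real ^ 'n::finite. U_fun p a x * cos (2 * pi * (\<xi> \<bullet> x)))"
    and "U_hat CARD('n) p a (norm \<xi>) = (LINT x|lborel. U_fun p a (x :: real ^ 'n) * cos (2 * pi * (\<xi> \<bullet> x)))"
proof -
  let ?h = "\<lambda>x :: real ^ 'n. complex_of_real (U_fun p a x) * cis (- (2 * pi * (\<xi> \<bullet> x)))"
  have i: "integrable lborel ?h"
    by (rule integrable_mult_bounded[where B = 1]) (auto intro!: integrable_U_fun p a borel_measurable_cis)
  have r: "Re (?h x) = U_fun p a x * cos (2 * pi * (\<xi> \<bullet> x))" for x by simp
  show "integrable lborel (\<lambda>x. U_fun p a x * cos (2 * pi * (\<xi> \<bullet> x)))"
    using integrable_Re[OF i] unfolding r .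
  have "U_hat CARD('n) p a (norm \<xi>) = Re (LINT x|lborel. ?h x)" unfolding integral_U_fun_cis[OF p a] by simp
  also have "\<dots> = (LINT x|lborel. Re (?h x))" by (rule integral_Re[OF i, symmetric])
  finally show "U_hat CARD('n) p a (norm \<xi>) = (LINT x|lborel. U_fun p a x * cos (2 * pi * (\<xi> \<bullet> x)))" unfolding r .
qed

lemma integral_torus_cos:
  assumes k: "k \<in> (int_lattice :: (real ^ 'n::finite) set)"
  shows "integrable lborel (\<lambda>x. indicator torus x * cos (2 * pi * (k \<bullet> x)))"
    and "(LINT x|lborel. indicator torus x * cos (2 * pi * (k \<bullet> x))) = (if k = 0 then 1 else 0)"
proof -
  have r: "Re (indicator torus x * chr k x) = indicator torus x * cos (2 * pi * (k \<bullet> x))" for x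
    by (simp add: chr_def indicator_def)
  show "integrable lborel (\<lambda>x. indicator torus x * cos (2 * pi * (k \<bullet> x)))"
    using integrable_Re[OF integral_torus_chr(1)[OF k]] unfolding r .
  show "(LINT x|lborel. indicator torus x * cos (2 * pi * (k \<bullet> x))) = (if k = 0 then 1 else 0)"
    using integral_Re[OF integral_torus_chr(1)[OF k]] unfolding r integral_torus_chr(2)[OF k] by simp
qed

text \<open>The mean is the integral of U against the normalized Riesz kernel \<open>D\<close>. By
  Poisson summation \<open>D\<close> is a rescaled Bessel-type bump plus a uniformly small tail from
  k \<noteq> 0. Its majorant has bounded integral, which handles the neighbourhood of 0 where U is
  close to U 0; away from 0 the kernel tends to 0 uniformly, so that integrability of U suffices
  there.\<close>

lemma Riesz_mean_tendsto_U_fun: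
  fixes \<beta> a :: real
  assumes \<beta>: "\<beta> > -1" and a: "0 < a" "a < 1/2" and J: "real J \<ge> 2 * real CARD('n::finite)"
  shows "((\<lambda>\<Lambda>. (\<Sum>m | (m :: real ^ 'n) \<in> int_lattice \<and> norm m < \<Lambda>. U_hat CARD('n) \<beta> a (norm m) * (\<Lambda>\<^sup>2 - (norm m)\<^sup>2) ^ J) / \<Lambda> ^ (2 * J))
     \<longlongrightarrow> U_fun \<beta> a (0 :: real ^ 'n)) at_top"
proof -
  let ?d = "real CARD('n)"
  let ?T = "indicator torus :: real ^ 'n \<Rightarrow> real"
  let ?L = "int_lattice - {0} :: (real ^ 'n) set"
  define U where "U = (U_fun \<beta> a :: real ^ 'n \<Rightarrow> real)"
  define \<mu> where "\<mu> = real J + (?d - 1) / 2"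
  have d1: "?d \<ge> 1" by (rule real_CARD_ge_1)
  have \<mu>: "\<mu> > -1" "\<mu> + 1 \<ge> 2 * ?d" using J d1 by (auto simp: \<mu>_def field_simps)
  define F where "F = (\<lambda>\<Lambda>. {m :: real ^ 'n. m \<in> int_lattice \<and> norm m < \<Lambda>})"
  have fin: "finite (F \<Lambda>)" for \<Lambda> unfolding F_def by (rule finite_int_lattice_ball)
  define w where "w = (\<lambda>\<Lambda> (m :: real ^ 'n). (\<Lambda>\<^sup>2 - (norm m)\<^sup>2) ^ J / \<Lambda> ^ (2 * J))"
  define D where "D = (\<lambda>\<Lambda> x. \<Sum>m\<in>F \<Lambda>. w \<Lambda> m * cos (2 * pi * (m \<bullet> x)))"
  have Dm [measurable]: "D \<Lambda> \<in> borel_measurable borel" for \<Lambda> unfolding D_def by measurable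
  have Db: "norm (D \<Lambda> x) \<le> (\<Sum>m\<in>F \<Lambda>. \<bar>w \<Lambda> m\<bar>)" for \<Lambda> x
    unfolding D_def real_norm_def by (rule order_trans[OF sum_abs sum_mono]) (simp add: abs_mult mult_left_le)
  have iU: "integrable lborel U" unfolding U_def by (rule integrable_U_fun[OF \<beta> a(1)])
  have UT: "?T x * U x = U x" for x using U_fun_outside_torus[OF a(2), of x \<beta>] by (auto simp: U_def indicator_def)
  have iT: "integrable lborel ?T" and T1: "(LINT x|lborel. ?T x) = 1"
    using integral_torus_cos[OF zero_in_int_lattice] by simp_all
  have iUD: "integrable lborel (\<lambda>x. U x * D \<Lambda> x)" for \<Lambda>
    by (rule integrable_mult_bounded[OF iU _ Db]) simp
  have iTD: "integrable lborel (\<lambda>x. ?T x * D \<Lambda> x)" for \<Lambda>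
    by (rule integrable_mult_bounded[OF iT _ Db]) simp
  have RD: "(\<Sum>m | (m :: real ^ 'n) \<in> int_lattice \<and> norm m < \<Lambda>. U_hat CARD('n) \<beta> a (norm m) * (\<Lambda>\<^sup>2 - (norm m)\<^sup>2) ^ J) / \<Lambda> ^ (2 * J) = (LINT x|lborel. U x * D \<Lambda> x)" for \<Lambda>
  proof -
    have "(\<Sum>m\<in>F \<Lambda>. U_hat CARD('n) \<beta> a (norm m) * (\<Lambda>\<^sup>2 - (norm m)\<^sup>2) ^ J) / \<Lambda> ^ (2 * J) = (\<Sum>m\<in>F \<Lambda>. w \<Lambda> m * (LINT x|lborel. U x * cos (2 * pi * (m \<bullet> x))))"
      unfolding w_def U_def U_hat_eq_integral_cos(2)[OF \<beta> a(1), where 'n = 'n] sum_divide_distrib by (intro sum.cong) auto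
    also have "\<dots> = (LINT x|lborel. (\<Sum>m\<in>F \<Lambda>. w \<Lambda> m * (U x * cos (2 * pi * (m \<bullet> x)))))"
      unfolding U_def by (subst Bochner_Integration.integral_sum) (auto intro!: integrable_mult_right U_hat_eq_integral_cos(1)[OF \<beta> a(1)])
    also have "\<dots> = (LINT x|lborel. U x * D \<Lambda> x)"
      unfolding D_def sum_distrib_left by (intro Bochner_Integration.integral_cong refl sum.cong) simp
    finally show ?thesis unfolding F_def .
  qed
  \<comment> \<open>By orthogonality only m = 0 survives, with weight 1. Total mass 1 is what lets U
    0 be subtracted inside the integral.\<close>
  have D1: "(LINT x|lborel. ?T x * D \<Lambda> x) = 1" if \<Lambda>: "\<Lambda> > 0" for \<Lambda>
  proof -
    have "(LINT x|lborel. ?T x * D \<Lambda> x) = (LINT x|lborel. (\<Sum>m\<in>F \<Lambda>. w \<Lambda> m * (?T x * cos (2 * pi * (m \<bullet> x)))))"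
      unfolding D_def sum_distrib_left by (intro Bochner_Integration.integral_cong refl sum.cong) simp
    also have "\<dots> = (\<Sum>m\<in>F \<Lambda>. w \<Lambda> m * (LINT x|lborel. ?T x * cos (2 * pi * (m \<bullet> x))))"
      by (subst Bochner_Integration.integral_sum) (auto intro!: integrable_mult_right integral_torus_cos simp: F_def)
    also have "\<dots> = (\<Sum>m\<in>F \<Lambda>. if m = 0 then w \<Lambda> 0 else 0)"
      by (intro sum.cong refl) (subst integral_torus_cos, auto simp: F_def)
    also have "\<dots> = w \<Lambda> 0" using fin[of \<Lambda>] \<Lambda> zero_in_int_lattice by (simp add: F_def)
    also have "\<dots> = 1" using \<Lambda> by (simp add: w_def power_mult)
    finally show ?thesis .
  qed
  obtain Cb where Cb: "Cb \<ge> 0"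
    "\<And>\<Lambda> x n. \<Lambda> > 0 \<Longrightarrow> x \<in> torus \<Longrightarrow> n \<in> int_lattice \<Longrightarrow> n \<noteq> 0 \<Longrightarrow>
       \<bar>U_hat CARD('n) (real J) \<Lambda> (norm (x + n :: real ^ 'n))\<bar> \<le> Cb * \<Lambda> powr \<mu> * lattice_weight n"
    using U_hat_shift_bound[OF J] unfolding \<mu>_def by blast
  define S where "S = (LINT k|count_space ?L. lattice_weight k)"
  have iw: "integrable (count_space ?L) lattice_weight" by (rule integral_count_space_split_0(1)[OF integrable_lattice_weight zero_in_int_lattice])
  \<comment> \<open>Contribution of k \<noteq> 0; it tends to 0 since \<mu> - 2 J = (d-1)/2 - J is
    negative.\<close>
  define \<tau> where "\<tau> = (\<lambda>\<Lambda>::real. Cb * S * \<Lambda> powr (\<mu> - 2 * real J))"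
  have D_split: "\<bar>D \<Lambda> x\<bar> \<le> \<bar>U_hat CARD('n) (real J) \<Lambda> (norm x)\<bar> / \<Lambda> ^ (2 * J) + \<tau> \<Lambda>" if \<Lambda>: "\<Lambda> > 0" and x: "x \<in> torus" for \<Lambda> x
  proof -
    let ?K = "\<lambda>k. U_hat CARD('n) (real J) \<Lambda> (norm (x + k))"
    have "complex_of_real (LINT k|count_space int_lattice. ?K k) = (\<Sum>m\<in>F \<Lambda>. complex_of_real ((\<Lambda>\<^sup>2 - (norm m)\<^sup>2) ^ J) * chr x m)"
      unfolding F_def by (rule Riesz_kernel[OF J \<Lambda> x, symmetric])
    then have "(LINT k|count_space int_lattice. ?K k) = Re (\<Sum>m\<in>F \<Lambda>. complex_of_real ((\<Lambda>\<^sup>2 - (norm m)\<^sup>2) ^ J) * chr x m)"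
      by (metis Re_complex_of_real)
    also have "\<dots> = (\<Sum>m\<in>F \<Lambda>. (\<Lambda>\<^sup>2 - (norm m)\<^sup>2) ^ J * cos (2 * pi * (m \<bullet> x)))"
      unfolding Re_sum Re_of_real_mult chr_def by (simp add: inner_commute)
    finally have "D \<Lambda> x = (LINT k|count_space int_lattice. ?K k) / \<Lambda> ^ (2 * J)"
      unfolding D_def w_def by (simp add: sum_divide_distrib)
    also have "(LINT k|count_space int_lattice. ?K k) = ?K 0 + (LINT k|count_space ?L. ?K k)"
      by (rule integral_count_space_split_0(2)[OF integrable_U_hat_shift[OF J \<Lambda> x] zero_in_int_lattice])
    finally have e: "D \<Lambda> x = (?K 0 + (LINT k|count_space ?L. ?K k)) / \<Lambda> ^ (2 * J)" .
    have "norm (LINT k|count_space ?L. ?K k) \<le> (LINT k|count_space ?L. Cb * \<Lambda> powr \<mu> * lattice_weight k)"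
      by (rule Bochner_Integration.integral_norm_bound_integral[OF integral_count_space_split_0(1)[OF integrable_U_hat_shift[OF J \<Lambda> x] zero_in_int_lattice]])
        (use iw Cb(2)[OF \<Lambda> x] in auto)
    also have "\<dots> = Cb * S * \<Lambda> powr \<mu>" by (simp add: S_def)
    finally have t: "\<bar>LINT k|count_space ?L. ?K k\<bar> \<le> Cb * S * \<Lambda> powr \<mu>" unfolding real_norm_def .
    have "\<bar>D \<Lambda> x\<bar> = \<bar>?K 0 + (LINT k|count_space ?L. ?K k)\<bar> / \<Lambda> ^ (2 * J)" unfolding e using \<Lambda> by (simp add: abs_divide)
    also have "\<dots> \<le> (\<bar>?K 0\<bar> + Cb * S * \<Lambda> powr \<mu>) / \<Lambda> ^ (2 * J)"
      using t \<Lambda> by (intro divide_right_mono) auto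
    also have "\<dots> = \<bar>?K 0\<bar> / \<Lambda> ^ (2 * J) + \<tau> \<Lambda>"
    proof -
      have "\<Lambda> powr (\<mu> - 2 * real J) = \<Lambda> powr \<mu> / \<Lambda> ^ (2 * J)" using \<Lambda> powr_realpow[OF \<Lambda>, of "2 * J"] by (simp add: powr_diff)
      then show ?thesis by (simp add: \<tau>_def add_divide_distrib)
    qed
    finally show ?thesis by simp
  qed
  define A where "A = pi powr ((?d - 1) / 2) * Gamma (real J + 1)"
  have A: "A > 0" unfolding A_def by (intro mult_pos_pos Gamma_real_pos) auto
  have UA: "\<bar>U_hat CARD('n) (real J) \<Lambda> r\<bar> / \<Lambda> ^ (2 * J) = A * \<Lambda> ^ CARD('n) * \<bar>bess \<mu> (2 * pi * \<Lambda> * r)\<bar>" if \<Lambda>: "\<Lambda> > 0" for \<Lambda> r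
  proof -
    have "\<Lambda> powr (2 * real J + ?d) = \<Lambda> ^ (2 * J) * \<Lambda> ^ CARD('n)"
      using \<Lambda> powr_realpow[OF \<Lambda>, of "2 * J"] by (simp add: powr_add powr_realpow)
    then show ?thesis using \<Lambda> A unfolding U_hat_def A_def[symmetric] \<mu>_def by (simp add: abs_mult)
  qed
  obtain C where C: "C \<ge> 0" "\<And>y :: real ^ 'n. \<bar>bess \<mu> (2 * pi * norm y)\<bar> \<le> C * (\<Prod>i\<in>UNIV. 1 / (1 + (y $ i)\<^sup>2))"
    using bess_product_decay[OF \<mu>(2)] by metis
  obtain C1 where C1: "C1 \<ge> 0" "\<And>z. z > 0 \<Longrightarrow> \<bar>bess \<mu> z\<bar> \<le> C1 * z powr (- \<mu> - 1)" using bess_decay[OF \<mu>(1)] by metis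
  define H where "H = (\<lambda>\<Lambda> (x :: real ^ 'n). \<Prod>i\<in>UNIV. \<Lambda> * (1 / (1 + (0 + \<Lambda> * x $ i)\<^sup>2)))"
  define c0 where "c0 = (LINT t|lborel. 1 / (1 + t\<^sup>2 :: real))"
  have H0: "H \<Lambda> x \<ge> 0" if "\<Lambda> > 0" for \<Lambda> x unfolding H_def using that by (intro prod_nonneg) auto
  have iH: "integrable lborel (H \<Lambda>)" and intH: "(LINT x|lborel. H \<Lambda> x) = c0 ^ CARD('n)" if \<Lambda>: "\<Lambda> > 0" for \<Lambda>
  proof -
    have i: "integrable lborel (\<lambda>t. \<Lambda> * (1 / (1 + (0 + \<Lambda> * t)\<^sup>2)))"
      using \<Lambda> by (intro integrable_mult_right lborel_integrable_real_affine[OF integrable_inverse_1_plus_square]) auto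
    have e: "(LINT t|lborel. \<Lambda> * (1 / (1 + (0 + \<Lambda> * t)\<^sup>2))) = c0"
      unfolding c0_def integral_mult_right_zero using lborel_integral_real_affine[of \<Lambda> "\<lambda>t. 1 / (1 + t\<^sup>2 :: real)" 0] \<Lambda> by simp
    show "integrable lborel (H \<Lambda>)" unfolding H_def
      by (rule integral_lborel_prod_cart(1)[where f = "\<lambda>i t. \<Lambda> * (1 / (1 + (0 + \<Lambda> * t)\<^sup>2))", OF i])
    show "(LINT x|lborel. H \<Lambda> x) = c0 ^ CARD('n)" unfolding H_def
      using integral_lborel_prod_cart(2)[where f = "\<lambda>(i::'n) t. \<Lambda> * (1 / (1 + (0 + \<Lambda> * t)\<^sup>2))", OF i] unfolding e by simp
  qed
  have D_near: "\<bar>D \<Lambda> x\<bar> \<le> A * C * H \<Lambda> x + \<tau> \<Lambda>" if \<Lambda>: "\<Lambda> > 0" and x: "x \<in> torus" for \<Lambda> x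
  proof -
    have "\<bar>bess \<mu> (2 * pi * \<Lambda> * norm x)\<bar> = \<bar>bess \<mu> (2 * pi * norm (\<Lambda> *\<^sub>R x))\<bar>" using \<Lambda> by (simp add: mult.assoc)
    also have "\<dots> \<le> C * (\<Prod>i\<in>UNIV. 1 / (1 + (\<Lambda> * x $ i)\<^sup>2))" using C(2)[of "\<Lambda> *\<^sub>R x"] by simp
    finally have "A * \<Lambda> ^ CARD('n) * \<bar>bess \<mu> (2 * pi * \<Lambda> * norm x)\<bar> \<le> A * \<Lambda> ^ CARD('n) * (C * (\<Prod>i\<in>UNIV. 1 / (1 + (\<Lambda> * x $ i)\<^sup>2)))"
      using A \<Lambda> by (intro mult_left_mono) auto
    also have "\<dots> = A * C * H \<Lambda> x" unfolding H_def prod.distrib by simp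
    finally show ?thesis using D_split[OF \<Lambda> x] unfolding UA[OF \<Lambda>] by linarith
  qed
  \<comment> \<open>Uniform bound for the kernel outside radius \<delta>. The exponent d - \<mu> - 1
    is negative because \<mu> + 1 \<ge> 2 d.\<close>
  define \<eta> where "\<eta> = (\<lambda>\<delta> \<Lambda>. A * C1 * (2 * pi * \<delta>) powr (- \<mu> - 1) * \<Lambda> powr (?d - \<mu> - 1) + \<tau> \<Lambda>)"
  have D_far: "\<bar>D \<Lambda> x\<bar> \<le> \<eta> \<delta> \<Lambda>" if \<Lambda>: "\<Lambda> > 0" and x: "x \<in> torus" and \<delta>: "\<delta> > 0" "norm x \<ge> \<delta>" for \<Lambda> x \<delta>
  proof -
    have z: "2 * pi * \<Lambda> * \<delta> > 0" "2 * pi * \<Lambda> * \<delta> \<le> 2 * pi * \<Lambda> * norm x" using \<Lambda> \<delta> by (auto intro!: mult_pos_pos mult_left_mono)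
    have "\<bar>bess \<mu> (2 * pi * \<Lambda> * norm x)\<bar> \<le> C1 * (2 * pi * \<Lambda> * norm x) powr (- \<mu> - 1)" using z by (intro C1) linarith
    also have "\<dots> \<le> C1 * (2 * pi * \<Lambda> * \<delta>) powr (- \<mu> - 1)" by (intro mult_left_mono powr_mono2' z) (use C1 \<mu> in auto)
    also have "(2 * pi * \<Lambda> * \<delta>) powr (- \<mu> - 1) = (2 * pi * \<delta>) powr (- \<mu> - 1) * \<Lambda> powr (- \<mu> - 1)"
      by (simp add: powr_mult)
    finally have "A * \<Lambda> ^ CARD('n) * \<bar>bess \<mu> (2 * pi * \<Lambda> * norm x)\<bar> \<le> A * \<Lambda> ^ CARD('n) * (C1 * ((2 * pi * \<delta>) powr (- \<mu> - 1) * \<Lambda> powr (- \<mu> - 1)))"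
      using A \<Lambda> by (intro mult_left_mono) auto
    also have "\<dots> = A * C1 * (2 * pi * \<delta>) powr (- \<mu> - 1) * (\<Lambda> ^ CARD('n) * \<Lambda> powr (- \<mu> - 1))" by simp
    also have "\<Lambda> ^ CARD('n) * \<Lambda> powr (- \<mu> - 1) = \<Lambda> powr (?d - \<mu> - 1)"
      unfolding powr_realpow[OF \<Lambda>, symmetric] powr_add[symmetric] by (rule arg_cong[where f = "\<lambda>e. \<Lambda> powr e"]) simp
    finally show ?thesis using D_split[OF \<Lambda> x] unfolding UA[OF \<Lambda>] \<eta>_def by linarith
  qed
  have S0: "S \<ge> 0" unfolding S_def by (intro Bochner_Integration.integral_nonneg) auto
  have \<tau>0: "\<tau> \<Lambda> \<ge> 0" for \<Lambda> unfolding \<tau>_def using Cb S0 by (intro mult_nonneg_nonneg) auto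
  have \<tau>_lim: "(\<tau> \<longlongrightarrow> 0) at_top"
  proof -
    have "\<mu> - 2 * real J < 0" using J d1 by (simp add: \<mu>_def field_simps)
    from tendsto_mult_right_zero[OF tendsto_neg_powr[OF this filterlim_ident]] show ?thesis unfolding \<tau>_def by simp
  qed
  have \<eta>_lim: "(\<eta> \<delta> \<longlongrightarrow> 0) at_top" for \<delta>
  proof -
    have "?d - \<mu> - 1 < 0" using \<mu> d1 by linarith
    from tendsto_add[OF tendsto_mult_right_zero[OF tendsto_neg_powr[OF this filterlim_ident]] \<tau>_lim] show ?thesis unfolding \<eta>_def by simp
  qed
  have \<eta>0: "\<eta> \<delta> \<Lambda> \<ge> 0" for \<delta> \<Lambda> unfolding \<eta>_def using A C1 \<tau>0 by (intro add_nonneg_nonneg mult_nonneg_nonneg) auto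
  have main: "\<bar>(LINT x|lborel. U x * D \<Lambda> x) - U 0\<bar> \<le> e * (A * C * c0 ^ CARD('n) + \<tau> \<Lambda>) + ((LINT x|lborel. \<bar>U x\<bar>) + \<bar>U 0\<bar>) * \<eta> \<delta> \<Lambda>"
    if \<Lambda>: "\<Lambda> > 0" and \<delta>: "\<delta> > 0" and e: "e > 0" "\<And>x. norm x < \<delta> \<Longrightarrow> \<bar>U x - U 0\<bar> < e" for \<Lambda> \<delta> e
  proof -
    let ?b = "\<lambda>x. e * (A * C * H \<Lambda> x + \<tau> \<Lambda> * ?T x) + (\<bar>U x\<bar> + \<bar>U 0\<bar> * ?T x) * \<eta> \<delta> \<Lambda>"
    have "(LINT x|lborel. U x * D \<Lambda> x) - U 0 = (LINT x|lborel. U x * D \<Lambda> x) - (LINT x|lborel. U 0 * (?T x * D \<Lambda> x))"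
      using D1[OF \<Lambda>] by simp
    also have "\<dots> = (LINT x|lborel. U x * D \<Lambda> x - U 0 * (?T x * D \<Lambda> x))"
      by (rule Bochner_Integration.integral_diff[symmetric]) (intro iUD integrable_mult_right iTD)+
    finally have eq: "(LINT x|lborel. U x * D \<Lambda> x) - U 0 = (LINT x|lborel. U x * D \<Lambda> x - U 0 * (?T x * D \<Lambda> x))" .
    have ib1: "integrable lborel (\<lambda>x. A * C * H \<Lambda> x + \<tau> \<Lambda> * ?T x)" "integrable lborel (\<lambda>x. \<bar>U x\<bar> + \<bar>U 0\<bar> * ?T x)"
      using iH[OF \<Lambda>] iT iU by auto
    have "norm (LINT x|lborel. U x * D \<Lambda> x - U 0 * (?T x * D \<Lambda> x)) \<le> (LINT x|lborel. ?b x)"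
    proof (rule Bochner_Integration.integral_norm_bound_integral)
      show "integrable lborel (\<lambda>x. U x * D \<Lambda> x - U 0 * (?T x * D \<Lambda> x))" by (intro Bochner_Integration.integrable_diff iUD integrable_mult_right iTD)
      show "integrable lborel ?b"
        by (rule Bochner_Integration.integrable_add[OF integrable_mult_right[OF ib1(1)] integrable_mult_left[OF ib1(2)]])
      fix x :: "real ^ 'n"
      show "norm (U x * D \<Lambda> x - U 0 * (?T x * D \<Lambda> x)) \<le> ?b x"
      proof (cases "x \<in> torus")
        case False
        then have "U x = 0" using UT[of x] by simp
        then show ?thesis using False e A C H0[OF \<Lambda>, of x] by simp
      next
        case True
        then have "norm (U x * D \<Lambda> x - U 0 * (?T x * D \<Lambda> x)) = \<bar>U x - U 0\<bar> * \<bar>D \<Lambda> x\<bar>"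
          by (simp add: left_diff_distrib[symmetric] abs_mult)
        also have "\<dots> \<le> ?b x"
        proof (cases "norm x < \<delta>")
          case near: True
          have "\<bar>U x - U 0\<bar> * \<bar>D \<Lambda> x\<bar> \<le> e * (A * C * H \<Lambda> x + \<tau> \<Lambda>)"
            using e(2)[OF near] e(1) by (intro mult_mono D_near[OF \<Lambda> True]) auto
          moreover have "(\<bar>U x\<bar> + \<bar>U 0\<bar> * ?T x) * \<eta> \<delta> \<Lambda> \<ge> 0" using \<eta>0[of \<delta> \<Lambda>] by (intro mult_nonneg_nonneg) auto
          ultimately show ?thesis using True by simp
        next
          case far: False
          have "\<bar>U x - U 0\<bar> * \<bar>D \<Lambda> x\<bar> \<le> (\<bar>U x\<bar> + \<bar>U 0\<bar>) * \<eta> \<delta> \<Lambda>"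
            using far by (intro mult_mono D_far[OF \<Lambda> True \<delta>] abs_triangle_ineq4) auto
          moreover have "e * (A * C * H \<Lambda> x + \<tau> \<Lambda> * ?T x) \<ge> 0" using e A C H0[OF \<Lambda>, of x] \<tau>0[of \<Lambda>]
            by (intro mult_nonneg_nonneg add_nonneg_nonneg) auto
          ultimately show ?thesis using True by simp
        qed
        finally show ?thesis .
      qed
    qed
    also have "(LINT x|lborel. ?b x) = e * (LINT x|lborel. A * C * H \<Lambda> x + \<tau> \<Lambda> * ?T x) + (LINT x|lborel. \<bar>U x\<bar> + \<bar>U 0\<bar> * ?T x) * \<eta> \<delta> \<Lambda>"
      unfolding Bochner_Integration.integral_add[OF integrable_mult_right[OF ib1(1)] integrable_mult_left[OF ib1(2)]]
      by (simp only: integral_mult_right_zero integral_mult_left_zero)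
    also have "(LINT x|lborel. A * C * H \<Lambda> x + \<tau> \<Lambda> * ?T x) = A * C * c0 ^ CARD('n) + \<tau> \<Lambda>"
      using iH[OF \<Lambda>] iT T1 intH[OF \<Lambda>] by (subst Bochner_Integration.integral_add) auto
    also have "(LINT x|lborel. \<bar>U x\<bar> + \<bar>U 0\<bar> * ?T x) = (LINT x|lborel. \<bar>U x\<bar>) + \<bar>U 0\<bar>"
      using iU iT T1 by (subst Bochner_Integration.integral_add) auto
    finally show ?thesis unfolding eq real_norm_def .
  qed
  have c0: "c0 \<ge> 0" unfolding c0_def by (intro Bochner_Integration.integral_nonneg) auto
  have "((\<lambda>\<Lambda>. LINT x|lborel. U x * D \<Lambda> x) \<longlongrightarrow> U 0) at_top"
  proof (rule tendstoI)
    fix \<epsilon> :: real assume \<epsilon>: "\<epsilon> > 0"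
    define M where "M = A * C * c0 ^ CARD('n)"
    have M: "M \<ge> 0" unfolding M_def using A C c0 by simp
    define e where "e = \<epsilon> / (M + 1)"
    have e: "e > 0" "e * M < \<epsilon>" using \<epsilon> M by (auto simp: e_def field_simps)
    obtain \<delta> where \<delta>: "\<delta> > 0" "\<And>x :: real ^ 'n. norm x < \<delta> \<Longrightarrow> \<bar>U x - U 0\<bar> < e"
      using U_fun_continuous_at_0[OF a(1) e(1), where 'n = 'n and \<beta> = \<beta>] unfolding U_def by metis
    have "((\<lambda>\<Lambda>. e * (M + \<tau> \<Lambda>) + ((LINT x|lborel. \<bar>U x\<bar>) + \<bar>U 0\<bar>) * \<eta> \<delta> \<Lambda>) \<longlongrightarrow> e * (M + 0) + ((LINT x|lborel. \<bar>U x\<bar>) + \<bar>U 0\<bar>) * 0) at_top"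
      by (intro tendsto_intros \<tau>_lim \<eta>_lim)
    then have "\<forall>\<^sub>F \<Lambda> in at_top. e * (M + \<tau> \<Lambda>) + ((LINT x|lborel. \<bar>U x\<bar>) + \<bar>U 0\<bar>) * \<eta> \<delta> \<Lambda> < \<epsilon>"
      by (rule order_tendstoD(2)) (use e in simp)
    then show "\<forall>\<^sub>F \<Lambda> in at_top. dist (LINT x|lborel. U x * D \<Lambda> x) (U 0) < \<epsilon>"
      using eventually_gt_at_top[of 0]
    proof eventually_elim
      case (elim \<Lambda>)
      from main[OF elim(2) \<delta>(1) e(1) \<delta>(2)] elim(1) show ?case unfolding dist_real_def M_def by linarith
    qed
  qed
  then show ?thesis unfolding RD U_def .
qed

section \<open>Limes inferior and superior\<close>

text \<open>The bound |Re z| \<le> |z| gives one inequality. It is attained at arbitrarily large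
  points where Arg b + \<omega> r is a multiple of 2 pi, which gives the other.\<close>

lemma Limsup_of_oscillation:
  fixes b :: complex and g :: "real \<Rightarrow> real"
  assumes \<omega>: "\<omega> > 0" and g: "((\<lambda>r. g r - Re (b * cis (\<omega> * r))) \<longlongrightarrow> 0) at_top"
  shows "Limsup at_top (\<lambda>r. ereal (g r)) = ereal (norm b)"
proof (rule antisym)
  have close: "\<forall>\<^sub>F r in at_top. \<bar>g r - Re (b * cis (\<omega> * r))\<bar> < e" if "e > 0" for e
    using tendstoD[OF g that] by (simp only: dist_real_def diff_0_right)
  show "Limsup at_top (\<lambda>r. ereal (g r)) \<le> ereal (norm b)"
    unfolding Limsup_le_iff
  proof (intro allI impI)
    fix y assume y: "ereal (norm b) < y"
    show "\<forall>\<^sub>F r in at_top. ereal (g r) < y"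
    proof (cases y)
      case (real s)
      with y have "s - norm b > 0" by simp
      from close[OF this] show ?thesis
      proof eventually_elim
        case (elim r)
        have "Re (b * cis (\<omega> * r)) \<le> norm b" using complex_Re_le_cmod[of "b * cis (\<omega> * r)"] by (simp only: norm_mult norm_cis mult_1_right)
        then show ?case using elim real by simp
      qed
    qed (use y in auto)
  qed
  show "ereal (norm b) \<le> Limsup at_top (\<lambda>r. ereal (g r))"
  proof (rule ccontr)
    assume "\<not> ereal (norm b) \<le> Limsup at_top (\<lambda>r. ereal (g r))"
    then obtain y where y: "Limsup at_top (\<lambda>r. ereal (g r)) < y" "y < ereal (norm b)" using dense[of "Limsup at_top (\<lambda>r. ereal (g r))"] by (auto simp: not_le)
    have ev: "\<forall>\<^sub>F r in at_top. ereal (g r) < y" using Limsup_le_iff[THEN iffD1, OF order_refl] y(1) by blast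
    obtain s where s: "y = ereal s" using y by (cases y) auto
    then have "norm b - s > 0" using y by simp
    from close[OF this] ev have "\<forall>\<^sub>F r in at_top. g r < s \<and> \<bar>g r - Re (b * cis (\<omega> * r))\<bar> < norm b - s"
      by eventually_elim (simp add: s)
    then obtain N where N: "\<And>r. r \<ge> N \<Longrightarrow> g r < s \<and> \<bar>g r - Re (b * cis (\<omega> * r))\<bar> < norm b - s"
      unfolding eventually_at_top_linorder by blast
    obtain k :: nat where k: "real k \<ge> (N * \<omega> + Arg b) / (2 * pi)" using real_arch_simple by blast
    define t where "t = (2 * pi * real k - Arg b) / \<omega>"
    have "t \<ge> N" using k \<omega> by (simp add: t_def field_simps)
    have "b * cis (\<omega> * t) = rcis (norm b) (Arg b) * cis (\<omega> * t)" by (simp only: rcis_cmod_Arg)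
    also have "\<dots> = complex_of_real (norm b) * cis (Arg b + \<omega> * t)" by (simp only: rcis_def mult.assoc cis_mult)
    also have "Arg b + \<omega> * t = 2 * pi * real k" using \<omega> by (simp add: t_def)
    also have "cis (2 * pi * real k) = 1" by (rule cis_multiple_2pi) simp
    finally have "Re (b * cis (\<omega> * t)) = norm b" by simp
    with N[OF \<open>t \<ge> N\<close>] show False by linarith
  qed
qed

text \<open>Passing to -g replaces b by -b, which has the same modulus.\<close>

lemma Liminf_of_oscillation:
  fixes b :: complex and g :: "real \<Rightarrow> real"
  assumes \<omega>: "\<omega> > 0" and g: "((\<lambda>r. g r - Re (b * cis (\<omega> * r))) \<longlongrightarrow> 0) at_top"
  shows "Liminf at_top (\<lambda>r. ereal (g r)) = ereal (- norm b)"
proof -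
  have "((\<lambda>r. - g r - Re ((- b) * cis (\<omega> * r))) \<longlongrightarrow> 0) at_top"
    using tendsto_minus[OF g] by (simp add: algebra_simps)
  from Limsup_of_oscillation[OF \<omega> this] have "Limsup at_top (\<lambda>r. - ereal (g r)) = ereal (norm b)" by simp
  then have "- Liminf at_top (\<lambda>r. ereal (g r)) = ereal (norm b)" unfolding ereal_Limsup_uminus .
  then show ?thesis by (metis ereal_uminus_uminus uminus_ereal.simps(1))
qed

text \<open>Every nonzero lattice shift moves a torus point to distance at least 1/2 > a from the
  origin, so the periodization has no overlap there.\<close>

lemma u_fun_on_torus:
  assumes a: "a < 1/2" and x: "x \<in> (torus :: (real ^ 'n::finite) set)"
  shows "u_fun \<beta> a x = U_fun \<beta> a x"
proof -
  have "U_fun \<beta> a (x + m) = 0" if "m \<in> int_lattice" "m \<noteq> 0" for m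
    using norm_lattice_shift(1)[OF that x order_refl] a by (simp add: U_fun_def)
  then have "{m. m \<in> int_lattice \<and> U_fun \<beta> a (x + m) \<noteq> 0} = (if U_fun \<beta> a x = 0 then {} else {0})"
    using zero_in_int_lattice by (auto split: if_splits) (metis add.right_neutral)+
  then show ?thesis unfolding u_fun_eq_finite_sum by simp
qed

lemma fourier_coeff_u_fun:
  assumes \<beta>: "\<beta> > -1" and a: "0 < a" "a < 1/2"
  shows "fourier_coeff (\<lambda>x :: real ^ 'n::finite. complex_of_real (u_fun \<beta> a x)) m = complex_of_real (U_hat CARD('n) \<beta> a (norm m))"
proof -
  let ?h = "\<lambda>x :: real ^ 'n. complex_of_real (U_fun \<beta> a x) * cis (- (2 * pi * (m \<bullet> x)))"
  have e: "indicator torus x *\<^sub>R (complex_of_real (u_fun \<beta> a x) * exp (- 2 * complex_of_real pi * \<i> * complex_of_real (m \<bullet> x))) = ?h x" for x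
  proof (cases "x \<in> torus")
    case True
    have "exp (- 2 * complex_of_real pi * \<i> * complex_of_real (m \<bullet> x)) = cis (- (2 * pi * (m \<bullet> x)))"
      unfolding cis_conv_exp by (simp add: mult_ac)
    then show ?thesis using True u_fun_on_torus[OF a(2) True] by simp
  next
    case False
    then show ?thesis using U_fun_outside_torus[OF a(2) False] by simp
  qed
  have i: "integrable lborel (\<lambda>x :: real ^ 'n. complex_of_real (U_fun \<beta> a x))"
    by (intro integrable_of_real integrable_U_fun \<beta> a)
  \<comment> \<open>\<open>fourier_coeff\<close> integrates over the completed measure; for a Borel
    function the value agrees with the integral over \<open>lborel\<close>.\<close>
  have "?h \<in> borel_measurable lborel"
    by (rule borel_measurable_times[OF borel_measurable_integrable[OF i]]) (auto intro!: borel_measurable_cis)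
  from integral_completion[OF this] show ?thesis
    unfolding fourier_coeff_def set_lebesgue_integral_def e using integral_U_fun_cis[OF \<beta> a(1), of m] by simp
qed

lemma spherical_sum_u_fun_0:
  assumes \<beta>: "\<beta> > -1" and a: "0 < a" "a < 1/2"
  shows "spherical_sum \<Lambda> (\<lambda>x :: real ^ 'n::finite. complex_of_real (u_fun \<beta> a x)) 0
     = complex_of_real (\<Sum>m | (m :: real ^ 'n) \<in> int_lattice \<and> norm m < \<Lambda>. U_hat CARD('n) \<beta> a (norm m))"
  unfolding spherical_sum_def fourier_coeff_u_fun[OF assms] by simp

theorem corollary1p2:
  fixes \<beta> a :: real
  assumes "\<beta> > -1" and "0 < a" and "a < 1/2"
  shows
    "(\<beta> > (real CARD('n::finite) - 3) / 2 \<longrightarrow>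
       ((\<lambda>\<Lambda>. spherical_sum \<Lambda> (\<lambda>x :: real ^ 'n. complex_of_real (u_fun \<beta> a x)) 0)
         \<longlongrightarrow> complex_of_real (u_fun \<beta> a (0 :: real ^ 'n))) at_top) \<and>
     (\<beta> \<le> (real CARD('n) - 3) / 2 \<longrightarrow>
       Liminf at_top (\<lambda>\<Lambda> :: real. ereal
         ((Re (spherical_sum \<Lambda> (\<lambda>x :: real ^ 'n. complex_of_real (u_fun \<beta> a x)) 0)
             - u_fun \<beta> a (0 :: real ^ 'n))
           / \<Lambda> powr ((real CARD('n) - 3) / 2 - \<beta>)))
         = ereal (- P_const CARD('n) \<beta> a) \<and>
       Limsup at_top (\<lambda>\<Lambda> :: real. ereal
         ((Re (spherical_sum \<Lambda> (\<lambda>x :: real ^ 'n. complex_of_real (u_fun \<beta> a x)) 0)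
             - u_fun \<beta> a (0 :: real ^ 'n))
           / \<Lambda> powr ((real CARD('n) - 3) / 2 - \<beta>)))
         = ereal (P_const CARD('n) \<beta> a))"
proof -
  define \<alpha> where "\<alpha> = (real CARD('n) - 3) / 2 - \<beta>"
  define A where "A = (\<lambda>\<Lambda>. \<Sum>m | (m :: real ^ 'n) \<in> int_lattice \<and> norm m < \<Lambda>. U_hat CARD('n) \<beta> a (norm m))"
  define u0 where "u0 = u_fun \<beta> a (0 :: real ^ 'n)"
  define \<omega> where "\<omega> = 2 * pi * a"
  have \<omega>: "\<omega> > 0" using assms by (simp add: \<omega>_def)
  have u0: "u0 = U_fun \<beta> a (0 :: real ^ 'n)"
    unfolding u0_def by (rule u_fun_on_torus[OF assms(3)]) (simp add: torus_def)
  have S: "spherical_sum \<Lambda> (\<lambda>x :: real ^ 'n. complex_of_real (u_fun \<beta> a x)) 0 = complex_of_real (A \<Lambda>)" for \<Lambda>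
    unfolding A_def by (rule spherical_sum_u_fun_0[OF assms])
  obtain b where b: "norm b = P_const CARD('n) \<beta> a"
    "\<alpha> \<le> 0 \<Longrightarrow> \<exists>L. ((\<lambda>\<Lambda>. A \<Lambda> - \<Lambda> powr \<alpha> * Re (b * cis (\<omega> * \<Lambda>))) \<longlongrightarrow> L) at_top"
    "\<alpha> > 0 \<Longrightarrow> ((\<lambda>\<Lambda>. (A \<Lambda> - \<Lambda> powr \<alpha> * Re (b * cis (\<omega> * \<Lambda>))) / \<Lambda> powr \<alpha>) \<longlongrightarrow> 0) at_top"
    unfolding A_def \<alpha>_def \<omega>_def
  proof (rule lattice_sum_asymp[OF assms, where 'n = 'n], goal_cases)
    case (1 b)
    show ?case by (rule 1(1)[of b]) (fact 1(2), erule 1(3), erule 1(4))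
  qed
  \<comment> \<open>Whenever the partial sums converge up to a pure oscillation, which may have
    amplitude 0, their Riesz means converge both to L and to the value at the origin.\<close>
  have limit: "L = u0" if "w \<noteq> 0" and lim: "((\<lambda>\<Lambda>. A \<Lambda> - Re (c * cis (w * \<Lambda>))) \<longlongrightarrow> L) at_top" for w c L
  proof -
    define J where "J = 2 * CARD('n)"
    have J: "real J \<ge> 2 * real CARD('n)" "J \<ge> 2" using real_CARD_ge_1[where 'n = 'n] by (auto simp: J_def)
    show ?thesis unfolding u0
      by (rule tendsto_unique[OF _ Riesz_mean_Abelian[OF J(2) that(1) lim[unfolded A_def]] Riesz_mean_tendsto_U_fun[OF assms J(1)]]) simp
  qed
  have 1: "(A \<longlongrightarrow> u0) at_top" if \<alpha>: "\<alpha> < 0"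
  proof -
    obtain L where L: "((\<lambda>\<Lambda>. A \<Lambda> - \<Lambda> powr \<alpha> * Re (b * cis (\<omega> * \<Lambda>))) \<longlongrightarrow> L) at_top" using b(2) \<alpha> by auto
    have "((\<lambda>\<Lambda>. \<Lambda> powr \<alpha> * Re (b * cis (\<omega> * \<Lambda>))) \<longlongrightarrow> 0) at_top"
    proof (rule Lim_null_comparison[where g = "\<lambda>\<Lambda>. \<Lambda> powr \<alpha> * norm b"])
      have "\<bar>Re (b * cis (\<omega> * \<Lambda>))\<bar> \<le> norm b" for \<Lambda>
        using abs_Re_le_cmod[of "b * cis (\<omega> * \<Lambda>)"] by (simp only: norm_mult norm_cis mult_1_right)
      then show "\<forall>\<^sub>F \<Lambda> in at_top. norm (\<Lambda> powr \<alpha> * Re (b * cis (\<omega> * \<Lambda>))) \<le> \<Lambda> powr \<alpha> * norm b"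
        by (intro always_eventually allI) (simp only: real_norm_def abs_mult abs_of_nonneg[OF powr_ge_zero] mult_left_mono powr_ge_zero)
      show "((\<lambda>\<Lambda>. \<Lambda> powr \<alpha> * norm b) \<longlongrightarrow> 0) at_top"
        by (rule tendsto_mult_left_zero[OF tendsto_neg_powr[OF \<alpha> filterlim_ident]])
    qed
    from tendsto_add[OF L this] have AL: "(A \<longlongrightarrow> L) at_top" by simp
    \<comment> \<open>For \<alpha> < 0 the oscillation has already decayed, so the amplitude is 0
      and the frequency 1 an arbitrary nonzero choice.\<close>
    then have "((\<lambda>\<Lambda>. A \<Lambda> - Re (0 * cis (1 * \<Lambda>))) \<longlongrightarrow> L) at_top" by simp
    then have "L = u0" by (rule limit[rotated]) simp
    with AL show ?thesis by simp
  qed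
  have 2: "((\<lambda>\<Lambda>. (A \<Lambda> - u0) / \<Lambda> powr \<alpha> - Re (b * cis (\<omega> * \<Lambda>))) \<longlongrightarrow> 0) at_top" if \<alpha>: "\<alpha> \<ge> 0"
  proof (cases "\<alpha> = 0")
    case True
    have p: "\<forall>\<^sub>F \<Lambda>::real in at_top. \<Lambda> powr \<alpha> = 1"
      by (rule eventually_mono[OF eventually_gt_at_top[of 0]]) (simp add: True)
    obtain L where "((\<lambda>\<Lambda>. A \<Lambda> - \<Lambda> powr \<alpha> * Re (b * cis (\<omega> * \<Lambda>))) \<longlongrightarrow> L) at_top" using b(2) True by auto
    then have L: "((\<lambda>\<Lambda>. A \<Lambda> - Re (b * cis (\<omega> * \<Lambda>))) \<longlongrightarrow> L) at_top"
      by (rule Lim_transform_eventually) (use p in eventually_elim, simp)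
    then have "L = u0" by (rule limit[rotated]) (use \<omega> in simp)
    with tendsto_diff[OF L tendsto_const[of u0]] have "((\<lambda>\<Lambda>. A \<Lambda> - Re (b * cis (\<omega> * \<Lambda>)) - u0) \<longlongrightarrow> 0) at_top" by simp
    then show ?thesis
      by (rule Lim_transform_eventually) (use p in eventually_elim, simp)
  next
    case False
    with \<alpha> have \<alpha>: "\<alpha> > 0" by simp
    \<comment> \<open>For \<alpha> > 0 the fixed value \<open>u0\<close> disappears after division
      by \<Lambda>^\<alpha>.\<close>
    have "((\<lambda>\<Lambda>::real. u0 * \<Lambda> powr - \<alpha>) \<longlongrightarrow> 0) at_top"
      using tendsto_mult_right_zero[OF tendsto_neg_powr[OF _ filterlim_ident, of "- \<alpha>"], of u0] \<alpha> by simp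
    from tendsto_diff[OF b(3)[OF \<alpha>] this]
    have "((\<lambda>\<Lambda>. (A \<Lambda> - \<Lambda> powr \<alpha> * Re (b * cis (\<omega> * \<Lambda>))) / \<Lambda> powr \<alpha> - u0 * \<Lambda> powr - \<alpha>) \<longlongrightarrow> 0) at_top" by simp
    then show ?thesis
    proof (rule Lim_transform_eventually)
      show "\<forall>\<^sub>F \<Lambda> in at_top. (A \<Lambda> - \<Lambda> powr \<alpha> * Re (b * cis (\<omega> * \<Lambda>))) / \<Lambda> powr \<alpha> - u0 * \<Lambda> powr - \<alpha> = (A \<Lambda> - u0) / \<Lambda> powr \<alpha> - Re (b * cis (\<omega> * \<Lambda>))"
        by (rule eventually_mono[OF eventually_gt_at_top[of 0]]) (simp add: powr_minus_divide diff_divide_distrib)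
    qed
  qed
  have c1: "((\<lambda>\<Lambda>. complex_of_real (A \<Lambda>)) \<longlongrightarrow> complex_of_real u0) at_top" if "\<beta> > (real CARD('n) - 3) / 2"
    using 1 that by (intro tendsto_of_real) (simp add: \<alpha>_def)
  have c2: "Liminf at_top (\<lambda>\<Lambda>. ereal ((A \<Lambda> - u0) / \<Lambda> powr \<alpha>)) = ereal (- P_const CARD('n) \<beta> a)"
      "Limsup at_top (\<lambda>\<Lambda>. ereal ((A \<Lambda> - u0) / \<Lambda> powr \<alpha>)) = ereal (P_const CARD('n) \<beta> a)" if "\<beta> \<le> (real CARD('n) - 3) / 2"
  proof -
    have "\<alpha> \<ge> 0" using that by (simp add: \<alpha>_def)
    from Liminf_of_oscillation[OF \<omega> 2[OF this]] Limsup_of_oscillation[OF \<omega> 2[OF this]]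
    show "Liminf at_top (\<lambda>\<Lambda>. ereal ((A \<Lambda> - u0) / \<Lambda> powr \<alpha>)) = ereal (- P_const CARD('n) \<beta> a)"
      "Limsup at_top (\<lambda>\<Lambda>. ereal ((A \<Lambda> - u0) / \<Lambda> powr \<alpha>)) = ereal (P_const CARD('n) \<beta> a)"
      unfolding b(1) .
  qed
  show ?thesis
    unfolding S Re_complex_of_real u0_def[symmetric] \<alpha>_def[symmetric] using c1 c2 by blast
qed

end
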